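(* Let $\{X_t\}_{t\ge0}$ be a real-valued symmetric Lévy process with generator $\mathcal{L}$ and Lévy exponent $\Psi$ (so $\mathrm{E}\,e^{i\xi X_1}=e^{-\Psi(\xi)}$, $\Psi(\xi)=\Psi(-\xi)\ge0$), satisfying Dalang's condition $\Upsilon(\beta):=\frac{1}{2\pi}\int_{-\infty}^\infty\frac{d\xi}{\beta+2\Psi(\xi)}<\infty$ for some (hence all) $\beta>0$. Let $\sigma:\mathbf{R}\to\mathbf{R}$ be Lipschitz continuous with $\sigma(0)=0$ and $\mathrm{L}_\sigma:=\inf_{x\in\mathbf{R}}|\sigma(x)/x|>0$. Let $u_0:\mathbf{R}\to\mathbf{R}_+$ be bounded, and let $u$ be the mild solution of $\partial_t u_t(x)=(\mathcal{L}u_t)(x)+\sigma(u_t(x))\,\partial^2_{t x}W(t,x)$, $t>0$, $x\in\mathbf{R}$, with initial datum $u_0$. Suppose there exists $c>0$ such that $\mathrm{E}[e^{cX_1}]<\infty$, that $u_0\in\mathcal{D}_{\mathit{exp}}$, and that $u_0$ is strictly positive on a set of positive Lebesgue measure. Then $0<\underline{\lambda}(\nu)\le\overline{\lambda}(\nu)<\infty$ for all $\nu\in[2,\infty)$.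
   Context: $W$ is a two-parameter Brownian sheet indexed by $\mathbf{R}_+\times\mathbf{R}$ (so $\partial^2_{tx}W$ is space-time white noise). Under Dalang's condition, $X$ has transition densities $p_t$ and semigroup $(P_tf)(x)=\int p_t(z-x) f(z)\,dz$ (equivalently $\mathrm{E}f(x+X_t)$), and the equation has a unique mild (Walsh) solution: a predictable random field $u$ with $u_t(x)=(P_tu_0)(x)+\int_{[0,t]\times\mathbf{R}}p_{t-s}(y-x)\sigma(u_s(y))\,W(ds\,dy)$. $\mathcal{D}_{\mathit{exp}}$ denotes the set of bounded lower semicontinuous functions $h:\mathbf{R}\to\mathbf{R}_+$ for which there exists $\rho>0$ with $h(x)=O(e^{-\rho|x|})$ as $|x|\to\infty$. Growth indices: $\overline{\lambda}(\nu):=\inf\{\alpha>0:\limsup_{t\to\infty}\frac1t\sup_{|x|\ge\alpha t}\ln\mathrm{E}(|u_t(x)|^\nu)<0\}$ (with $\inf\varnothing=\infty$), and $\underline{\lambda}(\nu):=\sup\{\alpha>0:\limsup_{t\to\infty}\frac1t\sup_{|x|\ge\alpha t}\ln\mathrm{E}(|u_t(x)|^\nu)>0\}$ (with $\sup\varnothing=0$). *)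

theory Defs
  imports "HOL-Probability.Probability" "HOL-Library.Landau_Symbols"
begin

definition lsc_fun :: "(real \<Rightarrow> real) \<Rightarrow> bool" where
  "lsc_fun h \<longleftrightarrow> (\<forall>a. open {x. h x > a})"

definition D_exp :: "(real \<Rightarrow> real) set" where
  "D_exp = {h. lsc_fun h \<and> bounded (range h) \<and> (\<forall>x. h x \<ge> 0) \<and>
               (\<exists>\<rho>>0. h \<in> O[at_infinity](\<lambda>x. exp (- \<rho> * \<bar>x\<bar>)))}"

definition levy_process :: "'b measure \<Rightarrow> (real \<Rightarrow> 'b \<Rightarrow> real) \<Rightarrow> bool" where
  "levy_process P X \<longleftrightarrow> prob_space P \<and>
     (\<forall>t. X t \<in> borel_measurable P) \<and>
     (\<forall>\<omega>\<in>space P. X 0 \<omega> = 0) \<and>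
     \<comment> \<open>independent increments\<close>
     (\<forall>(ts::nat \<Rightarrow> real) n. ts 0 \<ge> 0 \<and> (\<forall>i<n. ts i \<le> ts (Suc i)) \<longrightarrow>
        prob_space.indep_vars P (\<lambda>_. borel) (\<lambda>i \<omega>. X (ts (Suc i)) \<omega> - X (ts i) \<omega>) {..<n}) \<and>
     \<comment> \<open>stationary increments\<close>
     (\<forall>s t. 0 \<le> s \<and> 0 \<le> t \<longrightarrow>
        distr P borel (\<lambda>\<omega>. X (s + t) \<omega> - X s \<omega>) = distr P borel (X t)) \<and>
     \<comment> \<open>cadlag paths (almost surely)\<close>
     (AE \<omega> in P. \<forall>t\<ge>0. continuous (at_right t) (\<lambda>s. X s \<omega>) \<and>
                       (t > 0 \<longrightarrow> (\<exists>l. ((\<lambda>s. X s \<omega>) \<longlongrightarrow> l) (at_left t))))"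

definition symmetric_process :: "'b measure \<Rightarrow> (real \<Rightarrow> 'b \<Rightarrow> real) \<Rightarrow> bool" where
  "symmetric_process P X \<longleftrightarrow>
     (\<forall>t\<ge>0. distr P borel (\<lambda>\<omega>. - X t \<omega>) = distr P borel (X t))"

definition semigroup :: "'b measure \<Rightarrow> (real \<Rightarrow> 'b \<Rightarrow> real) \<Rightarrow> real \<Rightarrow> (real \<Rightarrow> real) \<Rightarrow> real \<Rightarrow> real" where
  "semigroup P X t f x = (\<integral>\<omega>. f (x + X t \<omega>) \<partial>P)"

definition real_gaussian :: "'a measure \<Rightarrow> ('a \<Rightarrow> real) \<Rightarrow> bool" where
  "real_gaussian M Y \<longleftrightarrow>
     (\<exists>\<mu>. \<exists>s>0. distributed M lborel Y (\<lambda>x. ennreal (normal_density \<mu> s x))) \<or>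
     (\<exists>\<mu>. AE \<omega> in M. Y \<omega> = \<mu>)"

definition sheet_cov :: "real \<Rightarrow> real \<Rightarrow> real \<Rightarrow> real \<Rightarrow> real" where
  "sheet_cov t x t' x' = min t t' * (if x * x' \<ge> 0 then min \<bar>x\<bar> \<bar>x'\<bar> else 0)"

definition brownian_sheet :: "'a measure \<Rightarrow> (real \<Rightarrow> real \<Rightarrow> 'a \<Rightarrow> real) \<Rightarrow> bool" where
  "brownian_sheet M W \<longleftrightarrow> prob_space M \<and>
     (\<forall>t x. W t x \<in> borel_measurable M) \<and>
     \<comment> \<open>jointly Gaussian: every finite linear combination is Gaussian\<close>
     (\<forall>L :: (real \<times> real \<times> real) list. (\<forall>(c,t,x)\<in>set L. t \<ge> 0) \<longrightarrow>
        real_gaussian M (\<lambda>\<omega>. sum_list (map (\<lambda>(c,t,x). c * W t x \<omega>) L))) \<and>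
     (\<forall>t\<ge>0. \<forall>x. prob_space.expectation M (W t x) = 0) \<and>
     (\<forall>t\<ge>0. \<forall>x. \<forall>t'\<ge>0. \<forall>x'.
        prob_space.expectation M (\<lambda>\<omega>. W t x \<omega> * W t' x' \<omega>) = sheet_cov t x t' x') \<and>
     (\<forall>\<omega>\<in>space M. continuous_on ({0..} \<times> UNIV) (\<lambda>(t,x). W t x \<omega>))"

definition sheet_filtration :: "'a measure \<Rightarrow> (real \<Rightarrow> 'a measure) \<Rightarrow> (real \<Rightarrow> real \<Rightarrow> 'a \<Rightarrow> real) \<Rightarrow> bool" where
  "sheet_filtration M F W \<longleftrightarrow>
     (\<forall>t\<ge>0. subalgebra M (F t)) \<and>
     (\<forall>s t. 0 \<le> s \<and> s \<le> t \<longrightarrow> sets (F s) \<subseteq> sets (F t)) \<and>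
     (\<forall>t\<ge>0. \<forall>s\<in>{0..t}. \<forall>x. W s x \<in> borel_measurable (F t)) \<and>
     (\<forall>t\<ge>0. prob_space.indep_set M (sets (F t))
        (sigma_sets (space M) {(\<lambda>\<omega>. W t' x \<omega> - W t x \<omega>) -` B \<inter> space M | t' x B.
                                 t \<le> t' \<and> B \<in> sets borel}))"

definition predictable_alg :: "'a measure \<Rightarrow> (real \<Rightarrow> 'a measure) \<Rightarrow> ('a \<times> real \<times> real) measure" where
  "predictable_alg M F = sigma (space M \<times> ({0..} \<times> UNIV))
     ({A \<times> ({s<..t} \<times> B) | A s t B. 0 \<le> s \<and> s < t \<and> A \<in> sets (F s) \<and> B \<in> sets borel} \<union>
      {A \<times> ({0} \<times> B) | A B. A \<in> sets (F 0) \<and> B \<in> sets borel})"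

definition predictable :: "'a measure \<Rightarrow> (real \<Rightarrow> 'a measure) \<Rightarrow> (real \<Rightarrow> real \<Rightarrow> 'a \<Rightarrow> real) \<Rightarrow> bool" where
  "predictable M F u \<longleftrightarrow> (\<lambda>(\<omega>,r,y). u r y \<omega>) \<in> borel_measurable (predictable_alg M F)"

text \<open>Simple predictable integrands: finite sums of c 1_A(omega) 1_(s,t](r) 1_(a,b](y), A in F_s.\<close>
type_synonym 'a simple_pred = "(real \<times> 'a set \<times> real \<times> real \<times> real \<times> real) list"

definition simple_ok :: "'a measure \<Rightarrow> (real \<Rightarrow> 'a measure) \<Rightarrow> 'a simple_pred \<Rightarrow> bool" where
  "simple_ok M F L \<longleftrightarrow> (\<forall>(c,A,s,t,a,b)\<in>set L. 0 \<le> s \<and> s < t \<and> a < b \<and> A \<in> sets (F s))"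

definition simple_eval :: "'a simple_pred \<Rightarrow> 'a \<Rightarrow> real \<Rightarrow> real \<Rightarrow> real" where
  "simple_eval L \<omega> r y = sum_list (map (\<lambda>(c,A,s,t,a,b).
      c * indicator A \<omega> * indicator {s<..t} r * indicator {a<..b} y) L)"

definition simple_int :: "(real \<Rightarrow> real \<Rightarrow> 'a \<Rightarrow> real) \<Rightarrow> 'a simple_pred \<Rightarrow> 'a \<Rightarrow> real" where
  "simple_int W L \<omega> = sum_list (map (\<lambda>(c,A,s,t,a,b).
      c * indicator A \<omega> * (W t b \<omega> - W s b \<omega> - W t a \<omega> + W s a \<omega>)) L)"

definition walsh_integral :: "'a measure \<Rightarrow> (real \<Rightarrow> 'a measure) \<Rightarrow> (real \<Rightarrow> real \<Rightarrow> 'a \<Rightarrow> real)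
    \<Rightarrow> ('a \<Rightarrow> real \<Rightarrow> real \<Rightarrow> real) \<Rightarrow> ('a \<Rightarrow> real) \<Rightarrow> bool" where
  "walsh_integral M F W f I \<longleftrightarrow>
     I \<in> borel_measurable M \<and>
     (\<lambda>(\<omega>,r,y). f \<omega> r y) \<in> borel_measurable (M \<Otimes>\<^sub>M (lborel \<Otimes>\<^sub>M lborel)) \<and>
     (\<exists>Ls :: nat \<Rightarrow> 'a simple_pred. (\<forall>n. simple_ok M F (Ls n)) \<and>
        ((\<lambda>n. \<integral>\<^sup>+\<omega>. \<integral>\<^sup>+r. \<integral>\<^sup>+y. ennreal (indicator {0..} r *
              (simple_eval (Ls n) \<omega> r y - f \<omega> r y)\<^sup>2) \<partial>lborel \<partial>lborel \<partial>M) \<longlonglongrightarrow> 0) \<and>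
        ((\<lambda>n. \<integral>\<^sup>+\<omega>. ennreal ((simple_int W (Ls n) \<omega> - I \<omega>)\<^sup>2) \<partial>M) \<longlonglongrightarrow> 0))"

definition mild_solution ::
  "'a measure \<Rightarrow> (real \<Rightarrow> 'a measure) \<Rightarrow> (real \<Rightarrow> real \<Rightarrow> 'a \<Rightarrow> real) \<Rightarrow>
   'b measure \<Rightarrow> (real \<Rightarrow> 'b \<Rightarrow> real) \<Rightarrow> (real \<Rightarrow> real \<Rightarrow> real) \<Rightarrow>
   (real \<Rightarrow> real) \<Rightarrow> (real \<Rightarrow> real) \<Rightarrow> (real \<Rightarrow> real \<Rightarrow> 'a \<Rightarrow> real) \<Rightarrow> bool" where
  "mild_solution M F W P X p \<sigma> u0 u \<longleftrightarrow>
     predictable M F u \<and>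
     (\<forall>T\<ge>0. \<exists>C::real. \<forall>t\<in>{0..T}. \<forall>x. (\<integral>\<^sup>+\<omega>. ennreal ((u t x \<omega>)\<^sup>2) \<partial>M) \<le> ennreal C) \<and>
     (\<forall>t\<ge>0. \<forall>x. \<exists>I. walsh_integral M F W
         (\<lambda>\<omega> r y. if r < t then p (t - r) (y - x) * \<sigma> (u r y \<omega>) else 0) I \<and>
        (AE \<omega> in M. u t x \<omega> = semigroup P X t u0 x + I \<omega>))"

definition eln :: "ennreal \<Rightarrow> ereal" where
  "eln a = (if a = 0 then -\<infinity> else if a = \<infinity> then \<infinity> else ereal (ln (enn2real a)))"

definition moment :: "'a measure \<Rightarrow> (real \<Rightarrow> real \<Rightarrow> 'a \<Rightarrow> real) \<Rightarrow> real \<Rightarrow> real \<Rightarrow> real \<Rightarrow> ennreal" where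
  "moment M u \<nu> t x = (\<integral>\<^sup>+\<omega>. ennreal (\<bar>u t x \<omega>\<bar> powr \<nu>) \<partial>M)"

definition growth_limsup :: "'a measure \<Rightarrow> (real \<Rightarrow> real \<Rightarrow> 'a \<Rightarrow> real) \<Rightarrow> real \<Rightarrow> real \<Rightarrow> ereal" where
  "growth_limsup M u \<nu> \<alpha> =
     Limsup at_top (\<lambda>t::real. ereal (1 / t) * (SUP x\<in>{x. \<bar>x\<bar> \<ge> \<alpha> * t}. eln (moment M u \<nu> t x)))"

definition lambda_upper :: "'a measure \<Rightarrow> (real \<Rightarrow> real \<Rightarrow> 'a \<Rightarrow> real) \<Rightarrow> real \<Rightarrow> ereal" where
  "lambda_upper M u \<nu> = Inf (ereal ` {\<alpha>. \<alpha> > 0 \<and> growth_limsup M u \<nu> \<alpha> < 0})"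

definition lambda_lower :: "'a measure \<Rightarrow> (real \<Rightarrow> real \<Rightarrow> 'a \<Rightarrow> real) \<Rightarrow> real \<Rightarrow> ereal" where
  "lambda_lower M u \<nu> = Sup (insert 0 (ereal ` {\<alpha>. \<alpha> > 0 \<and> growth_limsup M u \<nu> \<alpha> > 0}))"

end

(*
  Second moments. The Walsh isometry turns the mild equation into
    E u_t(x)^2 = (P_t u0)(x)^2 + int_0^t int q_{t-s}(y-x)^2 E sigma(u_s(y))^2 dy ds.
  For large g the kernel exp(-g s + c|z|) q_s(z)^2 has small mass (Dalang's condition and the exponential
  moment), so a contraction argument in the weighted supremum norm gives E u_t(x)^2 <= A exp(g t - c|x|).
  The weight exp(c|x|) is first replaced by min(exp(c|x|), R), for which the supremum is known to be finite.

  Higher moments. A mild solution is only assumed to be bounded in L^2, so E|u|^(2k+2) could be infinite.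
  The power is replaced by a function of quadratic growth. Given the past, a simple Walsh integral has
  Gaussian increments; a Taylor expansion over one time step followed by a discrete Gronwall argument
  bounds the expectation of the truncated power with constants that do not depend on the truncation.
  The same contraction argument applies and Fatou's lemma removes the truncation.
  The upper growth index is finite because |u|^nu interpolates between u^2 and a higher even power.

  Lower growth index. The mass of E u_t(x)^2 on {x >= alpha t} satisfies a renewal inequality with kernel
  T(s) = int_{z >= alpha s} q_s(z)^2 dz. Since Psi(xi) = O(xi^2) at 0, q_{2s}(0) >= const / sqrt s, so the
  Laplace transform of T at beta is as large as desired when beta and alpha are small. The Laplace
  transform of the mass is then infinite, which is incompatible with a nonpositive growth exponent.

  The densities p are determined only up to null sets and might be negative where the law has no mass, so
  strict positivity of the continuous density q is needed: a zero of q_t at x is a zero for all smaller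
  times by the Chapman-Kolmogorov equation, hence for all times by analyticity in t, and {q > 0} is an
  open neighbourhood of 0 that is closed under addition.
*)
theory Submission
  imports Defs "HOL-Complex_Analysis.Cauchy_Integral_Formula"
begin

section \<open>Symmetric Levy processes under Dalang's condition\<close>

text \<open>The estimates for Walsh integrals rest on one fact about the noise: its increments over
  a time step are Gaussian and independent of the past \<open>F r\<close>, so an expectation over a
  step is an explicit Gaussian average. Estimates are proved for simple integrands along the finite
  grid of their jump times and then passed to the limit in L^2.

  The Gronwall argument does not use time as its clock. The integrand of the mild equation contains
  the kernel p_(t-r)(y-x), which is singular as r approaches t, and the constants have to be uniform
  in t and x. A step is therefore measured by the mass \<kappa> of w^2 over it, where w is a
  positive weight comparable to the kernel. One step costs a factor exp(const * \<kappa>), and these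
  factors multiply to exp(const) because w^2 has total mass at most 1, however fine the grid.

  The Taylor remainder over a step involves the variance v of the increment. It is compared with the
  truncated power at the level sqrt(v / \<kappa>), the root mean square of f / w over the step,
  which is what lets the energy of the integrand f enter as the integral of w^2 times the truncated
  power of f / w.\<close>

locale levy_dalang = prob_space P for P :: "'b measure" +
  fixes X :: "real \<Rightarrow> 'b \<Rightarrow> real" and \<Psi> :: "real \<Rightarrow> real" and p :: "real \<Rightarrow> real \<Rightarrow> real"
  assumes levy: "levy_process P X" and symm: "symmetric_process P X"
    and exponent: "\<forall>\<xi>. char (distr P borel (X 1)) \<xi> = exp (- complex_of_real (\<Psi> \<xi>))"
    and dalang: "\<exists>\<beta>>0. integrable lborel (\<lambda>\<xi>. 1 / (\<beta> + 2 * \<Psi> \<xi>))"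
    and dens: "\<forall>t>0. distributed P lborel (X t) (\<lambda>z. ennreal (p t z))"
begin

lemma X_measurable [measurable]: "X t \<in> borel_measurable P"
  using levy unfolding levy_process_def by blast

lemma distr_neg: "t \<ge> 0 \<Longrightarrow> distr P borel (\<lambda>\<omega>. - X t \<omega>) = distr P borel (X t)"
  using symm unfolding symmetric_process_def by blast

lemma distr_incr: "s \<ge> 0 \<Longrightarrow> t \<ge> 0 \<Longrightarrow> distr P borel (\<lambda>\<omega>. X (s + t) \<omega> - X s \<omega>) = distr P borel (X t)"
  using levy unfolding levy_process_def by blast

lemma X_zero: "\<omega> \<in> space P \<Longrightarrow> X 0 \<omega> = 0"
  using levy unfolding levy_process_def by blast

text \<open>The grid 0, s, s + t in the definition. The two increments form a family over
  \<open>{..<2}\<close> because the product formulas applied later, for characteristic functions and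
  for exponential moments, are stated for indexed families.\<close>

lemma indep_increments:
  assumes "s \<ge> 0" "t \<ge> 0"
  shows "indep_vars (\<lambda>_. borel) (\<lambda>i \<omega>. if i = 0 then X s \<omega> - X 0 \<omega> else X (s + t) \<omega> - X s \<omega>) {..<2::nat}"
proof -
  define ts where "ts = (\<lambda>i::nat. if i = 0 then 0 else if i = 1 then s else s + t)"
  have "ts 0 \<ge> 0 \<and> (\<forall>i<2. ts i \<le> ts (Suc i))" using assms by (auto simp: ts_def)
  then have "indep_vars (\<lambda>_. borel) (\<lambda>i \<omega>. X (ts (Suc i)) \<omega> - X (ts i) \<omega>) {..<2}"
    using levy unfolding levy_process_def by blast
  then show ?thesis
    by (rule indep_vars_cong[THEN iffD1, rotated 3]) (auto simp: ts_def less_2_cases_iff)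
qed

lemma distr_zero_incr: "distr P borel (\<lambda>\<omega>. X s \<omega> - X 0 \<omega>) = distr P borel (X s)"
  by (rule distr_cong) (auto simp: X_zero)

section \<open>The characteristic function at every time\<close>

definition cX :: "real \<Rightarrow> real \<Rightarrow> real" where
  "cX t \<xi> = (\<integral>\<omega>. cos (\<xi> * X t \<omega>) \<partial>P)"

lemma integrable_cos_X [simp]: "integrable P (\<lambda>\<omega>. cos (\<xi> * X t \<omega>))"
  by (rule integrable_const_bound[of _ 1]) auto

lemma integrable_sin_X [simp]: "integrable P (\<lambda>\<omega>. sin (\<xi> * X t \<omega>))"
  by (rule integrable_const_bound[of _ 1]) auto

lemma sin_X_zero:
  assumes "t \<ge> 0"
  shows "(\<integral>\<omega>. sin (\<xi> * X t \<omega>) \<partial>P) = 0"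
proof -
  have "(\<integral>\<omega>. sin (\<xi> * X t \<omega>) \<partial>P) = (\<integral>x. sin (\<xi> * x) \<partial>distr P borel (X t))"
    by (subst integral_distr) auto
  also have "\<dots> = (\<integral>x. sin (\<xi> * x) \<partial>distr P borel (\<lambda>\<omega>. - X t \<omega>))" using distr_neg[OF assms] by simp
  also have "\<dots> = - (\<integral>\<omega>. sin (\<xi> * X t \<omega>) \<partial>P)" by (subst integral_distr) auto
  finally show ?thesis by simp
qed

lemma char_X:
  assumes "t \<ge> 0"
  shows "char (distr P borel (X t)) \<xi> = complex_of_real (cX t \<xi>)"
proof -
  have "char (distr P borel (X t)) \<xi> = (\<integral>\<omega>. iexp (\<xi> * X t \<omega>) \<partial>P)"
    unfolding char_def by (subst integral_distr) auto
  also have "\<dots> = (\<integral>\<omega>. complex_of_real (cos (\<xi> * X t \<omega>)) + \<i> * complex_of_real (sin (\<xi> * X t \<omega>)) \<partial>P)"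
    by (intro Bochner_Integration.integral_cong refl) (simp only: exp_Euler cos_of_real sin_of_real)
  also have "\<dots> = complex_of_real (cX t \<xi>) + \<i> * complex_of_real (\<integral>\<omega>. sin (\<xi> * X t \<omega>) \<partial>P)"
    unfolding cX_def by (simp add: integral_complex_of_real)
  finally show ?thesis by (simp add: sin_X_zero[OF assms])
qed

lemma cX_add:
  assumes "s \<ge> 0" "t \<ge> 0"
  shows "cX (s + t) \<xi> = cX s \<xi> * cX t \<xi>"
proof -
  let ?Y = "\<lambda>i::nat. \<lambda>\<omega>. if i = 0 then X s \<omega> - X 0 \<omega> else X (s + t) \<omega> - X s \<omega>"
  have "(\<lambda>\<omega>. \<Sum>i\<in>{..<2}. ?Y i \<omega>) = (\<lambda>\<omega>. X (s + t) \<omega> - X 0 \<omega>)"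
    by (simp add: eval_nat_numeral lessThan_Suc)
  then have "char (distr P borel (\<lambda>\<omega>. X (s + t) \<omega> - X 0 \<omega>)) \<xi> = (\<Prod>i<2. char (distr P borel (?Y i)) \<xi>)"
    using char_distr_sum[OF indep_increments[OF assms], of \<xi>] by simp
  also have "\<dots> = char (distr P borel (X s)) \<xi> * char (distr P borel (X t)) \<xi>"
    using distr_incr[OF assms] by (simp add: eval_nat_numeral lessThan_Suc distr_zero_incr mult.commute)
  finally have "complex_of_real (cX (s + t) \<xi>) = complex_of_real (cX s \<xi> * cX t \<xi>)"
    unfolding distr_zero_incr using assms by (simp add: char_X)
  then show ?thesis using of_real_eq_iff by blast
qed

text \<open>Nonnegativity comes from halving the time: \<open>cX t \<xi>\<close> is the square of
  the real number \<open>cX (t / 2) \<xi>\<close>.\<close>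

lemma cX_bounds:
  assumes "t \<ge> 0"
  shows "0 \<le> cX t \<xi>" "cX t \<xi> \<le> 1"
proof -
  have "cX t \<xi> = cX (t / 2) \<xi> * cX (t / 2) \<xi>" using cX_add[of "t/2" "t/2" \<xi>] assms by simp
  then show "0 \<le> cX t \<xi>" by simp
  have "cX t \<xi> \<le> (\<integral>\<omega>. 1 \<partial>P)" unfolding cX_def by (rule integral_mono) auto
  then show "cX t \<xi> \<le> 1" by (simp add: prob_space)
qed

lemma cX_0: "cX 0 \<xi> = 1"
proof -
  have "cX 0 \<xi> = (\<integral>\<omega>. 1 \<partial>P)" unfolding cX_def by (intro Bochner_Integration.integral_cong) (auto simp: X_zero)
  then show ?thesis by (simp add: prob_space)
qed

lemma cX_1: "cX 1 \<xi> = exp (- \<Psi> \<xi>)"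
proof -
  have "complex_of_real (cX 1 \<xi>) = complex_of_real (exp (- \<Psi> \<xi>))"
    using exponent char_X[of 1 \<xi>] by (simp add: exp_of_real[symmetric])
  then show ?thesis using of_real_eq_iff by blast
qed

lemma \<Psi>_nonneg: "\<Psi> \<xi> \<ge> 0"
  using cX_bounds(2)[of 1 \<xi>] by (simp add: cX_1)

lemma cX_measurable [measurable]: "cX t \<in> borel_measurable borel"
  unfolding cX_def[abs_def] by (rule borel_measurable_lebesgue_integral) measurable

lemma \<Psi>_measurable [measurable]: "\<Psi> \<in> borel_measurable borel"
proof -
  have "\<Psi> = (\<lambda>\<xi>. - ln (cX 1 \<xi>))" by (simp add: cX_1 fun_eq_iff)
  then show ?thesis by simp
qed

lemma cX_mult: "t \<ge> 0 \<Longrightarrow> cX (real n * t) \<xi> = cX t \<xi> ^ n"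
  by (induction n) (simp_all add: cX_0 distrib_right cX_add)

lemma cX_mono: "0 \<le> s \<Longrightarrow> s \<le> t \<Longrightarrow> cX t \<xi> \<le> cX s \<xi>"
  using cX_add[of s "t - s" \<xi>] cX_bounds[of s \<xi>] cX_bounds[of "t - s" \<xi>] by (simp add: mult_left_le)

lemma cX_rational: "cX (real m / real (Suc n)) \<xi> = exp (- (real m / real (Suc n)) * \<Psi> \<xi>)"
proof -
  have "cX (1 / real (Suc n)) \<xi> ^ Suc n = exp (- \<Psi> \<xi>)"
    using cX_mult[of "1 / real (Suc n)" "Suc n" \<xi>] cX_1 by simp
  also have "\<dots> = exp (- \<Psi> \<xi> / real (Suc n)) ^ Suc n"
    by (subst exp_of_nat_mult[symmetric]) (simp add: field_simps)
  finally have "cX (1 / real (Suc n)) \<xi> = exp (- \<Psi> \<xi> / real (Suc n))"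
    using cX_bounds(1)[of "1 / real (Suc n)" \<xi>] by (subst (asm) power_eq_iff_eq_base) auto
  then have "cX (real m * (1 / real (Suc n))) \<xi> = exp (- \<Psi> \<xi> / real (Suc n)) ^ m"
    by (subst cX_mult) auto
  then show ?thesis by (simp add: exp_of_nat_mult[symmetric] field_simps)
qed

text \<open>At rational times the formula follows by taking roots. A general time is squeezed
  between m / (n + 1) and (m + 1) / (n + 1) by monotonicity in time, and both bounds tend to the
  claimed value.\<close>

lemma cX_eq:
  assumes t: "t \<ge> 0"
  shows "cX t \<xi> = exp (- t * \<Psi> \<xi>)"
proof -
  define m where "m n = nat \<lfloor>real (Suc n) * t\<rfloor>" for n
  have m: "real (m n) \<le> real (Suc n) * t" "real (Suc n) * t \<le> real (m n + 1)" for n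
    using t real_of_int_floor_add_one_ge[of "real (Suc n) * t"] by (auto simp: m_def of_nat_nat add.commute)
  have "real (m n) / real (Suc n) \<le> t" "t \<le> real (m n + 1) / real (Suc n)" for n
    using m[of n] by (auto simp: field_simps)
  note m' = this
  have up: "cX t \<xi> \<le> exp (- t * \<Psi> \<xi>) * exp (\<Psi> \<xi> * (1 / real (Suc n)))" for n
  proof -
    have "cX t \<xi> \<le> exp (- (real (m n) / real (Suc n)) * \<Psi> \<xi>)"
      using cX_mono[OF _ m'(1), of n \<xi>] unfolding cX_rational by simp
    also have "\<dots> \<le> exp (- (t - 1 / real (Suc n)) * \<Psi> \<xi>)"
      unfolding exp_le_cancel_iff
      by (rule mult_right_mono) (use m'(2)[of n] \<Psi>_nonneg[of \<xi>] in \<open>simp_all add: add_divide_distrib\<close>)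
    finally show ?thesis by (simp add: exp_add[symmetric] algebra_simps)
  qed
  have lo: "exp (- t * \<Psi> \<xi>) * exp (- (\<Psi> \<xi> * (1 / real (Suc n)))) \<le> cX t \<xi>" for n
  proof -
    have "exp (- t * \<Psi> \<xi>) * exp (- (\<Psi> \<xi> * (1 / real (Suc n)))) = exp (- (t + 1 / real (Suc n)) * \<Psi> \<xi>)"
      by (simp add: exp_add[symmetric] algebra_simps)
    also have "\<dots> \<le> exp (- (real (m n + 1) / real (Suc n)) * \<Psi> \<xi>)"
      unfolding exp_le_cancel_iff
      by (rule mult_right_mono) (use m'(1)[of n] \<Psi>_nonneg[of \<xi>] in \<open>simp_all add: add_divide_distrib\<close>)
    also have "\<dots> \<le> cX t \<xi>"
      using cX_mono[OF t m'(2), of n \<xi>] unfolding cX_rational .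
    finally show ?thesis .
  qed
  have lim: "(\<lambda>n. 1 / real (Suc n)) \<longlonglongrightarrow> 0" using LIMSEQ_inverse_real_of_nat by (simp add: inverse_eq_divide)
  have "(\<lambda>n. exp (- t * \<Psi> \<xi>) * exp (\<Psi> \<xi> * (1 / real (Suc n)))) \<longlonglongrightarrow> exp (- t * \<Psi> \<xi>) * exp (\<Psi> \<xi> * 0)"
    "(\<lambda>n. exp (- t * \<Psi> \<xi>) * exp (- (\<Psi> \<xi> * (1 / real (Suc n))))) \<longlonglongrightarrow> exp (- t * \<Psi> \<xi>) * exp (- (\<Psi> \<xi> * 0))"
    by (intro tendsto_intros lim)+
  then have "cX t \<xi> \<le> exp (- t * \<Psi> \<xi>) * exp (\<Psi> \<xi> * 0)" "exp (- t * \<Psi> \<xi>) * exp (- (\<Psi> \<xi> * 0)) \<le> cX t \<xi>"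
    using up lo by (auto intro: LIMSEQ_le_const LIMSEQ_le_const2)
  then show ?thesis by simp
qed

text \<open>From y * exp(-y) <= 1 one gets exp(-t \<Psi>) <= (\<beta> + 2 / t) / (\<beta> + 2
  \<Psi>), which Dalang's condition makes integrable.\<close>

lemma integrable_exp_\<Psi>:
  assumes t: "t > 0"
  shows "integrable lborel (\<lambda>\<xi>. exp (- t * \<Psi> \<xi>))"
proof -
  obtain \<beta> where \<beta>: "\<beta> > 0" "integrable lborel (\<lambda>\<xi>. 1 / (\<beta> + 2 * \<Psi> \<xi>))" using dalang by blast
  show ?thesis
  proof (rule Bochner_Integration.integrable_bound)
    show "integrable lborel (\<lambda>\<xi>. (\<beta> + 2 / t) * (1 / (\<beta> + 2 * \<Psi> \<xi>)))" using \<beta>(2) by (rule integrable_mult_right)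
    show "AE \<xi> in lborel. norm (exp (- t * \<Psi> \<xi>)) \<le> norm ((\<beta> + 2 / t) * (1 / (\<beta> + 2 * \<Psi> \<xi>)))"
    proof (rule AE_I2)
      fix \<xi>
      have "t * \<Psi> \<xi> \<le> exp (t * \<Psi> \<xi>)" using exp_ge_add_one_self[of "t * \<Psi> \<xi>"] by linarith
      then have "t * \<Psi> \<xi> * exp (- t * \<Psi> \<xi>) \<le> 1" by (simp add: exp_minus field_simps)
      then have a: "\<Psi> \<xi> * exp (- t * \<Psi> \<xi>) \<le> 1 / t" using t by (simp add: field_simps)
      have "exp (- t * \<Psi> \<xi>) \<le> 1" using t \<Psi>_nonneg[of \<xi>] by simp
      then have "\<beta> * exp (- t * \<Psi> \<xi>) \<le> \<beta>" using \<beta>(1) by simp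
      then have "(\<beta> + 2 * \<Psi> \<xi>) * exp (- t * \<Psi> \<xi>) \<le> \<beta> + 2 / t" using a by (simp add: algebra_simps)
      moreover have "\<beta> + 2 * \<Psi> \<xi> > 0" using \<beta>(1) \<Psi>_nonneg[of \<xi>] by linarith
      ultimately show "norm (exp (- t * \<Psi> \<xi>)) \<le> norm ((\<beta> + 2 / t) * (1 / (\<beta> + 2 * \<Psi> \<xi>)))"
        using \<beta>(1) t by (simp add: pos_le_divide_eq mult.commute)
    qed
  qed measurable
qed

section \<open>The continuous version of the transition density, by Fourier inversion\<close>

definition q :: "real \<Rightarrow> real \<Rightarrow> real" where
  "q t x = (\<integral>\<xi>. cos (x * \<xi>) * exp (- t * \<Psi> \<xi>) \<partial>lborel) / (2 * pi)"

lemma q_measurable [measurable]: "(\<lambda>z. q (fst z) (snd z)) \<in> borel_measurable (borel \<Otimes>\<^sub>M borel)"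
proof -
  have "(\<lambda>z. \<integral>\<xi>. cos (snd z * \<xi>) * exp (- fst z * \<Psi> \<xi>) \<partial>lborel) \<in> borel_measurable (borel \<Otimes>\<^sub>M borel)"
    by (rule lborel.borel_measurable_lebesgue_integral) measurable
  then show ?thesis unfolding q_def by measurable
qed

lemma q_measurable_comp [measurable (raw)]:
  assumes "f \<in> borel_measurable N" "g \<in> borel_measurable N"
  shows "(\<lambda>x. q (f x) (g x)) \<in> borel_measurable N"
  using measurable_compose[OF _ q_measurable, of "\<lambda>x. (f x, g x)" N] assms by simp

lemma integrable_cos_exp_\<Psi>: "t > 0 \<Longrightarrow> integrable lborel (\<lambda>\<xi>. cos (x * \<xi>) * exp (- t * \<Psi> \<xi>))"
  by (rule Bochner_Integration.integrable_bound[OF integrable_exp_\<Psi>]) (auto simp: abs_mult mult_left_le_one_le)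

lemma q_even: "q t (- x) = q t x"
  by (simp add: q_def)

lemma q_le_q0: "t > 0 \<Longrightarrow> q t x \<le> q t 0"
  unfolding q_def using integrable_cos_exp_\<Psi>[of t x] integrable_exp_\<Psi>[of t]
  by (intro divide_right_mono integral_mono) auto

lemma q0_antimono: "0 < s \<Longrightarrow> s \<le> t \<Longrightarrow> q t 0 \<le> q s 0"
  unfolding q_def using integrable_exp_\<Psi>[of t] integrable_exp_\<Psi>[of s] \<Psi>_nonneg
  by (intro divide_right_mono integral_mono) (auto intro: mult_right_mono)

lemma q0_pos: "t > 0 \<Longrightarrow> q t 0 > 0"
proof -
  assume t: "t > 0"
  have "0 < (\<integral>\<xi>. exp (- t * \<Psi> \<xi>) \<partial>lborel)"
  proof (rule ccontr)
    assume "\<not> ?thesis"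
    moreover have "0 \<le> (\<integral>\<xi>. exp (- t * \<Psi> \<xi>) \<partial>lborel)" by simp
    ultimately have "(\<integral>\<xi>. exp (- t * \<Psi> \<xi>) \<partial>lborel) = 0" by linarith
    then have "AE \<xi> in lborel. exp (- t * \<Psi> \<xi>) = 0"
      using integrable_exp_\<Psi>[OF t] by (subst (asm) integral_nonneg_eq_0_iff_AE) auto
    then have "AE \<xi> in (lborel :: real measure). False" by simp
    then show False by (subst (asm) AE_iff_measurable[of UNIV]) auto
  qed
  then show ?thesis by (simp add: q_def)
qed

lemma q_continuous:
  assumes t: "t > 0"
  shows "continuous_on UNIV (q t)"
proof -
  have "isCont (\<lambda>x. \<integral>\<xi>. cos (x * \<xi>) * exp (- t * \<Psi> \<xi>) \<partial>lborel) x" for x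
    unfolding continuous_at_sequentially comp_def
  proof safe
    fix f assume f: "f \<longlonglongrightarrow> x"
    show "(\<lambda>n. \<integral>\<xi>. cos (f n * \<xi>) * exp (- t * \<Psi> \<xi>) \<partial>lborel) \<longlonglongrightarrow> (\<integral>\<xi>. cos (x * \<xi>) * exp (- t * \<Psi> \<xi>) \<partial>lborel)"
      by (rule integral_dominated_convergence[where w="\<lambda>\<xi>. exp (- t * \<Psi> \<xi>)"])
         (use integrable_exp_\<Psi>[OF t] f in \<open>auto intro!: tendsto_intros simp: abs_mult mult_left_le_one_le\<close>)
  qed
  then show ?thesis unfolding q_def
    by (intro continuous_at_imp_continuous_on ballI continuous_divide) auto
qed

text \<open>The Chapman-Kolmogorov equation, written as an expectation over \<open>X s\<close>
  because \<open>q\<close> is not yet known to be a density. Under the Fourier integral the average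
  of the cosine produces the factor \<open>cX s \<xi>\<close>; the sine term vanishes by
  symmetry.\<close>

lemma q_chapman:
  assumes t: "t > 0" and s: "s \<ge> 0"
  shows "q (s + t) x = (\<integral>\<omega>. q t (x - X s \<omega>) \<partial>P)"
    and "integrable P (\<lambda>\<omega>. q t (x - X s \<omega>))"
proof -
  interpret PL: pair_sigma_finite P lborel ..
  define g where "g = (\<lambda>(\<omega>, \<xi>). cos ((x - X s \<omega>) * \<xi>) * exp (- t * \<Psi> \<xi>))"
  have [measurable]: "g \<in> borel_measurable (P \<Otimes>\<^sub>M lborel)" unfolding g_def by measurable
  have "integrable (P \<Otimes>\<^sub>M lborel) g"
  proof (rule Bochner_Integration.integrable_bound)
    have "integrable (P \<Otimes>\<^sub>M lborel) (\<lambda>(\<omega>, \<xi>). exp (- t * \<Psi> \<xi>))"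
      by (rule PL.Fubini_integrable) (use integrable_exp_\<Psi>[OF t] in auto)
    then show "integrable (P \<Otimes>\<^sub>M lborel) (\<lambda>z. exp (- t * \<Psi> (snd z)))" unfolding case_prod_unfold .
    show "AE z in P \<Otimes>\<^sub>M lborel. norm (g z) \<le> norm (exp (- t * \<Psi> (snd z)))"
      by (auto simp: g_def abs_mult mult_left_le_one_le split_beta)
  qed measurable
  then have int: "integrable (P \<Otimes>\<^sub>M lborel) (\<lambda>(\<omega>, \<xi>). cos ((x - X s \<omega>) * \<xi>) * exp (- t * \<Psi> \<xi>))"
    unfolding g_def .
  have "(\<integral>\<xi>. (\<integral>\<omega>. cos ((x - X s \<omega>) * \<xi>) * exp (- t * \<Psi> \<xi>) \<partial>P) \<partial>lborel)
     = (\<integral>\<omega>. (\<integral>\<xi>. cos ((x - X s \<omega>) * \<xi>) * exp (- t * \<Psi> \<xi>) \<partial>lborel) \<partial>P)"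
    using PL.Fubini_integral[OF int] by simp
  moreover have "(\<integral>\<omega>. cos ((x - X s \<omega>) * \<xi>) * exp (- t * \<Psi> \<xi>) \<partial>P) = cos (x * \<xi>) * exp (- (s + t) * \<Psi> \<xi>)" for \<xi>
  proof -
    have "cos ((x - X s \<omega>) * \<xi>) = cos (x * \<xi>) * cos (\<xi> * X s \<omega>) + sin (x * \<xi>) * sin (\<xi> * X s \<omega>)" for \<omega>
      by (simp only: left_diff_distrib cos_diff mult.commute[of "X s \<omega>" \<xi>])
    then have "(\<integral>\<omega>. cos ((x - X s \<omega>) * \<xi>) \<partial>P) = cos (x * \<xi>) * cX s \<xi>"
      using sin_X_zero[OF s, of \<xi>] by (simp add: cX_def)
    then show ?thesis by (simp add: cX_eq[OF s] exp_add[symmetric] algebra_simps)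
  qed
  ultimately show "q (s + t) x = (\<integral>\<omega>. q t (x - X s \<omega>) \<partial>P)" unfolding q_def by simp
  have "integrable P (\<lambda>\<omega>. \<integral>\<xi>. cos ((x - X s \<omega>) * \<xi>) * exp (- t * \<Psi> \<xi>) \<partial>lborel)"
    using PL.integrable_fst[OF int] by simp
  then show "integrable P (\<lambda>\<omega>. q t (x - X s \<omega>))" unfolding q_def by simp
qed

end

lemma power_le_fact_exp:
  fixes x :: real
  assumes "x \<ge> 0"
  shows "x ^ k \<le> fact k * exp x"
proof -
  have "(\<Sum>i\<in>{k}. x ^ i /\<^sub>R fact i) \<le> (\<Sum>i. x ^ i /\<^sub>R fact i)"
    using assms summable_exp_generic[of x] by (intro sum_le_suminf) (auto simp: field_simps)
  then show ?thesis by (simp add: exp_def field_simps)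
qed

text \<open>\<open>ennreal\<close> cuts off negative values, so the integral sees only the positive
  part of f, and by continuity a positive value would persist on an interval.\<close>

lemma continuous_nn_integral_0_imp_0:
  fixes f :: "real \<Rightarrow> real"
  assumes f: "continuous_on UNIV f" and 0: "(\<integral>\<^sup>+x. ennreal (f x) \<partial>lborel) = 0"
  shows "f x \<le> 0"
proof (rule ccontr)
  assume "\<not> f x \<le> 0"
  have [measurable]: "f \<in> borel_measurable borel" using f by (rule borel_measurable_continuous_onI)
  have "open {x. 0 < f x}" using f by (intro open_Collect_less) (auto intro: continuous_on_const)
  moreover have "x \<in> {x. 0 < f x}" using \<open>\<not> f x \<le> 0\<close> by simp
  ultimately obtain e where e: "e > 0" "ball x e \<subseteq> {x. 0 < f x}"
    by (rule openE)
  have "AE x in lborel. ennreal (f x) = 0" using 0 by (subst (asm) nn_integral_0_iff_AE) auto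
  then have "AE y in lborel. y \<notin> {x<..<x + e}"
    using e by (auto elim!: eventually_mono simp: ennreal_eq_0_iff subset_iff dist_real_def not_less[symmetric])
  then have "emeasure lborel {x<..<x + e} = 0"
    by (subst (asm) AE_iff_measurable[of "{x<..<x + e}"]) auto
  then show False using e by simp
qed

text \<open>If some coefficient of positive index were nonzero, then f, which vanishes at 0, would
  have no other zero close to 0; but it vanishes on a whole left neighbourhood.\<close>

lemma powser_zero_left_imp_zero:
  fixes b :: "nat \<Rightarrow> real"
  assumes r: "r > 0" and sums: "\<And>h. \<bar>h\<bar> < r \<Longrightarrow> (\<lambda>n. b n * h ^ n) sums f h"
    and zero: "\<And>h. - r < h \<Longrightarrow> h \<le> 0 \<Longrightarrow> f h = 0" and h: "\<bar>h\<bar> < r"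
  shows "f h = 0"
proof -
  have f0: "f 0 = 0" using zero[of 0] r by simp
  have b: "b n = 0" if "n > 0" for n
  proof (rule ccontr)
    assume "b n \<noteq> 0"
    then obtain s where s: "0 < s" "\<And>z. z \<in> cball 0 s - {0} \<Longrightarrow> f z \<noteq> 0"
      using powser_0_nonzero[of r 0 b f n] r sums f0 \<open>n > 0\<close> by auto
    \<comment> \<open>A point of the punctured disc around 0 that lies to the left of 0 and inside
      the radius r.\<close>
    define z where "z = - min s (r / 2)"
    have "z \<in> cball 0 s - {0}" "- r < z" "z \<le> 0" using s(1) r by (auto simp: z_def)
    then show False using s(2) zero by blast
  qed
  have "(\<lambda>n. b n * 0 ^ n) sums b 0" using powser_sums_zero[of b] by simp
  then have "b 0 = 0" using sums[of 0] r f0 sums_unique2 by fastforce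
  then have "b n = 0" for n using b by (cases n) auto
  then show ?thesis using sums[OF h] by (simp add: sums_iff)
qed

section \<open>Identification of \<open>q t\<close> as a density of \<open>X t\<close>\<close>

context levy_dalang
begin

text \<open>Levy's inversion formula. The characteristic function is integrable, so the truncated
  integrals converge to the full one, and writing the inversion kernel as an integral of cosines
  over [a, b] brings out \<open>q\<close> after Fubini.\<close>

lemma interval_prob:
  assumes t: "t > 0" and ab: "a \<le> b"
  shows "measure (distr P borel (X t)) {a<..b} = (\<integral>x. indicator {a..b} x * q t x \<partial>lborel)"
proof -
  let ?D = "distr P borel (X t)"
  interpret D: real_distribution ?D by (auto intro!: real_distribution_distr)
  \<comment> \<open>The inversion formula needs endpoints without mass; this is where the existence
    of a density for \<open>X t\<close> enters.\<close>
  have null: "measure ?D {y} = 0" for y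
  proof -
    have "emeasure ?D {y} = emeasure (density lborel (\<lambda>z. ennreal (p t z))) {y}"
      using dens t distributed_distr_eq_density[of P lborel "X t"] by (metis distr_cong sets_lborel)
    also have "\<dots> = (\<integral>\<^sup>+z. ennreal (p t z) * indicator {y} z \<partial>lborel)"
      using dens t distributed_borel_measurable by (subst emeasure_density) auto
    also have "\<dots> = (\<integral>\<^sup>+z. 0 \<partial>(lborel :: real measure))"
      using AE_lborel_singleton[of y] by (intro nn_integral_cong_AE) auto
    finally show ?thesis by (simp add: measure_def)
  qed
  define Fu where "Fu = (\<lambda>u::real. (iexp (-(u * a)) - iexp (-(u * b))) / (\<i> * u))"
  define H where "H = (\<lambda>u. Fu u * char ?D u)"
  have [measurable]: "Fu \<in> borel_measurable borel" unfolding Fu_def by measurable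
  have [measurable]: "H \<in> borel_measurable borel" unfolding H_def by measurable
  have Hb: "norm (H u) \<le> (b - a) * exp (- t * \<Psi> u)" for u
  proof -
    have "norm (Fu u) \<le> b - a"
      using Levy_Inversion_aux2[of "-b" "-a" u] ab by (cases "u = 0") (auto simp: Fu_def)
    moreover have "norm (char ?D u) = exp (- t * \<Psi> u)" using t by (simp add: char_X cX_eq)
    ultimately show ?thesis unfolding H_def norm_mult by (simp add: mult_right_mono)
  qed
  have iw: "integrable lborel (\<lambda>u. (b - a) * exp (- t * \<Psi> u))"
    using integrable_exp_\<Psi>[OF t] by (rule integrable_mult_right)
  have H: "integrable lborel H"
    by (rule Bochner_Integration.integrable_bound[OF iw]) (use Hb ab in \<open>auto\<close>)
  have "(\<lambda>T::nat. 1 / (2 * pi) * (CLBINT u=-T..T. Fu u * char ?D u)) \<longlonglongrightarrow> complex_of_real (measure ?D {a<..b})"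
    unfolding Fu_def by (rule D.Levy_Inversion[OF ab null null])
  moreover have "(\<lambda>T::nat. CLBINT u=ereal (real_of_int (- int T))..ereal (real T). Fu u * char ?D u) \<longlonglongrightarrow> (\<integral>u. H u \<partial>lborel)"
  proof -
    have "(CLBINT u=ereal (real_of_int (- int T))..ereal (real T). Fu u * char ?D u) = (\<integral>u. indicator {-real T<..<real T} u *\<^sub>R H u \<partial>lborel)" for T :: nat
      by (subst interval_integral_Ioo) (auto simp: set_lebesgue_integral_def H_def)
    moreover have "(\<lambda>T::nat. \<integral>u. indicator {-real T<..<real T} u *\<^sub>R H u \<partial>lborel) \<longlonglongrightarrow> (\<integral>u. H u \<partial>lborel)"
    proof (rule integral_dominated_convergence[OF _ _ iw])
      show "AE u in lborel. (\<lambda>T::nat. indicator {-real T<..<real T} u *\<^sub>R H u) \<longlonglongrightarrow> H u"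
      proof (rule AE_I2)
        fix u :: real
        obtain N :: nat where N: "\<bar>u\<bar> < real N" using reals_Archimedean2 by blast
        have "eventually (\<lambda>T::nat. indicator {-real T<..<real T} u *\<^sub>R H u = H u) sequentially"
          using eventually_ge_at_top[of N] by eventually_elim (use N in \<open>auto simp: indicator_def\<close>)
        then show "(\<lambda>T::nat. indicator {-real T<..<real T} u *\<^sub>R H u) \<longlonglongrightarrow> H u" by (rule tendsto_eventually)
      qed
      show "AE u in lborel. norm (indicator {-real T<..<real T} u *\<^sub>R H u) \<le> (b - a) * exp (- t * \<Psi> u)" for T :: nat
        using Hb ab by (auto simp: indicator_def intro: order_trans)
    qed measurable
    ultimately show "(\<lambda>T::nat. CLBINT u=ereal (real_of_int (- int T))..ereal (real T). Fu u * char ?D u) \<longlonglongrightarrow> (\<integral>u. H u \<partial>lborel)" by simp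
  qed
  ultimately have "complex_of_real (measure ?D {a<..b}) = 1 / (2 * pi) * (\<integral>u. H u \<partial>lborel)"
    by (rule LIMSEQ_unique[OF _ tendsto_mult_left])
  then have "measure ?D {a<..b} = Re (1 / (2 * pi) * (\<integral>u. H u \<partial>lborel))"
    by (metis Re_complex_of_real)
  also have "\<dots> = (\<integral>u. Re (H u) \<partial>lborel) / (2 * pi)"
    using H by (simp add: integral_Re)
  also have "(\<integral>u. Re (H u) \<partial>lborel) = (\<integral>u. (\<integral>x. indicator {a..b} x * cos (x * u) \<partial>lborel) * exp (- t * \<Psi> u) \<partial>lborel)"
  proof (rule integral_cong_AE)
    \<comment> \<open>At u = 0 the quotient in \<open>Fu\<close> takes the default value 0 of
      division instead of b - a, so the identity is claimed almost everywhere only.\<close>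
    show "AE u in lborel. Re (H u) = (\<integral>x. indicator {a..b} x * cos (x * u) \<partial>lborel) * exp (- t * \<Psi> u)"
      using AE_lborel_singleton[of 0]
    proof eventually_elim
      fix u :: real assume u: "u \<noteq> 0"
      have "(\<integral>x. cos (x * u) * indicator {a..b} x \<partial>lborel) = sin (b * u) / u - sin (a * u) / u"
        using u by (intro integral_FTC_Icc_real ab) (auto intro!: derivative_eq_intros continuous_intros)
      moreover have "Re (Fu u) = sin (b * u) / u - sin (a * u) / u"
        using u by (simp add: Fu_def Re_divide exp_Euler cos_of_real sin_of_real Re_exp Im_exp field_simps power2_eq_square)
      ultimately show "Re (H u) = (\<integral>x. indicator {a..b} x * cos (x * u) \<partial>lborel) * exp (- t * \<Psi> u)"
        using t by (simp add: H_def char_X cX_eq mult.commute)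
    qed
  qed measurable
  also have "\<dots> / (2 * pi) = (\<integral>x. indicator {a..b} x * q t x \<partial>lborel)"
  proof -
    have int: "integrable (lborel \<Otimes>\<^sub>M lborel) (\<lambda>(x, u). indicator {a..b} x * cos (x * u) * exp (- t * \<Psi> u))"
    proof (rule Bochner_Integration.integrable_bound)
      have "integrable (lborel \<Otimes>\<^sub>M lborel) (\<lambda>(x, u). indicator {a..b} x * exp (- t * \<Psi> u) :: real)"
      proof (rule lborel_pair.Fubini_integrable)
        have "(\<lambda>x. \<integral>u. norm (indicator {a..b} x * exp (- t * \<Psi> u)) \<partial>lborel) = (\<lambda>x. indicator {a..b} x * (\<integral>u. exp (- t * \<Psi> u) \<partial>lborel))"
          by (simp add: abs_mult)
        then show "integrable lborel (\<lambda>x. \<integral>u. norm (case (x, u) of (x, u) \<Rightarrow> indicator {a..b} x * exp (- t * \<Psi> u)) \<partial>lborel)"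
          by (simp add: emeasure_lborel_Icc_eq)
      qed (use integrable_exp_\<Psi>[OF t] in \<open>auto\<close>)
      then show "integrable (lborel \<Otimes>\<^sub>M lborel) (\<lambda>z. indicator {a..b} (fst z) * exp (- t * \<Psi> (snd z)) :: real)"
        unfolding case_prod_unfold .
      show "AE z in lborel \<Otimes>\<^sub>M lborel. norm (case z of (x, u) \<Rightarrow> indicator {a..b} x * cos (x * u) * exp (- t * \<Psi> u)) \<le> norm (indicator {a..b} (fst z) * exp (- t * \<Psi> (snd z)) :: real)"
        by (auto simp: abs_mult indicator_def split_beta mult_left_le_one_le)
    qed measurable
    have "(\<integral>u. (\<integral>x. indicator {a..b} x * cos (x * u) * exp (- t * \<Psi> u) \<partial>lborel) \<partial>lborel)
      = (\<integral>x. (\<integral>u. indicator {a..b} x * cos (x * u) * exp (- t * \<Psi> u) \<partial>lborel) \<partial>lborel)"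
      by (rule lborel_pair.Fubini_integral[OF int])
    moreover have "(\<integral>x. indicator {a..b} x * cos (x * u) * exp (- t * \<Psi> u) \<partial>lborel)
      = (\<integral>x. indicator {a..b} x * cos (x * u) \<partial>lborel) * exp (- t * \<Psi> u)" for u
      by (rule integral_mult_left_zero)
    moreover have "(\<integral>u. indicator {a..b} x * cos (x * u) * exp (- t * \<Psi> u) \<partial>lborel)
      = indicator {a..b} x * (\<integral>u. cos (x * u) * exp (- t * \<Psi> u) \<partial>lborel)" for x
      unfolding mult.assoc by (rule integral_mult_right_zero)
    ultimately show ?thesis unfolding q_def by simp
  qed
  finally show ?thesis .
qed

lemma integrable_q_Icc: "t > 0 \<Longrightarrow> integrable lborel (\<lambda>x. indicator {a..b} x * q t x)"
  using borel_integrable_compact[of "{a..b}" "q t"] continuous_on_subset[OF q_continuous]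
  by (simp add: indicator_scaleR_eq_if mult.commute scaleR_conv_of_real if_distrib indicator_def cong: if_cong)

text \<open>A negative value would persist on a short interval by continuity, and the integral over
  that interval is a probability.\<close>

lemma q_nonneg:
  assumes t: "t > 0"
  shows "q t x \<ge> 0"
proof (rule ccontr)
  assume neg: "\<not> q t x \<ge> 0"
  have "isCont (q t) x" using q_continuous[OF t] by (simp add: continuous_on_eq_continuous_at)
  then obtain d where d: "d > 0" "\<And>y. \<bar>y - x\<bar> < d \<Longrightarrow> \<bar>q t y - q t x\<bar> < - q t x / 2"
    unfolding continuous_at_eps_delta dist_real_def using neg by (metis half_gt_zero neg_0_less_iff_less not_le)
  define e where "e = d / 2"
  have le: "q t y \<le> q t x / 2" if "y \<in> {x..x + e}" for y
    using d(2)[of y] that d(1) by (auto simp: e_def)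
  have e: "e > 0" using d by (simp add: e_def)
  have "0 \<le> (\<integral>y. indicator {x..x + e} y * q t y \<partial>lborel)"
    using interval_prob[OF t, of x "x + e"] e by (metis less_eq_real_def less_add_same_cancel1 measure_nonneg)
  also have "\<dots> \<le> (\<integral>y. indicator {x..x + e} y * (q t x / 2) \<partial>lborel)"
  proof (intro integral_mono integrable_q_Icc t)
    show "integrable lborel (\<lambda>y. indicator {x..x + e} y * (q t x / 2))"
      by (intro integrable_mult_left integrable_real_indicator) (auto simp: emeasure_lborel_Icc_eq)
  qed (use le in \<open>auto simp: indicator_def\<close>)
  also have "\<dots> = e * (q t x / 2)" using e by simp
  finally show False using e neg by (simp add: zero_le_mult_iff)
qed

lemma distributed_q:
  assumes t: "t > 0"
  shows "distributed P lborel (X t) (\<lambda>z. ennreal (q t z))"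
proof -
  let ?D = "distr P borel (X t)"
  interpret D: real_distribution ?D by (auto intro!: real_distribution_distr)
  have "?D = density lborel (\<lambda>z. ennreal (q t z))"
  proof (rule measure_eqI_generator_eq[where \<Omega>=UNIV and E="range (\<lambda>(a, b). {a<..b::real})" and A="\<lambda>i. {- real (i::nat)<..real i}"])
    fix Y assume "Y \<in> range (\<lambda>(a, b). {a<..b::real})"
    then obtain a b where Y: "Y = {a<..b}" by auto
    show "emeasure ?D Y = emeasure (density lborel (\<lambda>z. ennreal (q t z))) Y"
    proof (cases "a \<le> b")
      case True
      have "emeasure (density lborel (\<lambda>z. ennreal (q t z))) Y = (\<integral>\<^sup>+z. ennreal (indicator {a..b} z * q t z) \<partial>lborel)"
      proof -
        have "AE z in lborel. ennreal (q t z) * indicator {a<..b} z = ennreal (indicator {a..b} z * q t z)"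
          using AE_lborel_singleton[of a] by eventually_elim (auto simp: indicator_def)
        then show ?thesis unfolding Y by (subst emeasure_density) (auto intro!: nn_integral_cong_AE)
      qed
      also have "\<dots> = ennreal (\<integral>z. indicator {a..b} z * q t z \<partial>lborel)"
        using q_nonneg[OF t] integrable_q_Icc[OF t] by (intro nn_integral_eq_integral) auto
      also have "\<dots> = emeasure ?D Y" unfolding Y interval_prob[OF t True, symmetric] by (simp add: D.emeasure_eq_measure)
      finally show ?thesis by simp
    qed (simp add: Y)
  next
    show "(\<Union>i. {- real (i::nat)<..real i}) = UNIV" by (rule UN_Ioc_eq_UNIV)
    show "emeasure ?D {- real (i::nat)<..real i} \<noteq> \<infinity>" for i by simp
    show "sets ?D = sigma_sets UNIV (range (\<lambda>(a, b). {a<..b::real}))" by (simp add: borel_sigma_sets_Ioc)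
    show "sets (density lborel (\<lambda>z. ennreal (q t z))) = sigma_sets UNIV (range (\<lambda>(a, b). {a<..b::real}))"
      by (simp add: borel_sigma_sets_Ioc)
  qed (auto simp: Int_stable_def)
  moreover have "distr P lborel (X t) = ?D" by (rule distr_cong) auto
  ultimately show ?thesis unfolding distributed_def by simp
qed

lemma X_nn_integral:
  "t > 0 \<Longrightarrow> g \<in> borel_measurable borel \<Longrightarrow> (\<integral>\<^sup>+\<omega>. g (X t \<omega>) \<partial>P) = (\<integral>\<^sup>+z. ennreal (q t z) * g z \<partial>lborel)"
  using distributed_nn_integral[OF distributed_q, of t g] by simp

section \<open>Strict positivity of the density\<close>

lemma q_chapman_nn:
  assumes "s > 0" "t > 0"
  shows "ennreal (q (s + t) x) = (\<integral>\<^sup>+z. ennreal (q t (x - z) * q s z) \<partial>lborel)"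
proof -
  have "ennreal (q (s + t) x) = (\<integral>\<^sup>+\<omega>. ennreal (q t (x - X s \<omega>)) \<partial>P)"
    using assms q_nonneg[OF assms(2)] q_chapman[OF assms(2), of s x] by (simp add: nn_integral_eq_integral)
  also have "\<dots> = (\<integral>\<^sup>+z. ennreal (q s z) * ennreal (q t (x - z)) \<partial>lborel)"
    using assms by (intro X_nn_integral) auto
  finally show ?thesis using assms by (simp add: ennreal_mult q_nonneg mult.commute)
qed

text \<open>At a zero of q_(s+t) the Chapman-Kolmogorov integral vanishes; its integrand is
  continuous and nonnegative, hence zero at every point.\<close>

lemma q_zero_product:
  assumes "s > 0" "t > 0" "q (s + t) x = 0"
  shows "q t (x - z) * q s z = 0"
proof -
  have "continuous_on UNIV (\<lambda>z. q t (x - z) * q s z)"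
    by (intro continuous_on_mult continuous_on_compose2[OF q_continuous[OF assms(2)]] continuous_on_compose2[OF q_continuous[OF assms(1)]] continuous_intros) auto
  then have "q t (x - z) * q s z \<le> 0"
    using q_chapman_nn[OF assms(1,2), of x] assms(3) by (intro continuous_nn_integral_0_imp_0) auto
  then show ?thesis using q_nonneg[OF assms(1), of z] q_nonneg[OF assms(2), of "x - z"]
    by (metis antisym mult_nonneg_nonneg)
qed

text \<open>The choice z = 0 in \<open>q_zero_product\<close>: the second factor is then the
  positive number q_(t0-t)(0).\<close>

lemma q_zero_earlier: "0 < t \<Longrightarrow> t \<le> t0 \<Longrightarrow> q t0 x = 0 \<Longrightarrow> q t x = 0"
  using q_zero_product[of "t0 - t" t x 0] q0_pos[of "t0 - t"] by (cases "t = t0") auto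


text \<open>\<open>h \<mapsto> q (t0 + h) x\<close> is a power series for \<open>\<bar>h\<bar> < t0 / 2\<close> which vanishes for \<open>h \<le> 0\<close>.\<close>

lemma q_zero_extend:
  assumes t0: "t0 > 0" and z: "q t0 x = 0" and h: "\<bar>h\<bar> < t0 / 2"
  shows "q (t0 + h) x = 0"
proof -
  define b where "b n = (\<integral>\<xi>. cos (x * \<xi>) * (- \<Psi> \<xi>) ^ n / fact n * exp (- t0 * \<Psi> \<xi>) \<partial>lborel)" for n
  define f where "f h = (\<integral>\<xi>. cos (x * \<xi>) * exp (- (t0 + h) * \<Psi> \<xi>) \<partial>lborel)" for h
  let ?g = "\<lambda>\<xi>. exp (- (t0 / 2) * \<Psi> \<xi>)"
  have ig: "integrable lborel ?g" using integrable_exp_\<Psi>[of "t0/2"] t0 by simp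
  \<comment> \<open>Half of the factor exp(-t0 \<Psi>) is spent on the power, since (t0 \<Psi> /
    2)^n / n! <= exp(t0 \<Psi> / 2). The other half stays integrable, and the geometric factor (2 /
    t0)^n gives the radius t0 / 2.\<close>
  have bound: "norm (cos (x * \<xi>) * (- \<Psi> \<xi>) ^ n / fact n * exp (- t0 * \<Psi> \<xi>)) \<le> (2 / t0) ^ n * ?g \<xi>" for n \<xi>
  proof -
    have "0 \<le> t0 / 2 * \<Psi> \<xi>" using t0 \<Psi>_nonneg[of \<xi>] by simp
    from power_le_fact_exp[OF this, of n]
    have "(t0 / 2 * \<Psi> \<xi>) ^ n / fact n \<le> exp (t0 / 2 * \<Psi> \<xi>)"
      unfolding pos_divide_le_eq[OF fact_gt_zero] by (simp only: mult.commute)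
    then have le: "(2 / t0) ^ n * ((t0 / 2 * \<Psi> \<xi>) ^ n / fact n) * exp (- t0 * \<Psi> \<xi>) \<le> (2 / t0) ^ n * exp (t0 / 2 * \<Psi> \<xi>) * exp (- t0 * \<Psi> \<xi>)"
      using t0 by (intro mult_right_mono mult_left_mono) auto
    have eq: "(2 / t0) ^ n * ((t0 / 2 * \<Psi> \<xi>) ^ n / fact n) = \<Psi> \<xi> ^ n / fact n"
      using t0 by (simp add: power_mult_distrib power_divide field_simps)
    have "exp (t0 / 2 * \<Psi> \<xi>) * exp (- t0 * \<Psi> \<xi>) = ?g \<xi>" by (simp add: exp_add[symmetric])
    then have eq': "(2 / t0) ^ n * exp (t0 / 2 * \<Psi> \<xi>) * exp (- t0 * \<Psi> \<xi>) = (2 / t0) ^ n * ?g \<xi>"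
      by (simp only: mult.assoc)
    have *: "\<Psi> \<xi> ^ n / fact n * exp (- t0 * \<Psi> \<xi>) \<le> (2 / t0) ^ n * ?g \<xi>"
      using le unfolding eq eq' .
    have "norm (cos (x * \<xi>) * (- \<Psi> \<xi>) ^ n / fact n * exp (- t0 * \<Psi> \<xi>)) = \<bar>cos (x * \<xi>)\<bar> * (\<Psi> \<xi> ^ n / fact n * exp (- t0 * \<Psi> \<xi>))"
      using \<Psi>_nonneg[of \<xi>] by (simp add: abs_mult power_abs)
    also have "\<dots> \<le> 1 * (\<Psi> \<xi> ^ n / fact n * exp (- t0 * \<Psi> \<xi>))"
      using \<Psi>_nonneg[of \<xi>] by (intro mult_right_mono) auto
    finally show ?thesis using * by simp
  qed
  have sums: "(\<lambda>n. b n * h ^ n) sums f h" if h: "\<bar>h\<bar> < t0 / 2" for h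
  proof -
    let ?F = "\<lambda>n \<xi>. cos (x * \<xi>) * (- \<Psi> \<xi>) ^ n / fact n * exp (- t0 * \<Psi> \<xi>) * h ^ n"
    have Fb: "norm (?F n \<xi>) \<le> (2 * \<bar>h\<bar> / t0) ^ n * ?g \<xi>" for n \<xi>
    proof -
      have "norm (?F n \<xi>) = norm (cos (x * \<xi>) * (- \<Psi> \<xi>) ^ n / fact n * exp (- t0 * \<Psi> \<xi>)) * \<bar>h\<bar> ^ n"
        unfolding norm_mult[of _ "h ^ n"] by (simp only: real_norm_def power_abs)
      also have "\<dots> \<le> ((2 / t0) ^ n * ?g \<xi>) * \<bar>h\<bar> ^ n"
        by (intro mult_right_mono bound) auto
      finally have "norm (?F n \<xi>) \<le> ((2 / t0) ^ n * ?g \<xi>) * \<bar>h\<bar> ^ n" .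
      then show ?thesis using t0 by (simp add: power_divide power_mult_distrib field_simps)
    qed
    have r: "norm (2 * \<bar>h\<bar> / t0) < 1" using h t0 by simp
    have sumF: "(\<lambda>n. ?F n \<xi>) sums (cos (x * \<xi>) * exp (- (t0 + h) * \<Psi> \<xi>))" for \<xi>
    proof -
      have "(\<lambda>n. (- \<Psi> \<xi> * h) ^ n /\<^sub>R fact n) sums exp (- \<Psi> \<xi> * h)" by (rule exp_converges)
      then have "(\<lambda>n. (cos (x * \<xi>) * exp (- t0 * \<Psi> \<xi>)) * ((- \<Psi> \<xi> * h) ^ n /\<^sub>R fact n)) sums ((cos (x * \<xi>) * exp (- t0 * \<Psi> \<xi>)) * exp (- \<Psi> \<xi> * h))"
        by (rule sums_mult)
      moreover have B: "(cos (x * \<xi>) * exp (- t0 * \<Psi> \<xi>)) * exp (- \<Psi> \<xi> * h) = cos (x * \<xi>) * exp (- (t0 + h) * \<Psi> \<xi>)"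
        by (simp add: mult.assoc exp_add[symmetric] algebra_simps)
      moreover have C: "(cos (x * \<xi>) * exp (- t0 * \<Psi> \<xi>)) * ((- \<Psi> \<xi> * h) ^ n /\<^sub>R fact n) = ?F n \<xi>" for n
        unfolding power_mult_distrib by (simp add: field_simps)
      ultimately show ?thesis by (simp only: B C)
    qed
    have intF: "integrable lborel (?F n)" for n
    proof (rule Bochner_Integration.integrable_bound[OF integrable_mult_right[OF ig, of "(2 * \<bar>h\<bar> / t0) ^ n"]])
      show "AE \<xi> in lborel. norm (?F n \<xi>) \<le> norm ((2 * \<bar>h\<bar> / t0) ^ n * ?g \<xi>)"
      proof (rule AE_I2)
        fix \<xi> :: real
        show "norm (?F n \<xi>) \<le> norm ((2 * \<bar>h\<bar> / t0) ^ n * ?g \<xi>)"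
          using Fb[of \<xi> n] abs_ge_self[of "(2 * \<bar>h\<bar> / t0) ^ n * ?g \<xi>"] unfolding real_norm_def by linarith
      qed
    qed measurable
    have "(\<lambda>n. \<integral>\<xi>. ?F n \<xi> \<partial>lborel) sums (\<integral>\<xi>. (\<Sum>n. ?F n \<xi>) \<partial>lborel)"
    proof (rule sums_integral[OF intF])
      show "AE \<xi> in lborel. summable (\<lambda>n. norm (?F n \<xi>))"
      proof (rule AE_I2)
        fix \<xi>
        have "summable (\<lambda>n. (2 * \<bar>h\<bar> / t0) ^ n * ?g \<xi>)" using r by (intro summable_mult2 summable_geometric)
        then show "summable (\<lambda>n. norm (?F n \<xi>))" using Fb by (intro summable_comparison_test[of "\<lambda>n. norm (?F n \<xi>)"]) auto
      qed
      have S1: "summable (\<lambda>n. (2 * \<bar>h\<bar> / t0) ^ n * (\<integral>\<xi>. ?g \<xi> \<partial>lborel))" using r by (intro summable_mult2 summable_geometric)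
      have S2: "norm (\<integral>\<xi>. norm (?F n \<xi>) \<partial>lborel) \<le> (2 * \<bar>h\<bar> / t0) ^ n * (\<integral>\<xi>. ?g \<xi> \<partial>lborel)" for n
      proof -
        have "(\<integral>\<xi>. norm (?F n \<xi>) \<partial>lborel) \<le> (\<integral>\<xi>. (2 * \<bar>h\<bar> / t0) ^ n * ?g \<xi> \<partial>lborel)"
          by (intro integral_mono integrable_norm intF integrable_mult_right ig Fb)
        moreover have "0 \<le> (\<integral>\<xi>. norm (?F n \<xi>) \<partial>lborel)" by (rule integral_nonneg_AE) simp
        ultimately show ?thesis by simp
      qed
      show "summable (\<lambda>n. \<integral>\<xi>. norm (?F n \<xi>) \<partial>lborel)"
        by (rule summable_comparison_test'[where N=0, OF S1 S2])
    qed
    moreover have "(\<Sum>n. ?F n \<xi>) = cos (x * \<xi>) * exp (- (t0 + h) * \<Psi> \<xi>)" for \<xi>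
      using sumF by (simp add: sums_iff)
    ultimately show ?thesis unfolding b_def f_def by simp
  qed
  have fq: "f h = 2 * pi * q (t0 + h) x" for h by (simp add: f_def q_def)
  have "f h = 0"
  proof (rule powser_zero_left_imp_zero[of "t0 / 2" b f, OF _ sums _ h])
    fix h' :: real assume "- (t0 / 2) < h'" "h' \<le> 0"
    then show "f h' = 0" using q_zero_earlier[of "t0 + h'" t0 x] t0 z by (simp add: fq)
  qed (use t0 in auto)
  then show ?thesis by (simp add: fq)
qed

text \<open>Prolonging the time by a quarter stays inside the radius of
  \<open>q_zero_extend\<close>, so zeros spread to times t0 (5/4)^n. Once such a time exceeds t,
  \<open>q_zero_earlier\<close> brings the zero back to t.\<close>

lemma q_zero_all:
  assumes t0: "t0 > 0" and z: "q t0 x = 0" and t: "t > 0"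
  shows "q t x = 0"
proof -
  have "q (t0 * (5 / 4) ^ n) x = 0" for n
  proof (induction n)
    case (Suc n)
    have "q (t0 * (5 / 4) ^ n + t0 * (5 / 4) ^ n / 4) x = 0"
      using t0 by (intro q_zero_extend Suc.IH) auto
    then show ?case by (simp add: field_simps)
  qed (use z in simp)
  moreover obtain n where "t / t0 < (5 / 4 :: real) ^ n" using real_arch_pow[of "5/4" "t / t0"] by auto
  ultimately show ?thesis using q_zero_earlier[of t "t0 * (5 / 4) ^ n" x] t t0 by (simp add: field_simps)
qed

lemma q_pos:
  assumes t: "t > 0"
  shows "q t x > 0"
proof -
  have "isCont (q 1) 0" using q_continuous[of 1] by (simp add: continuous_on_eq_continuous_at)
  then obtain d where d: "d > 0" "\<And>y. \<bar>y\<bar> < d \<Longrightarrow> \<bar>q 1 y - q 1 0\<bar> < q 1 0"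
    unfolding continuous_at_eps_delta dist_real_def using q0_pos[of 1] by (metis diff_zero zero_less_one)
  have near: "q s y \<noteq> 0" if "\<bar>y\<bar> < d" "s > 0" for s y
    using d(2)[OF that(1)] q_zero_all[of s y 1] that(2) by auto
  \<comment> \<open>Any x equals n * (x / n) with x / n in the ball for n large. Adding the
    increments one at a time advances the time from n to n + 1, which is harmless because the zero
    set is the same at all times.\<close>
  have mult: "q (real (Suc n)) (real (Suc n) * y) \<noteq> 0" if "\<bar>y\<bar> < d" for n y
  proof (induction n)
    case (Suc n)
    show ?case
    proof
      assume "q (real (Suc (Suc n))) (real (Suc (Suc n)) * y) = 0"
      then have "q 1 (real (Suc (Suc n)) * y - real (Suc n) * y) * q (real (Suc n)) (real (Suc n) * y) = 0"
        by (intro q_zero_product) (auto simp: add.commute)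
      then show False using Suc.IH near[OF that, of 1] by (simp add: algebra_simps)
    qed
  qed (use near that in simp)
  obtain n where n: "\<bar>x\<bar> / d < real n" using reals_Archimedean2 by blast
  have "real n > 0" using n d(1) by (meson abs_ge_zero divide_nonneg_pos le_less_trans)
  then obtain m where m: "n = Suc m" by (cases n) auto
  have "\<bar>x / real n\<bar> < d" using n d(1) \<open>real n > 0\<close> by (simp add: field_simps)
  then have "q (real n) x \<noteq> 0" using mult[of "x / real n" m] \<open>real n > 0\<close> unfolding m[symmetric] by simp
  then have "q t x \<noteq> 0" using q_zero_all[OF t, of x "real n"] \<open>real n > 0\<close> by blast
  then show ?thesis using q_nonneg[OF t, of x] by simp
qed

lemma p_eq_q_AE:
  assumes t: "t > 0"
  shows "AE z in lborel. p t z = q t z"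
proof -
  have "density lborel (\<lambda>z. ennreal (p t z)) = density lborel (\<lambda>z. ennreal (q t z))"
    using distributed_distr_eq_density[OF distributed_q[OF t]] distributed_distr_eq_density[of P lborel "X t" "\<lambda>z. ennreal (p t z)"] dens t by simp
  then have "AE z in lborel. ennreal (p t z) = ennreal (q t z)"
    using dens t distributed_borel_measurable
    by (intro sigma_finite_measure.density_unique[OF sigma_finite_lborel]) auto
  then show ?thesis
  proof eventually_elim
    case (elim z)
    then show ?case
      using q_pos[OF t, of z] by (cases "p t z \<ge> 0") (auto simp: ennreal_neg)
  qed
qed

end

section \<open>Exponential moments\<close>

lemma exp_plus_exp_minus_ge_2: "2 \<le> exp x + exp (- x :: real)"
  using exp_ge_add_one_self[of x] exp_ge_add_one_self[of "- x"] by linarith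

lemma nn_integral_exp_Ioi:
  assumes "g > 0"
  shows "(\<integral>\<^sup>+s. indicator {0<..} s * ennreal (exp (- g * s)) \<partial>lborel) = ennreal (1 / g)"
proof -
  have "((\<lambda>s. - exp (- g * s) / g) \<longlongrightarrow> - 0 / g) at_top"
    using assms by (intro tendsto_intros filterlim_compose[OF exp_at_bot] filterlim_tendsto_neg_mult_at_bot[OF tendsto_const]) (auto simp: filterlim_ident)
  then have "(\<integral>\<^sup>+s. ennreal (exp (- g * s)) * indicator {0..} s \<partial>lborel) = - 0 / g - (- exp (- g * 0) / g)"
    using assms by (intro nn_integral_FTC_atLeast) (auto intro!: derivative_eq_intros)
  moreover have "(\<integral>\<^sup>+s. ennreal (exp (- g * s)) * indicator {0..} s \<partial>lborel) = (\<integral>\<^sup>+s. indicator {0<..} s * ennreal (exp (- g * s)) \<partial>lborel)"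
    using AE_lborel_singleton[of 0] by (intro nn_integral_cong_AE) (auto elim!: eventually_mono simp: indicator_def)
  ultimately show ?thesis by simp
qed

locale levy_exp = levy_dalang +
  fixes c :: real
  assumes c_pos: "c > 0" and exp_moment: "integrable P (\<lambda>\<omega>. exp (c * X 1 \<omega>))"
begin

definition mgf :: "real \<Rightarrow> ennreal" where
  "mgf t = (\<integral>\<^sup>+\<omega>. ennreal (exp (c * X t \<omega>)) \<partial>P)"

lemma mgf_distr: "mgf t = (\<integral>\<^sup>+x. ennreal (exp (c * x)) \<partial>distr P borel (X t))"
  unfolding mgf_def by (subst nn_integral_distr) auto

lemma mgf_add:
  assumes "s \<ge> 0" "t \<ge> 0"
  shows "mgf (s + t) = mgf s * mgf t"
proof -
  let ?Y = "\<lambda>i::nat. \<lambda>\<omega>. if i = 0 then X s \<omega> - X 0 \<omega> else X (s + t) \<omega> - X s \<omega>"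
  have "indep_vars (\<lambda>_. borel) (\<lambda>i \<omega>. ennreal (exp (c * ?Y i \<omega>))) {..<2}"
    by (rule indep_vars_compose2[OF indep_increments[OF assms]]) measurable
  then have "(\<integral>\<^sup>+\<omega>. (\<Prod>i<2. ennreal (exp (c * ?Y i \<omega>))) \<partial>P) = (\<Prod>i<2. \<integral>\<^sup>+\<omega>. ennreal (exp (c * ?Y i \<omega>)) \<partial>P)"
    by (intro indep_vars_nn_integral) auto
  moreover have "(\<Prod>i<2. ennreal (exp (c * ?Y i \<omega>))) = ennreal (exp (c * (X (s + t) \<omega> - X 0 \<omega>)))" for \<omega>
    by (simp add: eval_nat_numeral lessThan_Suc ennreal_mult[symmetric] exp_add[symmetric] algebra_simps)
  moreover have 0: "(\<integral>\<^sup>+\<omega>. ennreal (exp (c * (X r \<omega> - X 0 \<omega>))) \<partial>P) = mgf r" for r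
    unfolding mgf_def by (intro nn_integral_cong) (simp add: X_zero)
  moreover have "(\<integral>\<^sup>+\<omega>. ennreal (exp (c * (X (s + t) \<omega> - X s \<omega>))) \<partial>P) = mgf t"
  proof -
    have "(\<integral>\<^sup>+\<omega>. ennreal (exp (c * (X (s + t) \<omega> - X s \<omega>))) \<partial>P)
      = (\<integral>\<^sup>+x. ennreal (exp (c * x)) \<partial>distr P borel (\<lambda>\<omega>. X (s + t) \<omega> - X s \<omega>))"
      by (subst nn_integral_distr) auto
    then show ?thesis unfolding distr_incr[OF assms] mgf_distr .
  qed
  ultimately show ?thesis by (simp add: eval_nat_numeral lessThan_Suc mult.commute)
qed

lemma mgf_neg:
  assumes "t \<ge> 0"
  shows "(\<integral>\<^sup>+\<omega>. ennreal (exp (- (c * X t \<omega>))) \<partial>P) = mgf t"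
proof -
  have "(\<integral>\<^sup>+\<omega>. ennreal (exp (- (c * X t \<omega>))) \<partial>P) = (\<integral>\<^sup>+x. ennreal (exp (c * x)) \<partial>distr P borel (\<lambda>\<omega>. - X t \<omega>))"
    by (subst nn_integral_distr) auto
  then show ?thesis unfolding distr_neg[OF assms] mgf_distr .
qed

text \<open>By symmetry twice the left side is the expectation of exp(c X) + exp(-c X), which is at
  least 2.\<close>

lemma mgf_ge_1:
  assumes "t \<ge> 0"
  shows "1 \<le> mgf t"
proof -
  have "2 = (\<integral>\<^sup>+\<omega>. 2 \<partial>P)" by (simp add: emeasure_space_1)
  also have "\<dots> \<le> (\<integral>\<^sup>+\<omega>. ennreal (exp (c * X t \<omega>)) + ennreal (exp (- (c * X t \<omega>))) \<partial>P)"
  proof (rule nn_integral_mono)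
    fix \<omega>
    have "ennreal 2 \<le> ennreal (exp (c * X t \<omega>) + exp (- (c * X t \<omega>)))"
      by (rule ennreal_leI) (rule exp_plus_exp_minus_ge_2)
    then show "2 \<le> ennreal (exp (c * X t \<omega>)) + ennreal (exp (- (c * X t \<omega>)))" by simp
  qed
  also have "\<dots> = mgf t + mgf t" using mgf_neg[OF assms] by (simp add: nn_integral_add mgf_def)
  finally have "2 \<le> 2 * mgf t" by (simp add: mult_2)
  then show ?thesis
    by (cases "mgf t") (auto simp: ennreal_mult'[symmetric] ennreal_1[symmetric] ennreal_numeral[symmetric] simp del: ennreal_1 ennreal_numeral)
qed

text \<open>The cumulant generating function of \<open>X 1\<close> at c, that is, the exponential
  growth rate of \<open>mgf\<close>.\<close>

definition \<kappa> :: real where "\<kappa> = ln (enn2real (mgf 1))"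

lemma mgf_1: "mgf 1 = ennreal (exp \<kappa>)" and \<kappa>_nonneg: "\<kappa> \<ge> 0"
proof -
  have fin: "mgf 1 < \<top>" using exp_moment unfolding mgf_def by (subst nn_integral_eq_integral) auto
  then obtain r where r: "mgf 1 = ennreal r" "r \<ge> 0" by (cases "mgf 1") auto
  have "r \<ge> 1" using mgf_ge_1[of 1] r by (simp add: ennreal_1[symmetric] del: ennreal_1)
  then show "mgf 1 = ennreal (exp \<kappa>)" "\<kappa> \<ge> 0" using r by (auto simp: \<kappa>_def)
qed

lemma mgf_0: "mgf 0 = 1"
proof -
  have "mgf 0 = (\<integral>\<^sup>+\<omega>. 1 \<partial>P)" unfolding mgf_def by (intro nn_integral_cong) (simp add: X_zero)
  then show ?thesis by (simp add: emeasure_space_1)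
qed

text \<open>The value is computed at integer times only. A general time is rounded up, which
  increases \<open>mgf\<close> because of \<open>mgf_ge_1\<close>; hence t + 1 in place of
  t.\<close>

lemma mgf_bound:
  assumes "t \<ge> 0"
  shows "mgf t \<le> ennreal (exp (\<kappa> * (t + 1)))"
proof -
  define n where "n = nat \<lceil>t\<rceil>"
  have n: "t \<le> real n" "real n \<le> t + 1" using assms by (auto simp: n_def of_nat_ceiling)
  have mgf_n: "mgf (real k) = ennreal (exp (\<kappa> * real k))" for k
  proof (induction k)
    case (Suc k)
    have "real (Suc k) = real k + 1" by simp
    moreover have "mgf (real k + 1) = mgf (real k) * mgf 1" by (rule mgf_add) auto
    moreover have "exp (\<kappa> * (real k + 1)) = exp (\<kappa> * real k) * exp \<kappa>" by (simp add: distrib_left exp_add)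
    ultimately show ?case by (simp only: Suc.IH mgf_1 ennreal_mult exp_ge_zero)
  qed (simp add: mgf_0)
  have "mgf t \<le> mgf (real n)"
  proof -
    have "mgf t * 1 \<le> mgf t * mgf (real n - t)" using n by (intro mult_left_mono mgf_ge_1) auto
    then show ?thesis using mgf_add[of t "real n - t"] assms n by simp
  qed
  moreover have "ennreal (exp (\<kappa> * real n)) \<le> ennreal (exp (\<kappa> * (t + 1)))"
    using n \<kappa>_nonneg by (intro ennreal_leI) (simp add: mult_left_mono)
  ultimately show ?thesis unfolding mgf_n by (rule order_trans)
qed

lemma exp_abs_moment:
  assumes "t \<ge> 0"
  shows "(\<integral>\<^sup>+\<omega>. ennreal (exp (c * \<bar>X t \<omega>\<bar>)) \<partial>P) \<le> ennreal (2 * exp (\<kappa> * (t + 1)))"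
proof -
  have "(\<integral>\<^sup>+\<omega>. ennreal (exp (c * \<bar>X t \<omega>\<bar>)) \<partial>P) \<le> (\<integral>\<^sup>+\<omega>. ennreal (exp (c * X t \<omega>)) + ennreal (exp (- (c * X t \<omega>))) \<partial>P)"
  proof (rule nn_integral_mono)
    fix \<omega>
    have "exp (c * \<bar>X t \<omega>\<bar>) \<le> exp (c * X t \<omega>) + exp (- (c * X t \<omega>))" by (cases "X t \<omega> \<ge> 0") auto
    then show "ennreal (exp (c * \<bar>X t \<omega>\<bar>)) \<le> ennreal (exp (c * X t \<omega>)) + ennreal (exp (- (c * X t \<omega>)))"
      by (simp add: ennreal_plus[symmetric] ennreal_leI del: ennreal_plus)
  qed
  also have "\<dots> = mgf t + mgf t" using mgf_neg[OF assms] by (simp add: nn_integral_add mgf_def)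
  also have "\<dots> \<le> ennreal (exp (\<kappa> * (t + 1))) + ennreal (exp (\<kappa> * (t + 1)))"
    by (intro add_mono mgf_bound assms)
  also have "\<dots> = ennreal (2 * exp (\<kappa> * (t + 1)))" by (simp add: ennreal_plus[symmetric] del: ennreal_plus)
  finally show ?thesis .
qed

section \<open>Smallness of the weighted squared kernel\<close>

lemma exp_moment_q:
  "t > 0 \<Longrightarrow> (\<integral>\<^sup>+z. ennreal (q t z * exp (c * \<bar>z\<bar>)) \<partial>lborel) \<le> ennreal (2 * exp (\<kappa> * (t + 1)))"
  using exp_abs_moment[of t] X_nn_integral[of t "\<lambda>z. ennreal (exp (c * \<bar>z\<bar>))"]
  by (simp add: ennreal_mult q_nonneg)

text \<open>Up to a constant the Laplace transform of q_s(0). Dalang's function comes from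
  q_(2s)(0), which accounts for \<open>\<Psi>\<close> here instead of 2
  \<open>\<Psi>\<close>.\<close>

definition \<Upsilon> :: "real \<Rightarrow> ennreal" where
  "\<Upsilon> g = (\<integral>\<^sup>+\<xi>. ennreal (1 / (g + \<Psi> \<xi>)) \<partial>lborel)"

text \<open>Tonelli applied to the Fourier integral at x = 0. Only an upper bound is wanted, so the
  factor 1 / (2 pi) is dropped.\<close>

lemma laplace_q0:
  assumes "g > 0"
  shows "(\<integral>\<^sup>+s. indicator {0<..} s * ennreal (exp (- g * s) * q s 0) \<partial>lborel) \<le> \<Upsilon> g"
proof -
  have "(\<integral>\<^sup>+s. indicator {0<..} s * ennreal (exp (- g * s) * q s 0) \<partial>lborel)
    \<le> (\<integral>\<^sup>+s. \<integral>\<^sup>+\<xi>. indicator {0<..} s * ennreal (exp (- (g + \<Psi> \<xi>) * s)) \<partial>lborel \<partial>lborel)"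
  proof (rule nn_integral_mono)
    fix s :: real
    show "indicator {0<..} s * ennreal (exp (- g * s) * q s 0) \<le> (\<integral>\<^sup>+\<xi>. indicator {0<..} s * ennreal (exp (- (g + \<Psi> \<xi>) * s)) \<partial>lborel)"
    proof (cases "s > 0")
      case True
      have "q s 0 \<le> (\<integral>\<xi>. exp (- s * \<Psi> \<xi>) \<partial>lborel)"
      proof -
        have "0 \<le> (\<integral>\<xi>. exp (- s * \<Psi> \<xi>) \<partial>lborel)" by simp
        moreover have "1 \<le> 2 * pi" using pi_gt3 by linarith
        ultimately have "1 * (\<integral>\<xi>. exp (- s * \<Psi> \<xi>) \<partial>lborel) \<le> (2 * pi) * (\<integral>\<xi>. exp (- s * \<Psi> \<xi>) \<partial>lborel)"
          by (intro mult_right_mono)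
        then show ?thesis unfolding q_def by (simp add: divide_le_eq mult.commute)
      qed
      then have "ennreal (exp (- g * s) * q s 0) \<le> ennreal (exp (- g * s)) * (\<integral>\<^sup>+\<xi>. ennreal (exp (- s * \<Psi> \<xi>)) \<partial>lborel)"
        using integrable_exp_\<Psi>[OF True] by (subst nn_integral_eq_integral) (auto simp: ennreal_mult'[symmetric] intro!: ennreal_leI)
      also have "\<dots> = (\<integral>\<^sup>+\<xi>. ennreal (exp (- (g + \<Psi> \<xi>) * s)) \<partial>lborel)"
        by (subst nn_integral_cmult[symmetric]) (auto simp: ennreal_mult[symmetric] exp_add[symmetric] algebra_simps intro!: nn_integral_cong)
      finally show ?thesis using True by simp
    qed simp
  qed
  also have "\<dots> = (\<integral>\<^sup>+\<xi>. \<integral>\<^sup>+s. indicator {0<..} s * ennreal (exp (- (g + \<Psi> \<xi>) * s)) \<partial>lborel \<partial>lborel)"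
    by (rule lborel_pair.Fubini') measurable
  also have "\<dots> = \<Upsilon> g"
    unfolding \<Upsilon>_def using assms \<Psi>_nonneg by (intro nn_integral_cong nn_integral_exp_Ioi) (simp add: add_pos_nonneg)
  finally show ?thesis .
qed

text \<open>Dominated convergence along g = n + \<beta>, with twice the integrand of Dalang's
  condition as the dominating function.\<close>

lemma \<Upsilon>_small:
  assumes "\<epsilon> > 0"
  shows "\<exists>g>0. \<Upsilon> g \<le> ennreal \<epsilon>"
proof -
  obtain \<beta> where \<beta>: "\<beta> > 0" "integrable lborel (\<lambda>\<xi>. 1 / (\<beta> + 2 * \<Psi> \<xi>))" using dalang by blast
  have pos: "real n + \<beta> + \<Psi> \<xi> > 0" for n \<xi> using \<beta>(1) \<Psi>_nonneg[of \<xi>] by linarith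
  have "(\<lambda>n. \<integral>\<^sup>+\<xi>. ennreal (1 / (real n + \<beta> + \<Psi> \<xi>)) \<partial>lborel) \<longlonglongrightarrow> (\<integral>\<^sup>+\<xi>. 0 \<partial>(lborel :: real measure))"
  proof (rule nn_integral_dominated_convergence[where w="\<lambda>\<xi>. ennreal (2 * (1 / (\<beta> + 2 * \<Psi> \<xi>)))"])
    show "AE \<xi> in lborel. ennreal (1 / (real n + \<beta> + \<Psi> \<xi>)) \<le> ennreal (2 * (1 / (\<beta> + 2 * \<Psi> \<xi>)))" for n
    proof (intro AE_I2 ennreal_leI)
      fix \<xi>
      have "0 < \<beta> + 2 * \<Psi> \<xi>" using \<beta>(1) \<Psi>_nonneg[of \<xi>] by linarith
      moreover have "\<beta> + 2 * \<Psi> \<xi> \<le> 2 * (real n + \<beta> + \<Psi> \<xi>)" using \<beta>(1) by simp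
      ultimately show "1 / (real n + \<beta> + \<Psi> \<xi>) \<le> 2 * (1 / (\<beta> + 2 * \<Psi> \<xi>))"
        using pos[of n \<xi>] by (simp add: divide_simps)
    qed
    have "integrable lborel (\<lambda>\<xi>. 2 * (1 / (\<beta> + 2 * \<Psi> \<xi>)))" using \<beta>(2) by (rule integrable_mult_right)
    then have "(\<integral>\<^sup>+\<xi>. ennreal (2 * (1 / (\<beta> + 2 * \<Psi> \<xi>))) \<partial>lborel) = ennreal (\<integral>\<xi>. 2 * (1 / (\<beta> + 2 * \<Psi> \<xi>)) \<partial>lborel)"
      using \<beta>(1) \<Psi>_nonneg by (intro nn_integral_eq_integral) (auto intro!: AE_I2 add_nonneg_nonneg divide_nonneg_nonneg)
    then show "(\<integral>\<^sup>+\<xi>. ennreal (2 * (1 / (\<beta> + 2 * \<Psi> \<xi>))) \<partial>lborel) < \<infinity>" by simp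
    show "AE \<xi> in lborel. (\<lambda>n. ennreal (1 / (real n + \<beta> + \<Psi> \<xi>))) \<longlonglongrightarrow> 0"
    proof (rule AE_I2)
      fix \<xi>
      have "filterlim (\<lambda>n. (\<beta> + \<Psi> \<xi>) + real n) at_top sequentially"
        by (rule filterlim_tendsto_add_at_top[OF tendsto_const filterlim_real_sequentially])
      then have "(\<lambda>n. 1 / (\<beta> + \<Psi> \<xi> + real n)) \<longlonglongrightarrow> 0"
        by (intro tendsto_divide_0[OF tendsto_const] filterlim_at_top_imp_at_infinity)
      then have "(\<lambda>n. ennreal (1 / (\<beta> + \<Psi> \<xi> + real n))) \<longlonglongrightarrow> ennreal 0" by (intro tendsto_ennrealI)
      then show "(\<lambda>n. ennreal (1 / (real n + \<beta> + \<Psi> \<xi>))) \<longlonglongrightarrow> 0" by (simp add: add_ac)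
    qed
  qed measurable
  then have "(\<lambda>n. \<Upsilon> (real n + \<beta>)) \<longlonglongrightarrow> 0" by (simp add: \<Upsilon>_def)
  then have "eventually (\<lambda>n. \<Upsilon> (real n + \<beta>) < ennreal \<epsilon>) sequentially"
    using assms by (intro order_tendstoD(2)) auto
  then obtain n where "\<Upsilon> (real n + \<beta>) < ennreal \<epsilon>" using eventually_happens'[OF sequentially_bot] by blast
  then show ?thesis using \<beta>(1) by (intro exI[of _ "real n + \<beta>"]) (auto intro: less_imp_le)
qed

text \<open>One factor of q_s(z)^2 is bounded by q_s(0), whose Laplace transform is small for a
  large rate. The other factor stays to integrate exp(c |z|).\<close>

lemma kernel_small:
  assumes "C \<ge> 0"
  shows "\<exists>g>0. (\<integral>\<^sup>+s. \<integral>\<^sup>+z. indicator {0<..} s * ennreal (C * (q s z)\<^sup>2 * exp (- g * s + c * \<bar>z\<bar>)) \<partial>lborel \<partial>lborel) \<le> ennreal (1 / 2)"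
proof -
  \<comment> \<open>Collects the constants of \<open>exp_moment_q\<close>; the summand 1 keeps it
    positive when C = 0. The rate used below is g + \<kappa>: the part \<kappa> cancels the growth
    in s of the exponential moment.\<close>
  define D where "D = 2 * C * exp \<kappa> + 1"
  have D: "D > 0" using assms by (simp add: D_def add_nonneg_pos)
  obtain g where g: "g > 0" "\<Upsilon> g \<le> ennreal (1 / 2 / D)" using \<Upsilon>_small[of "1 / 2 / D"] D by auto
  have "(\<integral>\<^sup>+s. \<integral>\<^sup>+z. indicator {0<..} s * ennreal (C * (q s z)\<^sup>2 * exp (- (g + \<kappa>) * s + c * \<bar>z\<bar>)) \<partial>lborel \<partial>lborel)
    \<le> (\<integral>\<^sup>+s. ennreal D * (indicator {0<..} s * ennreal (exp (- g * s) * q s 0)) \<partial>lborel)"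
  proof (rule nn_integral_mono)
    fix s :: real
    show "(\<integral>\<^sup>+z. indicator {0<..} s * ennreal (C * (q s z)\<^sup>2 * exp (- (g + \<kappa>) * s + c * \<bar>z\<bar>)) \<partial>lborel)
      \<le> ennreal D * (indicator {0<..} s * ennreal (exp (- g * s) * q s 0))"
    proof (cases "s > 0")
      case True
      have "(\<integral>\<^sup>+z. ennreal (C * (q s z)\<^sup>2 * exp (- (g + \<kappa>) * s + c * \<bar>z\<bar>)) \<partial>lborel)
        \<le> (\<integral>\<^sup>+z. ennreal (C * q s 0 * exp (- (g + \<kappa>) * s)) * ennreal (q s z * exp (c * \<bar>z\<bar>)) \<partial>lborel)"
      proof (rule nn_integral_mono)
        fix z
        have "(q s z)\<^sup>2 \<le> q s 0 * q s z" unfolding power2_eq_square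
          using q_le_q0[OF True, of z] q_nonneg[OF True, of z] by (rule mult_right_mono)
        then have "C * (q s z)\<^sup>2 * exp (- (g + \<kappa>) * s + c * \<bar>z\<bar>) \<le> C * (q s 0 * q s z) * exp (- (g + \<kappa>) * s + c * \<bar>z\<bar>)"
          using assms by (intro mult_right_mono mult_left_mono) auto
        also have "\<dots> = (C * q s 0 * exp (- (g + \<kappa>) * s)) * (q s z * exp (c * \<bar>z\<bar>))"
          by (simp add: exp_add)
        finally show "ennreal (C * (q s z)\<^sup>2 * exp (- (g + \<kappa>) * s + c * \<bar>z\<bar>)) \<le> ennreal (C * q s 0 * exp (- (g + \<kappa>) * s)) * ennreal (q s z * exp (c * \<bar>z\<bar>))"
          using assms q_nonneg[OF True] by (simp add: ennreal_mult[symmetric] ennreal_leI)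
      qed
      also have "\<dots> = ennreal (C * q s 0 * exp (- (g + \<kappa>) * s)) * (\<integral>\<^sup>+z. ennreal (q s z * exp (c * \<bar>z\<bar>)) \<partial>lborel)"
        by (rule nn_integral_cmult) measurable
      also have "\<dots> \<le> ennreal (C * q s 0 * exp (- (g + \<kappa>) * s)) * ennreal (2 * exp (\<kappa> * (s + 1)))"
        by (intro mult_left_mono exp_moment_q True) auto
      also have "\<dots> = ennreal (2 * C * exp \<kappa> * (exp (- g * s) * q s 0))"
      proof -
        have "exp (- (g + \<kappa>) * s) * exp (\<kappa> * (s + 1)) = exp \<kappa> * exp (- g * s)"
          by (simp add: exp_add[symmetric] algebra_simps)
        then have "(C * q s 0 * exp (- (g + \<kappa>) * s)) * (2 * exp (\<kappa> * (s + 1))) = 2 * C * exp \<kappa> * (exp (- g * s) * q s 0)"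
          by (metis (no_types, lifting) mult.assoc mult.commute mult.left_commute)
        then show ?thesis using assms q_nonneg[OF True] by (simp add: ennreal_mult[symmetric])
      qed
      also have "\<dots> \<le> ennreal (D * (exp (- g * s) * q s 0))"
        using q_nonneg[OF True] by (intro ennreal_leI mult_right_mono) (auto simp: D_def)
      finally show ?thesis using True D q_nonneg[OF True] by (simp add: ennreal_mult)
    qed simp
  qed
  also have "\<dots> = ennreal D * (\<integral>\<^sup>+s. indicator {0<..} s * ennreal (exp (- g * s) * q s 0) \<partial>lborel)"
    by (rule nn_integral_cmult) measurable
  also have "\<dots> \<le> ennreal D * ennreal (1 / 2 / D)"
    by (intro mult_left_mono order_trans[OF laplace_q0] g) auto
  also have "\<dots> = ennreal (1 / 2)" using D by (simp add: ennreal_mult[symmetric])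
  finally show ?thesis using g(1) \<kappa>_nonneg by (intro exI[of _ "g + \<kappa>"]) auto
qed

section \<open>Lower bounds for the squared kernel on half-lines\<close>

lemma q_square_integral:
  assumes t: "t > 0"
  shows "(\<integral>\<^sup>+z. ennreal ((q t z)\<^sup>2) \<partial>lborel) = ennreal (q (2 * t) 0)"
proof -
  have "q t (0 - z) = q t z" for z using q_even[of t z] by simp
  then show ?thesis using q_chapman_nn[OF t t, of 0] by (simp only: power2_eq_square mult_2)
qed

text \<open>\<open>X 1\<close> has a finite second moment, so 1 - cos x <= x^2 / 2 gives 1 -
  exp(-\<Psi>) <= V \<xi>^2 / 2. For V \<xi>^2 <= 1 this keeps exp(-\<Psi>) above 1/2, and then
  \<Psi> <= 2 (1 - exp(-\<Psi>)). The summand 1 in V makes it positive.\<close>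

lemma \<Psi>_quadratic: "\<exists>V>0. \<forall>\<xi>. V * \<xi>\<^sup>2 \<le> 1 \<longrightarrow> \<Psi> \<xi> \<le> V * \<xi>\<^sup>2"
proof -
  have i2: "integrable P (\<lambda>\<omega>. (X 1 \<omega>)\<^sup>2)"
  proof (rule Bochner_Integration.integrable_bound)
    have "(\<integral>\<^sup>+\<omega>. ennreal (exp (c * \<bar>X 1 \<omega>\<bar>)) \<partial>P) < \<infinity>"
      using exp_abs_moment[of 1] by (simp add: le_less_trans)
    then have "integrable P (\<lambda>\<omega>. exp (c * \<bar>X 1 \<omega>\<bar>))" by (intro integrableI_nonneg) auto
    then show "integrable P (\<lambda>\<omega>. 2 / c\<^sup>2 * exp (c * \<bar>X 1 \<omega>\<bar>))" by (rule integrable_mult_right)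
    show "AE \<omega> in P. norm ((X 1 \<omega>)\<^sup>2) \<le> norm (2 / c\<^sup>2 * exp (c * \<bar>X 1 \<omega>\<bar>))"
    proof (rule AE_I2)
      fix \<omega>
      have "(c * \<bar>X 1 \<omega>\<bar>)\<^sup>2 \<le> fact 2 * exp (c * \<bar>X 1 \<omega>\<bar>)" using c_pos by (intro power_le_fact_exp) auto
      then show "norm ((X 1 \<omega>)\<^sup>2) \<le> norm (2 / c\<^sup>2 * exp (c * \<bar>X 1 \<omega>\<bar>))"
        using c_pos by (simp add: power_mult_distrib field_simps)
    qed
  qed measurable
  define V where "V = (\<integral>\<omega>. (X 1 \<omega>)\<^sup>2 \<partial>P) + 1"
  have V0: "0 \<le> (\<integral>\<omega>. (X 1 \<omega>)\<^sup>2 \<partial>P)" by simp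
  have "\<Psi> \<xi> \<le> V * \<xi>\<^sup>2" if small: "V * \<xi>\<^sup>2 \<le> 1" for \<xi>
  proof -
    have cos_le: "1 - cos x \<le> x\<^sup>2 / 2" for x :: real
    proof -
      have "1 - cos x = 2 * (sin (x / 2))\<^sup>2" using cos_double_sin[of "x / 2"] by simp
      moreover have "(sin (x / 2))\<^sup>2 \<le> (x / 2)\<^sup>2" using abs_sin_x_le_abs_x[of "x / 2"] by (simp only: abs_le_square_iff)
      ultimately show ?thesis by (simp add: power2_eq_square)
    qed
    have "1 - cX 1 \<xi> = (\<integral>\<omega>. 1 - cos (\<xi> * X 1 \<omega>) \<partial>P)" unfolding cX_def by (simp add: prob_space)
    also have "\<dots> \<le> (\<integral>\<omega>. \<xi>\<^sup>2 / 2 * (X 1 \<omega>)\<^sup>2 \<partial>P)"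
      using i2 cos_le[of "\<xi> * X 1 _"] by (intro integral_mono) (auto simp: power_mult_distrib)
    also have "\<dots> \<le> \<xi>\<^sup>2 / 2 * V" by (simp add: V_def mult_left_mono)
    finally have le: "1 - exp (- \<Psi> \<xi>) \<le> V * \<xi>\<^sup>2 / 2" by (simp add: cX_1 mult.commute)
    then have half: "1 / 2 \<le> exp (- \<Psi> \<xi>)" using small by linarith
    have "(1 + \<Psi> \<xi>) * exp (- \<Psi> \<xi>) \<le> exp (\<Psi> \<xi>) * exp (- \<Psi> \<xi>)" by (intro mult_right_mono exp_ge_add_one_self) auto
    then have "\<Psi> \<xi> * exp (- \<Psi> \<xi>) \<le> 1 - exp (- \<Psi> \<xi>)" by (simp add: exp_minus field_simps)
    moreover have "\<Psi> \<xi> * (1 / 2) \<le> \<Psi> \<xi> * exp (- \<Psi> \<xi>)" using half \<Psi>_nonneg by (rule mult_left_mono)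
    ultimately show ?thesis using le by linarith
  qed
  moreover have "V > 0" using V0 unfolding V_def by linarith
  ultimately show ?thesis by blast
qed

text \<open>The Fourier integral is restricted to |\<xi>| <= r with V r^2 t = 1. There the exponent
  is at least -2, and the length 2 r of the interval supplies the decay 1 / sqrt t. For t >= 1 the
  interval lies where \<open>\<Psi>_quadratic\<close> applies.\<close>

lemma q0_lower: "\<exists>a>0. \<forall>t\<ge>1. a / sqrt t \<le> q (2 * t) 0"
proof -
  obtain V where V: "V > 0" "\<And>\<xi>. V * \<xi>\<^sup>2 \<le> 1 \<Longrightarrow> \<Psi> \<xi> \<le> V * \<xi>\<^sup>2" using \<Psi>_quadratic by blast
  have "exp (- 2) / (pi * sqrt V) / sqrt t \<le> q (2 * t) 0" if t: "t \<ge> 1" for t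
  proof -
    define r where "r = 1 / (sqrt V * sqrt t)"
    have r: "r > 0" "V * r\<^sup>2 * t = 1" using V t by (auto simp: r_def power_divide power_mult_distrib)
    have "(\<integral>\<xi>. indicator {-r..r} \<xi> * exp (- 2) \<partial>lborel) \<le> (\<integral>\<xi>. exp (- (2 * t) * \<Psi> \<xi>) \<partial>lborel)"
    proof (rule integral_mono)
      show "integrable lborel (\<lambda>\<xi>. exp (- (2 * t) * \<Psi> \<xi>))" using t by (intro integrable_exp_\<Psi>) auto
      show "integrable lborel (\<lambda>\<xi>. indicator {-r..r} \<xi> * exp (- 2 :: real))"
        by (intro integrable_mult_left integrable_real_indicator) (auto simp: emeasure_lborel_Icc_eq)
      show "indicator {-r..r} \<xi> * exp (- 2) \<le> exp (- (2 * t) * \<Psi> \<xi>)" for \<xi>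
      proof (cases "\<xi> \<in> {-r..r}")
        case True
        then have "\<xi>\<^sup>2 \<le> r\<^sup>2" using r abs_le_square_iff[of \<xi> r] by auto
        then have Vx: "V * \<xi>\<^sup>2 \<le> V * r\<^sup>2" using V by simp
        have "V * r\<^sup>2 * 1 \<le> V * r\<^sup>2 * t" using t V by (intro mult_left_mono) auto
        then have "V * \<xi>\<^sup>2 \<le> 1" using Vx r by simp
        then have "\<Psi> \<xi> \<le> V * r\<^sup>2" using V(2)[of \<xi>] Vx by linarith
        then have "t * \<Psi> \<xi> \<le> t * (V * r\<^sup>2)" using t by (intro mult_left_mono) auto
        then have "2 * t * \<Psi> \<xi> \<le> 2" using r by (simp add: mult_ac)
        then show ?thesis using True by simp
      qed simp
    qed
    then have "2 * r * exp (- 2) / (2 * pi) \<le> q (2 * t) 0"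
      unfolding q_def using r by (intro divide_right_mono) auto
    then show ?thesis by (simp add: r_def field_simps)
  qed
  then show ?thesis using V by (intro exI[of _ "exp (- 2) / (pi * sqrt V)"]) auto
qed

text \<open>The integral of q_t^2 over the line is q_(2t)(0). It splits into two half-lines, equal
  by evenness, and a strip of width 2 b on which q_t <= q_t(0).\<close>

lemma half_line_q:
  assumes t: "t > 0" and b: "b \<ge> 0"
  shows "ennreal (q (2 * t) 0) \<le> 2 * (\<integral>\<^sup>+z. indicator {b..} z * ennreal ((q t z)\<^sup>2) \<partial>lborel) + ennreal (2 * b * (q t 0)\<^sup>2)"
proof -
  let ?T = "\<integral>\<^sup>+z. indicator {b..} z * ennreal ((q t z)\<^sup>2) \<partial>lborel"
  have T': "(\<integral>\<^sup>+z. indicator {..-b} z * ennreal ((q t z)\<^sup>2) \<partial>lborel) = ?T"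
    by (subst nn_integral_real_affine[where c="-1" and t=0]) (auto simp: q_even indicator_def intro!: nn_integral_cong)
  have "ennreal (q (2 * t) 0) = (\<integral>\<^sup>+z. ennreal ((q t z)\<^sup>2) \<partial>lborel)" by (simp add: q_square_integral[OF t])
  also have "\<dots> \<le> (\<integral>\<^sup>+z. indicator {b..} z * ennreal ((q t z)\<^sup>2) + (indicator {..-b} z * ennreal ((q t z)\<^sup>2)
      + ennreal ((q t 0)\<^sup>2) * indicator {-b..b} z) \<partial>lborel)"
  proof (rule nn_integral_mono)
    fix z
    have "(q t z)\<^sup>2 \<le> (q t 0)\<^sup>2" using q_le_q0[OF t] q_nonneg[OF t] by (intro power_mono)
    then have "ennreal ((q t z)\<^sup>2) \<le> ennreal ((q t 0)\<^sup>2)" by (rule ennreal_leI)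
    then show "ennreal ((q t z)\<^sup>2) \<le> indicator {b..} z * ennreal ((q t z)\<^sup>2) + (indicator {..-b} z * ennreal ((q t z)\<^sup>2)
      + ennreal ((q t 0)\<^sup>2) * indicator {-b..b} z)"
      by (auto simp: indicator_def add_increasing2 not_le)
  qed
  also have "\<dots> = ?T + (?T + ennreal ((q t 0)\<^sup>2) * ennreal (2 * b))"
    using b by (simp add: nn_integral_add T' nn_integral_cmult)
  also have "\<dots> = 2 * ?T + ennreal (2 * b * (q t 0)\<^sup>2)"
    using b by (simp add: ennreal_mult'[symmetric] mult_2 add.assoc mult.commute)
  finally show ?thesis .
qed

text \<open>The constants are chosen in the order t0, \<alpha>, \<beta>. On the window [1, t0] the
  squared kernel has total mass of order at least 1 / sqrt t0, so integrating over the window gives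
  sqrt t0, which beats 1 / l. Then \<alpha> is so small that the strip |z| < \<alpha> s takes away
  at most half of that mass, and \<beta> = 1 / t0 keeps the exponential above 1 / e.\<close>

lemma renewal:
  assumes l: "l > 0"
  shows "\<exists>\<alpha>>0. \<exists>\<beta>>0. 1 \<le> ennreal l * (\<integral>\<^sup>+s. indicator {0<..} s * (ennreal (exp (- \<beta> * s)) *
      (\<integral>\<^sup>+z. indicator {\<alpha> * s..} z * ennreal ((q s z)\<^sup>2) \<partial>lborel)) \<partial>lborel)"
proof -
  obtain a where a: "a > 0" "\<And>t. t \<ge> 1 \<Longrightarrow> a / sqrt t \<le> q (2 * t) 0" using q0_lower by blast
  \<comment> \<open>r = sqrt t0. The final bound is l * (t0 / 2) * exp(-1) * a / (4 r) = l a r / (8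
    e), hence the second entry. The entry 2 ensures t0 - 1 >= t0 / 2.\<close>
  define r where "r = max 2 (8 * exp 1 / (l * a))"
  define t0 where "t0 = r\<^sup>2"
  have r: "r \<ge> 2" "r \<ge> 8 * exp 1 / (l * a)" by (auto simp: r_def)
  have t0: "t0 \<ge> 4" "sqrt t0 = r" using r power_mono[of 2 r 2] by (auto simp: t0_def)
  define b where "b = q 1 0"
  have b: "b > 0" using q0_pos[of 1] by (simp add: b_def)
  \<comment> \<open>Makes the strip term 2 \<alpha> t0 b^2 equal to a / (2 r), half of the lower
    bound a / r for q_(2s)(0) on the window.\<close>
  define \<alpha> where "\<alpha> = a / (4 * r * t0 * b\<^sup>2)"
  have \<alpha>: "\<alpha> > 0" using a b r t0 by (simp add: \<alpha>_def)
  define T where "T s = (\<integral>\<^sup>+z. indicator {\<alpha> * s..} z * ennreal ((q s z)\<^sup>2) \<partial>lborel)" for s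
  have T: "ennreal (a / (4 * r)) \<le> T s" if s: "1 \<le> s" "s \<le> t0" for s
  proof -
    have "sqrt s \<le> r" using real_sqrt_le_mono[OF s(2)] t0(2) by simp
    then have "a / r \<le> a / sqrt s" using s a r by (intro divide_left_mono) auto
    then have "ennreal (a / r) \<le> ennreal (q (2 * s) 0)" using a(2)[OF s(1)] by (intro ennreal_leI) linarith
    also have "\<dots> \<le> 2 * T s + ennreal (2 * (\<alpha> * s) * (q s 0)\<^sup>2)"
      unfolding T_def using s \<alpha> by (intro half_line_q) auto
    also have "\<dots> \<le> 2 * T s + ennreal (a / (2 * r))"
    proof (intro add_left_mono ennreal_leI)
      have "q s 0 \<le> b" "0 \<le> q s 0" using q0_antimono[of 1 s] q_nonneg[of s 0] s by (auto simp: b_def)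
      then have "(q s 0)\<^sup>2 \<le> b\<^sup>2" by (intro power_mono)
      then have "2 * (\<alpha> * s) * (q s 0)\<^sup>2 \<le> 2 * (\<alpha> * t0) * b\<^sup>2"
        using s \<alpha> by (intro mult_mono mult_left_mono) auto
      also have "\<dots> = a / (2 * r)" using a b r t0 by (simp add: \<alpha>_def field_simps)
      finally show "2 * (\<alpha> * s) * (q s 0)\<^sup>2 \<le> a / (2 * r)" .
    qed
    finally have *: "ennreal (a / r) \<le> 2 * T s + ennreal (a / (2 * r))" .
    show ?thesis
    proof (cases "T s")
      case (real x)
      then have "ennreal (a / r) \<le> ennreal (2 * x + a / (2 * r))"
        using * a r by (simp add: ennreal_mult' ennreal_plus)
      then have "a / r \<le> 2 * x + a / (2 * r)" using real a r by (subst (asm) ennreal_le_iff) auto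
      moreover have "a / r = 4 * (a / (4 * r))" "a / (2 * r) = 2 * (a / (4 * r))" using r by auto
      ultimately have "a / (4 * r) \<le> x" by linarith
      then show ?thesis using real by (simp add: ennreal_leI)
    qed simp
  qed
  have "(1::ennreal) \<le> ennreal (l * ((t0 - 1) * (exp (- 1) * (a / (4 * r)))))"
  proof -
    have "8 * exp 1 \<le> r * (l * a)" using r(2) l a by (simp add: divide_le_eq)
    then have "1 \<le> r * (l * a) / (8 * exp 1)" by simp
    also have "\<dots> = l * ((t0 / 2) * (exp (- 1) * (a / (4 * r))))"
      using r by (simp add: t0_def exp_minus power2_eq_square field_simps)
    also have "\<dots> \<le> l * ((t0 - 1) * (exp (- 1) * (a / (4 * r))))"
      using l a r t0 by (intro mult_left_mono mult_right_mono) auto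
    finally show ?thesis by (simp add: ennreal_1[symmetric] ennreal_leI del: ennreal_1)
  qed
  also have "\<dots> = ennreal l * (\<integral>\<^sup>+s. ennreal (exp (- 1) * (a / (4 * r))) * indicator {1..t0} s \<partial>lborel)"
  proof -
    have "(\<integral>\<^sup>+s. ennreal (exp (- 1) * (a / (4 * r))) * indicator {1..t0} s \<partial>lborel)
      = ennreal (exp (- 1) * (a / (4 * r))) * ennreal (t0 - 1)"
      using t0 by (subst nn_integral_cmult_indicator) auto
    then show ?thesis using t0 l a r by (simp add: ennreal_mult[symmetric] mult_ac)
  qed
  also have "\<dots> \<le> ennreal l * (\<integral>\<^sup>+s. indicator {0<..} s * (ennreal (exp (- (1 / t0) * s)) * T s) \<partial>lborel)"
  proof (intro mult_left_mono nn_integral_mono)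
    fix s :: real
    show "ennreal (exp (- 1) * (a / (4 * r))) * indicator {1..t0} s \<le> indicator {0<..} s * (ennreal (exp (- (1 / t0) * s)) * T s)"
    proof (cases "s \<in> {1..t0}")
      case True
      then have "exp (- 1) \<le> exp (- (1 / t0) * s)" by (simp add: divide_le_eq)
      then have "ennreal (exp (- 1)) * ennreal (a / (4 * r)) \<le> ennreal (exp (- (1 / t0) * s)) * T s"
        using True T by (intro mult_mono) (auto intro: ennreal_leI)
      moreover have "ennreal (exp (- 1) * (a / (4 * r))) = ennreal (exp (- 1)) * ennreal (a / (4 * r))"
        using a r by (intro ennreal_mult) auto
      ultimately show ?thesis using True by (simp only:) simp
    qed simp
  qed simp
  finally show ?thesis unfolding T_def using \<alpha> t0 by (intro exI[of _ \<alpha>] exI[of _ "1 / t0"] conjI) auto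
qed

end

section \<open>Truncated powers\<close>

text \<open>Equal to \<open>z ^ (2 * k + 2)\<close> for \<open>z\<^sup>2 \<le> n\<close>, of quadratic growth beyond.\<close>

definition trunc_power :: "nat \<Rightarrow> real \<Rightarrow> real \<Rightarrow> real" where
  "trunc_power k n z = z\<^sup>2 * (min (z\<^sup>2) n) ^ k"

lemma trunc_power_nonneg: "n \<ge> 0 \<Longrightarrow> trunc_power k n z \<ge> 0"
  unfolding trunc_power_def by (rule mult_nonneg_nonneg) auto

lemma trunc_power_0 [simp]: "trunc_power k n 0 = 0"
  by (simp add: trunc_power_def)

lemma trunc_power_measurable [measurable]: "trunc_power k n \<in> borel_measurable borel"
  unfolding trunc_power_def by measurable

lemma trunc_power_le_square: "n \<ge> 0 \<Longrightarrow> trunc_power k n z \<le> n ^ k * z\<^sup>2"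
  unfolding trunc_power_def
  by (subst mult.commute, intro mult_right_mono power_mono) auto

lemma trunc_power_le_power: "n \<ge> 0 \<Longrightarrow> trunc_power k n z \<le> z ^ (2 * k + 2)"
proof -
  assume "n \<ge> 0"
  have "trunc_power k n z \<le> z\<^sup>2 * (z\<^sup>2) ^ k"
    unfolding trunc_power_def using \<open>n \<ge> 0\<close> by (intro mult_left_mono power_mono) auto
  also have "\<dots> = z ^ (2 * k + 2)" by (simp add: power_mult[of z 2] mult.commute flip: power_mult_distrib power_add power_mult)
  finally show ?thesis .
qed

lemma trunc_power_eq_power: "z\<^sup>2 \<le> n \<Longrightarrow> trunc_power k n z = z ^ (2 * k + 2)"
  unfolding trunc_power_def by (simp add: min_def power_mult power_add power2_eq_square)

lemma trunc_power_mono: "n \<ge> 0 \<Longrightarrow> \<bar>a\<bar> \<le> \<bar>b\<bar> \<Longrightarrow> trunc_power k n a \<le> trunc_power k n b"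
  unfolding trunc_power_def
  by (rule mult_mono[OF _ power_mono]) (auto simp: abs_le_square_iff)

lemma min_scale: 
  fixes c :: real
  assumes "1 \<le> c" "0 \<le> n" "0 \<le> s"
  shows "min (c * s) n \<le> c * min s n"
proof -
  have "n \<le> c * n" "s \<le> c * s" using assms by (simp_all add: mult_le_cancel_right1)
  then show ?thesis using assms by (auto simp: min_def)
qed

lemma trunc_power_scale:
  assumes "n \<ge> 0" "1 \<le> \<bar>c\<bar>"
  shows "trunc_power k n (c * z) \<le> c ^ (2 * k + 2) * trunc_power k n z"
proof -
  have c: "1 \<le> c\<^sup>2" using assms(2) by (simp add: abs_square_le_1 one_le_power abs_le_square_iff[of 1 c, simplified])
  have "(min (c\<^sup>2 * z\<^sup>2) n) ^ k \<le> (c\<^sup>2 * min (z\<^sup>2) n) ^ k"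
    using assms c by (intro power_mono min_scale) auto
  then have "(c * z)\<^sup>2 * (min ((c * z)\<^sup>2) n) ^ k \<le> (c * z)\<^sup>2 * (c\<^sup>2 * min (z\<^sup>2) n) ^ k"
    by (intro mult_left_mono) (auto simp: power_mult_distrib)
  also have "\<dots> = c ^ (2 * k + 2) * trunc_power k n z"
    by (simp add: trunc_power_def power_mult_distrib power_mult power_add power2_eq_square)
  finally show ?thesis by (simp add: trunc_power_def)
qed

text \<open>|a + b| is at most twice the larger of the two, and scaling by 2 costs 2^(2k+2). The
  constant is free of the truncation level n, as all constants in the moment estimate have to
  be.\<close>

lemma trunc_power_add:
  assumes "n \<ge> 0"
  shows "trunc_power k n (a + b) \<le> 4 ^ (k + 1) * (trunc_power k n a + trunc_power k n b)"
proof -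
  define c where "c = max \<bar>a\<bar> \<bar>b\<bar>"
  have "trunc_power k n (a + b) \<le> trunc_power k n (2 * c)"
    using assms by (intro trunc_power_mono) (auto simp: c_def)
  also have "\<dots> \<le> 2 ^ (2 * k + 2) * trunc_power k n c"
    using assms by (intro trunc_power_scale) auto
  also have "(2::real) ^ (2 * k + 2) = 4 ^ (k + 1)"
    by (simp add: power_add power_mult)
  also have "trunc_power k n c \<le> trunc_power k n a + trunc_power k n b"
    using trunc_power_nonneg[OF assms, of k a] trunc_power_nonneg[OF assms, of k b]
    by (auto simp: c_def max_def trunc_power_def)
  finally show ?thesis by simp
qed

text \<open>Induction on the exponent: the remainder is multiplied by z + d and acquires the new
  term (j + 2) z^(j+1) d^2, and (j + 2)^2 + (j + 2) <= (j + 3)^2.\<close>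

lemma power_taylor_remainder:
  fixes z d :: real
  shows "\<bar>(z + d) ^ (j + 2) - z ^ (j + 2) - (real j + 2) * z ^ (j + 1) * d\<bar>
    \<le> (real j + 2)\<^sup>2 * d\<^sup>2 * (\<bar>z\<bar> + \<bar>d\<bar>) ^ j"
proof (induction j)
  case 0
  then show ?case by (simp add: power2_eq_square algebra_simps)
next
  case (Suc j)
  define E where "E = (z + d) ^ (j + 2) - z ^ (j + 2) - (real j + 2) * z ^ (j + 1) * d"
  define R where "R = \<bar>z\<bar> + \<bar>d\<bar>"
  have R: "R \<ge> 0" by (simp add: R_def)
  have "(z + d) ^ (Suc j + 2) - z ^ (Suc j + 2) - (real (Suc j) + 2) * z ^ (Suc j + 1) * d
      = (z + d) * E + (real j + 2) * z ^ (j + 1) * d\<^sup>2"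
    by (simp add: E_def algebra_simps power2_eq_square)
  also have "\<bar>\<dots>\<bar> \<le> \<bar>z + d\<bar> * \<bar>E\<bar> + (real j + 2) * \<bar>z\<bar> ^ (j + 1) * d\<^sup>2"
    by (rule order_trans[OF abs_triangle_ineq]) (simp add: abs_mult power_abs)
  also have "\<dots> \<le> R * ((real j + 2)\<^sup>2 * d\<^sup>2 * R ^ j) + (real j + 2) * R ^ (j + 1) * d\<^sup>2"
    using Suc R unfolding E_def[symmetric]
    by (intro add_mono mult_mono mult_right_mono mult_left_mono power_mono) (auto simp: R_def)
  also have "\<dots> = ((real j + 2)\<^sup>2 + (real j + 2)) * d\<^sup>2 * R ^ Suc j"
    by (simp add: algebra_simps)
  also have "\<dots> \<le> (real (Suc j) + 2)\<^sup>2 * d\<^sup>2 * R ^ Suc j"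
    using R by (intro mult_right_mono) (auto simp: power2_eq_square algebra_simps)
  finally show ?case by (simp add: R_def)
qed

text \<open>The function has a concave kink at \<open>z\<^sup>2 = n\<close>; any choice of one-sided derivative there is
  admissible in a one-sided Taylor estimate from above.\<close>

definition trunc_power_deriv :: "nat \<Rightarrow> real \<Rightarrow> real \<Rightarrow> real" where
  "trunc_power_deriv k n z = (if z\<^sup>2 \<le> n then (2 * k + 2) * z ^ (2 * k + 1) else 2 * n ^ k * z)"

lemma trunc_power_taylor:
  fixes z d :: real
  assumes n: "n > 0"
  shows "trunc_power k n (z + d) \<le> trunc_power k n z + trunc_power_deriv k n z * d
     + (2 * real k + 2)\<^sup>2 * 4 ^ (k + 1) * d\<^sup>2 * (min ((\<bar>z\<bar> + \<bar>d\<bar>)\<^sup>2) n) ^ k"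
    (is "_ \<le> _ + _ + ?C * d\<^sup>2 * ?l")
proof -
  have C4: "?C \<ge> 4"
  proof -
    have "(2::real)\<^sup>2 * 1 \<le> ?C" by (intro mult_mono power_mono one_le_power) auto
    then show ?thesis by simp
  qed
  have l0: "?l \<ge> 0" using n by simp
  define r where "r = sqrt n"
  have r: "r > 0" "r\<^sup>2 = n" using n by (auto simp: r_def)
  have le_r: "x\<^sup>2 \<le> n \<longleftrightarrow> \<bar>x\<bar> \<le> r" for x
    using r abs_le_square_iff[of x r] by simp
  consider "z\<^sup>2 > n" | "z\<^sup>2 \<le> n" "\<bar>d\<bar> \<le> r" | "z\<^sup>2 \<le> n" "\<bar>d\<bar> > r" by linarith
  then show ?thesis
  proof cases
    case 1
    have "z\<^sup>2 \<le> (\<bar>z\<bar> + \<bar>d\<bar>)\<^sup>2" by (simp add: abs_le_square_iff[symmetric])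
    with 1 have l: "?l = n ^ k" by (simp add: min_def)
    have "trunc_power k n (z + d) \<le> n ^ k * (z + d)\<^sup>2" using n by (intro trunc_power_le_square) auto
    also have "\<dots> = trunc_power k n z + trunc_power_deriv k n z * d + 1 * d\<^sup>2 * n ^ k"
      using 1 by (simp add: trunc_power_def trunc_power_deriv_def min_def power2_eq_square algebra_simps)
    also have "1 * d\<^sup>2 * n ^ k \<le> ?C * d\<^sup>2 * n ^ k"
      using C4 n by (intro mult_right_mono) auto
    finally show ?thesis unfolding l by simp
  next
    case 2
    define R where "R = \<bar>z\<bar> + \<bar>d\<bar>"
    have "R \<le> 2 * r" "R \<ge> 0" using 2 le_r by (auto simp: R_def)
    then have "R\<^sup>2 \<le> (2 * r)\<^sup>2" by (intro power_mono)
    then have "R\<^sup>2 \<le> 4 * min (R\<^sup>2) n" using r(2) by (auto simp: min_def power_mult_distrib)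
    then have "(R\<^sup>2) ^ k \<le> (4 * min (R\<^sup>2) n) ^ k" by (intro power_mono) auto
    then have Rk: "R ^ (2 * k) \<le> 4 ^ k * (min (R\<^sup>2) n) ^ k"
      by (simp add: power_mult power_mult_distrib)
    have "trunc_power k n (z + d) \<le> (z + d) ^ (2 * k + 2)" using n by (intro trunc_power_le_power) auto
    also have "\<dots> \<le> z ^ (2 * k + 2) + (2 * k + 2) * z ^ (2 * k + 1) * d + (real (2 * k) + 2)\<^sup>2 * d\<^sup>2 * R ^ (2 * k)"
      using power_taylor_remainder[of z d "2 * k"] unfolding R_def[symmetric]
      by (simp add: abs_le_iff add.commute[of 2])
    also have "\<dots> \<le> z ^ (2 * k + 2) + (2 * k + 2) * z ^ (2 * k + 1) * d + (real (2 * k) + 2)\<^sup>2 * d\<^sup>2 * (4 ^ (k + 1) * (min (R\<^sup>2) n) ^ k)"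
    proof -
      have "0 \<le> (4::real) ^ k * (min (R\<^sup>2) n) ^ k" using n by simp
      then have "R ^ (2 * k) \<le> 4 ^ (k + 1) * (min (R\<^sup>2) n) ^ k" using Rk by simp
      then show ?thesis by (intro add_left_mono mult_left_mono) auto
    qed
    also have "\<dots> = trunc_power k n z + trunc_power_deriv k n z * d + ?C * d\<^sup>2 * ?l"
      using 2 trunc_power_eq_power[OF 2(1), of k] by (simp add: trunc_power_deriv_def R_def algebra_simps)
    finally show ?thesis .
  next
    case 3
    have zr: "\<bar>z\<bar> \<le> r" using 3 le_r by blast
    have "\<bar>d\<bar> \<le> \<bar>z\<bar> + \<bar>d\<bar>" by simp
    then have "n \<le> (\<bar>z\<bar> + \<bar>d\<bar>)\<^sup>2" using 3(2) r by (metis less_imp_le order_trans power_mono)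
    then have l: "?l = n ^ k" by (simp add: min_def)
    have "\<bar>z + d\<bar> \<le> \<bar>2 * d\<bar>" using zr 3 by auto
    then have "(z + d)\<^sup>2 \<le> 4 * d\<^sup>2" using abs_le_square_iff[of "z + d" "2 * d"] by (simp add: power_mult_distrib)
    then have "n ^ k * (z + d)\<^sup>2 \<le> n ^ k * (4 * d\<^sup>2)" using n by (intro mult_left_mono) auto
    moreover have "trunc_power k n (z + d) \<le> n ^ k * (z + d)\<^sup>2" using n by (intro trunc_power_le_square) auto
    moreover have "- (trunc_power_deriv k n z * d) \<le> (2 * real k + 2) * d\<^sup>2 * n ^ k"
    proof -
      have "- (trunc_power_deriv k n z * d) \<le> \<bar>trunc_power_deriv k n z * d\<bar>" by simp
      also have "\<dots> = (2 * real k + 2) * (\<bar>z\<bar> ^ (2 * k + 1) * \<bar>d\<bar>)"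
        using 3 by (simp add: trunc_power_deriv_def abs_mult power_abs)
      also have "\<dots> \<le> (2 * real k + 2) * (r ^ (2 * k) * \<bar>d\<bar> * \<bar>d\<bar>)"
      proof (intro mult_left_mono mult_right_mono)
        have "\<bar>z\<bar> ^ (2 * k + 1) = \<bar>z\<bar> ^ (2 * k) * \<bar>z\<bar>" by simp
        also have "\<dots> \<le> r ^ (2 * k) * \<bar>d\<bar>" using zr 3 r by (intro mult_mono power_mono) auto
        finally show "\<bar>z\<bar> ^ (2 * k + 1) \<le> r ^ (2 * k) * \<bar>d\<bar>" .
      qed auto
      also have "r ^ (2 * k) = n ^ k" using r by (simp add: power_mult)
      finally show ?thesis by (simp add: power2_eq_square algebra_simps)
    qed
    moreover have "0 \<le> trunc_power k n z" using n by (intro trunc_power_nonneg) auto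
    moreover have "(4 + (2 * real k + 2)) * (d\<^sup>2 * n ^ k) \<le> ?C * (d\<^sup>2 * n ^ k)"
    proof (intro mult_right_mono)
      have "(4::real) \<le> 4 ^ (k + 1)" by simp
      then have "(2 * real k + 2)\<^sup>2 * 4 \<le> ?C" by (intro mult_left_mono) auto
      moreover have "4 + (2 * real k + 2) \<le> (2 * real k + 2)\<^sup>2 * 4" by (simp add: power2_eq_square algebra_simps)
      ultimately show "4 + (2 * real k + 2) \<le> ?C" by linarith
    qed (use n in auto)
    ultimately show ?thesis unfolding l by (simp add: algebra_simps)
  qed
qed

definition taylor_const :: "nat \<Rightarrow> real" where
  "taylor_const k = (2 * real k + 2)\<^sup>2 * 4 ^ (k + 1) * 4 ^ k * 4 ^ k"

lemma taylor_const_pos: "taylor_const k > 0"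
  unfolding taylor_const_def by (intro mult_pos_pos zero_less_power) auto

text \<open>b is a free unit of length for the increment d. The remainder separates into a
  polynomial in d / b, which will be averaged over a Gaussian, and values of the truncated power,
  which feed the Gronwall argument.\<close>

lemma trunc_power_young:
  fixes z d b :: real
  assumes n: "n > 0" and b: "b > 0"
  shows "trunc_power k n (z + d) \<le> trunc_power k n z + trunc_power_deriv k n z * d
     + taylor_const k * ((d / b)\<^sup>2 + (d / b) ^ (2 * k + 2)) * (trunc_power k n z + trunc_power k n b)"
proof -
  \<comment> \<open>With M the larger of |z| and b one has |z| + |d| <= (1 + s) M, and the truncated
    power of M is one of the two values on the right-hand side.\<close>
  define M where "M = max \<bar>z\<bar> b"
  define s where "s = \<bar>d\<bar> / b"
  have s: "s \<ge> 0" "\<bar>d\<bar> = s * b" using b by (auto simp: s_def)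
  have M: "b \<le> M" "\<bar>z\<bar> \<le> M" "M > 0" using b by (auto simp: M_def)
  have R: "\<bar>z\<bar> + \<bar>d\<bar> \<le> (1 + s) * M"
    using M s(2) mult_left_mono[OF M(1) s(1)] by (simp add: algebra_simps)
  have "(min ((\<bar>z\<bar> + \<bar>d\<bar>)\<^sup>2) n) ^ k \<le> (min (((1 + s) * M)\<^sup>2) n) ^ k"
    using R n by (intro power_mono min.mono) auto
  also have "\<dots> \<le> ((1 + s)\<^sup>2 * min (M\<^sup>2) n) ^ k"
    unfolding power_mult_distrib[of "1 + s" M 2] using n s M
    by (intro power_mono min_scale) (auto simp: one_le_power)
  also have "\<dots> = (1 + s) ^ (2 * k) * (min (M\<^sup>2) n) ^ k"
    by (simp add: power_mult_distrib power_mult)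
  finally have l: "(min ((\<bar>z\<bar> + \<bar>d\<bar>)\<^sup>2) n) ^ k \<le> (1 + s) ^ (2 * k) * (min (M\<^sup>2) n) ^ k" .
  have "d\<^sup>2 * (min ((\<bar>z\<bar> + \<bar>d\<bar>)\<^sup>2) n) ^ k \<le> (s\<^sup>2 * M\<^sup>2) * ((1 + s) ^ (2 * k) * (min (M\<^sup>2) n) ^ k)"
  proof (intro mult_mono l)
    have "d\<^sup>2 = s\<^sup>2 * b\<^sup>2" using s by (metis power2_abs power_mult_distrib)
    also have "\<dots> \<le> s\<^sup>2 * M\<^sup>2" using M b by (intro mult_left_mono power_mono) auto
    finally show "d\<^sup>2 \<le> s\<^sup>2 * M\<^sup>2" .
  qed (use n in auto)
  also have "\<dots> = s\<^sup>2 * (1 + s) ^ (2 * k) * trunc_power k n M" by (simp add: trunc_power_def)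
  also have "\<dots> \<le> (4 ^ k * 4 ^ k * (s\<^sup>2 + s ^ (2 * k + 2))) * (trunc_power k n z + trunc_power k n b)"
  proof (rule mult_mono)
    have "(1 + s) ^ (2 * k) \<le> (2 * max 1 s) ^ (2 * k)" using s by (intro power_mono) auto
    also have "\<dots> = 4 ^ k * (max 1 s) ^ (2 * k)" by (simp add: power_mult_distrib power_mult)
    also have "(max 1 s) ^ (2 * k) \<le> 1 + s ^ (2 * k)" using s by (auto simp: max_def)
    finally have "(1 + s) ^ (2 * k) \<le> 4 ^ k * (1 + s ^ (2 * k))" by simp
    then have "s\<^sup>2 * (1 + s) ^ (2 * k) \<le> s\<^sup>2 * (4 ^ k * (1 + s ^ (2 * k)))" by (intro mult_left_mono) auto
    moreover have "s\<^sup>2 * (4 ^ k * (1 + s ^ (2 * k))) = 4 ^ k * (s\<^sup>2 + s ^ (2 * k + 2))"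
      by (simp add: algebra_simps power2_eq_square)
    moreover have "1 * 4 ^ k * (s\<^sup>2 + s ^ (2 * k + 2)) \<le> 4 ^ k * 4 ^ k * (s\<^sup>2 + s ^ (2 * k + 2))"
      using s by (intro mult_right_mono) auto
    ultimately show "s\<^sup>2 * (1 + s) ^ (2 * k) \<le> 4 ^ k * 4 ^ k * (s\<^sup>2 + s ^ (2 * k + 2))" by linarith
    show "trunc_power k n M \<le> trunc_power k n z + trunc_power k n b"
      using trunc_power_nonneg[of n k z] trunc_power_nonneg[of n k b] n
      by (auto simp: M_def max_def trunc_power_def)
  qed (use n s in \<open>auto intro: trunc_power_nonneg\<close>)
  finally have "(2 * real k + 2)\<^sup>2 * 4 ^ (k + 1) * (d\<^sup>2 * (min ((\<bar>z\<bar> + \<bar>d\<bar>)\<^sup>2) n) ^ k)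
     \<le> (2 * real k + 2)\<^sup>2 * 4 ^ (k + 1) * ((4 ^ k * 4 ^ k * (s\<^sup>2 + s ^ (2 * k + 2))) * (trunc_power k n z + trunc_power k n b))"
    by (intro mult_left_mono) auto
  moreover have "s\<^sup>2 = (d / b)\<^sup>2" "s ^ (2 * k + 2) = (d / b) ^ (2 * k + 2)"
    using b power_even_abs[of "2 * k + 2" "d / b"] by (auto simp: s_def power_divide)
  ultimately show ?thesis
    using trunc_power_taylor[OF n, of k z d] unfolding taylor_const_def by (simp only: mult.assoc)
qed

text \<open>A linearisation at \<open>s0\<close> that replaces Jensen's inequality: with \<open>s0\<close> the quotient of the integrals of
  \<open>L\<^sup>2\<close> and \<open>w\<^sup>2\<close>, the last term integrates to half of the left-hand side.\<close>

lemma trunc_power_jensen: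
  fixes L w s0 :: real
  assumes w: "w > 0" and n: "n \<ge> 0" and s0: "s0 \<ge> 0"
  shows "L\<^sup>2 * (min s0 n) ^ k \<le> 2 ^ k * (w\<^sup>2 * trunc_power k n (L / w)) + (w\<^sup>2 * s0 / 2) * (min s0 n) ^ k"
proof (cases "(L / w)\<^sup>2 \<ge> s0 / 2")
  case True
  have "min s0 n \<le> 2 * min (s0 / 2) n" using n s0 by (auto simp: min_def)
  also have "\<dots> \<le> 2 * min ((L / w)\<^sup>2) n" using True by (auto simp: min_def)
  finally have "(min s0 n) ^ k \<le> (2 * min ((L / w)\<^sup>2) n) ^ k" using n s0 by (intro power_mono) auto
  then have "L\<^sup>2 * (min s0 n) ^ k \<le> L\<^sup>2 * (2 ^ k * (min ((L / w)\<^sup>2) n) ^ k)"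
    by (intro mult_left_mono) (auto simp: power_mult_distrib)
  also have "\<dots> = 2 ^ k * (w\<^sup>2 * trunc_power k n (L / w))"
    using w by (simp add: trunc_power_def power_divide)
  finally show ?thesis using n s0 by (simp add: add_increasing2)
next
  case False
  then have "L\<^sup>2 \<le> w\<^sup>2 * s0 / 2" using w by (simp add: power_divide field_simps)
  then have "L\<^sup>2 * (min s0 n) ^ k \<le> (w\<^sup>2 * s0 / 2) * (min s0 n) ^ k"
    using n s0 by (intro mult_right_mono) auto
  moreover have "0 \<le> 2 ^ k * (w\<^sup>2 * trunc_power k n (L / w))"
    using n by (simp add: trunc_power_nonneg)
  ultimately show ?thesis by linarith
qed

section \<open>Increments of the Brownian sheet\<close>

lemma integrable_mult_of_squares:
  fixes f g :: "'a \<Rightarrow> real"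
  assumes [measurable]: "f \<in> borel_measurable M" "g \<in> borel_measurable M"
    and "integrable M (\<lambda>x. (f x)\<^sup>2)" "integrable M (\<lambda>x. (g x)\<^sup>2)"
  shows "integrable M (\<lambda>x. f x * g x)"
proof (rule Bochner_Integration.integrable_bound)
  show "integrable M (\<lambda>x. (f x)\<^sup>2 + (g x)\<^sup>2)" using assms by simp
  have "\<bar>a * b\<bar> \<le> a\<^sup>2 + b\<^sup>2" for a b :: real
  proof -
    have "0 \<le> (\<bar>a\<bar> - \<bar>b\<bar>)\<^sup>2" by simp
    then have "2 * (\<bar>a\<bar> * \<bar>b\<bar>) \<le> a\<^sup>2 + b\<^sup>2" by (simp add: power2_diff)
    moreover have "0 \<le> \<bar>a\<bar> * \<bar>b\<bar>" by simp
    ultimately show ?thesis unfolding abs_mult by linarith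
  qed
  then show "AE x in M. norm (f x * g x) \<le> norm ((f x)\<^sup>2 + (g x)\<^sup>2)" by simp
qed measurable

lemma borel_measurable_sum_list [measurable (raw)]:
  fixes f :: "'c \<Rightarrow> 'a \<Rightarrow> real"
  assumes "\<And>e. e \<in> set L \<Longrightarrow> f e \<in> borel_measurable M"
  shows "(\<lambda>x. sum_list (map (\<lambda>e. f e x) L)) \<in> borel_measurable M"
  using assms by (induction L) auto

lemma real_gaussian_square_integrable:
  assumes "prob_space M" and [measurable]: "Y \<in> borel_measurable M" and Y: "real_gaussian M Y"
  shows "integrable M (\<lambda>\<omega>. (Y \<omega>)\<^sup>2)"
proof -
  interpret prob_space M by fact
  from Y consider \<mu> s where "s > 0" "distributed M lborel Y (\<lambda>x. ennreal (normal_density \<mu> s x))"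
    | \<mu> where "AE \<omega> in M. Y \<omega> = \<mu>" unfolding real_gaussian_def by blast
  then show ?thesis
  proof cases
    case 1
    have "integrable lborel (\<lambda>x. normal_density \<mu> s x * (x - \<mu>)^2 + 2 * \<mu> * (normal_density \<mu> s x * (x - \<mu>)^1)
        + \<mu>\<^sup>2 * normal_density \<mu> s x)"
      using 1(1) integrable_normal_moment[OF 1(1), of \<mu> 2] integrable_normal_moment[OF 1(1), of \<mu> 1]
      by (intro Bochner_Integration.integrable_add integrable_mult_right) auto
    also have "(\<lambda>x. normal_density \<mu> s x * (x - \<mu>)^2 + 2 * \<mu> * (normal_density \<mu> s x * (x - \<mu>)^1)
        + \<mu>\<^sup>2 * normal_density \<mu> s x) = (\<lambda>x. normal_density \<mu> s x * x\<^sup>2)"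
      by (simp add: power2_eq_square algebra_simps)
    finally show ?thesis
      using distributed_integrable[OF 1(2), of "\<lambda>x. x\<^sup>2"] by simp
  next
    case 2
    have "integrable M (\<lambda>\<omega>. \<mu>\<^sup>2)" by simp
    then show ?thesis
      by (rule integrable_cong_AE_imp) (use 2 in auto)
  qed
qed

text \<open>The expectation of \<phi> under the normal law with mean z and variance v. Writing it
  through the standard normal density includes the degenerate case v = 0.\<close>

definition gauss_avg :: "(real \<Rightarrow> real) \<Rightarrow> real \<Rightarrow> real \<Rightarrow> ennreal" where
  "gauss_avg \<phi> z v = (\<integral>\<^sup>+g. ennreal (std_normal_density g) * ennreal (\<phi> (z + sqrt v * g)) \<partial>lborel)"

lemma nn_integral_std_normal: "(\<integral>\<^sup>+g. ennreal (std_normal_density g) \<partial>lborel) = 1"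
  by (subst nn_integral_eq_integral) auto

lemma gauss_avg_0: "gauss_avg \<phi> z 0 = ennreal (\<phi> z)"
  by (simp add: gauss_avg_def nn_integral_multc nn_integral_std_normal)

lemma real_gaussian_centered_avg:
  assumes "prob_space M" and [measurable]: "Y \<in> borel_measurable M" "\<phi> \<in> borel_measurable borel"
    and Y: "real_gaussian M Y" and mean: "integral\<^sup>L M Y = 0" and var: "(\<integral>\<omega>. (Y \<omega>)\<^sup>2 \<partial>M) = v"
  shows "(\<integral>\<^sup>+\<omega>. ennreal (\<phi> (z + Y \<omega>)) \<partial>M) = gauss_avg \<phi> z v"
proof -
  interpret prob_space M by fact
  from Y consider \<mu> s where "s > 0" "distributed M lborel Y (\<lambda>x. ennreal (normal_density \<mu> s x))"
    | \<mu> where "AE \<omega> in M. Y \<omega> = \<mu>" unfolding real_gaussian_def by blast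
  then show ?thesis
  proof cases
    case 1
    have "integral\<^sup>L M Y = \<mu>"
      using distributed_integral[OF 1(2), of "\<lambda>x. x"] integral_normal_moment_nz_1[OF 1(1), of \<mu>] by simp
    then have \<mu>: "\<mu> = 0" using mean by simp
    have "(\<integral>\<omega>. (Y \<omega>)\<^sup>2 \<partial>M) = s\<^sup>2"
      using distributed_integral[OF 1(2), of "\<lambda>x. x\<^sup>2"] integral_normal_moment_even[OF 1(1), of 0 1] \<mu>
      by (simp add: field_simps power2_eq_square)
    then have v: "sqrt v = s" using var 1(1) by simp
    have D: "distributed M lborel (\<lambda>x. Y x / s) std_normal_density"
      using normal_standard_normal_convert[OF 1(1), of Y \<mu>] 1(2) \<mu> by simp
    have "gauss_avg \<phi> z v = (\<integral>\<^sup>+\<omega>. ennreal (\<phi> (z + s * (Y \<omega> / s))) \<partial>M)"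
      unfolding gauss_avg_def v by (rule distributed_nn_integral[OF D]) simp
    then show ?thesis using 1(1) by simp
  next
    case 2
    have "integral\<^sup>L M Y = integral\<^sup>L M (\<lambda>_. \<mu>)" using 2 by (intro integral_cong_AE) auto
    then have \<mu>: "\<mu> = 0" using mean by (simp add: prob_space)
    have "(\<integral>\<omega>. (Y \<omega>)\<^sup>2 \<partial>M) = integral\<^sup>L M (\<lambda>_. 0)" using 2 \<mu> by (intro integral_cong_AE) auto
    then have v: "v = 0" using var by simp
    have "(\<integral>\<^sup>+\<omega>. ennreal (\<phi> (z + Y \<omega>)) \<partial>M) = (\<integral>\<^sup>+\<omega>. ennreal (\<phi> z) \<partial>M)"
      using 2 \<mu> by (intro nn_integral_cong_AE) auto
    then show ?thesis by (simp add: v gauss_avg_0 emeasure_space_1)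
  qed
qed

section \<open>Noise integrals of step functions over one time interval\<close>

definition sheet_incr :: "(real \<Rightarrow> real \<Rightarrow> 'a \<Rightarrow> real) \<Rightarrow> real \<Rightarrow> real \<Rightarrow> real \<Rightarrow> real \<Rightarrow> 'a \<Rightarrow> real" where
  "sheet_incr W s t a b \<omega> = W t b \<omega> - W s b \<omega> - W t a \<omega> + W s a \<omega>"

text \<open>The noise integral of the spatial step function \<open>step_fun Ds\<close> over the time
  interval (s, t]. The intervals in the list may overlap, so variances are expressed through
  \<open>step_fun\<close> and not through the coefficients.\<close>

definition incr_comb :: "(real \<Rightarrow> real \<Rightarrow> 'a \<Rightarrow> real) \<Rightarrow> real \<Rightarrow> real \<Rightarrow> (real \<times> real \<times> real) list \<Rightarrow> 'a \<Rightarrow> real" where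
  "incr_comb W s t Ds \<omega> = sum_list (map (\<lambda>(d,a,b). d * sheet_incr W s t a b \<omega>) Ds)"

definition step_fun :: "(real \<times> real \<times> real) list \<Rightarrow> real \<Rightarrow> real" where
  "step_fun Ds y = sum_list (map (\<lambda>(d,a,b). d * indicator {a<..b} y) Ds)"

lemma step_fun_measurable [measurable]: "step_fun Ds \<in> borel_measurable borel"
  unfolding step_fun_def split_beta by measurable

lemma interval_overlap:
  fixes a b a' b' :: real
  assumes "a \<le> b" "a' \<le> b'"
  shows "(\<integral>y. indicator {a<..b} y * indicator {a'<..b'} y \<partial>lborel) = max 0 (min b b' - max a a')"
    and "integrable lborel (\<lambda>y. indicator {a<..b} y * indicator {a'<..b'} y :: real)"
proof -
  have eq: "(\<lambda>y. indicator {a<..b} y * indicator {a'<..b'} y :: real) = indicator {max a a'<..min b b'}"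
    by (auto simp: fun_eq_iff indicator_def)
  show "(\<integral>y. indicator {a<..b} y * indicator {a'<..b'} y \<partial>lborel) = max 0 (min b b' - max a a')"
  proof (cases "max a a' \<le> min b b'")
    case True
    then show ?thesis unfolding eq by (simp add: measure_lborel_Ioc)
  next
    case False
    then have "{max a a'<..min b b'} = {}" by auto
    moreover have "max 0 (min b b' - max a a') = 0" using False by (intro max_absorb1) linarith
    ultimately show ?thesis unfolding eq by simp
  qed
  show "integrable lborel (\<lambda>y. indicator {a<..b} y * indicator {a'<..b'} y :: real)"
    unfolding eq by (cases "max a a' \<le> min b b'") (auto intro!: integrable_real_indicator)
qed

lemma integrable_indicator_step_fun:
  assumes "a \<le> b" "\<forall>(d,a,b)\<in>set Es. a \<le> b"
  shows "integrable lborel (\<lambda>y. indicator {a<..b} y * step_fun Es y)"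
  using assms(2)
proof (induction Es)
  case (Cons e Es)
  obtain d a' b' where e: "e = (d, a', b')" by (cases e)
  have "integrable lborel (\<lambda>y. d * (indicator {a<..b} y * indicator {a'<..b'} y) + indicator {a<..b} y * step_fun Es y)"
    using Cons assms(1) e
    by (intro Bochner_Integration.integrable_add integrable_mult_right interval_overlap) auto
  then show ?case by (simp add: step_fun_def e algebra_simps)
qed (simp add: step_fun_def)

lemma integrable_step_fun_mult:
  assumes "\<forall>(d,a,b)\<in>set Ds. a \<le> b" "\<forall>(d,a,b)\<in>set Es. a \<le> b"
  shows "integrable lborel (\<lambda>y. step_fun Ds y * step_fun Es y)"
  using assms(1)
proof (induction Ds)
  case (Cons e Ds)
  obtain d a b where e: "e = (d, a, b)" by (cases e)
  have "integrable lborel (\<lambda>y. d * (indicator {a<..b} y * step_fun Es y) + step_fun Ds y * step_fun Es y)"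
    using Cons assms(2) e
    by (intro Bochner_Integration.integrable_add integrable_mult_right integrable_indicator_step_fun) auto
  then show ?case by (simp add: step_fun_def e algebra_simps)
qed (simp add: step_fun_def)

text \<open>K is the covariance of a two-sided Brownian motion: a sum of two terms min, for the
  positive and for the negative parts. On each half-line the mixed difference of min is the length
  of an overlap, and the two lengths add up to the overlap on the line.\<close>

lemma spatial_cov_eq_overlap:
  fixes a b a' b' :: real
  defines "K \<equiv> \<lambda>x x'::real. (if x * x' \<ge> 0 then min \<bar>x\<bar> \<bar>x'\<bar> else 0)"
  assumes "a \<le> b" "a' \<le> b'"
  shows "K b b' - K b a' - K a b' + K a a' = max 0 (min b b' - max a a')"
proof -
  have K: "K x x' = min (max x 0) (max x' 0) + min (max (-x) 0) (max (-x') 0)" for x x'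
    unfolding K_def by (auto simp: zero_le_mult_iff min_def max_def)
  have overlap: "min q q' - min q p' - min p q' + min p p' = max 0 (min q q' - max p p')"
    if "p \<le> q" "p' \<le> q'" for p q p' q' :: real
    using that by (auto simp: min_def max_def)
  have pos: "min (max x 0) (max y 0) = max (min x y) 0" "max (max x 0) (max y 0) = max (max x y) 0"
    and neg: "min (max (-x) 0) (max (-y) 0) = max (- max x y) 0" "max (max (-x) 0) (max (-y) 0) = max (- min x y) 0" for x y :: real
    by (auto simp: min_def max_def)
  have "max 0 (max m 0 - max n 0) + max 0 (max (-n) 0 - max (-m) 0) = max 0 (m - n)" for m n :: real
    by (auto simp: max_def)
  from this[of "min b b'" "max a a'"]
  have "max 0 (min (max b 0) (max b' 0) - max (max a 0) (max a' 0))
    + max 0 (min (max (-a) 0) (max (-a') 0) - max (max (-b) 0) (max (-b') 0)) = max 0 (min b b' - max a a')"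
    unfolding neg unfolding pos .
  moreover have "max a 0 \<le> max b 0" "max a' 0 \<le> max b' 0" "max (-b) 0 \<le> max (-a) 0" "max (-b') 0 \<le> max (-a') 0"
    using assms(2,3) by auto
  note overlap[OF this(1,2)] overlap[OF this(3,4)]
  ultimately show ?thesis unfolding K by linarith
qed

locale noise = prob_space M for M :: "'a measure" +
  fixes F :: "real \<Rightarrow> 'a measure" and W :: "real \<Rightarrow> real \<Rightarrow> 'a \<Rightarrow> real"
  assumes sheet: "brownian_sheet M W" and filt: "sheet_filtration M F W"
begin

lemma W_measurable [measurable]: "W t x \<in> borel_measurable M"
  using sheet unfolding brownian_sheet_def by blast

lemma W_gaussian: "(\<forall>(c,t,x)\<in>set L. t \<ge> 0) \<Longrightarrow> real_gaussian M (\<lambda>\<omega>. sum_list (map (\<lambda>(c,t,x). c * W t x \<omega>) L))"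
  using sheet unfolding brownian_sheet_def by blast

lemma W_square_integrable: "t \<ge> 0 \<Longrightarrow> integrable M (\<lambda>\<omega>. (W t x \<omega>)\<^sup>2)"
  using W_gaussian[of "[(1, t, x)]"] by (intro real_gaussian_square_integrable prob_space_axioms) auto

lemma W_integrable: "t \<ge> 0 \<Longrightarrow> integrable M (W t x)"
  using W_square_integrable by (rule square_integrable_imp_integrable[rotated]) auto

lemma W_mean: "t \<ge> 0 \<Longrightarrow> integral\<^sup>L M (W t x) = 0"
  using sheet unfolding brownian_sheet_def by blast

lemma W_cov: "t \<ge> 0 \<Longrightarrow> t' \<ge> 0 \<Longrightarrow> (\<integral>\<omega>. W t x \<omega> * W t' x' \<omega> \<partial>M) = sheet_cov t x t' x'"
  using sheet unfolding brownian_sheet_def by blast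

lemma W_mult_integrable: "t \<ge> 0 \<Longrightarrow> t' \<ge> 0 \<Longrightarrow> integrable M (\<lambda>\<omega>. W t x \<omega> * W t' x' \<omega>)"
  by (intro integrable_mult_of_squares W_square_integrable) auto

lemma sheet_incr_measurable [measurable]: "sheet_incr W s t a b \<in> borel_measurable M"
  unfolding sheet_incr_def by measurable

lemma incr_comb_measurable [measurable]: "incr_comb W s t Ds \<in> borel_measurable M"
  unfolding incr_comb_def split_beta by measurable

lemma sheet_incr_cov:
  assumes "0 \<le> s" "s \<le> t" "a \<le> b" "a' \<le> b'"
  shows "(\<integral>\<omega>. sheet_incr W s t a b \<omega> * sheet_incr W s t a' b' \<omega> \<partial>M)
    = (t - s) * (\<integral>y. indicator {a<..b} y * indicator {a'<..b'} y \<partial>lborel)"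
    and "integrable M (\<lambda>\<omega>. sheet_incr W s t a b \<omega> * sheet_incr W s t a' b' \<omega>)"
proof -
  have t: "t \<ge> 0" using assms by linarith
  note W_mult_integrable[simp, intro]
  have st: "min s t = s" "min t s = s" using assms by auto
  have i: "integrable M (\<lambda>\<omega>. W r x \<omega> * sheet_incr W s t a' b' \<omega>)" if "r \<ge> 0" for r x
    unfolding sheet_incr_def ring_distribs using that assms t by (intro Bochner_Integration.integrable_add Bochner_Integration.integrable_diff W_mult_integrable) auto
  have e: "(\<integral>\<omega>. W r x \<omega> * sheet_incr W s t a' b' \<omega> \<partial>M)
     = sheet_cov r x t b' - sheet_cov r x s b' - sheet_cov r x t a' + sheet_cov r x s a'" if "r \<ge> 0" for r x
    unfolding sheet_incr_def ring_distribs using that assms t by (simp add: W_cov)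
  have eq: "(\<lambda>\<omega>. sheet_incr W s t a b \<omega> * sheet_incr W s t a' b' \<omega>) =
     (\<lambda>\<omega>. W t b \<omega> * sheet_incr W s t a' b' \<omega> - W s b \<omega> * sheet_incr W s t a' b' \<omega>
        - W t a \<omega> * sheet_incr W s t a' b' \<omega> + W s a \<omega> * sheet_incr W s t a' b' \<omega>)"
    by (rule ext, subst sheet_incr_def) (simp add: algebra_simps)
  show "integrable M (\<lambda>\<omega>. sheet_incr W s t a b \<omega> * sheet_incr W s t a' b' \<omega>)"
    unfolding eq using t assms by (intro Bochner_Integration.integrable_add Bochner_Integration.integrable_diff i)
  have "(\<integral>\<omega>. sheet_incr W s t a b \<omega> * sheet_incr W s t a' b' \<omega> \<partial>M)
     = (\<integral>\<omega>. W t b \<omega> * sheet_incr W s t a' b' \<omega> \<partial>M) - (\<integral>\<omega>. W s b \<omega> * sheet_incr W s t a' b' \<omega> \<partial>M)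
        - (\<integral>\<omega>. W t a \<omega> * sheet_incr W s t a' b' \<omega> \<partial>M) + (\<integral>\<omega>. W s a \<omega> * sheet_incr W s t a' b' \<omega> \<partial>M)"
    unfolding eq using t assms i by simp
  also have "\<dots> = (t - s) * max 0 (min b b' - max a a')"
    unfolding spatial_cov_eq_overlap[OF assms(3,4), symmetric]
    using t assms by (simp add: e sheet_cov_def st algebra_simps)
  finally show "(\<integral>\<omega>. sheet_incr W s t a b \<omega> * sheet_incr W s t a' b' \<omega> \<partial>M)
    = (t - s) * (\<integral>y. indicator {a<..b} y * indicator {a'<..b'} y \<partial>lborel)"
    using interval_overlap(1)[OF assms(3,4)] by simp
qed

lemma sheet_incr_comb_cov:
  assumes "0 \<le> s" "s \<le> t" "a \<le> b" "\<forall>(d,a,b)\<in>set Es. a \<le> b"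
  shows "integrable M (\<lambda>\<omega>. sheet_incr W s t a b \<omega> * incr_comb W s t Es \<omega>) \<and>
    (\<integral>\<omega>. sheet_incr W s t a b \<omega> * incr_comb W s t Es \<omega> \<partial>M)
      = (t - s) * (\<integral>y. indicator {a<..b} y * step_fun Es y \<partial>lborel)"
  using assms(4)
proof (induction Es)
  case Nil
  then show ?case by (simp add: incr_comb_def step_fun_def)
next
  case (Cons e Es)
  obtain d a' b' where e: "e = (d, a', b')" by (cases e)
  have ab: "a' \<le> b'" and Es: "\<forall>(d,a,b)\<in>set Es. a \<le> b" using Cons.prems e by auto
  have 1: "(\<lambda>\<omega>. sheet_incr W s t a b \<omega> * incr_comb W s t (e # Es) \<omega>) =
    (\<lambda>\<omega>. d * (sheet_incr W s t a b \<omega> * sheet_incr W s t a' b' \<omega>) + sheet_incr W s t a b \<omega> * incr_comb W s t Es \<omega>)"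
    by (auto simp: incr_comb_def e algebra_simps)
  have 2: "(\<lambda>y. indicator {a<..b} y * step_fun (e # Es) y) =
    (\<lambda>y. d * (indicator {a<..b} y * indicator {a'<..b'} y) + indicator {a<..b} y * step_fun Es y)"
    by (auto simp: step_fun_def e algebra_simps)
  note i = sheet_incr_cov[OF assms(1-3) ab] interval_overlap(2)[OF assms(3) ab] integrable_indicator_step_fun[OF assms(3) Es]
  show ?case unfolding 1 2 using Cons.IH[OF Es] i by (simp, simp add: algebra_simps)
qed

lemma incr_comb_cov:
  assumes "0 \<le> s" "s \<le> t" "\<forall>(d,a,b)\<in>set Ds. a \<le> b" "\<forall>(d,a,b)\<in>set Es. a \<le> b"
  shows "integrable M (\<lambda>\<omega>. incr_comb W s t Ds \<omega> * incr_comb W s t Es \<omega>) \<and>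
    (\<integral>\<omega>. incr_comb W s t Ds \<omega> * incr_comb W s t Es \<omega> \<partial>M)
      = (t - s) * (\<integral>y. step_fun Ds y * step_fun Es y \<partial>lborel)"
  using assms(3)
proof (induction Ds)
  case Nil
  then show ?case by (simp add: incr_comb_def step_fun_def)
next
  case (Cons e Ds)
  obtain d a b where e: "e = (d, a, b)" by (cases e)
  have ab: "a \<le> b" and Ds: "\<forall>(d,a,b)\<in>set Ds. a \<le> b" using Cons.prems e by auto
  have 1: "(\<lambda>\<omega>. incr_comb W s t (e # Ds) \<omega> * incr_comb W s t Es \<omega>) =
    (\<lambda>\<omega>. d * (sheet_incr W s t a b \<omega> * incr_comb W s t Es \<omega>) + incr_comb W s t Ds \<omega> * incr_comb W s t Es \<omega>)"
    by (auto simp: incr_comb_def e algebra_simps)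
  have 2: "(\<lambda>y. step_fun (e # Ds) y * step_fun Es y) =
    (\<lambda>y. d * (indicator {a<..b} y * step_fun Es y) + step_fun Ds y * step_fun Es y)"
    by (auto simp: step_fun_def e algebra_simps)
  note i = sheet_incr_comb_cov[OF assms(1,2) ab assms(4)] integrable_indicator_step_fun[OF ab assms(4)]
    integrable_step_fun_mult[OF Ds assms(4)]
  show ?case unfolding 1 2 using Cons.IH[OF Ds] i by (simp, simp add: algebra_simps)
qed

lemma incr_comb_gaussian:
  assumes "0 \<le> s" "s \<le> t"
  shows "real_gaussian M (incr_comb W s t Ds)"
proof -
  define L where "L = concat (map (\<lambda>(d,a,b). [(d,t,b), (-d,s,b), (-d,t,a), (d,s,a)]) Ds)"
  have "incr_comb W s t Ds = (\<lambda>\<omega>. sum_list (map (\<lambda>(c,t,x). c * W t x \<omega>) L))"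
    unfolding L_def incr_comb_def sheet_incr_def
    by (induction Ds) (auto simp: fun_eq_iff algebra_simps)
  moreover have "\<forall>(c,r,x)\<in>set L. r \<ge> 0" using assms unfolding L_def by auto
  ultimately show ?thesis using W_gaussian[of L] by simp
qed

lemma incr_comb_mean:
  assumes "0 \<le> s" "s \<le> t"
  shows "integrable M (incr_comb W s t Ds) \<and> integral\<^sup>L M (incr_comb W s t Ds) = 0"
proof (induction Ds)
  case Nil
  then show ?case by (simp add: incr_comb_def[abs_def])
next
  case (Cons e Ds)
  obtain d a b where e: "e = (d, a, b)" by (cases e)
  have t: "t \<ge> 0" using assms by linarith
  have i: "integrable M (sheet_incr W s t a b)" "integral\<^sup>L M (sheet_incr W s t a b) = 0"
    unfolding sheet_incr_def[abs_def] using assms t by (auto simp: W_integrable W_mean)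
  have "incr_comb W s t (e # Ds) = (\<lambda>\<omega>. d * sheet_incr W s t a b \<omega> + incr_comb W s t Ds \<omega>)"
    by (auto simp: incr_comb_def e)
  then show ?case using Cons.IH i by simp
qed

lemma incr_comb_avg:
  assumes "0 \<le> s" "s \<le> t" "\<forall>(d,a,b)\<in>set Ds. a \<le> b" and [measurable]: "\<phi> \<in> borel_measurable borel"
  shows "(\<integral>\<^sup>+\<omega>. ennreal (\<phi> (z + incr_comb W s t Ds \<omega>)) \<partial>M)
     = gauss_avg \<phi> z ((t - s) * (\<integral>y. (step_fun Ds y)\<^sup>2 \<partial>lborel))"
  using incr_comb_gaussian[OF assms(1,2)] incr_comb_mean[OF assms(1,2)] incr_comb_cov[OF assms(1-3,3)]
  by (intro real_gaussian_centered_avg prob_space_axioms) (auto simp: power2_eq_square)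

text \<open>The sigma-algebra that the filtration makes independent of \<open>F s\<close>, packaged
  as a measure space so that its product with \<open>F s\<close> can be formed.\<close>

definition future :: "real \<Rightarrow> 'a measure" where
  "future s = sigma (space M) {(\<lambda>\<omega>. W t' x \<omega> - W s x \<omega>) -` B \<inter> space M | t' x B. s \<le> t' \<and> B \<in> sets borel}"

lemma space_future [simp]: "space (future s) = space M"
  unfolding future_def by (rule space_measure_of) auto

lemma sets_future: "sets (future s) = sigma_sets (space M) {(\<lambda>\<omega>. W t' x \<omega> - W s x \<omega>) -` B \<inter> space M | t' x B. s \<le> t' \<and> B \<in> sets borel}"
  unfolding future_def by (rule sets_measure_of) auto

lemma incr_future_measurable: "s \<le> t' \<Longrightarrow> (\<lambda>\<omega>. W t' x \<omega> - W s x \<omega>) \<in> borel_measurable (future s)"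
  by (rule measurableI) (auto simp: sets_future)

lemma sheet_incr_future_measurable:
  assumes "s \<le> t"
  shows "sheet_incr W s t a b \<in> borel_measurable (future s)"
proof -
  have "(\<lambda>\<omega>. (W t b \<omega> - W s b \<omega>) - (W t a \<omega> - W s a \<omega>)) \<in> borel_measurable (future s)"
    by (intro borel_measurable_diff incr_future_measurable assms)
  then show ?thesis by (simp add: sheet_incr_def[abs_def] algebra_simps)
qed

lemma F_space [simp]: "t \<ge> 0 \<Longrightarrow> space (F t) = space M"
  and F_sets: "t \<ge> 0 \<Longrightarrow> sets (F t) \<subseteq> sets M"
  using filt unfolding sheet_filtration_def subalgebra_def by auto

lemma F_mono: "0 \<le> s \<Longrightarrow> s \<le> t \<Longrightarrow> sets (F s) \<subseteq> sets (F t)"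
  using filt unfolding sheet_filtration_def by auto

lemma W_F_measurable: "0 \<le> s \<Longrightarrow> s \<le> t \<Longrightarrow> W s x \<in> borel_measurable (F t)"
  using filt unfolding sheet_filtration_def by auto

text \<open>Conditioning on \<open>F s\<close>: the increments after time \<open>s\<close> may be replaced by those of an independent copy.\<close>

lemma decouple:
  assumes s: "s \<ge> 0" and \<Phi>: "(\<lambda>(\<omega>, \<omega>'). \<Phi> \<omega> \<omega>') \<in> borel_measurable (F s \<Otimes>\<^sub>M future s)"
  shows "(\<integral>\<^sup>+\<omega>. \<Phi> \<omega> \<omega> \<partial>M) = (\<integral>\<^sup>+\<omega>. \<integral>\<^sup>+\<omega>'. \<Phi> \<omega> \<omega>' \<partial>M \<partial>M)"
proof -
  have ind: "indep_set (sets (F s)) (sets (future s))"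
    using filt s unfolding sheet_filtration_def sets_future by auto
  \<comment> \<open>The identity is regarded as two random elements, with values in
    \<open>F s\<close> and in \<open>future s\<close>. Independence of the sigma-algebras says that
    the law of the diagonal map is a product measure.\<close>
  have X[measurable]: "(\<lambda>x. x) \<in> measurable M (F s)"
    using F_sets[OF s] F_space[OF s] by (intro measurableI) auto
  have fut: "sets (future s) \<subseteq> sets M"
    using indep_setD_ev2[OF ind] by simp
  have Y[measurable]: "(\<lambda>x. x) \<in> measurable M (future s)"
    using fut by (intro measurableI) auto
  have "{(\<lambda>x. x) -` A \<inter> space M |A. A \<in> sets (F s)} = sets (F s)"
    using sets.sets_into_space[of _ "F s"] F_space[OF s] by (auto simp: Int_absorb2)
  moreover have "{(\<lambda>x. x) -` A \<inter> space M |A. A \<in> sets (future s)} = sets (future s)"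
    using sets.sets_into_space[of _ "future s"] by (auto simp: Int_absorb2)
  moreover have "sigma_sets (space M) (sets (F s)) = sets (F s)"
    using sets.sigma_sets_eq[of "F s"] F_space[OF s] by simp
  moreover have "sigma_sets (space M) (sets (future s)) = sets (future s)"
    using sets.sigma_sets_eq[of "future s"] by simp
  ultimately have "indep_var (F s) (\<lambda>x. x) (future s) (\<lambda>x. x)"
    unfolding indep_var_eq using ind X Y by simp
  then have eq: "distr M (F s) (\<lambda>x. x) \<Otimes>\<^sub>M distr M (future s) (\<lambda>x. x) = distr M (F s \<Otimes>\<^sub>M future s) (\<lambda>x. (x, x))"
    unfolding indep_var_distribution_eq by simp
  interpret Y: prob_space "distr M (future s) (\<lambda>x. x)" by (rule prob_space_distr) simp
  have "(\<integral>\<^sup>+\<omega>. \<Phi> \<omega> \<omega> \<partial>M) = (\<integral>\<^sup>+p. (\<lambda>(\<omega>, \<omega>'). \<Phi> \<omega> \<omega>') p \<partial>distr M (F s \<Otimes>\<^sub>M future s) (\<lambda>x. (x, x)))"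
    using \<Phi> by (subst nn_integral_distr) auto
  also have "\<dots> = (\<integral>\<^sup>+\<omega>. \<integral>\<^sup>+\<omega>'. \<Phi> \<omega> \<omega>' \<partial>distr M (future s) (\<lambda>x. x) \<partial>distr M (F s) (\<lambda>x. x))"
    unfolding eq[symmetric] using \<Phi> by (subst Y.nn_integral_fst[symmetric]) (auto cong: measurable_cong_sets)
  also have "\<dots> = (\<integral>\<^sup>+\<omega>. \<integral>\<^sup>+\<omega>'. \<Phi> \<omega> \<omega>' \<partial>distr M (future s) (\<lambda>x. x) \<partial>M)"
    using Y.borel_measurable_nn_integral[of "\<Phi>" "F s"] \<Phi> 
    by (subst nn_integral_distr) (auto cong: measurable_cong_sets)
  also have "\<dots> = (\<integral>\<^sup>+\<omega>. \<integral>\<^sup>+\<omega>'. \<Phi> \<omega> \<omega>' \<partial>M \<partial>M)"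
  proof (intro nn_integral_cong)
    fix \<omega> assume "\<omega> \<in> space M"
    then have "\<omega> \<in> space (F s)" using s by simp
    then have "\<Phi> \<omega> \<in> borel_measurable (future s)"
      using measurable_compose[OF measurable_Pair1' \<Phi>, of \<omega>] by simp
    then show "(\<integral>\<^sup>+\<omega>'. \<Phi> \<omega> \<omega>' \<partial>distr M (future s) (\<lambda>x. x)) = (\<integral>\<^sup>+\<omega>'. \<Phi> \<omega> \<omega>' \<partial>M)"
      by (subst nn_integral_distr) auto
  qed
  finally show ?thesis .
qed

end

section \<open>Walsh integrals\<close>

text \<open>Induction on the number of points of T below R: the last of them, or 0, satisfies the
  claim, and one step without interior grid points leads from there to R.\<close>

lemma grid_induct [consumes 2, case_names zero step]:
  fixes T :: "real set"
  assumes T: "finite T" and R: "R \<ge> 0"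
    and zero: "P 0"
    and step: "\<And>r r'. 0 \<le> r \<Longrightarrow> r < r' \<Longrightarrow> (\<And>t. t \<in> T \<Longrightarrow> t \<le> r \<or> r' \<le> t) \<Longrightarrow> P r \<Longrightarrow> P r'"
  shows "P R"
  using R
proof (induction "card (T \<inter> {..<R})" arbitrary: R rule: less_induct)
  case less
  show ?case
  proof (cases "R = 0")
    case False
    then have R: "R > 0" using less.prems by simp
    define m where "m = Max (insert 0 (T \<inter> {0..<R}))"
    have fin: "finite (insert 0 (T \<inter> {0..<R}))" using T by auto
    have m: "m \<in> insert 0 (T \<inter> {0..<R})" unfolding m_def by (rule Max_in[OF fin]) auto
    have mle: "t \<le> m" if "t \<in> insert 0 (T \<inter> {0..<R})" for t
      unfolding m_def by (rule Max_ge[OF fin that])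
    have m0: "m \<ge> 0" "m < R" using m R by auto
    have "P m"
    proof (cases "m = 0")
      case False
      then have "T \<inter> {..<m} \<subset> T \<inter> {..<R}" using m m0 by auto
      then have "card (T \<inter> {..<m}) < card (T \<inter> {..<R})" using T by (intro psubset_card_mono) auto
      then show ?thesis using less.hyps m0 by blast
    qed (simp add: zero)
    moreover have "t \<le> m \<or> R \<le> t" if "t \<in> T" for t
      using mle[of t] that m0 by (cases "t \<ge> 0"; cases "t < R") auto
    ultimately show ?thesis using step[of m R] m0 by blast
  qed (simp add: zero)
qed

section \<open>Integrals over space-time\<close>

definition st_int :: "real set \<Rightarrow> (real \<Rightarrow> real \<Rightarrow> ennreal) \<Rightarrow> ennreal" where
  "st_int S h = (\<integral>\<^sup>+r. \<integral>\<^sup>+y. indicator S r * h r y \<partial>lborel \<partial>lborel)"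

lemma st_int_mono: "(\<And>r y. r \<in> S \<Longrightarrow> h r y \<le> h' r y) \<Longrightarrow> st_int S h \<le> st_int S h'"
  unfolding st_int_def by (intro nn_integral_mono) (auto simp: indicator_def)

lemma st_int_cong: "(\<And>r y. r \<in> S \<Longrightarrow> h r y = h' r y) \<Longrightarrow> st_int S h = st_int S h'"
  unfolding st_int_def by (intro nn_integral_cong) (auto simp: indicator_def)

lemma st_int_Un:
  assumes [measurable]: "(\<lambda>p. h (fst p) (snd p)) \<in> borel_measurable (borel \<Otimes>\<^sub>M borel)" "S \<in> sets borel" "T \<in> sets borel"
    and "S \<inter> T = {}"
  shows "st_int (S \<union> T) h = st_int S h + st_int T h"
proof -
  have [measurable]: "(\<lambda>y. h r y) \<in> borel_measurable borel" for r
    using measurable_compose[OF measurable_Pair1' assms(1), of r] by simp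
  have "indicator (S \<union> T) r * h r y = indicator S r * h r y + indicator T r * h r y" for r y
    using assms(4) by (auto simp: indicator_def)
  then show ?thesis unfolding st_int_def
    by (simp add: nn_integral_add)
qed

lemma st_int_add:
  assumes [measurable]: "(\<lambda>p. h (fst p) (snd p)) \<in> borel_measurable (borel \<Otimes>\<^sub>M borel)"
    "(\<lambda>p. h' (fst p) (snd p)) \<in> borel_measurable (borel \<Otimes>\<^sub>M borel)" "S \<in> sets borel"
  shows "st_int S (\<lambda>r y. h r y + h' r y) = st_int S h + st_int S h'"
proof -
  have [measurable]: "(\<lambda>y. h r y) \<in> borel_measurable borel" "(\<lambda>y. h' r y) \<in> borel_measurable borel" for r
    using measurable_compose[OF measurable_Pair1' assms(1), of r] measurable_compose[OF measurable_Pair1' assms(2), of r] by auto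
  show ?thesis unfolding st_int_def
    by (simp add: nn_integral_add distrib_left)
qed

lemma st_int_cmult:
  assumes [measurable]: "(\<lambda>p. h (fst p) (snd p)) \<in> borel_measurable (borel \<Otimes>\<^sub>M borel)" "S \<in> sets borel"
  shows "st_int S (\<lambda>r y. c * h r y) = c * st_int S h"
proof -
  have [measurable]: "(\<lambda>y. h r y) \<in> borel_measurable borel" for r
    using measurable_compose[OF measurable_Pair1' assms(1), of r] by simp
  show ?thesis unfolding st_int_def
    by (simp add: nn_integral_cmult mult.left_commute[of _ c])
qed

section \<open>Gaussian averages of squares and of truncated powers\<close>

definition gauss_moment :: "nat \<Rightarrow> real" where
  "gauss_moment k = fact (2 * k) / (2 ^ k * fact k)"

lemma gauss_avg_square:
  assumes "v \<ge> 0"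
  shows "gauss_avg (\<lambda>x. x\<^sup>2) z v = ennreal (z\<^sup>2 + v)"
proof -
  have "has_bochner_integral lborel (\<lambda>g. z\<^sup>2 * std_normal_density g + 2 * z * sqrt v * (std_normal_density g * g) + v * (std_normal_density g * g ^ (2 * 1)))
    (z\<^sup>2 * 1 + 2 * z * sqrt v * 0 + v * (fact (2 * 1) / (2 ^ 1 * fact 1)))"
    using std_normal_moment_even[of 0] std_normal_moment_odd[of 0] std_normal_moment_even[of 1]
    by (intro has_bochner_integral_add has_bochner_integral_mult_right) auto
  also have "(\<lambda>g. z\<^sup>2 * std_normal_density g + 2 * z * sqrt v * (std_normal_density g * g) + v * (std_normal_density g * g ^ (2 * 1)))
    = (\<lambda>g. std_normal_density g * (z + sqrt v * g)\<^sup>2)"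
    using assms by (auto simp: power2_eq_square algebra_simps)
  finally have "has_bochner_integral lborel (\<lambda>g. std_normal_density g * (z + sqrt v * g)\<^sup>2) (z\<^sup>2 + v)" by simp
  then show ?thesis unfolding gauss_avg_def
    by (subst ennreal_mult[symmetric]) (auto simp: has_bochner_integral_iff nn_integral_eq_integral)
qed

definition moment_const :: "nat \<Rightarrow> real" where
  "moment_const k = taylor_const k * (1 + gauss_moment (k + 1) * fact k) + 1"

lemma moment_const_ge_1: "moment_const k \<ge> 1"
  using taylor_const_pos[of k] by (simp add: moment_const_def gauss_moment_def)

text \<open>\<kappa> is the length of the step on the clock of the weight. At the level b = sqrt(v /
  \<kappa>) of \<open>trunc_power_young\<close> the increment measures sqrt(\<kappa>) g in units of
  b, so the linear term averages to 0 and the remainder to a polynomial in \<kappa> without constant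
  term. The bound has the form exp(C \<kappa>) because such factors multiply along the grid.\<close>

lemma gauss_avg_trunc_power:
  assumes n: "n > 0" and \<kappa>: "\<kappa> > 0" and v: "v > 0"
  shows "gauss_avg (trunc_power k n) z v
    \<le> ennreal (exp (moment_const k * \<kappa>) * (trunc_power k n z + moment_const k * (\<kappa> * trunc_power k n (sqrt (v / \<kappa>)))))"
proof -
  define b where "b = sqrt (v / \<kappa>)"
  have b: "b > 0" using v \<kappa> by (simp add: b_def)
  have sv: "sqrt v / b = sqrt \<kappa>" using v \<kappa> by (simp add: b_def real_sqrt_divide)
  define P where "P = trunc_power k n z + trunc_power k n b"
  have P: "P \<ge> 0" "trunc_power k n z \<ge> 0" "trunc_power k n b \<ge> 0"
    using n by (auto simp: P_def intro!: add_nonneg_nonneg trunc_power_nonneg)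
  define G where "G g = std_normal_density g * (trunc_power k n z + trunc_power_deriv k n z * (sqrt v * g)
      + taylor_const k * (\<kappa> * g\<^sup>2 + \<kappa> ^ (k + 1) * g ^ (2 * (k + 1))) * P)" for g
  have le: "std_normal_density g * trunc_power k n (z + sqrt v * g) \<le> G g" for g
  proof -
    have "(sqrt v * g / b)\<^sup>2 = \<kappa> * g\<^sup>2" 
      using \<kappa> by (metis less_imp_le power_mult_distrib real_sqrt_pow2 sv times_divide_eq_left)
    moreover then have "(sqrt v * g / b) ^ (2 * k + 2) = \<kappa> ^ (k + 1) * g ^ (2 * (k + 1))"
      by (metis mult_2_right power_mult power_mult_distrib add.commute distrib_left mult.right_neutral)
    ultimately show ?thesis
      unfolding G_def P_def using trunc_power_young[OF n b, of k z "sqrt v * g"]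
      by (intro mult_left_mono) auto
  qed
  have "has_bochner_integral lborel (\<lambda>g. trunc_power k n z * std_normal_density g
       + trunc_power_deriv k n z * sqrt v * (std_normal_density g * g)
       + taylor_const k * P * \<kappa> * (std_normal_density g * g ^ 2)
       + taylor_const k * P * \<kappa> ^ (k + 1) * (std_normal_density g * g ^ (2 * (k + 1))))
     (trunc_power k n z * 1 + trunc_power_deriv k n z * sqrt v * 0
       + taylor_const k * P * \<kappa> * 1
       + taylor_const k * P * \<kappa> ^ (k + 1) * (fact (2 * (k + 1)) / (2 ^ (k + 1) * fact (k + 1))))"
    using std_normal_moment_even[of 0] std_normal_moment_odd[of 0] std_normal_moment_even[of 1]
      std_normal_moment_even[of "k + 1"]
    by (intro has_bochner_integral_add has_bochner_integral_mult_right) auto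
  moreover have "(\<lambda>g. trunc_power k n z * std_normal_density g
       + trunc_power_deriv k n z * sqrt v * (std_normal_density g * g)
       + taylor_const k * P * \<kappa> * (std_normal_density g * g ^ 2)
       + taylor_const k * P * \<kappa> ^ (k + 1) * (std_normal_density g * g ^ (2 * (k + 1)))) = G"
    unfolding G_def by (rule ext) (simp add: algebra_simps power2_eq_square)
  ultimately have G: "has_bochner_integral lborel G
     (trunc_power k n z + taylor_const k * (\<kappa> + \<kappa> ^ (k + 1) * gauss_moment (k + 1)) * P)"
    by (simp add: gauss_moment_def algebra_simps del: fact_Suc power_Suc)
  have G0: "0 \<le> G g" for g
    using le[of g] trunc_power_nonneg[of n k "z + sqrt v * g"] n
    by (intro order_trans[OF _ le]) auto
  have "gauss_avg (trunc_power k n) z v \<le> (\<integral>\<^sup>+g. ennreal (G g) \<partial>lborel)"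
    unfolding gauss_avg_def using n
    by (intro nn_integral_mono) (simp add: ennreal_mult[symmetric] trunc_power_nonneg le ennreal_leI)
  also have "\<dots> = ennreal (trunc_power k n z + taylor_const k * (\<kappa> + \<kappa> ^ (k + 1) * gauss_moment (k + 1)) * P)"
    using G G0 by (simp add: nn_integral_eq_integral has_bochner_integral_iff)
  also have "\<dots> \<le> ennreal (exp (moment_const k * \<kappa>) * (trunc_power k n z + moment_const k * (\<kappa> * trunc_power k n b)))"
  proof (rule ennreal_leI)
    define C0 where "C0 = taylor_const k * (1 + gauss_moment (k + 1) * fact k)"
    have g0: "gauss_moment (k + 1) \<ge> 0" by (simp add: gauss_moment_def)
    have C0: "C0 \<ge> 0" using taylor_const_pos[of k] g0 by (simp add: C0_def)
    have mc: "moment_const k = C0 + 1" by (simp add: moment_const_def C0_def)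
    have e1: "1 \<le> exp \<kappa>" using \<kappa> by simp
    \<comment> \<open>\<kappa>^k <= k! exp(\<kappa>) turns the higher power into a multiple of
      \<kappa>. The summand 1 in \<open>moment_const\<close> pays for the factor exp(\<kappa>) that
      appears.\<close>
    have "\<kappa> + \<kappa> ^ (k + 1) * gauss_moment (k + 1) \<le> \<kappa> * exp \<kappa> + \<kappa> * (fact k * exp \<kappa>) * gauss_moment (k + 1)"
      using \<kappa> g0 e1 power_le_fact_exp[of \<kappa> k] by (intro add_mono mult_right_mono) auto
    then have "taylor_const k * (\<kappa> + \<kappa> ^ (k + 1) * gauss_moment (k + 1)) \<le> taylor_const k * (\<kappa> * exp \<kappa> + \<kappa> * (fact k * exp \<kappa>) * gauss_moment (k + 1))"
      using taylor_const_pos[of k] by (intro mult_left_mono) auto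
    also have "\<dots> = C0 * \<kappa> * exp \<kappa>" by (simp add: C0_def algebra_simps)
    finally have 1: "taylor_const k * (\<kappa> + \<kappa> ^ (k + 1) * gauss_moment (k + 1)) * P \<le> C0 * \<kappa> * exp \<kappa> * P"
      using P by (intro mult_right_mono)
    have "exp \<kappa> * (1 + C0 * \<kappa>) \<le> exp \<kappa> * exp (C0 * \<kappa>)"
      by (intro mult_left_mono exp_ge_add_one_self) auto
    then have E: "exp \<kappa> + C0 * \<kappa> * exp \<kappa> \<le> exp (moment_const k * \<kappa>)"
      by (simp add: mc algebra_simps exp_add)
    have "trunc_power k n z + C0 * \<kappa> * exp \<kappa> * P
      = (1 + C0 * \<kappa> * exp \<kappa>) * trunc_power k n z + exp \<kappa> * (C0 * (\<kappa> * trunc_power k n b))"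
      by (simp add: P_def algebra_simps)
    also have "\<dots> \<le> exp (moment_const k * \<kappa>) * trunc_power k n z
      + exp (moment_const k * \<kappa>) * (moment_const k * (\<kappa> * trunc_power k n b))"
    proof (intro add_mono mult_mono)
      show "1 + C0 * \<kappa> * exp \<kappa> \<le> exp (moment_const k * \<kappa>)" using E e1 by linarith
      show "exp \<kappa> \<le> exp (moment_const k * \<kappa>)" using \<kappa> C0 by (simp add: mc)
    qed (use P \<kappa> C0 mc in auto)
    finally show "trunc_power k n z + taylor_const k * (\<kappa> + \<kappa> ^ (k + 1) * gauss_moment (k + 1)) * P
      \<le> exp (moment_const k * \<kappa>) * (trunc_power k n z + moment_const k * (\<kappa> * trunc_power k n b))"
      using 1 by (simp add: distrib_left)
  qed
  finally show ?thesis unfolding b_def .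
qed

section \<open>Simple integrals, stopped at a time and followed along the grid of jump times\<close>

definition simple_upto :: "(real \<Rightarrow> real \<Rightarrow> 'a \<Rightarrow> real) \<Rightarrow> 'a simple_pred \<Rightarrow> real \<Rightarrow> 'a \<Rightarrow> real" where
  "simple_upto W L r \<omega> = sum_list (map (\<lambda>(c,A,s,t,a,b).
     c * indicator A \<omega> * sheet_incr W (min s r) (min t r) a b \<omega>) L)"

text \<open>Terms not alive during the step keep their interval and get the coefficient 0, so that
  the list of intervals is the same for every outcome and only the coefficients are random.\<close>

definition active :: "'a simple_pred \<Rightarrow> real \<Rightarrow> real \<Rightarrow> 'a \<Rightarrow> (real \<times> real \<times> real) list" where
  "active L r r' \<omega> = map (\<lambda>(c,A,s,t,a,b). (if s \<le> r \<and> r' \<le> t then c * indicator A \<omega> else 0, a, b)) L"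

definition grid_times :: "'a simple_pred \<Rightarrow> real set" where
  "grid_times L = (\<Union>(c,A,s,t,a,b)\<in>set L. {s, t})"

lemma grid_times_finite: "finite (grid_times L)"
  unfolding grid_times_def by auto

lemma simple_upto_step:
  assumes "r < r'" and "\<And>\<tau>. \<tau> \<in> grid_times L \<Longrightarrow> \<tau> \<le> r \<or> r' \<le> \<tau>" and "\<forall>(c,A,s,t,a,b)\<in>set L. s < t"
  shows "simple_upto W L r' \<omega> = simple_upto W L r \<omega> + incr_comb W r r' (active L r r' \<omega>) \<omega>"
  using assms(2,3)
proof (induction L)
  case Nil
  then show ?case by (simp add: simple_upto_def incr_comb_def active_def)
next
  case (Cons e L)
  obtain c A s t a b where e: "e = (c, A, s, t, a, b)" by (cases e)
  have IH: "simple_upto W L r' \<omega> = simple_upto W L r \<omega> + incr_comb W r r' (active L r r' \<omega>) \<omega>"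
    using Cons by (auto simp: grid_times_def)
  have st: "s \<le> r \<or> r' \<le> s" "t \<le> r \<or> r' \<le> t" "s < t"
    using Cons.prems e by (auto simp: grid_times_def)
  then have "sheet_incr W (min s r') (min t r') a b \<omega> = sheet_incr W (min s r) (min t r) a b \<omega>
      + (if s \<le> r \<and> r' \<le> t then sheet_incr W r r' a b \<omega> else 0)"
    using assms(1) by (auto simp: sheet_incr_def min_def)
  then show ?case using IH
    by (auto simp: simple_upto_def incr_comb_def active_def e algebra_simps)
qed

lemma simple_eval_step:
  assumes "r < \<rho>" "\<rho> \<le> r'" and "\<And>\<tau>. \<tau> \<in> grid_times L \<Longrightarrow> \<tau> \<le> r \<or> r' \<le> \<tau>"
  shows "simple_eval L \<omega> \<rho> y = step_fun (active L r r' \<omega>) y"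
  using assms(3)
proof (induction L)
  case Nil
  then show ?case by (simp add: simple_eval_def step_fun_def active_def)
next
  case (Cons e L)
  obtain c A s t a b where e: "e = (c, A, s, t, a, b)" by (cases e)
  have IH: "simple_eval L \<omega> \<rho> y = step_fun (active L r r' \<omega>) y"
    using Cons by (auto simp: grid_times_def)
  have st: "s \<le> r \<or> r' \<le> s" "t \<le> r \<or> r' \<le> t"
    using Cons.prems e by (auto simp: grid_times_def)
  then have "(indicator {s<..t} \<rho> :: real) = (if s \<le> r \<and> r' \<le> t then 1 else 0)"
    using assms(1,2) by auto
  then show ?case using IH
    by (auto simp: simple_eval_def step_fun_def active_def e)
qed

lemma st_int_singleton: "st_int {a} h = 0"
proof -
  have "st_int {a} h = (\<integral>\<^sup>+r. 0 \<partial>(lborel :: real measure))"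
    unfolding st_int_def using AE_lborel_singleton[of a]
    by (intro nn_integral_cong_AE) auto
  then show ?thesis by simp
qed

lemma measurable_comp3:
  assumes "(\<lambda>p. H (fst p) (fst (snd p)) (snd (snd p))) \<in> borel_measurable (N \<Otimes>\<^sub>M (borel \<Otimes>\<^sub>M borel))"
    and "g \<in> measurable K N" "r \<in> borel_measurable K" "y \<in> borel_measurable K"
  shows "(\<lambda>x. H (g x) (r x) (y x)) \<in> borel_measurable K"
  using measurable_compose[OF _ assms(1), of "\<lambda>x. (g x, r x, y x)" K] assms(2-) by simp

lemma st_int_measurable:
  fixes H :: "'a \<Rightarrow> real \<Rightarrow> real \<Rightarrow> ennreal"
  assumes H: "(\<lambda>p. H (fst p) (fst (snd p)) (snd (snd p))) \<in> borel_measurable (N \<Otimes>\<^sub>M (borel \<Otimes>\<^sub>M borel))"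
    and [measurable]: "S \<in> sets borel"
  shows "(\<lambda>\<omega>. st_int S (H \<omega>)) \<in> borel_measurable N"
proof -
  have [measurable]: "(\<lambda>q. H (fst (fst q)) (snd (fst q)) (snd q)) \<in> borel_measurable ((N \<Otimes>\<^sub>M borel) \<Otimes>\<^sub>M borel)"
    by (rule measurable_comp3[OF H]) measurable
  have "(\<lambda>(x, y). indicator S (snd x) * H (fst x) (snd x) y) \<in> borel_measurable ((N \<Otimes>\<^sub>M borel) \<Otimes>\<^sub>M lborel)"
    unfolding split_beta by measurable
  then have "(\<lambda>x. \<integral>\<^sup>+y. indicator S (snd x) * H (fst x) (snd x) y \<partial>lborel) \<in> borel_measurable (N \<Otimes>\<^sub>M borel)"
    by (rule lborel.borel_measurable_nn_integral)
  then have "(\<lambda>(\<omega>, r). \<integral>\<^sup>+y. indicator S r * H \<omega> r y \<partial>lborel) \<in> borel_measurable (N \<Otimes>\<^sub>M lborel)"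
    unfolding split_beta by (simp cong: measurable_cong_sets)
  then show ?thesis
    unfolding st_int_def by (rule lborel.borel_measurable_nn_integral)
qed

lemma st_int_eq_0_imp_null:
  assumes [measurable]: "(\<lambda>p. h (fst p) (snd p)) \<in> borel_measurable (borel \<Otimes>\<^sub>M borel)" "S \<in> sets borel"
    and pos: "\<And>r y. r \<in> S \<Longrightarrow> h r y > 0" and 0: "st_int S h = 0"
  shows "emeasure lborel S = 0"
proof -
  have m[measurable]: "(\<lambda>y. h r y) \<in> borel_measurable borel" for r
    using measurable_compose[OF measurable_Pair1' assms(1), of r] by simp
  have "(\<lambda>(r, y). indicator S r * h r y) \<in> borel_measurable (lborel \<Otimes>\<^sub>M lborel)"
    unfolding split_beta by (simp cong: measurable_cong_sets)
  then have [measurable]: "(\<lambda>r. \<integral>\<^sup>+y. indicator S r * h r y \<partial>lborel) \<in> borel_measurable lborel"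
    by (rule lborel.borel_measurable_nn_integral)
  have "AE r in lborel. (\<integral>\<^sup>+y. indicator S r * h r y \<partial>lborel) = 0"
    using 0 unfolding st_int_def by (subst (asm) nn_integral_0_iff_AE) auto
  moreover have "r \<notin> S" if "(\<integral>\<^sup>+y. indicator S r * h r y \<partial>lborel) = 0" for r :: real
  proof
    assume r: "r \<in> S"
    then have "AE y in lborel. h r y = 0"
      using that by (subst (asm) nn_integral_0_iff_AE) auto
    then have "AE y in (lborel :: real measure). False"
      using pos[OF r] by (auto elim!: eventually_mono) (metis less_irrefl)
    then show False by (subst (asm) AE_iff_measurable[of UNIV]) auto
  qed
  ultimately have "AE r in lborel. r \<notin> S" by (rule eventually_mono)
  then show ?thesis by (subst (asm) AE_iff_measurable[of S]) auto
qed

text \<open>A substitute for Jensen's inequality under the probability density w^2 / \<kappa>. The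
  function s * min(s, n)^k is not convex across s = n, and the linearisation of
  \<open>trunc_power_jensen\<close> at s0 = v / \<kappa> costs the factor 2^(k+1).\<close>

lemma st_int_trunc_power_jensen:
  assumes [measurable]: "(\<lambda>p. h (fst p) (snd p)) \<in> borel_measurable (borel \<Otimes>\<^sub>M borel)"
    "(\<lambda>p. w (fst p) (snd p)) \<in> borel_measurable (borel \<Otimes>\<^sub>M borel)" "S \<in> sets borel"
    and w: "\<And>r y. w r y > 0" and n: "n > 0" and \<kappa>: "\<kappa> > 0" "st_int S (\<lambda>r y. ennreal ((w r y)\<^sup>2)) = ennreal \<kappa>"
    and v: "v > 0" "st_int S (\<lambda>r y. ennreal ((h r y)\<^sup>2)) = ennreal v"
  shows "ennreal (\<kappa> * trunc_power k n (sqrt (v / \<kappa>)))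
    \<le> ennreal (2 ^ (k + 1)) * st_int S (\<lambda>r y. ennreal ((w r y)\<^sup>2 * trunc_power k n (h r y / w r y)))"
proof -
  define A where "A = (min (v / \<kappa>) n) ^ k"
  define I where "I = st_int S (\<lambda>r y. ennreal ((w r y)\<^sup>2 * trunc_power k n (h r y / w r y)))"
  have A: "A \<ge> 0" using n \<kappa> v by (simp add: A_def)
  have lhs: "\<kappa> * trunc_power k n (sqrt (v / \<kappa>)) = v * A"
    using \<kappa> v by (simp add: trunc_power_def A_def)
  have tp: "trunc_power k n x \<ge> 0" for x using n by (simp add: trunc_power_nonneg)
  have "ennreal A * st_int S (\<lambda>r y. ennreal ((h r y)\<^sup>2)) = st_int S (\<lambda>r y. ennreal A * ennreal ((h r y)\<^sup>2))"
    by (subst st_int_cmult) auto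
  also have "\<dots> \<le> st_int S (\<lambda>r y. ennreal (2 ^ k) * ennreal ((w r y)\<^sup>2 * trunc_power k n (h r y / w r y))
      + ennreal (v / \<kappa> / 2 * A) * ennreal ((w r y)\<^sup>2))"
  proof (rule st_int_mono)
    fix r y
    have "(h r y)\<^sup>2 * A \<le> 2 ^ k * ((w r y)\<^sup>2 * trunc_power k n (h r y / w r y)) + ((w r y)\<^sup>2 * (v / \<kappa>) / 2) * A"
      unfolding A_def using w n \<kappa> v by (intro trunc_power_jensen) auto
    then show "ennreal A * ennreal ((h r y)\<^sup>2) \<le> ennreal (2 ^ k) * ennreal ((w r y)\<^sup>2 * trunc_power k n (h r y / w r y))
      + ennreal (v / \<kappa> / 2 * A) * ennreal ((w r y)\<^sup>2)"
      using A tp \<kappa> v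
      by (simp add: ennreal_mult[symmetric] ennreal_plus[symmetric] del: ennreal_plus) (simp add: algebra_simps)
  qed
  also have "\<dots> = ennreal (2 ^ k) * I + ennreal (v / \<kappa> / 2 * A) * ennreal \<kappa>"
    unfolding I_def \<kappa>(2)[symmetric] by (subst st_int_add; (subst st_int_cmult)?) (auto simp: st_int_cmult)
  also have "ennreal (v / \<kappa> / 2 * A) * ennreal \<kappa> = ennreal (v * A / 2)"
    using \<kappa> v A by (subst ennreal_mult[symmetric]) (auto simp: field_simps)
  finally have *: "ennreal (v * A) \<le> ennreal (2 ^ k) * I + ennreal (v * A / 2)"
    unfolding v(2) using v A by (simp add: ennreal_mult[symmetric] mult.commute)
  show ?thesis
  proof (cases "I = \<top>")
    case True
    then show ?thesis unfolding I_def[symmetric] by (simp add: ennreal_mult_top)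
  next
    case False
    then obtain i where i: "I = ennreal i" "i \<ge> 0" by (cases I) auto
    have "v * A \<le> 2 ^ k * i + v * A / 2"
      using * i v A by (simp add: ennreal_mult[symmetric] ennreal_plus[symmetric] del: ennreal_plus)
    then have "v * A \<le> 2 ^ (k + 1) * i" by simp
    then show ?thesis unfolding I_def[symmetric] lhs i(1) using i
      by (simp add: ennreal_mult[symmetric])
  qed
qed

lemma simple_okD:
  "simple_ok M F L \<Longrightarrow> (c, A, s, t, a, b) \<in> set L \<Longrightarrow> 0 \<le> s \<and> s < t \<and> a < b \<and> A \<in> sets (F s)"
  unfolding simple_ok_def by fast

context noise
begin

lemma simple_eval_measurable:
  assumes "simple_ok M F L"
  shows "(\<lambda>p. simple_eval L (fst p) (fst (snd p)) (snd (snd p))) \<in> borel_measurable (M \<Otimes>\<^sub>M (borel \<Otimes>\<^sub>M borel))"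
  unfolding simple_eval_def
proof (rule borel_measurable_sum_list)
  fix e assume e: "e \<in> set L"
  obtain c A s t a b where ee: "e = (c, A, s, t, a, b)" by (cases e)
  have "0 \<le> s \<and> A \<in> sets (F s)" using simple_okD[OF assms] e ee by blast
  then have [measurable]: "A \<in> sets M" using F_sets[of s] by blast
  show "(\<lambda>x. case e of (c, A, s, t, a, b) \<Rightarrow> c * indicator A (fst x) * indicator {s<..t} (fst (snd x)) * indicator {a<..b} (snd (snd x)))
    \<in> borel_measurable (M \<Otimes>\<^sub>M (borel \<Otimes>\<^sub>M borel))"
    unfolding ee by simp
qed

lemmas simple_eval_comp = measurable_comp3[OF simple_eval_measurable]

lemma active_ordered: "simple_ok M F L \<Longrightarrow> \<forall>(d,a,b)\<in>set (active L r r' \<omega>). a \<le> b"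
  unfolding simple_ok_def active_def by fastforce

lemma energy_step:
  assumes ok: "simple_ok M F L" and r: "0 \<le> r" "r < r'" and gap: "\<And>\<tau>. \<tau> \<in> grid_times L \<Longrightarrow> \<tau> \<le> r \<or> r' \<le> \<tau>"
  shows "st_int {r<..r'} (\<lambda>\<rho> y. ennreal ((simple_eval L \<omega> \<rho> y)\<^sup>2))
    = ennreal ((r' - r) * (\<integral>y. (step_fun (active L r r' \<omega>) y)\<^sup>2 \<partial>lborel))"
proof -
  let ?s = "step_fun (active L r r' \<omega>)"
  have i: "integrable lborel (\<lambda>y. (?s y)\<^sup>2)"
    using integrable_step_fun_mult[OF active_ordered[OF ok] active_ordered[OF ok]] by (simp add: power2_eq_square)
  have "st_int {r<..r'} (\<lambda>\<rho> y. ennreal ((simple_eval L \<omega> \<rho> y)\<^sup>2)) = st_int {r<..r'} (\<lambda>\<rho> y. ennreal ((?s y)\<^sup>2))"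
    by (rule st_int_cong) (simp add: simple_eval_step[of r _ r' L, OF _ _ gap])
  also have "\<dots> = ennreal (r' - r) * ennreal (\<integral>y. (?s y)\<^sup>2 \<partial>lborel)"
    unfolding st_int_def using r i
    by (simp add: nn_integral_cmult nn_integral_multc nn_integral_eq_integral)
  finally show ?thesis using r by (simp add: ennreal_mult)
qed

lemma simple_upto_F_measurable:
  assumes ok: "simple_ok M F L" and r: "0 \<le> r"
  shows "simple_upto W L r \<in> borel_measurable (F r)"
  unfolding simple_upto_def[abs_def]
proof (rule borel_measurable_sum_list)
  fix e assume e: "e \<in> set L"
  obtain c A s t a b where ee: "e = (c, A, s, t, a, b)" by (cases e)
  have st: "0 \<le> s" "s < t" "A \<in> sets (F s)" using simple_okD[OF ok] e ee by blast+
  show "(\<lambda>\<omega>. case e of (c, A, s, t, a, b) \<Rightarrow> c * indicator A \<omega> * sheet_incr W (min s r) (min t r) a b \<omega>) \<in> borel_measurable (F r)"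
  proof (cases "s \<le> r")
    case True
    then have [measurable]: "A \<in> sets (F r)" using st F_mono[of s r] by auto
    have [measurable]: "W (min s r) x \<in> borel_measurable (F r)" "W (min t r) x \<in> borel_measurable (F r)" for x
      using st r by (auto intro!: W_F_measurable)
    show ?thesis unfolding ee sheet_incr_def by simp
  next
    case False
    then have "min s r = r" "min t r = r" using st by auto
    then show ?thesis unfolding ee sheet_incr_def by simp
  qed
qed

lemma F_imp_M_measurable: "r \<ge> 0 \<Longrightarrow> f \<in> measurable (F r) N \<Longrightarrow> f \<in> measurable M N"
  using F_sets[of r] F_space[of r] by (auto simp: measurable_def)

text \<open>Inside a grid step the integrand is a spatial step function whose coefficients are known
  at time r. Given the past the increment is therefore a centred Gaussian with that step function's
  energy as variance.\<close>

lemma simple_upto_avg: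
  assumes ok: "simple_ok M F L" and r: "0 \<le> r" "r < r'" and gap: "\<And>\<tau>. \<tau> \<in> grid_times L \<Longrightarrow> \<tau> \<le> r \<or> r' \<le> \<tau>"
    and [measurable]: "\<phi> \<in> borel_measurable borel"
  shows "(\<integral>\<^sup>+\<omega>. ennreal (\<phi> (z + simple_upto W L r' \<omega>)) \<partial>M) =
    (\<integral>\<^sup>+\<omega>. gauss_avg \<phi> (z + simple_upto W L r \<omega>) ((r' - r) * (\<integral>y. (step_fun (active L r r' \<omega>) y)\<^sup>2 \<partial>lborel)) \<partial>M)"
proof -
  define \<Phi> where "\<Phi> \<omega> \<omega>' = ennreal (\<phi> (z + simple_upto W L r \<omega> + incr_comb W r r' (active L r r' \<omega>) \<omega>'))" for \<omega> \<omega>'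
  have [measurable]: "simple_upto W L r \<in> borel_measurable (F r)" using simple_upto_F_measurable[OF ok r(1)] .
  have "(\<lambda>p. incr_comb W r r' (active L r r' (fst p)) (snd p)) =
     (\<lambda>p. sum_list (map (\<lambda>e. (case e of (c, A, s, t, a, b) \<Rightarrow>
        (if s \<le> r \<and> r' \<le> t then c * indicator A (fst p) else 0) * sheet_incr W r r' a b (snd p))) L))"
    by (auto simp: fun_eq_iff incr_comb_def active_def intro!: arg_cong[where f=sum_list])
  also have "\<dots> \<in> borel_measurable (F r \<Otimes>\<^sub>M future r)"
  proof (rule borel_measurable_sum_list)
    fix e assume e: "e \<in> set L"
    obtain c A s t a b where ee: "e = (c, A, s, t, a, b)" by (cases e)
    have [measurable]: "sheet_incr W r r' a b \<in> borel_measurable (future r)"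
      using r by (intro sheet_incr_future_measurable) auto
    have "A \<in> sets (F r)" if "s \<le> r" 
      using simple_okD[OF ok e[unfolded ee]] F_mono[of s r] that by auto
    then show "(\<lambda>p. case e of (c, A, s, t, a, b) \<Rightarrow>
        (if s \<le> r \<and> r' \<le> t then c * indicator A (fst p) else 0) * sheet_incr W r r' a b (snd p)) \<in> borel_measurable (F r \<Otimes>\<^sub>M future r)"
      unfolding ee by (cases "s \<le> r \<and> r' \<le> t") auto
  qed
  finally have [measurable]: "(\<lambda>p. incr_comb W r r' (active L r r' (fst p)) (snd p)) \<in> borel_measurable (F r \<Otimes>\<^sub>M future r)" .
  have "(\<lambda>(\<omega>, \<omega>'). \<Phi> \<omega> \<omega>') \<in> borel_measurable (F r \<Otimes>\<^sub>M future r)"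
    unfolding \<Phi>_def split_beta by measurable
  then have "(\<integral>\<^sup>+\<omega>. \<Phi> \<omega> \<omega> \<partial>M) = (\<integral>\<^sup>+\<omega>. \<integral>\<^sup>+\<omega>'. \<Phi> \<omega> \<omega>' \<partial>M \<partial>M)"
    using decouple r by blast
  moreover have "\<Phi> \<omega> \<omega> = ennreal (\<phi> (z + simple_upto W L r' \<omega>))" for \<omega>
  proof -
    have "\<forall>(c,A,s,t,a,b)\<in>set L. s < t" using simple_okD[OF ok] by blast
    then show ?thesis unfolding \<Phi>_def using simple_upto_step[OF r(2) gap, of L W \<omega>] by (simp add: add.assoc)
  qed
  moreover have "(\<integral>\<^sup>+\<omega>'. \<Phi> \<omega> \<omega>' \<partial>M) = gauss_avg \<phi> (z + simple_upto W L r \<omega>) ((r' - r) * (\<integral>y. (step_fun (active L r r' \<omega>) y)\<^sup>2 \<partial>lborel))" for \<omega>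
    unfolding \<Phi>_def using r active_ordered[OF ok] by (intro incr_comb_avg) auto
  ultimately show ?thesis by simp
qed

lemma simple_upto_0: "simple_ok M F L \<Longrightarrow> simple_upto W L 0 \<omega> = 0"
proof -
  assume ok: "simple_ok M F L"
  have "map (\<lambda>(c,A,s,t,a,b). c * indicator A \<omega> * sheet_incr W (min s 0) (min t 0) a b \<omega>) L = map (\<lambda>_. 0) L"
  proof (intro map_cong refl)
    fix e assume "e \<in> set L"
    moreover obtain c A s t a b where ee: "e = (c, A, s, t, a, b)" by (cases e)
    ultimately have "min s 0 = 0" "min t 0 = 0" using simple_okD[OF ok, of c A s t a b] by auto
    then show "(case e of (c,A,s,t,a,b) \<Rightarrow> c * indicator A \<omega> * sheet_incr W (min s 0) (min t 0) a b \<omega>) = 0"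
      by (simp add: ee sheet_incr_def)
  qed
  then show ?thesis unfolding simple_upto_def by (simp only: sum_list_0)
qed

lemma simple_horizon:
  assumes ok: "simple_ok M F L"
  obtains R where "R \<ge> 0" "simple_upto W L R = simple_int W L" 
    "\<And>\<omega> r y. r > R \<Longrightarrow> simple_eval L \<omega> r y = 0"
proof
  define R where "R = Max (insert 0 (grid_times L))"
  have fin: "finite (insert 0 (grid_times L))" using grid_times_finite by auto
  show "R \<ge> 0" unfolding R_def using fin by simp
  have st: "s \<le> R \<and> t \<le> R" if "(c,A,s,t,a,b) \<in> set L" for c A s t a b
  proof -
    have "s \<in> grid_times L" "t \<in> grid_times L" unfolding grid_times_def using that by force+
    then show ?thesis unfolding R_def by (auto intro!: Max_ge[OF fin])
  qed
  show "simple_upto W L R = simple_int W L"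
    unfolding simple_upto_def[abs_def] simple_int_def[abs_def]
    by (intro ext arg_cong[where f=sum_list] map_cong) (use st in \<open>auto simp: sheet_incr_def min_absorb1\<close>)
  show "simple_eval L \<omega> r y = 0" if "r > R" for \<omega> r y
  proof -
    have "map (\<lambda>(c,A,s,t,a,b). c * indicator A \<omega> * indicator {s<..t} r * indicator {a<..b} y) L = map (\<lambda>_. 0) L"
      using st that by (intro map_cong) fastforce+
    then show ?thesis unfolding simple_eval_def by (simp only: sum_list_0)
  qed
qed

text \<open>The Gaussian average of x^2 adds the variance to the square, so the energies of the grid
  steps accumulate. The constant z stands for the deterministic part of the mild equation.\<close>

lemma simple_isometry:
  assumes ok: "simple_ok M F L"
  shows "(\<integral>\<^sup>+\<omega>. ennreal ((z + simple_int W L \<omega>)\<^sup>2) \<partial>M)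
     = ennreal (z\<^sup>2) + (\<integral>\<^sup>+\<omega>. st_int {0..} (\<lambda>r y. ennreal ((simple_eval L \<omega> r y)\<^sup>2)) \<partial>M)"
proof -
  let ?e = "\<lambda>\<omega> r y. ennreal ((simple_eval L \<omega> r y)\<^sup>2)"
  note [measurable] = simple_eval_measurable[OF ok]
  have e1[measurable]: "(\<lambda>p. ?e \<omega> (fst p) (snd p)) \<in> borel_measurable (borel \<Otimes>\<^sub>M borel)" if "\<omega> \<in> space M" for \<omega>
    using that by (auto intro!: simple_eval_comp[OF ok] measurable_compose[OF _ measurable_ennreal] borel_measurable_power)
  have e2[measurable]: "(\<lambda>\<omega>. st_int S (?e \<omega>)) \<in> borel_measurable M" if "S \<in> sets borel" for S
    by (rule st_int_measurable[OF _ that]) measurable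
  obtain R where R: "R \<ge> 0" "simple_upto W L R = simple_int W L" "\<And>\<omega> r y. r > R \<Longrightarrow> simple_eval L \<omega> r y = 0"
    by (rule simple_horizon[OF ok]) blast
  have "(\<integral>\<^sup>+\<omega>. ennreal ((z + simple_upto W L R \<omega>)\<^sup>2) \<partial>M) = ennreal (z\<^sup>2) + (\<integral>\<^sup>+\<omega>. st_int {0..R} (?e \<omega>) \<partial>M)"
    using grid_times_finite[of L] R(1)
  proof (induction R rule: grid_induct)
    case zero
    then show ?case by (simp add: simple_upto_0[OF ok] emeasure_space_1 st_int_singleton)
  next
    case (step r r')
    have [measurable]: "simple_upto W L r \<in> borel_measurable M"
      using simple_upto_F_measurable[OF ok step(1)] F_imp_M_measurable[OF step(1)] by auto
    have "(\<integral>\<^sup>+\<omega>. ennreal ((z + simple_upto W L r' \<omega>)\<^sup>2) \<partial>M) =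
      (\<integral>\<^sup>+\<omega>. gauss_avg (\<lambda>x. x\<^sup>2) (z + simple_upto W L r \<omega>) ((r' - r) * (\<integral>y. (step_fun (active L r r' \<omega>) y)\<^sup>2 \<partial>lborel)) \<partial>M)"
      using simple_upto_avg[OF ok step(1-3), of "\<lambda>x. x\<^sup>2"] by simp
    also have "\<dots> = (\<integral>\<^sup>+\<omega>. ennreal ((z + simple_upto W L r \<omega>)\<^sup>2) + st_int {r<..r'} (?e \<omega>) \<partial>M)"
      using step(2) by (simp add: gauss_avg_square energy_step[OF ok step(1-3)] ennreal_plus)
    also have "\<dots> = ennreal (z\<^sup>2) + ((\<integral>\<^sup>+\<omega>. st_int {0..r} (?e \<omega>) \<partial>M) + (\<integral>\<^sup>+\<omega>. st_int {r<..r'} (?e \<omega>) \<partial>M))"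
      by (subst nn_integral_add) (auto simp: step.IH add.assoc)
    also have "(\<integral>\<^sup>+\<omega>. st_int {0..r} (?e \<omega>) \<partial>M) + (\<integral>\<^sup>+\<omega>. st_int {r<..r'} (?e \<omega>) \<partial>M)
      = (\<integral>\<^sup>+\<omega>. st_int {0..r'} (?e \<omega>) \<partial>M)"
    proof (subst nn_integral_add[symmetric])
      have "{0..r'} = {0..r} \<union> {r<..r'}" using step by auto
      then show "(\<integral>\<^sup>+\<omega>. st_int {0..r} (?e \<omega>) + st_int {r<..r'} (?e \<omega>) \<partial>M) = (\<integral>\<^sup>+\<omega>. st_int {0..r'} (?e \<omega>) \<partial>M)"
        by (intro nn_integral_cong) (simp, subst st_int_Un[OF e1], auto)
    qed auto
    finally show ?case .
  qed
  moreover have "st_int {0..R} (?e \<omega>) = st_int {0..} (?e \<omega>)" for \<omega>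
    unfolding st_int_def using R(3) by (intro nn_integral_cong) (auto simp: indicator_def not_le)
  ultimately show ?thesis using R(2) by simp
qed

end

definition moment_factor :: "nat \<Rightarrow> real" where
  "moment_factor k = moment_const k * 2 ^ (k + 1)"

lemma moment_factor_nonneg: "moment_factor k \<ge> 0"
  using moment_const_ge_1[of k] by (simp add: moment_factor_def)

lemma gauss_avg_trunc_power_st_int:
  assumes h: "(\<lambda>p. h (fst p) (snd p)) \<in> borel_measurable (borel \<Otimes>\<^sub>M borel)"
    and w: "(\<lambda>p. w (fst p) (snd p)) \<in> borel_measurable (borel \<Otimes>\<^sub>M borel)" "\<And>r y. w r y > 0"
    and S: "S \<in> sets borel" and n: "n > 0"
    and \<kappa>: "\<kappa> > 0" "st_int S (\<lambda>r y. ennreal ((w r y)\<^sup>2)) = ennreal \<kappa>"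
    and v: "v \<ge> 0" "st_int S (\<lambda>r y. ennreal ((h r y)\<^sup>2)) = ennreal v"
  shows "gauss_avg (trunc_power k n) z v \<le> ennreal (exp (moment_const k * \<kappa>)) *
    (ennreal (trunc_power k n z) + ennreal (moment_factor k) *
      st_int S (\<lambda>r y. ennreal ((w r y)\<^sup>2 * trunc_power k n (h r y / w r y))))"
    (is "_ \<le> _ * (_ + _ * ?I)")
proof (cases "v = 0")
  \<comment> \<open>The level sqrt(v / \<kappa>) degenerates at v = 0, where the average is just the
    value at z.\<close>
  case True
  have "1 \<le> exp (moment_const k * \<kappa>)" using moment_const_ge_1[of k] \<kappa> by simp
  then have "1 * ennreal (trunc_power k n z) \<le> ennreal (exp (moment_const k * \<kappa>)) *
    (ennreal (trunc_power k n z) + ennreal (moment_factor k) * ?I)"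
    by (intro mult_mono) (auto simp: ennreal_1[symmetric] simp del: ennreal_1)
  then show ?thesis using True by (simp add: gauss_avg_0)
next
  case False
  then have v0: "v > 0" using v by simp
  have tp: "trunc_power k n x \<ge> 0" for x using n by (simp add: trunc_power_nonneg)
  have mc: "moment_const k \<ge> 0" using moment_const_ge_1[of k] by simp
  have "gauss_avg (trunc_power k n) z v
    \<le> ennreal (exp (moment_const k * \<kappa>) * (trunc_power k n z + moment_const k * (\<kappa> * trunc_power k n (sqrt (v / \<kappa>)))))"
    by (rule gauss_avg_trunc_power[OF n \<kappa>(1) v0])
  also have "\<dots> = ennreal (exp (moment_const k * \<kappa>)) * (ennreal (trunc_power k n z)
      + ennreal (moment_const k) * ennreal (\<kappa> * trunc_power k n (sqrt (v / \<kappa>))))"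
    using tp \<kappa> mc by (simp add: ennreal_mult ennreal_plus)
  also have "\<dots> \<le> ennreal (exp (moment_const k * \<kappa>)) * (ennreal (trunc_power k n z)
      + ennreal (moment_const k) * (ennreal (2 ^ (k + 1)) * ?I))"
    by (intro mult_left_mono add_left_mono st_int_trunc_power_jensen[OF h w(1) S w(2) n \<kappa> v0 v(2)]) auto
  also have "ennreal (moment_const k) * (ennreal (2 ^ (k + 1)) * ?I) = ennreal (moment_factor k) * ?I"
    using mc by (simp add: moment_factor_def ennreal_mult mult.assoc)
  finally show ?thesis .
qed

lemma ennreal_limit_le:
  fixes A B :: ennreal
  assumes "d \<longlonglongrightarrow> 0" "d' \<longlonglongrightarrow> 0" and "\<And>n. A \<le> B + ennreal c * d n + ennreal c' * d' n"
  shows "A \<le> B"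
proof -
  have "(\<lambda>n. B + ennreal c * d n + ennreal c' * d' n) \<longlonglongrightarrow> B + ennreal c * 0 + ennreal c' * 0"
    using assms(1,2) by (intro tendsto_add tendsto_const ennreal_tendsto_cmult) auto
  then show ?thesis using LIMSEQ_le_const[of _ B A] assms(3) by simp
qed

lemma ennreal_le_scale_limit:
  assumes "\<And>\<epsilon>. \<epsilon> > 0 \<Longrightarrow> A \<le> ennreal ((1 + \<epsilon>) * (1 + \<epsilon>)) * B"
  shows "A \<le> B"
proof (cases B)
  case (real b)
  have "A \<le> ennreal ((1 + 1 / Suc n) * (1 + 1 / Suc n) * b)" for n
    using assms[of "1 / Suc n"] real by (simp add: ennreal_mult)
  moreover have "(\<lambda>n. (1 + 1 / Suc n) * (1 + 1 / Suc n) * b) \<longlonglongrightarrow> (1 + 0) * (1 + 0) * b"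
    by (intro tendsto_intros LIMSEQ_inverse_real_of_nat[unfolded inverse_eq_divide])
  then have "(\<lambda>n. ennreal ((1 + 1 / Suc n) * (1 + 1 / Suc n) * b)) \<longlonglongrightarrow> ennreal b"
    by (intro tendsto_ennrealI) simp
  ultimately show ?thesis using LIMSEQ_le_const[of _ "ennreal b" A] real by blast
qed simp

text \<open>Young's inequality with a leading factor arbitrarily close to 1, so that L^2
  approximation preserves the isometry as an equality.\<close>

lemma square_le_scaled:
  fixes a b \<epsilon> :: real
  assumes "\<epsilon> > 0"
  shows "a\<^sup>2 \<le> (1 + \<epsilon>) * b\<^sup>2 + (1 + 1 / \<epsilon>) * (a - b)\<^sup>2"
proof -
  have "0 \<le> (\<epsilon> * b - (a - b))\<^sup>2 / \<epsilon>" using assms by simp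
  also have "\<dots> = (1 + \<epsilon>) * b\<^sup>2 + (1 + 1 / \<epsilon>) * (a - b)\<^sup>2 - a\<^sup>2"
    using assms by (simp add: field_simps power2_eq_square)
  finally show ?thesis by simp
qed

context noise
begin

lemma simple_int_measurable:
  assumes "simple_ok M F L"
  shows "simple_int W L \<in> borel_measurable M"
proof -
  obtain R where R: "R \<ge> 0" "simple_upto W L R = simple_int W L"
    by (rule simple_horizon[OF assms]) blast
  show ?thesis using F_imp_M_measurable[OF R(1) simple_upto_F_measurable[OF assms R(1)]] R(2) by simp
qed

text \<open>Discrete Gronwall. The induction hypothesis carries the factor exp(C \<kappa>) with
  \<kappa> the mass of w^2 over the elapsed time. This mass is additive, so the factors of the
  single steps combine to at most exp(C K), however many grid points there are.\<close>

lemma simple_moment: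
  assumes ok: "simple_ok M F L"
    and w: "(\<lambda>p. w (fst p) (snd p)) \<in> borel_measurable (borel \<Otimes>\<^sub>M borel)" "\<And>r y. w r y > 0"
    and K: "st_int {0..} (\<lambda>r y. ennreal ((w r y)\<^sup>2)) = ennreal K" "K \<ge> 0" and n: "n > 0"
  shows "(\<integral>\<^sup>+\<omega>. ennreal (trunc_power k n (z + simple_int W L \<omega>)) \<partial>M)
     \<le> ennreal (exp (moment_const k * K)) * (ennreal (trunc_power k n z) + ennreal (moment_factor k) *
       (\<integral>\<^sup>+\<omega>. st_int {0..} (\<lambda>r y. ennreal ((w r y)\<^sup>2 * trunc_power k n (simple_eval L \<omega> r y / w r y))) \<partial>M))"
proof -
  let ?\<phi> = "trunc_power k n"
  let ?e = "\<lambda>\<omega> r y. ennreal ((w r y)\<^sup>2 * ?\<phi> (simple_eval L \<omega> r y / w r y))"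
  let ?w = "\<lambda>r y. ennreal ((w r y)\<^sup>2)"
  define \<kappa> where "\<kappa> S = enn2real (st_int S ?w)" for S
  have mc: "moment_const k \<ge> 0" using moment_const_ge_1[of k] by simp
  note [measurable] = simple_eval_measurable[OF ok] w(1)
  have w'[measurable]: "(\<lambda>p. w (fst (snd p)) (snd (snd p))) \<in> borel_measurable (M \<Otimes>\<^sub>M (borel \<Otimes>\<^sub>M borel))"
    by (rule measurable_compose[OF measurable_snd w(1)])
  have wm[measurable]: "(\<lambda>p. ?w (fst p) (snd p)) \<in> borel_measurable (borel \<Otimes>\<^sub>M borel)" by measurable
  have ev[measurable]: "(\<lambda>p. simple_eval L \<omega> (fst p) (snd p)) \<in> borel_measurable (borel \<Otimes>\<^sub>M borel)" if "\<omega> \<in> space M" for \<omega>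
    using that by (auto intro!: simple_eval_comp[OF ok])
  have e1[measurable]: "(\<lambda>p. ?e \<omega> (fst p) (snd p)) \<in> borel_measurable (borel \<Otimes>\<^sub>M borel)" if [simp]: "\<omega> \<in> space M" for \<omega>
    by measurable
  have e2[measurable]: "(\<lambda>\<omega>. st_int S (?e \<omega>)) \<in> borel_measurable M" if "S \<in> sets borel" for S
    by (rule st_int_measurable[OF _ that]) measurable
  have st_le: "st_int S ?w \<le> ennreal K" if "S \<subseteq> {0..}" for S
    unfolding K(1)[symmetric] st_int_def using that
    by (intro nn_integral_mono) (auto simp: indicator_def)
  then have \<kappa>: "st_int S ?w = ennreal (\<kappa> S)" "\<kappa> S \<le> K" "\<kappa> S \<ge> 0" if "S \<subseteq> {0..}" for S
    unfolding \<kappa>_def using that K(2) st_le[OF that]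
    by (auto simp: enn2real_leI ennreal_enn2real_if) (metis ennreal_neq_top top.extremum_uniqueI)
  obtain R where R: "R \<ge> 0" "simple_upto W L R = simple_int W L" "\<And>\<omega> r y. r > R \<Longrightarrow> simple_eval L \<omega> r y = 0"
    by (rule simple_horizon[OF ok]) blast
  have "(\<integral>\<^sup>+\<omega>. ennreal (?\<phi> (z + simple_upto W L R \<omega>)) \<partial>M) \<le> ennreal (exp (moment_const k * \<kappa> {0..R})) *
     (ennreal (?\<phi> z) + ennreal (moment_factor k) * (\<integral>\<^sup>+\<omega>. st_int {0..R} (?e \<omega>) \<partial>M))"
    using grid_times_finite[of L] R(1)
  proof (induction R rule: grid_induct)
    case zero
    then show ?case by (simp add: simple_upto_0[OF ok] emeasure_space_1 st_int_singleton \<kappa>_def)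
  next
    case (step r r')
    have split: "{0..r'} = {0..r} \<union> {r<..r'}" "{0..r} \<inter> {r<..r'} = {}" using step by auto
    have "st_int {0..r'} ?w = st_int {0..r} ?w + st_int {r<..r'} ?w"
      unfolding split(1) by (intro st_int_Un[OF wm]) auto
    moreover have sub: "{0..r'} \<subseteq> {0..}" "{0..r} \<subseteq> {0..}" "{r<..r'} \<subseteq> {0..}" using step by auto
    ultimately have \<kappa>sum: "\<kappa> {0..r'} = \<kappa> {0..r} + \<kappa> {r<..r'}"
      using \<kappa> by (simp add: ennreal_plus[symmetric] del: ennreal_plus)
    \<comment> \<open>A weight that is positive everywhere gives each step a positive length on its
      clock; the level sqrt(v / \<kappa>) divides by that length.\<close>
    have \<kappa>pos: "\<kappa> {r<..r'} > 0"
    proof (rule ccontr)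
      assume "\<not> \<kappa> {r<..r'} > 0"
      then have "st_int {r<..r'} ?w = 0" using \<kappa>[OF sub(3)] by (simp add: ennreal_neg)
      then have "emeasure lborel {r<..r'} = 0"
        using less_imp_neq[OF w(2)] by (intro st_int_eq_0_imp_null[OF wm]) (auto simp: zero_less_power2)
      then show False using step(2) by simp
    qed
    have [measurable]: "simple_upto W L r \<in> borel_measurable M"
      using simple_upto_F_measurable[OF ok step(1)] F_imp_M_measurable[OF step(1)] by auto
    define E where "E = ennreal (exp (moment_const k * \<kappa> {r<..r'}))"
    define B where "B S = ennreal (moment_factor k) * (\<integral>\<^sup>+\<omega>. st_int S (?e \<omega>) \<partial>M)" for S
    have "(\<integral>\<^sup>+\<omega>. ennreal (?\<phi> (z + simple_upto W L r' \<omega>)) \<partial>M) =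
      (\<integral>\<^sup>+\<omega>. gauss_avg ?\<phi> (z + simple_upto W L r \<omega>) ((r' - r) * (\<integral>y. (step_fun (active L r r' \<omega>) y)\<^sup>2 \<partial>lborel)) \<partial>M)"
      using simple_upto_avg[OF ok step(1-3), of ?\<phi>] by simp
    also have "\<dots> \<le> (\<integral>\<^sup>+\<omega>. E * (ennreal (?\<phi> (z + simple_upto W L r \<omega>)) + ennreal (moment_factor k) * st_int {r<..r'} (?e \<omega>)) \<partial>M)"
      unfolding E_def
      by (intro nn_integral_mono gauss_avg_trunc_power_st_int[OF ev w _ n \<kappa>pos \<kappa>(1)[OF sub(3)]])
         (use step(2) in \<open>auto simp: energy_step[OF ok step(1-3)]\<close>)
    also have "\<dots> = E * ((\<integral>\<^sup>+\<omega>. ennreal (?\<phi> (z + simple_upto W L r \<omega>)) \<partial>M) + B {r<..r'})"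
      unfolding B_def by (simp add: nn_integral_cmult nn_integral_add)
    also have "\<dots> \<le> E * (ennreal (exp (moment_const k * \<kappa> {0..r})) * (ennreal (?\<phi> z) + B {0..r})
        + ennreal (exp (moment_const k * \<kappa> {0..r})) * B {r<..r'})"
    proof (intro mult_left_mono add_mono)
      show "(\<integral>\<^sup>+\<omega>. ennreal (?\<phi> (z + simple_upto W L r \<omega>)) \<partial>M) \<le> ennreal (exp (moment_const k * \<kappa> {0..r})) * (ennreal (?\<phi> z) + B {0..r})"
        using step.IH unfolding B_def .
      \<comment> \<open>The energy of the new step also receives the earlier exponential factor, so
        that one common factor can be pulled out.\<close>
      have "1 \<le> ennreal (exp (moment_const k * \<kappa> {0..r}))" using mc \<kappa>(3)[OF sub(2)] by (simp add: ennreal_1[symmetric] del: ennreal_1)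
      then show "B {r<..r'} \<le> ennreal (exp (moment_const k * \<kappa> {0..r})) * B {r<..r'}"
        using mult_right_mono[of 1 _ "B {r<..r'}"] by simp
    qed simp
    also have "\<dots> = (E * ennreal (exp (moment_const k * \<kappa> {0..r}))) * (ennreal (?\<phi> z) + (B {0..r} + B {r<..r'}))"
      by (simp add: algebra_simps)
    also have "E * ennreal (exp (moment_const k * \<kappa> {0..r})) = ennreal (exp (moment_const k * \<kappa> {0..r'}))"
      unfolding E_def \<kappa>sum by (simp add: ennreal_mult[symmetric] exp_add[symmetric] algebra_simps)
    also have "B {0..r} + B {r<..r'} = B {0..r'}"
      unfolding B_def split(1)
      by (simp add: distrib_left[symmetric] nn_integral_add[symmetric] st_int_Un[OF e1 _ _ split(2)] cong: nn_integral_cong_simp)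
    finally show ?case unfolding B_def .
  qed
  also have "\<dots> \<le> ennreal (exp (moment_const k * K)) * (ennreal (?\<phi> z) + ennreal (moment_factor k) * (\<integral>\<^sup>+\<omega>. st_int {0..} (?e \<omega>) \<partial>M))"
  proof (intro mult_mono add_left_mono mult_left_mono nn_integral_mono ennreal_leI)
    show "exp (moment_const k * \<kappa> {0..R}) \<le> exp (moment_const k * K)" using mc \<kappa>(2)[of "{0..R}"] by (simp add: mult_left_mono)
    show "st_int {0..R} (?e \<omega>) \<le> st_int {0..} (?e \<omega>)" for \<omega>
      unfolding st_int_def by (intro nn_integral_mono) (auto simp: indicator_def)
  qed auto
  finally show ?thesis using R(2) by simp
qed

section \<open>From simple integrands to Walsh integrals\<close>

lemma walsh_unfold:
  assumes "walsh_integral M F W f I"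
  shows "I \<in> borel_measurable M"
    and "(\<lambda>p. f (fst p) (fst (snd p)) (snd (snd p))) \<in> borel_measurable (M \<Otimes>\<^sub>M (borel \<Otimes>\<^sub>M borel))"
    and "\<exists>Ls. (\<forall>n. simple_ok M F (Ls n)) \<and>
       (\<lambda>n. \<integral>\<^sup>+\<omega>. st_int {0..} (\<lambda>r y. ennreal ((simple_eval (Ls n) \<omega> r y - f \<omega> r y)\<^sup>2)) \<partial>M) \<longlonglongrightarrow> 0 \<and>
       (\<lambda>n. \<integral>\<^sup>+\<omega>. ennreal ((simple_int W (Ls n) \<omega> - I \<omega>)\<^sup>2) \<partial>M) \<longlonglongrightarrow> 0"
proof -
  show "I \<in> borel_measurable M" using assms unfolding walsh_integral_def by blast
  have s: "sets (M \<Otimes>\<^sub>M (lborel \<Otimes>\<^sub>M lborel)) = sets (M \<Otimes>\<^sub>M (borel \<Otimes>\<^sub>M borel :: (real \<times> real) measure))"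
    by (intro sets_pair_measure_cong) auto
  have "(\<lambda>(\<omega>, r, y). f \<omega> r y) \<in> borel_measurable (M \<Otimes>\<^sub>M (lborel \<Otimes>\<^sub>M lborel))"
    using assms unfolding walsh_integral_def by blast
  then show "(\<lambda>p. f (fst p) (fst (snd p)) (snd (snd p))) \<in> borel_measurable (M \<Otimes>\<^sub>M (borel \<Otimes>\<^sub>M borel))"
    unfolding split_beta by (simp cong: measurable_cong_sets add: measurable_cong_sets[OF s refl])
  have eq: "ennreal (indicator {0..} r * x) = indicator {0..} r * ennreal x" for r x :: real
    by (auto simp: indicator_def)
  show "\<exists>Ls. (\<forall>n. simple_ok M F (Ls n)) \<and>
       (\<lambda>n. \<integral>\<^sup>+\<omega>. st_int {0..} (\<lambda>r y. ennreal ((simple_eval (Ls n) \<omega> r y - f \<omega> r y)\<^sup>2)) \<partial>M) \<longlonglongrightarrow> 0 \<and>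
       (\<lambda>n. \<integral>\<^sup>+\<omega>. ennreal ((simple_int W (Ls n) \<omega> - I \<omega>)\<^sup>2) \<partial>M) \<longlonglongrightarrow> 0"
    using assms unfolding walsh_integral_def st_int_def eq by blast
qed

lemma nn_integral_square_le_scaled:
  assumes "\<epsilon> > 0" and [measurable]: "f \<in> borel_measurable N" "g \<in> borel_measurable N"
  shows "(\<integral>\<^sup>+x. ennreal ((f x)\<^sup>2) \<partial>N) \<le> ennreal (1 + \<epsilon>) * (\<integral>\<^sup>+x. ennreal ((g x)\<^sup>2) \<partial>N)
      + ennreal (1 + 1 / \<epsilon>) * (\<integral>\<^sup>+x. ennreal ((f x - g x)\<^sup>2) \<partial>N)"
proof -
  have "(\<integral>\<^sup>+x. ennreal ((f x)\<^sup>2) \<partial>N) \<le> (\<integral>\<^sup>+x. ennreal (1 + \<epsilon>) * ennreal ((g x)\<^sup>2) + ennreal (1 + 1 / \<epsilon>) * ennreal ((f x - g x)\<^sup>2) \<partial>N)"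
    using assms(1) square_le_scaled[OF assms(1)]
    by (intro nn_integral_mono) (simp add: ennreal_mult[symmetric] ennreal_plus[symmetric] del: ennreal_plus)
  then show ?thesis by (simp add: nn_integral_add nn_integral_cmult)
qed

lemma nn_integral_st_int_square_le_scaled:
  assumes \<epsilon>: "\<epsilon> > 0" and f: "(\<lambda>p. f (fst p) (fst (snd p)) (snd (snd p))) \<in> borel_measurable (M \<Otimes>\<^sub>M (borel \<Otimes>\<^sub>M borel))"
    and g: "(\<lambda>p. g (fst p) (fst (snd p)) (snd (snd p))) \<in> borel_measurable (M \<Otimes>\<^sub>M (borel \<Otimes>\<^sub>M borel))"
  shows "(\<integral>\<^sup>+\<omega>. st_int {0..} (\<lambda>r y. ennreal ((f \<omega> r y)\<^sup>2)) \<partial>M) \<le>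
     ennreal (1 + \<epsilon>) * (\<integral>\<^sup>+\<omega>. st_int {0..} (\<lambda>r y. ennreal ((g \<omega> r y)\<^sup>2)) \<partial>M)
      + ennreal (1 + 1 / \<epsilon>) * (\<integral>\<^sup>+\<omega>. st_int {0..} (\<lambda>r y. ennreal ((f \<omega> r y - g \<omega> r y)\<^sup>2)) \<partial>M)"
proof -
  note [measurable] = f g
  have 1[measurable]: "(\<lambda>p. f \<omega> (fst p) (snd p)) \<in> borel_measurable (borel \<Otimes>\<^sub>M borel)" 
    "(\<lambda>p. g \<omega> (fst p) (snd p)) \<in> borel_measurable (borel \<Otimes>\<^sub>M borel)" if "\<omega> \<in> space M" for \<omega>
    using that by (auto intro!: measurable_comp3[OF f] measurable_comp3[OF g])
  have [measurable]: "(\<lambda>\<omega>. st_int {0..} (\<lambda>r y. ennreal ((g \<omega> r y)\<^sup>2))) \<in> borel_measurable M"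
    "(\<lambda>\<omega>. st_int {0..} (\<lambda>r y. ennreal ((f \<omega> r y - g \<omega> r y)\<^sup>2))) \<in> borel_measurable M"
    by (rule st_int_measurable; measurable)+
  have "(\<integral>\<^sup>+\<omega>. st_int {0..} (\<lambda>r y. ennreal ((f \<omega> r y)\<^sup>2)) \<partial>M) \<le>
     (\<integral>\<^sup>+\<omega>. ennreal (1 + \<epsilon>) * st_int {0..} (\<lambda>r y. ennreal ((g \<omega> r y)\<^sup>2))
       + ennreal (1 + 1 / \<epsilon>) * st_int {0..} (\<lambda>r y. ennreal ((f \<omega> r y - g \<omega> r y)\<^sup>2)) \<partial>M)"
  proof (rule nn_integral_mono)
    fix \<omega> assume \<omega>[simp]: "\<omega> \<in> space M"
    have "st_int {0..} (\<lambda>r y. ennreal ((f \<omega> r y)\<^sup>2)) \<le> st_int {0..} (\<lambda>r y. ennreal (1 + \<epsilon>) * ennreal ((g \<omega> r y)\<^sup>2)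
       + ennreal (1 + 1 / \<epsilon>) * ennreal ((f \<omega> r y - g \<omega> r y)\<^sup>2))"
      using \<epsilon> square_le_scaled[OF \<epsilon>]
      by (intro st_int_mono) (simp add: ennreal_mult[symmetric] ennreal_plus[symmetric] del: ennreal_plus)
    also have "\<dots> = ennreal (1 + \<epsilon>) * st_int {0..} (\<lambda>r y. ennreal ((g \<omega> r y)\<^sup>2))
       + ennreal (1 + 1 / \<epsilon>) * st_int {0..} (\<lambda>r y. ennreal ((f \<omega> r y - g \<omega> r y)\<^sup>2))"
      by (subst st_int_add) (auto simp: st_int_cmult)
    finally show "st_int {0..} (\<lambda>r y. ennreal ((f \<omega> r y)\<^sup>2)) \<le> \<dots>" .
  qed
  then show ?thesis by (simp add: nn_integral_add nn_integral_cmult)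
qed

text \<open>Each of the two inequalities is shown with the factor (1 + \<epsilon>)^2: the
  approximation tends to its limit for fixed \<epsilon>, and only then does \<epsilon> tend to 0.
  Nothing is subtracted, so both sides may be infinite.\<close>

lemma walsh_isometry:
  assumes "walsh_integral M F W f I"
  shows "(\<integral>\<^sup>+\<omega>. ennreal ((z + I \<omega>)\<^sup>2) \<partial>M)
     = ennreal (z\<^sup>2) + (\<integral>\<^sup>+\<omega>. st_int {0..} (\<lambda>r y. ennreal ((f \<omega> r y)\<^sup>2)) \<partial>M)"
proof -
  note [measurable] = walsh_unfold(1)[OF assms] and f = walsh_unfold(2)[OF assms]
  from walsh_unfold(3)[OF assms] obtain Ls where ok: "\<And>n. simple_ok M F (Ls n)"
    and d': "(\<lambda>n. \<integral>\<^sup>+\<omega>. st_int {0..} (\<lambda>r y. ennreal ((simple_eval (Ls n) \<omega> r y - f \<omega> r y)\<^sup>2)) \<partial>M) \<longlonglongrightarrow> 0" (is "?d' \<longlonglongrightarrow> 0")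
    and d: "(\<lambda>n. \<integral>\<^sup>+\<omega>. ennreal ((simple_int W (Ls n) \<omega> - I \<omega>)\<^sup>2) \<partial>M) \<longlonglongrightarrow> 0" (is "?d \<longlonglongrightarrow> 0") by blast
  have X[measurable]: "simple_int W (Ls n) \<in> borel_measurable M" for n
    by (rule simple_int_measurable[OF ok])
  let ?A = "\<integral>\<^sup>+\<omega>. ennreal ((z + I \<omega>)\<^sup>2) \<partial>M"
  let ?e = "\<integral>\<^sup>+\<omega>. st_int {0..} (\<lambda>r y. ennreal ((f \<omega> r y)\<^sup>2)) \<partial>M"
  let ?An = "\<lambda>n. \<integral>\<^sup>+\<omega>. ennreal ((z + simple_int W (Ls n) \<omega>)\<^sup>2) \<partial>M"
  let ?en = "\<lambda>n. \<integral>\<^sup>+\<omega>. st_int {0..} (\<lambda>r y. ennreal ((simple_eval (Ls n) \<omega> r y)\<^sup>2)) \<partial>M"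
  have iso: "?An n = ennreal (z\<^sup>2) + ?en n" for n by (rule simple_isometry[OF ok])
  have z_le: "ennreal (z\<^sup>2) \<le> ennreal (1 + \<epsilon>) * ennreal (z\<^sup>2)" if "\<epsilon> > 0" for \<epsilon>
    using that mult_right_mono[of 1 "ennreal (1 + \<epsilon>)" "ennreal (z\<^sup>2)"] by simp
  have "?A \<le> ennreal ((1 + \<epsilon>) * (1 + \<epsilon>)) * (ennreal (z\<^sup>2) + ?e)" if \<epsilon>: "\<epsilon> > 0" for \<epsilon>
  proof (rule ennreal_limit_le[OF d d'])
    fix n
    have "?A \<le> ennreal (1 + \<epsilon>) * ?An n + ennreal (1 + 1 / \<epsilon>) * ?d n"
      using nn_integral_square_le_scaled[OF \<epsilon>, of "\<lambda>\<omega>. z + I \<omega>" M "\<lambda>\<omega>. z + simple_int W (Ls n) \<omega>"]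
      by (simp add: power2_commute[of "I _"])
    also have "?An n \<le> ennreal (1 + \<epsilon>) * ennreal (z\<^sup>2) + (ennreal (1 + \<epsilon>) * ?e + ennreal (1 + 1 / \<epsilon>) * ?d' n)"
      unfolding iso using z_le[OF \<epsilon>] nn_integral_st_int_square_le_scaled[OF \<epsilon> simple_eval_measurable[OF ok] f]
      by (intro add_mono) auto
    finally have "?A \<le> ennreal (1 + \<epsilon>) * (ennreal (1 + \<epsilon>) * ennreal (z\<^sup>2) + (ennreal (1 + \<epsilon>) * ?e + ennreal (1 + 1 / \<epsilon>) * ?d' n)) + ennreal (1 + 1 / \<epsilon>) * ?d n"
      by (simp add: mult_left_mono add_mono)
    also have "\<dots> = ennreal ((1 + \<epsilon>) * (1 + \<epsilon>)) * (ennreal (z\<^sup>2) + ?e) + ennreal (1 + 1 / \<epsilon>) * ?d n + ennreal ((1 + \<epsilon>) * (1 + 1 / \<epsilon>)) * ?d' n"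
      using \<epsilon> by (simp only: ennreal_mult[of "1 + \<epsilon>" "1 + \<epsilon>"] ennreal_mult[of "1 + \<epsilon>" "1 + 1 / \<epsilon>"] add_nonneg_nonneg less_imp_le zero_le_one zero_le_divide_1_iff) (simp only: algebra_simps)
    finally show "?A \<le> \<dots>" .
  qed
  then have 1: "?A \<le> ennreal (z\<^sup>2) + ?e" by (rule ennreal_le_scale_limit)
  have "ennreal (z\<^sup>2) + ?e \<le> ennreal ((1 + \<epsilon>) * (1 + \<epsilon>)) * ?A" if \<epsilon>: "\<epsilon> > 0" for \<epsilon>
  proof (rule ennreal_limit_le[OF d d'])
    fix n
    have "ennreal (z\<^sup>2) + ?e \<le> ennreal (1 + \<epsilon>) * ennreal (z\<^sup>2) + (ennreal (1 + \<epsilon>) * ?en n + ennreal (1 + 1 / \<epsilon>) * ?d' n)"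
      using z_le[OF \<epsilon>] nn_integral_st_int_square_le_scaled[OF \<epsilon> f simple_eval_measurable[OF ok], of n]
      by (intro add_mono) (auto simp: power2_commute[of "f _ _ _"])
    also have "\<dots> = ennreal (1 + \<epsilon>) * ?An n + ennreal (1 + 1 / \<epsilon>) * ?d' n"
      unfolding iso by (simp only: distrib_left add.assoc)
    also have "\<dots> \<le> ennreal (1 + \<epsilon>) * (ennreal (1 + \<epsilon>) * ?A + ennreal (1 + 1 / \<epsilon>) * ?d n) + ennreal (1 + 1 / \<epsilon>) * ?d' n"
      using nn_integral_square_le_scaled[OF \<epsilon>, of "\<lambda>\<omega>. z + simple_int W (Ls n) \<omega>" M "\<lambda>\<omega>. z + I \<omega>"]
      by (intro add_mono mult_left_mono) auto
    also have "\<dots> = ennreal ((1 + \<epsilon>) * (1 + \<epsilon>)) * ?A + ennreal ((1 + \<epsilon>) * (1 + 1 / \<epsilon>)) * ?d n + ennreal (1 + 1 / \<epsilon>) * ?d' n"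
      using \<epsilon> by (simp only: ennreal_mult[of "1 + \<epsilon>" "1 + \<epsilon>"] ennreal_mult[of "1 + \<epsilon>" "1 + 1 / \<epsilon>"] add_nonneg_nonneg less_imp_le zero_le_one zero_le_divide_1_iff) (simp only: algebra_simps)
    finally show "ennreal (z\<^sup>2) + ?e \<le> \<dots>" .
  qed
  then have 2: "ennreal (z\<^sup>2) + ?e \<le> ?A" by (rule ennreal_le_scale_limit)
  show ?thesis using 1 2 by (rule antisym)
qed

text \<open>The weight \<open>w\<close> is free: it plays the part of the kernel in Gronwall's lemma and has to be
  square-integrable uniformly in all parameters.\<close>

lemma walsh_moment:
  assumes wi: "walsh_integral M F W f I"
    and w: "(\<lambda>p. w (fst p) (snd p)) \<in> borel_measurable (borel \<Otimes>\<^sub>M borel)" "\<And>r y. w r y > 0"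
    and K: "st_int {0..} (\<lambda>r y. ennreal ((w r y)\<^sup>2)) = ennreal K" "K \<ge> 0" and n: "n > 0"
  shows "(\<integral>\<^sup>+\<omega>. ennreal (trunc_power k n (z + I \<omega>)) \<partial>M)
     \<le> ennreal (4 ^ (k + 1) * 4 ^ (k + 1) * exp (moment_const k * K)) * (ennreal (trunc_power k n z) + ennreal (moment_factor k) *
       (\<integral>\<^sup>+\<omega>. st_int {0..} (\<lambda>r y. ennreal ((w r y)\<^sup>2 * trunc_power k n (f \<omega> r y / w r y))) \<partial>M))"
proof -
  note [measurable] = walsh_unfold(1)[OF wi] and f[measurable] = walsh_unfold(2)[OF wi]
  from walsh_unfold(3)[OF wi] obtain Ls where ok: "\<And>n. simple_ok M F (Ls n)"
    and d': "(\<lambda>n. \<integral>\<^sup>+\<omega>. st_int {0..} (\<lambda>r y. ennreal ((simple_eval (Ls n) \<omega> r y - f \<omega> r y)\<^sup>2)) \<partial>M) \<longlonglongrightarrow> 0" (is "?d' \<longlonglongrightarrow> 0")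
    and d: "(\<lambda>n. \<integral>\<^sup>+\<omega>. ennreal ((simple_int W (Ls n) \<omega> - I \<omega>)\<^sup>2) \<partial>M) \<longlonglongrightarrow> 0" (is "?d \<longlonglongrightarrow> 0") by blast
  have X[measurable]: "simple_int W (Ls n) \<in> borel_measurable M" for n
    by (rule simple_int_measurable[OF ok])
  let ?\<phi> = "trunc_power k n"
  define C :: real where "C = 4 ^ (k + 1)"
  have C: "C \<ge> 1" unfolding C_def by (rule one_le_power) simp
  have \<phi>0: "?\<phi> x \<ge> 0" for x using n by (simp add: trunc_power_nonneg)
  have nk: "n ^ k \<ge> 0" using n by simp
  \<comment> \<open>Replacing the integral or the integrand by its approximation costs C in front of
    the main term and C n^k in front of an L^2 error. That error tends to 0 for fixed n, so only the
    two factors C survive, which gives the square of 4^(k+1) in the bound.\<close>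
  have \<phi>C: "?\<phi> a \<le> C * ?\<phi> b + (C * n ^ k) * (a - b)\<^sup>2" for a b
  proof -
    have "?\<phi> a \<le> C * (?\<phi> b + ?\<phi> (a - b))" using trunc_power_add[of n k b "a - b"] n by (simp add: C_def)
    also have "\<dots> \<le> C * (?\<phi> b + n ^ k * (a - b)\<^sup>2)"
      using trunc_power_le_square[of n k "a - b"] n C by (intro mult_left_mono add_left_mono) auto
    finally show ?thesis by (simp add: algebra_simps)
  qed
  define E where "E = ennreal (exp (moment_const k * K))"
  define m where "m = ennreal (moment_factor k)"
  let ?A = "\<integral>\<^sup>+\<omega>. ennreal (?\<phi> (z + I \<omega>)) \<partial>M"
  let ?An = "\<lambda>i. \<integral>\<^sup>+\<omega>. ennreal (?\<phi> (z + simple_int W (Ls i) \<omega>)) \<partial>M"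
  define B where "B g = (\<integral>\<^sup>+\<omega>. st_int {0..} (\<lambda>r y. ennreal ((w r y)\<^sup>2 * ?\<phi> (g \<omega> r y / w r y))) \<partial>M)" for g
  have A: "?A \<le> ennreal C * ?An i + ennreal (C * n ^ k) * ?d i" for i
  proof -
    have "?A \<le> (\<integral>\<^sup>+\<omega>. ennreal C * ennreal (?\<phi> (z + simple_int W (Ls i) \<omega>)) + ennreal (C * n ^ k) * ennreal ((simple_int W (Ls i) \<omega> - I \<omega>)\<^sup>2) \<partial>M)"
    proof (rule nn_integral_mono)
      fix \<omega>
      show "ennreal (?\<phi> (z + I \<omega>)) \<le> ennreal C * ennreal (?\<phi> (z + simple_int W (Ls i) \<omega>)) + ennreal (C * n ^ k) * ennreal ((simple_int W (Ls i) \<omega> - I \<omega>)\<^sup>2)"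
        using \<phi>C[of "z + I \<omega>" "z + simple_int W (Ls i) \<omega>"] C nk \<phi>0
        by (simp add: ennreal_mult[symmetric] ennreal_plus[symmetric] power2_commute[of "I _"] ennreal_leI del: ennreal_plus)
    qed
    then show ?thesis by (simp add: nn_integral_add nn_integral_cmult)
  qed
  have w'[measurable]: "(\<lambda>p. w (fst (snd p)) (snd (snd p))) \<in> borel_measurable (M \<Otimes>\<^sub>M (borel \<Otimes>\<^sub>M borel))"
    by (rule measurable_compose[OF measurable_snd w(1)])
  have Bn: "B (simple_eval (Ls i)) \<le> ennreal C * B f + ennreal (C * n ^ k) * ?d' i" for i
  proof -
    note [measurable] = simple_eval_measurable[OF ok, of i] w(1)
    have [measurable]: "(\<lambda>p. f \<omega> (fst p) (snd p)) \<in> borel_measurable (borel \<Otimes>\<^sub>M borel)"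
      "(\<lambda>p. simple_eval (Ls i) \<omega> (fst p) (snd p)) \<in> borel_measurable (borel \<Otimes>\<^sub>M borel)" if "\<omega> \<in> space M" for \<omega>
      using that by (auto intro!: measurable_comp3[OF f] simple_eval_comp[OF ok])
    have [measurable]: "(\<lambda>\<omega>. st_int {0..} (\<lambda>r y. ennreal ((w r y)\<^sup>2 * ?\<phi> (f \<omega> r y / w r y)))) \<in> borel_measurable M"
      "(\<lambda>\<omega>. st_int {0..} (\<lambda>r y. ennreal ((simple_eval (Ls i) \<omega> r y - f \<omega> r y)\<^sup>2))) \<in> borel_measurable M"
      by (rule st_int_measurable; measurable)+
    have "B (simple_eval (Ls i)) \<le> (\<integral>\<^sup>+\<omega>. ennreal C * st_int {0..} (\<lambda>r y. ennreal ((w r y)\<^sup>2 * ?\<phi> (f \<omega> r y / w r y)))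
       + ennreal (C * n ^ k) * st_int {0..} (\<lambda>r y. ennreal ((simple_eval (Ls i) \<omega> r y - f \<omega> r y)\<^sup>2)) \<partial>M)"
      unfolding B_def
    proof (rule nn_integral_mono)
      fix \<omega> assume \<omega>[simp]: "\<omega> \<in> space M"
      have "st_int {0..} (\<lambda>r y. ennreal ((w r y)\<^sup>2 * ?\<phi> (simple_eval (Ls i) \<omega> r y / w r y)))
        \<le> st_int {0..} (\<lambda>r y. ennreal C * ennreal ((w r y)\<^sup>2 * ?\<phi> (f \<omega> r y / w r y)) + ennreal (C * n ^ k) * ennreal ((simple_eval (Ls i) \<omega> r y - f \<omega> r y)\<^sup>2))"
      proof (rule st_int_mono)
        fix r y
        let ?a = "simple_eval (Ls i) \<omega> r y" and ?b = "f \<omega> r y"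
        have "(w r y)\<^sup>2 * ?\<phi> (?a / w r y) \<le> (w r y)\<^sup>2 * (C * ?\<phi> (?b / w r y) + (C * n ^ k) * (?a / w r y - ?b / w r y)\<^sup>2)"
          by (intro mult_left_mono \<phi>C) auto
        also have "\<dots> = C * ((w r y)\<^sup>2 * ?\<phi> (?b / w r y)) + (C * n ^ k) * (?a - ?b)\<^sup>2"
          using w(2)[of r y] by (simp add: diff_divide_distrib[symmetric] power_divide algebra_simps)
        finally show "ennreal ((w r y)\<^sup>2 * ?\<phi> (?a / w r y)) \<le> ennreal C * ennreal ((w r y)\<^sup>2 * ?\<phi> (?b / w r y)) + ennreal (C * n ^ k) * ennreal ((?a - ?b)\<^sup>2)"
          using C nk \<phi>0 by (simp add: ennreal_mult[symmetric] ennreal_plus[symmetric] ennreal_leI del: ennreal_plus)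
      qed
      also have "\<dots> = ennreal C * st_int {0..} (\<lambda>r y. ennreal ((w r y)\<^sup>2 * ?\<phi> (f \<omega> r y / w r y)))
       + ennreal (C * n ^ k) * st_int {0..} (\<lambda>r y. ennreal ((simple_eval (Ls i) \<omega> r y - f \<omega> r y)\<^sup>2))"
        by (subst st_int_add) (auto simp: st_int_cmult)
      finally show "st_int {0..} (\<lambda>r y. ennreal ((w r y)\<^sup>2 * ?\<phi> (simple_eval (Ls i) \<omega> r y / w r y))) \<le> \<dots>" .
    qed
    then show ?thesis unfolding B_def by (simp add: nn_integral_add nn_integral_cmult)
  qed
  have EC: "ennreal (C * n ^ k) \<noteq> \<top>" "E \<noteq> \<top>" "m \<noteq> \<top>" by (auto simp: E_def m_def)
  have "?A \<le> ennreal C * ennreal C * E * (ennreal (?\<phi> z) + m * B f)"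
  proof (rule ennreal_limit_le[OF d d'])
    fix i
    have "?A \<le> ennreal C * (E * (ennreal (?\<phi> z) + m * B (simple_eval (Ls i)))) + ennreal (C * n ^ k) * ?d i"
      using simple_moment[OF ok w K n, of k z i] unfolding E_def m_def B_def
      by (intro order_trans[OF A] add_mono mult_left_mono) auto
    also have "\<dots> \<le> ennreal C * (E * (ennreal C * ennreal (?\<phi> z) + m * (ennreal C * B f + ennreal (C * n ^ k) * ?d' i))) + ennreal (C * n ^ k) * ?d i"
    proof (intro add_mono mult_left_mono Bn order_refl)
      show "ennreal (?\<phi> z) \<le> ennreal C * ennreal (?\<phi> z)"
        using C mult_right_mono[of 1 "ennreal C" "ennreal (?\<phi> z)"] by simp
    qed auto
    also have "\<dots> = ennreal C * ennreal C * E * (ennreal (?\<phi> z) + m * B f) + ennreal (C * n ^ k) * ?d i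
        + (ennreal C * E * m * ennreal (C * n ^ k)) * ?d' i"
      by (simp only: algebra_simps)
    also have "ennreal C * E * m * ennreal (C * n ^ k) = ennreal (C * exp (moment_const k * K) * moment_factor k * (C * n ^ k))"
      unfolding E_def m_def using C nk moment_factor_nonneg[of k] by (simp add: ennreal_mult)
    finally show "?A \<le> ennreal C * ennreal C * E * (ennreal (?\<phi> z) + m * B f) + ennreal (C * n ^ k) * ?d i
        + ennreal (C * exp (moment_const k * K) * moment_factor k * (C * n ^ k)) * ?d' i" .
  qed
  also have "ennreal C * ennreal C * E = ennreal (C * C * exp (moment_const k * K))"
    unfolding E_def using C by (simp add: ennreal_mult)
  finally show ?thesis unfolding B_def m_def C_def .
qed

end

section \<open>Convolution inequalities\<close>

lemma st_int_swap:
  assumes "sigma_finite_measure N" and H: "(\<lambda>p. H (fst p) (fst (snd p)) (snd (snd p))) \<in> borel_measurable (N \<Otimes>\<^sub>M (borel \<Otimes>\<^sub>M borel))"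
    and [measurable]: "S \<in> sets borel"
  shows "(\<integral>\<^sup>+\<omega>. st_int S (H \<omega>) \<partial>N) = st_int S (\<lambda>r y. \<integral>\<^sup>+\<omega>. H \<omega> r y \<partial>N)"
proof -
  interpret N: sigma_finite_measure N by fact
  interpret NL: pair_sigma_finite N "lborel :: real measure" ..
  have m1: "(\<lambda>p. H (fst p) r (snd p)) \<in> borel_measurable (N \<Otimes>\<^sub>M lborel)" for r
    using measurable_comp3[OF H, of fst "N \<Otimes>\<^sub>M lborel" "\<lambda>_. r" snd] by simp
  have "(\<lambda>(x, y). indicator S (snd x) * H (fst x) (snd x) y) \<in> borel_measurable ((N \<Otimes>\<^sub>M borel) \<Otimes>\<^sub>M lborel)"
  proof -
    have [measurable]: "(\<lambda>q. H (fst (fst q)) (snd (fst q)) (snd q)) \<in> borel_measurable ((N \<Otimes>\<^sub>M borel) \<Otimes>\<^sub>M borel)"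
      by (rule measurable_comp3[OF H]) measurable
    show ?thesis unfolding split_beta by measurable
  qed
  then have "(\<lambda>x. \<integral>\<^sup>+y. indicator S (snd x) * H (fst x) (snd x) y \<partial>lborel) \<in> borel_measurable (N \<Otimes>\<^sub>M borel)"
    by (rule lborel.borel_measurable_nn_integral)
  then have m2: "(\<lambda>(\<omega>, r). \<integral>\<^sup>+y. indicator S r * H \<omega> r y \<partial>lborel) \<in> borel_measurable (N \<Otimes>\<^sub>M lborel)"
    unfolding split_beta by (simp cong: measurable_cong_sets)
  have "(\<integral>\<^sup>+\<omega>. st_int S (H \<omega>) \<partial>N) = (\<integral>\<^sup>+r. \<integral>\<^sup>+\<omega>. \<integral>\<^sup>+y. indicator S r * H \<omega> r y \<partial>lborel \<partial>N \<partial>lborel)"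
    unfolding st_int_def by (rule NL.Fubini'[OF m2, symmetric])
  also have "\<dots> = (\<integral>\<^sup>+r. \<integral>\<^sup>+y. \<integral>\<^sup>+\<omega>. indicator S r * H \<omega> r y \<partial>N \<partial>lborel \<partial>lborel)"
  proof (rule nn_integral_cong)
    fix r :: real
    have "(\<lambda>(\<omega>, y). indicator S r * H \<omega> r y) \<in> borel_measurable (N \<Otimes>\<^sub>M lborel)"
      unfolding split_beta using m1[of r] by measurable
    then show "(\<integral>\<^sup>+\<omega>. \<integral>\<^sup>+y. indicator S r * H \<omega> r y \<partial>lborel \<partial>N) = (\<integral>\<^sup>+y. \<integral>\<^sup>+\<omega>. indicator S r * H \<omega> r y \<partial>N \<partial>lborel)"
      by (rule NL.Fubini'[symmetric])
  qed
  also have "\<dots> = st_int S (\<lambda>r y. \<integral>\<^sup>+\<omega>. H \<omega> r y \<partial>N)"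
    unfolding st_int_def by (intro nn_integral_cong) (auto simp: indicator_def)
  finally show ?thesis .
qed

lemma nn_integral_shift:
  fixes f :: "real \<Rightarrow> ennreal"
  assumes "f \<in> borel_measurable borel"
  shows "(\<integral>\<^sup>+y. f (y - x) \<partial>lborel) = (\<integral>\<^sup>+z. f z \<partial>lborel)"
proof -
  have [measurable]: "f \<in> borel_measurable borel" by fact
  show ?thesis by (subst (2) nn_integral_real_affine[where c=1 and t="-x"]) auto
qed

lemma AE_lborel_shift:
  assumes "AE z in lborel. P z"
  shows "AE y in lborel. P (y - x :: real)"
proof -
  obtain N where "{z \<in> space lborel. \<not> P z} \<subseteq> N" "emeasure lborel N = 0" "N \<in> sets lborel"
    using assms by (rule AE_E)
  then have N: "N \<in> null_sets lborel" "{z. \<not> P z} \<subseteq> N" by (auto intro: null_setsI)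
  have [measurable]: "N \<in> sets borel" using N by auto
  have "emeasure lborel {y. y - x \<in> N} = (\<integral>\<^sup>+y. indicator N (y - x) \<partial>lborel)"
  proof -
    have "{y. y - x \<in> N} \<in> sets lborel" by measurable
    then have "emeasure lborel {y. y - x \<in> N} = (\<integral>\<^sup>+y. indicator {y. y - x \<in> N} y \<partial>lborel)" by simp
    then show ?thesis by (simp add: indicator_def)
  qed
  also have "\<dots> = (\<integral>\<^sup>+y. indicator N y \<partial>lborel)" by (rule nn_integral_shift) simp
  also have "\<dots> = 0" using N by auto
  finally have "{y. y - x \<in> N} \<in> null_sets lborel" by auto
  then show ?thesis by (rule AE_I') (use N in auto)
qed

text \<open>The second part serves the weight in \<open>trunc_moment_renewal\<close>, which is
  continued beyond time t by reflection.\<close>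

lemma st_int_convolution_le:
  assumes k: "(\<lambda>p. k (fst p) (snd p)) \<in> borel_measurable (borel \<Otimes>\<^sub>M borel)"
  shows "st_int {0..<t} (\<lambda>r y. k (t - r) (y - x)) \<le> st_int {0<..} k"
    and "st_int {t<..} (\<lambda>r y. k (r - t) (y - x)) = st_int {0<..} k"
proof -
  define K where "K s = (\<integral>\<^sup>+z. k s z \<partial>lborel)" for s
  have m[measurable]: "(\<lambda>z. k s z) \<in> borel_measurable borel" for s
    using measurable_compose[OF measurable_Pair1' k, of s] by simp
  have "(\<lambda>(s, z). k s z) \<in> borel_measurable (borel \<Otimes>\<^sub>M lborel)" using k unfolding split_beta by (simp cong: measurable_cong_sets)
  then have [measurable]: "K \<in> borel_measurable borel" unfolding K_def by (rule lborel.borel_measurable_nn_integral)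
  have eq: "st_int S (\<lambda>r y. k (f r) (y - x)) = (\<integral>\<^sup>+r. indicator S r * K (f r) \<partial>lborel)" for S f
    unfolding st_int_def K_def
    by (intro nn_integral_cong) (simp add: nn_integral_cmult nn_integral_shift)
  have eq0: "st_int {0<..} k = (\<integral>\<^sup>+s. indicator {0<..} s * K s \<partial>lborel)"
    unfolding st_int_def K_def by (intro nn_integral_cong) (simp add: nn_integral_cmult)
  have "(\<integral>\<^sup>+r. indicator {0..<t} r * K (t - r) \<partial>lborel) \<le> (\<integral>\<^sup>+r. indicator {0<..} (t - r) * K (t - r) \<partial>lborel)"
    by (intro nn_integral_mono) (auto simp: indicator_def)
  also have "\<dots> = (\<integral>\<^sup>+s. indicator {0<..} s * K s \<partial>lborel)"
    by (subst (2) nn_integral_real_affine[where c="-1" and t=t]) auto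
  finally show "st_int {0..<t} (\<lambda>r y. k (t - r) (y - x)) \<le> st_int {0<..} k" unfolding eq eq0 .
  have "(\<integral>\<^sup>+r. indicator {t<..} r * K (r - t) \<partial>lborel) = (\<integral>\<^sup>+r. indicator {0<..} (r - t) * K (r - t) \<partial>lborel)"
    by (intro nn_integral_cong) (auto simp: indicator_def)
  also have "\<dots> = (\<integral>\<^sup>+s. indicator {0<..} s * K s \<partial>lborel)" by (rule nn_integral_shift) measurable
  finally show "st_int {t<..} (\<lambda>r y. k (r - t) (y - x)) = st_int {0<..} k" unfolding eq eq0 .
qed

text \<open>The weighted supremum is required to be finite a priori: the inequality alone does not exclude an infinite one.\<close>

lemma renewal_bound:
  fixes h a \<rho> :: "real \<Rightarrow> real \<Rightarrow> ennreal"
  assumes k: "(\<lambda>p. k (fst p) (snd p)) \<in> borel_measurable (borel \<Otimes>\<^sub>M borel)"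
    and e: "(\<lambda>p. e (fst p) (snd p)) \<in> borel_measurable (borel \<Otimes>\<^sub>M borel)"
    and ineq: "\<And>t x. 0 \<le> t \<Longrightarrow> t \<le> T \<Longrightarrow> h t x \<le> a t x + st_int {0..<t} (\<lambda>r y. k (t - r) (y - x) * h r y)"
    and weight: "\<And>t x r y. 0 \<le> r \<Longrightarrow> r < t \<Longrightarrow> \<rho> t x \<le> \<rho> r y * e (t - r) (y - x)"
    and source: "\<And>t x. 0 \<le> t \<Longrightarrow> t \<le> T \<Longrightarrow> \<rho> t x * a t x \<le> A"
    and small: "st_int {0<..} (\<lambda>s z. k s z * e s z) \<le> ennreal (1 / 2)"
    and bounded: "\<And>t x. 0 \<le> t \<Longrightarrow> t \<le> T \<Longrightarrow> \<rho> t x * h t x \<le> B" "B < \<top>"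
    and fin: "\<And>t x. \<rho> t x < \<top>" and t: "0 \<le> t" "t \<le> T"
  shows "\<rho> t x * h t x \<le> 2 * A"
proof -
  define S where "S = (SUP p\<in>{0..T} \<times> UNIV. \<rho> (fst p) (snd p) * h (fst p) (snd p))"
  have le_S: "\<rho> r y * h r y \<le> S" if "0 \<le> r" "r \<le> T" for r y
    unfolding S_def using that by (intro SUP_upper2[of "(r, y)"]) auto
  have ke: "(\<lambda>p. k (fst p) (snd p) * e (fst p) (snd p)) \<in> borel_measurable (borel \<Otimes>\<^sub>M borel)"
    using k e by measurable
  have one: "\<rho> t x * h t x \<le> A + S * ennreal (1 / 2)" if t: "0 \<le> t" "t \<le> T" for t x
  proof -
    have "\<rho> t x * h t x \<le> \<rho> t x * a t x + \<rho> t x * st_int {0..<t} (\<lambda>r y. k (t - r) (y - x) * h r y)"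
      unfolding distrib_left[symmetric] by (intro mult_left_mono ineq t) auto
    also have "\<rho> t x * st_int {0..<t} (\<lambda>r y. k (t - r) (y - x) * h r y) \<le> st_int {0..<t} (\<lambda>r y. S * (k (t - r) (y - x) * e (t - r) (y - x)))"
    proof -
      obtain w where w: "\<rho> t x = ennreal w" "w \<ge> 0" using fin[of t x] by (cases "\<rho> t x") auto
      show ?thesis
      proof (cases "w = 0")
        case False
        \<comment> \<open>The factor 1 / \<rho> is introduced pointwise and pulled out only after h
          has been eliminated: the kernel k * e is known to be measurable, the product with h is
          not.\<close>
        define c where "c = ennreal (1 / w)"
        have cw: "c * \<rho> t x = 1" using w False by (simp add: c_def ennreal_mult[symmetric])
        have "st_int {0..<t} (\<lambda>r y. k (t - r) (y - x) * h r y) \<le> st_int {0..<t} (\<lambda>r y. c * (S * (k (t - r) (y - x) * e (t - r) (y - x))))"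
        proof (rule st_int_mono)
          fix r y assume r: "r \<in> {0..<t}"
          have "k (t - r) (y - x) * h r y = c * (k (t - r) (y - x) * (\<rho> t x * h r y))"
          proof -
            have "c * (k (t - r) (y - x) * (\<rho> t x * h r y)) = (c * \<rho> t x) * (k (t - r) (y - x) * h r y)" by (simp only: mult_ac)
            then show ?thesis unfolding cw by simp
          qed
          also have "\<dots> \<le> c * (k (t - r) (y - x) * (\<rho> r y * e (t - r) (y - x) * h r y))"
            using r by (intro mult_left_mono mult_right_mono weight) auto
          also have "\<dots> = c * ((\<rho> r y * h r y) * (k (t - r) (y - x) * e (t - r) (y - x)))" by (simp only: mult_ac)
          also have "\<dots> \<le> c * (S * (k (t - r) (y - x) * e (t - r) (y - x)))"
            using r t by (intro mult_left_mono mult_right_mono le_S) auto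
          finally show "k (t - r) (y - x) * h r y \<le> c * (S * (k (t - r) (y - x) * e (t - r) (y - x)))" .
        qed
        also have "\<dots> = c * st_int {0..<t} (\<lambda>r y. S * (k (t - r) (y - x) * e (t - r) (y - x)))"
        proof (rule st_int_cmult)
          have "(\<lambda>p. (t - fst p, snd p - x)) \<in> measurable (borel \<Otimes>\<^sub>M borel) (borel \<Otimes>\<^sub>M borel)" by measurable
          from measurable_compose[OF this ke] show "(\<lambda>p. S * (k (t - fst p) (snd p - x) * e (t - fst p) (snd p - x))) \<in> borel_measurable (borel \<Otimes>\<^sub>M borel)"
            by simp
        qed simp
        finally have "\<rho> t x * st_int {0..<t} (\<lambda>r y. k (t - r) (y - x) * h r y) \<le> \<rho> t x * (c * st_int {0..<t} (\<lambda>r y. S * (k (t - r) (y - x) * e (t - r) (y - x))))"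
          by (rule mult_left_mono) simp
        also have "\<dots> = st_int {0..<t} (\<lambda>r y. S * (k (t - r) (y - x) * e (t - r) (y - x)))"
        proof -
          have "\<rho> t x * (c * Z) = (c * \<rho> t x) * Z" for Z by (simp only: mult_ac)
          then show ?thesis unfolding cw by simp
        qed
        finally show ?thesis .
      qed (use w in simp)
    qed
    also have "\<dots> = S * st_int {0..<t} (\<lambda>r y. k (t - r) (y - x) * e (t - r) (y - x))"
    proof (rule st_int_cmult)
      have "(\<lambda>p. (t - fst p, snd p - x)) \<in> measurable (borel \<Otimes>\<^sub>M borel) (borel \<Otimes>\<^sub>M borel)" by measurable
      from measurable_compose[OF this ke] show "(\<lambda>p. k (t - fst p) (snd p - x) * e (t - fst p) (snd p - x)) \<in> borel_measurable (borel \<Otimes>\<^sub>M borel)"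
        by simp
    qed simp
    also have "\<dots> \<le> S * ennreal (1 / 2)"
      by (intro mult_left_mono order_trans[OF st_int_convolution_le(1)[OF ke] small]) auto
    finally show ?thesis using source[OF t, of x] by (meson add_mono order_refl order_trans)
  qed
  have "(SUP p\<in>{0..T} \<times> UNIV. \<rho> (fst p) (snd p) * h (fst p) (snd p)) \<le> A + S * ennreal (1 / 2)"
    by (rule SUP_least) (use one in auto)
  then have "S \<le> A + S * ennreal (1 / 2)" unfolding S_def[symmetric] .
  moreover have "S \<le> B" unfolding S_def by (rule SUP_least) (use bounded(1) in auto)
  ultimately have "S \<le> 2 * A"
  proof (cases A)
    case (real a)
    obtain s where s: "S = ennreal s" "s \<ge> 0" using \<open>S \<le> B\<close> bounded(2) by (cases S) (auto simp: top_unique)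
    have "S * ennreal (1 / 2) = ennreal (s / 2)" unfolding s(1) using s(2) by (subst ennreal_mult[symmetric]) auto
    then have "s \<le> a + s / 2"
      using \<open>S \<le> A + S * ennreal (1 / 2)\<close> s real
      by (simp add: ennreal_plus[symmetric] del: ennreal_plus)
    then show ?thesis using s real by (simp add: ennreal_mult'[symmetric] ennreal_numeral[symmetric] del: ennreal_numeral)
  qed (simp add: ennreal_mult_top)
  then show ?thesis using le_S[OF t] by (rule order_trans[rotated])
qed

context noise
begin

text \<open>The predictable sigma-algebra lives on nonnegative times and is contained in the trace
  of the product sigma-algebra. Extension by zero gives joint measurability on the whole line, which
  Tonelli requires.\<close>

lemma predictable_measurable:
  assumes "predictable M F u"
  shows "(\<lambda>p. indicator {0..} (fst (snd p)) * u (fst (snd p)) (snd (snd p)) (fst p)) \<in> borel_measurable (M \<Otimes>\<^sub>M (borel \<Otimes>\<^sub>M borel))"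
proof -
  let ?B = "M \<Otimes>\<^sub>M (borel \<Otimes>\<^sub>M borel) :: ('a \<times> real \<times> real) measure"
  define \<Omega> where "\<Omega> = space M \<times> ({0::real..} \<times> (UNIV :: real set))"
  have \<Omega>: "\<Omega> \<in> sets ?B" unfolding \<Omega>_def by (intro pair_measureI) auto
  let ?R = "restrict_space ?B \<Omega>"
  define G where "G = {A \<times> ({s<..t} \<times> B) | A s t B. 0 \<le> s \<and> s < t \<and> A \<in> sets (F s) \<and> B \<in> sets borel} \<union>
      {A \<times> ({0::real} \<times> B) | A B. A \<in> sets (F 0) \<and> B \<in> sets (borel :: real measure)}"
  have sp: "space ?R = \<Omega>" by (auto simp: space_restrict_space \<Omega>_def space_pair_measure)
  have G: "G \<subseteq> sets ?R"
  proof
    fix Y assume "Y \<in> G"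
    then consider A s t B where "Y = A \<times> ({s<..t} \<times> B)" "0 \<le> s" "s < t" "A \<in> sets (F s)" "B \<in> sets borel"
      | A B where "Y = A \<times> ({0} \<times> B)" "A \<in> sets (F 0)" "B \<in> sets borel" unfolding G_def by blast
    then have "Y \<in> sets ?B \<and> Y \<subseteq> \<Omega>"
    proof cases
      case 1
      have A: "A \<in> sets M" using 1 F_sets[of s] by auto
      then have "A \<subseteq> space M" by (rule sets.sets_into_space)
      then show ?thesis using 1 A by (auto simp: \<Omega>_def intro!: pair_measureI)
    next
      case 2
      have A: "A \<in> sets M" using 2 F_sets[of 0] by auto
      then have "A \<subseteq> space M" by (rule sets.sets_into_space)
      then show ?thesis using 2 A by (auto simp: \<Omega>_def intro!: pair_measureI)
    qed
    then show "Y \<in> sets ?R" using \<Omega> by (auto simp: sets_restrict_space_iff)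
  qed
  have alg: "predictable_alg M F = sigma \<Omega> G" unfolding predictable_alg_def \<Omega>_def G_def ..
  have GP: "G \<subseteq> Pow \<Omega>" using G sets.sets_into_space[of _ ?R] sp by auto
  have "sigma_sets \<Omega> G \<subseteq> sets ?R" using sets.sigma_sets_subset[OF G] sp by simp
  then have sub: "subalgebra ?R (sigma \<Omega> G)"
    using GP sp by (auto simp: subalgebra_def sets_measure_of space_measure_of)
  have "(\<lambda>(\<omega>, r, y). u r y \<omega>) \<in> borel_measurable (sigma \<Omega> G)"
    using assms unfolding predictable_def alg .
  then have "(\<lambda>(\<omega>, r, y). u r y \<omega>) \<in> borel_measurable ?R" by (rule measurable_from_subalg[OF sub])
  then have "(\<lambda>p. indicator \<Omega> p *\<^sub>R (case p of (\<omega>, r, y) \<Rightarrow> u r y \<omega>)) \<in> borel_measurable ?B"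
    using \<Omega> by (subst (asm) borel_measurable_restrict_space_iff) auto
  then show ?thesis
    by (rule measurable_cong[THEN iffD1, rotated]) (auto simp: \<Omega>_def space_pair_measure indicator_def)
qed

end

section \<open>Moments of the mild solution\<close>

text \<open>A single rate c is used for the exponential moment of the process and for the decay of
  the initial datum; it becomes the spatial decay rate of the second moment.\<close>

locale spde = noise M F W + K: levy_exp P X \<Psi> p c
  for M :: "'a measure" and F W and P :: "'b measure" and X \<Psi> p c +
  fixes \<sigma> u0 :: "real \<Rightarrow> real" and u :: "real \<Rightarrow> real \<Rightarrow> 'a \<Rightarrow> real" and Lip ell A0 :: real
  assumes sol: "mild_solution M F W P X p \<sigma> u0 u"
    and \<sigma>_measurable [measurable]: "\<sigma> \<in> borel_measurable borel"
    and Lip: "Lip \<ge> 1" "\<And>z. \<bar>\<sigma> z\<bar> \<le> Lip * \<bar>z\<bar>"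
    and ell: "ell > 0" "\<And>z. ell * \<bar>z\<bar> \<le> \<bar>\<sigma> z\<bar>"
    and u0_measurable [measurable]: "u0 \<in> borel_measurable borel"
    and u0_nonneg: "\<And>x. u0 x \<ge> 0" and u0_le: "\<And>x. u0 x \<le> A0 * exp (- c * \<bar>x\<bar>)"
    and u0_pos: "emeasure lborel {x. u0 x > 0} > 0"
begin

lemma A0_nonneg: "A0 \<ge> 0"
  using u0_nonneg[of 0] u0_le[of 0] by simp

lemma u0_le_A0: "u0 x \<le> A0"
proof -
  have "u0 x \<le> A0 * exp (- c * \<bar>x\<bar>)" by (rule u0_le)
  also have "\<dots> \<le> A0 * 1" using A0_nonneg K.c_pos by (intro mult_left_mono) auto
  finally show ?thesis by simp
qed

section \<open>The deterministic part of the mild equation\<close>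

definition J :: "real \<Rightarrow> real \<Rightarrow> real" where
  "J t x = semigroup P X t u0 x"

lemma J_nn: "ennreal (J t x) = (\<integral>\<^sup>+\<omega>. ennreal (u0 (x + X t \<omega>)) \<partial>P)"
  unfolding J_def semigroup_def using u0_nonneg u0_le_A0
  by (intro nn_integral_eq_integral[symmetric] K.integrable_const_bound[of _ A0]) auto

lemma J_nonneg: "J t x \<ge> 0"
  unfolding J_def semigroup_def using u0_nonneg by simp

lemma J_le_A0: "J t x \<le> A0"
proof -
  have "ennreal (J t x) \<le> (\<integral>\<^sup>+\<omega>. ennreal A0 \<partial>P)"
    unfolding J_nn by (intro nn_integral_mono ennreal_leI u0_le_A0)
  then show ?thesis using A0_nonneg by (simp add: K.emeasure_space_1)
qed

text \<open>|x| <= |x + X_t| + |X_t| splits the decay: the first term is covered by the bound on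
  \<open>u0\<close>, the second by the exponential moment.\<close>

lemma J_decay:
  assumes "t \<ge> 0"
  shows "J t x \<le> A0 * 2 * exp (K.\<kappa> * (t + 1)) * exp (- c * \<bar>x\<bar>)"
proof -
  have "ennreal (J t x) \<le> (\<integral>\<^sup>+\<omega>. ennreal (A0 * exp (- c * \<bar>x\<bar>)) * ennreal (exp (c * \<bar>X t \<omega>\<bar>)) \<partial>P)"
    unfolding J_nn
  proof (rule nn_integral_mono)
    fix \<omega>
    have "u0 (x + X t \<omega>) \<le> A0 * exp (- c * \<bar>x + X t \<omega>\<bar>)" by (rule u0_le)
    also have "\<dots> \<le> A0 * exp (- c * \<bar>x\<bar> + c * \<bar>X t \<omega>\<bar>)"
    proof (intro mult_left_mono A0_nonneg)
      have "c * \<bar>x\<bar> \<le> c * (\<bar>x + X t \<omega>\<bar> + \<bar>X t \<omega>\<bar>)" using K.c_pos by (intro mult_left_mono) auto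
      then show "exp (- c * \<bar>x + X t \<omega>\<bar>) \<le> exp (- c * \<bar>x\<bar> + c * \<bar>X t \<omega>\<bar>)" by (simp add: algebra_simps)
    qed
    finally show "ennreal (u0 (x + X t \<omega>)) \<le> ennreal (A0 * exp (- c * \<bar>x\<bar>)) * ennreal (exp (c * \<bar>X t \<omega>\<bar>))"
      using A0_nonneg by (simp add: ennreal_mult[symmetric] ennreal_leI exp_add[symmetric] mult.assoc)
  qed
  also have "\<dots> = ennreal (A0 * exp (- c * \<bar>x\<bar>)) * (\<integral>\<^sup>+\<omega>. ennreal (exp (c * \<bar>X t \<omega>\<bar>)) \<partial>P)"
    by (rule nn_integral_cmult) measurable
  also have "\<dots> \<le> ennreal (A0 * exp (- c * \<bar>x\<bar>)) * ennreal (2 * exp (K.\<kappa> * (t + 1)))"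
    by (intro mult_left_mono K.exp_abs_moment assms) auto
  also have "\<dots> = ennreal (A0 * 2 * exp (K.\<kappa> * (t + 1)) * exp (- c * \<bar>x\<bar>))"
    using A0_nonneg by (simp add: ennreal_mult[symmetric] mult_ac)
  finally show ?thesis using A0_nonneg by (subst (asm) ennreal_le_iff) auto
qed

lemma J_density:
  "t > 0 \<Longrightarrow> ennreal (J t x) = (\<integral>\<^sup>+z. ennreal (K.q t z) * ennreal (u0 (x + z)) \<partial>lborel)"
  unfolding J_nn by (rule K.X_nn_integral) measurable

text \<open>\<open>q\<close> is positive everywhere, so a zero of J at a single point would force
  \<open>u0\<close> to vanish almost everywhere.\<close>

lemma J_pos:
  assumes t: "t > 0"
  shows "J t x > 0"
proof (rule ccontr)
  assume "\<not> J t x > 0"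
  then have "ennreal (J t x) = 0" by (simp add: ennreal_neg)
  then have "AE z in lborel. ennreal (K.q t z) * ennreal (u0 (x + z)) = 0"
    unfolding J_density[OF t] by (subst (asm) nn_integral_0_iff_AE) auto
  then have "AE z in lborel. \<not> u0 (x + z) > 0"
    using K.q_pos[OF t] by (auto elim!: eventually_mono simp: ennreal_eq_0_iff not_less[symmetric])
  from AE_lborel_shift[OF this, of x] have "AE z in lborel. z \<notin> {x. u0 x > 0}" by simp
  then have "emeasure lborel {x. u0 x > 0} = 0" by (subst (asm) AE_iff_measurable[of "{x. u0 x > 0}"]) auto
  then show False using u0_pos by simp
qed

lemma J_measurable: "(\<lambda>z. indicator {0<..} (fst z) * ennreal (J (fst z) (snd z))) \<in> borel_measurable (borel \<Otimes>\<^sub>M borel)"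
proof -
  have "(\<lambda>(w, z). ennreal (K.q (fst w) z) * ennreal (u0 (snd w + z))) \<in> borel_measurable ((borel \<Otimes>\<^sub>M borel) \<Otimes>\<^sub>M lborel)"
    unfolding split_beta by measurable
  then have [measurable]: "(\<lambda>w. \<integral>\<^sup>+z. ennreal (K.q (fst w) z) * ennreal (u0 (snd w + z)) \<partial>lborel) \<in> borel_measurable (borel \<Otimes>\<^sub>M borel)"
    by (rule lborel.borel_measurable_nn_integral)
  have "(\<lambda>w. indicator {0<..} (fst w) * (\<integral>\<^sup>+z. ennreal (K.q (fst w) z) * ennreal (u0 (snd w + z)) \<partial>lborel)) \<in> borel_measurable (borel \<Otimes>\<^sub>M borel)"
    by measurable
  then show ?thesis by (rule measurable_cong[THEN iffD1, rotated]) (auto simp: J_density indicator_def)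
qed

lemma U_measurable: "(\<lambda>z. indicator {0..} (fst (snd z)) * u (fst (snd z)) (snd (snd z)) (fst z)) \<in> borel_measurable (M \<Otimes>\<^sub>M (borel \<Otimes>\<^sub>M borel))"
  using sol unfolding mild_solution_def by (intro predictable_measurable) auto

lemma u_measurable: "t \<ge> 0 \<Longrightarrow> u t x \<in> borel_measurable M"
  using measurable_comp3[where H="\<lambda>\<omega> r y. indicator {0..} r * u r y \<omega>", OF U_measurable, of "\<lambda>\<omega>. \<omega>" M "\<lambda>_. t" "\<lambda>_. x"] by simp

lemma expect_measurable:
  assumes [measurable]: "\<phi> \<in> borel_measurable borel"
  shows "(\<lambda>z. indicator {0..} (fst z) * (\<integral>\<^sup>+\<omega>. ennreal (\<phi> (u (fst z) (snd z) \<omega>)) \<partial>M)) \<in> borel_measurable (borel \<Otimes>\<^sub>M borel)"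
proof -
  have [measurable]: "(\<lambda>w. indicator {0..} (fst (fst w)) * u (fst (fst w)) (snd (fst w)) (snd w)) \<in> borel_measurable ((borel \<Otimes>\<^sub>M borel) \<Otimes>\<^sub>M M)"
    by (rule measurable_comp3[where H="\<lambda>\<omega> r y. indicator {0..} r * u r y \<omega>", OF U_measurable]) measurable
  have "(\<lambda>(z, \<omega>). ennreal (\<phi> (indicator {0..} (fst z) * u (fst z) (snd z) \<omega>))) \<in> borel_measurable ((borel \<Otimes>\<^sub>M borel) \<Otimes>\<^sub>M M)"
    unfolding split_beta by measurable
  then have [measurable]: "(\<lambda>z. \<integral>\<^sup>+\<omega>. ennreal (\<phi> (indicator {0..} (fst z) * u (fst z) (snd z) \<omega>)) \<partial>M) \<in> borel_measurable (borel \<Otimes>\<^sub>M borel)"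
    by (rule borel_measurable_nn_integral)
  have "(\<lambda>z. indicator {0..} (fst z) * (\<integral>\<^sup>+\<omega>. ennreal (\<phi> (indicator {0..} (fst z) * u (fst z) (snd z) \<omega>)) \<partial>M)) \<in> borel_measurable (borel \<Otimes>\<^sub>M borel)"
    by measurable
  then show ?thesis by (rule measurable_cong[THEN iffD1, rotated]) (auto simp: indicator_def)
qed

lemma sol_walsh:
  assumes "t \<ge> 0"
  obtains I where "walsh_integral M F W (\<lambda>\<omega> r y. if r < t then p (t - r) (y - x) * \<sigma> (u r y \<omega>) else 0) I"
    "AE \<omega> in M. u t x \<omega> = J t x + I \<omega>"
  using sol assms unfolding mild_solution_def J_def by blast

text \<open>\<open>p\<close> is given for each time separately, so joint measurability is taken from
  the Walsh integrand itself, and \<open>p\<close> is exchanged for \<open>q\<close> after Tonelli,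
  in the space integral at a fixed time. The condition on G at 0 removes the times from t
  on.\<close>

lemma integrand_expectation:
  assumes f: "walsh_integral M F W (\<lambda>\<omega> r y. if r < t then p (t - r) (y - x) * \<sigma> (u r y \<omega>) else 0) I"
    and G: "(\<lambda>z. G (fst z) (fst (snd z)) (snd (snd z))) \<in> borel_measurable (borel \<Otimes>\<^sub>M (borel \<Otimes>\<^sub>M borel))"
    and G0: "\<And>r y. G r y 0 = 0"
  shows "(\<integral>\<^sup>+\<omega>. st_int {0..} (\<lambda>r y. G r y (if r < t then p (t - r) (y - x) * \<sigma> (u r y \<omega>) else 0)) \<partial>M)
    = st_int {0..<t} (\<lambda>r y. \<integral>\<^sup>+\<omega>. G r y (K.q (t - r) (y - x) * \<sigma> (u r y \<omega>)) \<partial>M)"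
proof -
  let ?f = "\<lambda>\<omega> r y. if r < t then p (t - r) (y - x) * \<sigma> (u r y \<omega>) else 0"
  have "(\<lambda>z. ?f (fst z) (fst (snd z)) (snd (snd z))) \<in> borel_measurable (M \<Otimes>\<^sub>M (borel \<Otimes>\<^sub>M borel))"
    by (rule walsh_unfold(2)[OF f])
  then have "(\<lambda>z. G (fst (snd z)) (snd (snd z)) (?f (fst z) (fst (snd z)) (snd (snd z)))) \<in> borel_measurable (M \<Otimes>\<^sub>M (borel \<Otimes>\<^sub>M borel))"
    by (intro measurable_comp3[OF G]) auto
  then have "(\<integral>\<^sup>+\<omega>. st_int {0..} (\<lambda>r y. G r y (?f \<omega> r y)) \<partial>M) = st_int {0..} (\<lambda>r y. \<integral>\<^sup>+\<omega>. G r y (?f \<omega> r y) \<partial>M)"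
    by (intro st_int_swap) (auto intro: sigma_finite_measure_axioms)
  also have "\<dots> = st_int {0..<t} (\<lambda>r y. \<integral>\<^sup>+\<omega>. G r y (K.q (t - r) (y - x) * \<sigma> (u r y \<omega>)) \<partial>M)"
    unfolding st_int_def
  proof (rule nn_integral_cong)
    fix r :: real
    show "(\<integral>\<^sup>+y. indicator {0..} r * (\<integral>\<^sup>+\<omega>. G r y (?f \<omega> r y) \<partial>M) \<partial>lborel)
      = (\<integral>\<^sup>+y. indicator {0..<t} r * (\<integral>\<^sup>+\<omega>. G r y (K.q (t - r) (y - x) * \<sigma> (u r y \<omega>)) \<partial>M) \<partial>lborel)"
    proof (cases "r < t")
      case True
      then have "AE y in lborel. p (t - r) (y - x) = K.q (t - r) (y - x)"
        by (intro AE_lborel_shift K.p_eq_q_AE) simp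
      then show ?thesis using True by (intro nn_integral_cong_AE) (auto elim!: eventually_mono simp: indicator_def)
    qed (simp add: G0)
  qed
  finally show ?thesis .
qed

section \<open>Second moments\<close>

definition v :: "real \<Rightarrow> real \<Rightarrow> ennreal" where
  "v t x = (\<integral>\<^sup>+\<omega>. ennreal ((u t x \<omega>)\<^sup>2) \<partial>M)"

lemma v_measurable: "(\<lambda>z. indicator {0..} (fst z) * v (fst z) (snd z)) \<in> borel_measurable (borel \<Otimes>\<^sub>M borel)"
  unfolding v_def by (rule expect_measurable) measurable

lemma v_locally_bounded: "T \<ge> 0 \<Longrightarrow> \<exists>C. \<forall>t\<in>{0..T}. \<forall>x. v t x \<le> ennreal C"
  using sol unfolding mild_solution_def v_def by blast

lemma second_moment:
  assumes t: "t \<ge> 0"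
  shows "v t x = ennreal ((J t x)\<^sup>2) + st_int {0..<t} (\<lambda>r y. ennreal ((K.q (t - r) (y - x))\<^sup>2) * (\<integral>\<^sup>+\<omega>. ennreal ((\<sigma> (u r y \<omega>))\<^sup>2) \<partial>M))"
proof -
  obtain I where I: "walsh_integral M F W (\<lambda>\<omega> r y. if r < t then p (t - r) (y - x) * \<sigma> (u r y \<omega>) else 0) I"
    "AE \<omega> in M. u t x \<omega> = J t x + I \<omega>" by (rule sol_walsh[OF t])
  have "v t x = (\<integral>\<^sup>+\<omega>. ennreal ((J t x + I \<omega>)\<^sup>2) \<partial>M)"
    unfolding v_def using I(2) by (intro nn_integral_cong_AE) auto
  also have "\<dots> = ennreal ((J t x)\<^sup>2) + (\<integral>\<^sup>+\<omega>. st_int {0..} (\<lambda>r y. ennreal ((if r < t then p (t - r) (y - x) * \<sigma> (u r y \<omega>) else 0)\<^sup>2)) \<partial>M)"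
    by (rule walsh_isometry[OF I(1)])
  also have "(\<integral>\<^sup>+\<omega>. st_int {0..} (\<lambda>r y. ennreal ((if r < t then p (t - r) (y - x) * \<sigma> (u r y \<omega>) else 0)\<^sup>2)) \<partial>M)
    = st_int {0..<t} (\<lambda>r y. \<integral>\<^sup>+\<omega>. ennreal ((K.q (t - r) (y - x) * \<sigma> (u r y \<omega>))\<^sup>2) \<partial>M)"
    by (rule integrand_expectation[OF I(1), where G="\<lambda>r y z. ennreal (z\<^sup>2)"]) auto
  also have "\<dots> = st_int {0..<t} (\<lambda>r y. ennreal ((K.q (t - r) (y - x))\<^sup>2) * (\<integral>\<^sup>+\<omega>. ennreal ((\<sigma> (u r y \<omega>))\<^sup>2) \<partial>M))"
  proof (rule st_int_cong)
    fix r y assume "r \<in> {0..<t}"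
    then have [measurable]: "u r y \<in> borel_measurable M" by (intro u_measurable) auto
    show "(\<integral>\<^sup>+\<omega>. ennreal ((K.q (t - r) (y - x) * \<sigma> (u r y \<omega>))\<^sup>2) \<partial>M) = ennreal ((K.q (t - r) (y - x))\<^sup>2) * (\<integral>\<^sup>+\<omega>. ennreal ((\<sigma> (u r y \<omega>))\<^sup>2) \<partial>M)"
      by (subst nn_integral_cmult[symmetric]) (auto simp: power_mult_distrib ennreal_mult)
  qed
  finally show ?thesis .
qed

lemma \<sigma>_square_bounds:
  assumes "r \<ge> 0"
  shows "(\<integral>\<^sup>+\<omega>. ennreal ((\<sigma> (u r y \<omega>))\<^sup>2) \<partial>M) \<le> ennreal (Lip\<^sup>2) * v r y"
    and "ennreal (ell\<^sup>2) * v r y \<le> (\<integral>\<^sup>+\<omega>. ennreal ((\<sigma> (u r y \<omega>))\<^sup>2) \<partial>M)"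
proof -
  have [measurable]: "u r y \<in> borel_measurable M" by (intro u_measurable assms)
  have up: "(\<sigma> z)\<^sup>2 \<le> Lip\<^sup>2 * z\<^sup>2" for z
    using power_mono[OF Lip(2)[of z], of 2] by (simp add: power_mult_distrib)
  have lo: "ell\<^sup>2 * z\<^sup>2 \<le> (\<sigma> z)\<^sup>2" for z
    using power_mono[OF ell(2)[of z], of 2] ell(1) by (simp add: power_mult_distrib)
  show "(\<integral>\<^sup>+\<omega>. ennreal ((\<sigma> (u r y \<omega>))\<^sup>2) \<partial>M) \<le> ennreal (Lip\<^sup>2) * v r y"
    unfolding v_def by (subst nn_integral_cmult[symmetric]) (auto simp: ennreal_mult[symmetric] intro!: nn_integral_mono ennreal_leI up)
  show "ennreal (ell\<^sup>2) * v r y \<le> (\<integral>\<^sup>+\<omega>. ennreal ((\<sigma> (u r y \<omega>))\<^sup>2) \<partial>M)"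
    unfolding v_def by (subst nn_integral_cmult[symmetric]) (auto simp: ennreal_mult[symmetric] intro!: nn_integral_mono ennreal_leI lo)
qed

lemma v_upper:
  assumes t: "t \<ge> 0"
  shows "v t x \<le> ennreal ((J t x)\<^sup>2) + st_int {0..<t} (\<lambda>r y. ennreal (Lip\<^sup>2 * (K.q (t - r) (y - x))\<^sup>2) * v r y)"
  unfolding second_moment[OF t]
proof (intro add_left_mono st_int_mono)
  fix r y assume "r \<in> {0..<t}"
  then have "ennreal ((K.q (t - r) (y - x))\<^sup>2) * (\<integral>\<^sup>+\<omega>. ennreal ((\<sigma> (u r y \<omega>))\<^sup>2) \<partial>M)
    \<le> ennreal ((K.q (t - r) (y - x))\<^sup>2) * (ennreal (Lip\<^sup>2) * v r y)"
    by (intro mult_left_mono \<sigma>_square_bounds) auto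
  then show "ennreal ((K.q (t - r) (y - x))\<^sup>2) * (\<integral>\<^sup>+\<omega>. ennreal ((\<sigma> (u r y \<omega>))\<^sup>2) \<partial>M) \<le> ennreal (Lip\<^sup>2 * (K.q (t - r) (y - x))\<^sup>2) * v r y"
    by (simp add: ennreal_mult mult_ac)
qed

lemma v_lower:
  assumes t: "t \<ge> 0"
  shows "ennreal ((J t x)\<^sup>2) + st_int {0..<t} (\<lambda>r y. ennreal (ell\<^sup>2 * (K.q (t - r) (y - x))\<^sup>2) * v r y) \<le> v t x"
  unfolding second_moment[OF t]
proof (intro add_left_mono st_int_mono)
  fix r y assume "r \<in> {0..<t}"
  then have "ennreal ((K.q (t - r) (y - x))\<^sup>2) * (ennreal (ell\<^sup>2) * v r y) \<le> ennreal ((K.q (t - r) (y - x))\<^sup>2) * (\<integral>\<^sup>+\<omega>. ennreal ((\<sigma> (u r y \<omega>))\<^sup>2) \<partial>M)"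
    by (intro mult_left_mono \<sigma>_square_bounds) auto
  then show "ennreal (ell\<^sup>2 * (K.q (t - r) (y - x))\<^sup>2) * v r y \<le> ennreal ((K.q (t - r) (y - x))\<^sup>2) * (\<integral>\<^sup>+\<omega>. ennreal ((\<sigma> (u r y \<omega>))\<^sup>2) \<partial>M)"
    by (simp add: ennreal_mult mult_ac)
qed

text \<open>More damping only helps, so the rate may be raised above \<kappa> in
  \<open>second_moment_bound\<close>.\<close>

lemma kernel_small_st_int:
  assumes "C \<ge> 0"
  shows "\<exists>g0>0. \<forall>g\<ge>g0. st_int {0<..} (\<lambda>s z. ennreal (C * (K.q s z)\<^sup>2 * exp (- g * s + c * \<bar>z\<bar>))) \<le> ennreal (1 / 2)"
proof -
  obtain g0 where g0: "g0 > 0" "st_int {0<..} (\<lambda>s z. ennreal (C * (K.q s z)\<^sup>2 * exp (- g0 * s + c * \<bar>z\<bar>))) \<le> ennreal (1 / 2)"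
    using K.kernel_small[OF assms] unfolding st_int_def by blast
  have "st_int {0<..} (\<lambda>s z. ennreal (C * (K.q s z)\<^sup>2 * exp (- g * s + c * \<bar>z\<bar>))) \<le> ennreal (1 / 2)" if "g \<ge> g0" for g
  proof (rule order_trans[OF _ g0(2)], intro st_int_mono ennreal_leI mult_left_mono)
    fix s z :: real assume "s \<in> {0<..}"
    then have "g0 * s \<le> g * s" using that by (intro mult_right_mono) auto
    then show "exp (- g * s + c * \<bar>z\<bar>) \<le> exp (- g0 * s + c * \<bar>z\<bar>)" by simp
  qed (use assms in auto)
  then show ?thesis using g0(1) by blast
qed

lemma second_moment_bound:
  "\<exists>A\<ge>0. \<exists>\<gamma>>0. \<forall>t\<ge>0. \<forall>x. v t x \<le> ennreal (A * exp (\<gamma> * t - c * \<bar>x\<bar>))"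
proof -
  obtain g0 where g0: "g0 > 0" "\<And>g. g \<ge> g0 \<Longrightarrow> st_int {0<..} (\<lambda>s z. ennreal (Lip\<^sup>2 * (K.q s z)\<^sup>2 * exp (- g * s + c * \<bar>z\<bar>))) \<le> ennreal (1 / 2)"
    using kernel_small_st_int[of "Lip\<^sup>2"] by auto
  \<comment> \<open>g0 makes the weighted kernel have mass at most 1/2; \<kappa> absorbs the growth
    in time of the bound \<open>J_decay\<close>.\<close>
  define \<gamma> where "\<gamma> = g0 + K.\<kappa>"
  have \<gamma>: "\<gamma> \<ge> g0" "\<gamma> \<ge> K.\<kappa>" "\<gamma> > 0" using g0(1) K.\<kappa>_nonneg by (auto simp: \<gamma>_def)
  \<comment> \<open>In J^2 one factor is bounded by A0 and only the other by its decaying bound,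
    which matches a weight growing at rate c.\<close>
  define A where "A = A0 * (A0 * 2 * exp K.\<kappa>)"
  have A: "A \<ge> 0" using A0_nonneg by (simp add: A_def)
  have "v t x \<le> ennreal (2 * A * exp (\<gamma> * t - c * \<bar>x\<bar>))" if t: "t \<ge> 0" for t x
  proof -
    \<comment> \<open>The cap is the value of the weight at the target point x: there it does not
      change the weight, elsewhere it makes the weighted supremum finite.\<close>
    define R where "R = exp (c * \<bar>x\<bar>)"
    define \<rho> where "\<rho> t y = ennreal (exp (- \<gamma> * t) * min (exp (c * \<bar>y\<bar>)) R)" for t y
    have R: "R > 0" by (simp add: R_def)
    obtain C where C: "\<And>s y. s \<in> {0..t} \<Longrightarrow> v s y \<le> ennreal C" using v_locally_bounded[OF t] by blast
    have "\<rho> t x * v t x \<le> 2 * ennreal A"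
    proof (rule renewal_bound[where T=t and k="\<lambda>s z. ennreal (Lip\<^sup>2 * (K.q s z)\<^sup>2)" and e="\<lambda>s z. ennreal (exp (- \<gamma> * s + c * \<bar>z\<bar>))"
          and a="\<lambda>t x. ennreal ((J t x)\<^sup>2)" and B="ennreal R * ennreal C"])
      show "\<rho> t x \<le> \<rho> r y * ennreal (exp (- \<gamma> * (t - r) + c * \<bar>y - x\<bar>))" if "0 \<le> r" "r < t" for t x r y
      proof -
        have "c * \<bar>x\<bar> \<le> c * (\<bar>y\<bar> + \<bar>y - x\<bar>)" using K.c_pos by (intro mult_left_mono) auto
        then have 1: "exp (c * \<bar>x\<bar>) \<le> exp (c * \<bar>y\<bar>) * exp (c * \<bar>y - x\<bar>)" by (simp add: exp_add[symmetric] distrib_left)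
        have "1 \<le> exp (c * \<bar>y - x\<bar>)" using K.c_pos by simp
        then have 2: "R * 1 \<le> R * exp (c * \<bar>y - x\<bar>)" using R by (intro mult_left_mono) auto
        have "min (exp (c * \<bar>x\<bar>)) R \<le> min (exp (c * \<bar>y\<bar>)) R * exp (c * \<bar>y - x\<bar>)"
          using 1 2 by (auto simp: min_def)
        then have "exp (- \<gamma> * t) * min (exp (c * \<bar>x\<bar>)) R \<le> exp (- \<gamma> * t) * (min (exp (c * \<bar>y\<bar>)) R * exp (c * \<bar>y - x\<bar>))"
          by (intro mult_left_mono) auto
        also have "\<dots> = (exp (- \<gamma> * r) * min (exp (c * \<bar>y\<bar>)) R) * exp (- \<gamma> * (t - r) + c * \<bar>y - x\<bar>)"
        proof -
          have e: "exp (- \<gamma> * t) = exp (- \<gamma> * r) * exp (- \<gamma> * (t - r))" by (simp add: exp_add[symmetric] algebra_simps)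
          show ?thesis unfolding e exp_add by (simp only: mult_ac)
        qed
        finally show ?thesis unfolding \<rho>_def using R by (simp add: ennreal_mult[symmetric] ennreal_leI)
      qed
      show "\<rho> t x * ennreal ((J t x)\<^sup>2) \<le> ennreal A" if "0 \<le> t" for t x
      proof -
        have "(exp (- \<gamma> * t) * min (exp (c * \<bar>x\<bar>)) R) * (J t x)\<^sup>2 \<le> (exp (- K.\<kappa> * t) * exp (c * \<bar>x\<bar>)) * (J t x)\<^sup>2"
          using \<gamma> R that by (intro mult_right_mono mult_mono exp_le_cancel_iff[THEN iffD2]) auto
        also have "\<dots> \<le> (exp (- K.\<kappa> * t) * exp (c * \<bar>x\<bar>)) * (A0 * (A0 * 2 * exp (K.\<kappa> * (t + 1)) * exp (- c * \<bar>x\<bar>)))"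
          unfolding power2_eq_square using J_nonneg[of t x] A0_nonneg that
          by (intro mult_left_mono mult_mono J_le_A0 J_decay) auto
        also have "\<dots> = A * ((exp (- K.\<kappa> * t) * exp (K.\<kappa> * t)) * (exp (c * \<bar>x\<bar>) * exp (- c * \<bar>x\<bar>)))"
        proof -
          have e: "exp (K.\<kappa> * (t + 1)) = exp K.\<kappa> * exp (K.\<kappa> * t)" by (simp add: distrib_left exp_add)
          show ?thesis unfolding A_def e by (simp only: mult_ac)
        qed
        also have "\<dots> = A" by (simp add: exp_add[symmetric])
        finally show ?thesis unfolding \<rho>_def using R by (simp add: ennreal_mult[symmetric] ennreal_leI)
      qed
      show "st_int {0<..} (\<lambda>s z. ennreal (Lip\<^sup>2 * (K.q s z)\<^sup>2) * ennreal (exp (- \<gamma> * s + c * \<bar>z\<bar>))) \<le> ennreal (1 / 2)"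
        using g0(2)[OF \<gamma>(1)] by (simp add: ennreal_mult)
      show "\<rho> s y * v s y \<le> ennreal R * ennreal C" if "0 \<le> s" "s \<le> t" for s y
      proof (rule mult_mono)
        have "exp (- \<gamma> * s) * min (exp (c * \<bar>y\<bar>)) R \<le> 1 * R"
          using \<gamma> that R by (intro mult_mono) auto
        then show "\<rho> s y \<le> ennreal R" unfolding \<rho>_def by (intro ennreal_leI) simp
      qed (use C that in auto)
      show "ennreal R * ennreal C < \<top>" by (simp add: ennreal_mult_less_top)
      show "\<rho> t x < \<top>" for t x by (simp add: \<rho>_def)
    qed (use t v_upper in auto)
    moreover have "\<rho> t x = ennreal (exp (- (\<gamma> * t - c * \<bar>x\<bar>)))"
      by (simp add: \<rho>_def R_def exp_add[symmetric])
    ultimately have "ennreal (exp (\<gamma> * t - c * \<bar>x\<bar>)) * (ennreal (exp (- (\<gamma> * t - c * \<bar>x\<bar>))) * v t x) \<le> ennreal (exp (\<gamma> * t - c * \<bar>x\<bar>)) * (2 * ennreal A)"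
      by (intro mult_left_mono) auto
    moreover have "ennreal (exp (\<gamma> * t - c * \<bar>x\<bar>)) * (ennreal (exp (- (\<gamma> * t - c * \<bar>x\<bar>))) * v t x) = v t x"
    proof -
      have "exp (\<gamma> * t - c * \<bar>x\<bar>) * exp (- (\<gamma> * t - c * \<bar>x\<bar>)) = 1" by (simp only: exp_add[symmetric]) simp
      then have "ennreal (exp (\<gamma> * t - c * \<bar>x\<bar>)) * ennreal (exp (- (\<gamma> * t - c * \<bar>x\<bar>))) = 1"
        by (subst ennreal_mult[symmetric]) (simp_all only: ennreal_1 exp_ge_zero)
      then show ?thesis unfolding mult.assoc[symmetric] by simp
    qed
    moreover have "ennreal (exp (\<gamma> * t - c * \<bar>x\<bar>)) * (2 * ennreal A) = ennreal (2 * A * exp (\<gamma> * t - c * \<bar>x\<bar>))"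
      using A by (simp add: ennreal_mult' ennreal_mult mult_ac)
    ultimately show ?thesis by simp
  qed
  then show ?thesis using A \<gamma>(3) by (intro exI[of _ "2 * A"] conjI exI[of _ \<gamma>]) auto
qed

end

section \<open>Higher moments\<close>

lemma trunc_power_tendsto: "(\<lambda>i. trunc_power k (real i) z) \<longlonglongrightarrow> z ^ (2 * k + 2)"
proof (rule tendsto_eventually)
  obtain N :: nat where "z\<^sup>2 \<le> real N" using real_arch_simple by blast
  then have le: "z\<^sup>2 \<le> real i" if "i \<ge> N" for i using that by (meson of_nat_le_iff order_trans)
  show "\<forall>\<^sub>F i in sequentially. trunc_power k (real i) z = z ^ (2 * k + 2)"
    using eventually_ge_at_top[of N] by eventually_elim (intro trunc_power_eq_power le)
qed

context spde
begin

text \<open>\<open>walsh_moment\<close> is applied with w the kernel damped by exp(-g s / 2), s = t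
  - r, where g makes the mass of w^2 at most 1/2 on either side of t, uniformly in t and x. Dividing
  the integrand by w cancels the kernel and leaves exp(g s / 2) \<sigma>(u); multiplied by w^2, its
  truncated power is at most q^2 exp(g k s) times a multiple of the truncated power of u.\<close>

lemma trunc_moment_renewal:
  fixes k :: nat
  shows "\<exists>B\<ge>0. \<exists>C\<ge>0. \<exists>g\<ge>0. \<forall>n>0. \<forall>t\<ge>0. \<forall>x.
    (\<integral>\<^sup>+\<omega>. ennreal (trunc_power k n (u t x \<omega>)) \<partial>M) \<le> ennreal B +
      st_int {0..<t} (\<lambda>r y. ennreal (C * (K.q (t - r) (y - x))\<^sup>2 * exp (g * (t - r))) * (\<integral>\<^sup>+\<omega>. ennreal (trunc_power k n (u r y \<omega>)) \<partial>M))"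
proof -
  obtain g where g: "g > 0" "st_int {0<..} (\<lambda>s z. ennreal (1 * (K.q s z)\<^sup>2 * exp (- g * s + c * \<bar>z\<bar>))) \<le> ennreal (1 / 2)"
    using kernel_small_st_int[of 1] by auto
  define E where "E = 4 ^ (k + 1) * 4 ^ (k + 1) * exp (moment_const k)"
  have E: "E \<ge> 0" by (simp add: E_def)
  define C where "C = E * moment_factor k * Lip ^ (2 * k + 2)"
  have C: "C \<ge> 0" using E moment_factor_nonneg[of k] Lip(1) by (simp add: C_def)
  define B where "B = E * A0 ^ (2 * k + 2)"
  have B: "B \<ge> 0" using E A0_nonneg by (simp add: B_def)
  have "(\<integral>\<^sup>+\<omega>. ennreal (trunc_power k n (u t x \<omega>)) \<partial>M) \<le> ennreal B +
      st_int {0..<t} (\<lambda>r y. ennreal (C * (K.q (t - r) (y - x))\<^sup>2 * exp (g * real k * (t - r))) * (\<integral>\<^sup>+\<omega>. ennreal (trunc_power k n (u r y \<omega>)) \<partial>M))"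
    if n: "n > 0" and t: "t \<ge> 0" for n t x
  proof -
    let ?\<phi> = "trunc_power k n"
    let ?h = "\<lambda>r y. \<integral>\<^sup>+\<omega>. ennreal (?\<phi> (u r y \<omega>)) \<partial>M"
    have \<phi>0: "?\<phi> z \<ge> 0" for z using n by (simp add: trunc_power_nonneg)
    \<comment> \<open>The integrand vanishes for \<open>r \<ge> t\<close>; there \<open>w\<close> only has to be positive and square-integrable.\<close>
    define w where "w r y = (if r = t then 1 else exp (- g * \<bar>t - r\<bar> / 2) * K.q \<bar>t - r\<bar> (y - x))" for r y
    have wm[measurable]: "(\<lambda>z. w (fst z) (snd z)) \<in> borel_measurable (borel \<Otimes>\<^sub>M borel)"
      unfolding w_def by measurable
    have wpos: "w r y > 0" for r y using K.q_pos[of "\<bar>t - r\<bar>" "y - x"] by (simp add: w_def)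
    define k1 where "k1 s z = ennreal ((exp (- g * s / 2) * K.q s z)\<^sup>2)" for s z
    have k1m: "(\<lambda>p. k1 (fst p) (snd p)) \<in> borel_measurable (borel \<Otimes>\<^sub>M borel)" unfolding k1_def by measurable
    have k1_le: "st_int {0<..} k1 \<le> ennreal (1 / 2)"
    proof (rule order_trans[OF _ g(2)], rule st_int_mono)
      fix s z :: real
      have "(exp (- g * s / 2) * K.q s z)\<^sup>2 = (K.q s z)\<^sup>2 * exp (- g * s)"
        by (simp add: power_mult_distrib power2_eq_square exp_add[symmetric])
      also have "\<dots> \<le> (K.q s z)\<^sup>2 * exp (- g * s + c * \<bar>z\<bar>)" using K.c_pos by (intro mult_left_mono) auto
      finally show "k1 s z \<le> ennreal (1 * (K.q s z)\<^sup>2 * exp (- g * s + c * \<bar>z\<bar>))" unfolding k1_def by (simp add: ennreal_leI)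
    qed
    let ?w = "\<lambda>r y. ennreal ((w r y)\<^sup>2)"
    have w2m: "(\<lambda>z. ?w (fst z) (snd z)) \<in> borel_measurable (borel \<Otimes>\<^sub>M borel)" by measurable
    have "{0..} = {0..<t} \<union> ({t} \<union> {t<..})" using t by auto
    then have "st_int {0..} ?w = st_int {0..<t} ?w + (st_int {t} ?w + st_int {t<..} ?w)"
      by (simp only:) (subst st_int_Un[OF w2m]; (subst st_int_Un[OF w2m])?; auto)
    also have "st_int {0..<t} ?w = st_int {0..<t} (\<lambda>r y. k1 (t - r) (y - x))"
      by (rule st_int_cong) (auto simp: w_def k1_def)
    also have "st_int {t<..} ?w = st_int {t<..} (\<lambda>r y. k1 (r - t) (y - x))"
      by (rule st_int_cong) (auto simp: w_def k1_def)
    also have "st_int {0..<t} (\<lambda>r y. k1 (t - r) (y - x)) + (st_int {t} ?w + st_int {t<..} (\<lambda>r y. k1 (r - t) (y - x))) \<le> ennreal (1 / 2) + (0 + ennreal (1 / 2))"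
      unfolding st_int_convolution_le(2)[OF k1m] st_int_singleton
      by (intro add_mono order_trans[OF st_int_convolution_le(1)[OF k1m]] k1_le order_refl)
    also have "\<dots> = ennreal 1" by (subst add_0, subst ennreal_plus[symmetric]) auto
    finally have K1: "st_int {0..} ?w \<le> ennreal 1" .
    obtain K' where K': "st_int {0..} ?w = ennreal K'" "K' \<ge> 0" using K1 by (cases "st_int {0..} ?w") (auto simp: top_unique)
    then have "K' \<le> 1" using K1 by simp
    have Ele: "4 ^ (k + 1) * 4 ^ (k + 1) * exp (moment_const k * K') \<le> E"
      unfolding E_def using \<open>K' \<le> 1\<close> moment_const_ge_1[of k] by (intro mult_left_mono) auto
    obtain I where I: "walsh_integral M F W (\<lambda>\<omega> r y. if r < t then p (t - r) (y - x) * \<sigma> (u r y \<omega>) else 0) I"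
      "AE \<omega> in M. u t x \<omega> = J t x + I \<omega>" by (rule sol_walsh[OF t])
    let ?S = "\<integral>\<^sup>+\<omega>. st_int {0..} (\<lambda>r y. ennreal ((w r y)\<^sup>2 * ?\<phi> ((if r < t then p (t - r) (y - x) * \<sigma> (u r y \<omega>) else 0) / w r y))) \<partial>M"
    have Gm: "(\<lambda>z. ennreal ((w (fst z) (fst (snd z)))\<^sup>2 * ?\<phi> (snd (snd z) / w (fst z) (fst (snd z))))) \<in> borel_measurable (borel \<Otimes>\<^sub>M (borel \<Otimes>\<^sub>M borel))"
    proof -
      have [measurable]: "(\<lambda>z::real \<times> real \<times> real. w (fst z) (fst (snd z))) \<in> borel_measurable (borel \<Otimes>\<^sub>M (borel \<Otimes>\<^sub>M borel))"
        unfolding w_def by measurable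
      show ?thesis by measurable
    qed
    have "?S = st_int {0..<t} (\<lambda>r y. \<integral>\<^sup>+\<omega>. ennreal ((w r y)\<^sup>2 * ?\<phi> (K.q (t - r) (y - x) * \<sigma> (u r y \<omega>) / w r y)) \<partial>M)"
      by (rule integrand_expectation[OF I(1), where G="\<lambda>r y z. ennreal ((w r y)\<^sup>2 * ?\<phi> (z / w r y))"]) (use Gm in auto)
    also have "\<dots> \<le> st_int {0..<t} (\<lambda>r y. ennreal (Lip ^ (2 * k + 2)) * (ennreal ((K.q (t - r) (y - x))\<^sup>2 * exp (g * real k * (t - r))) * (indicator {0..} r * ?h r y)))"
    proof (rule st_int_mono)
      fix r y assume r: "r \<in> {0..<t}"
      define s where "s = t - r"
      have s: "s > 0" using r by (simp add: s_def)
      have [measurable]: "u r y \<in> borel_measurable M" using r by (intro u_measurable) auto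
      have w: "w r y = exp (- g * s / 2) * K.q s (y - x)" using r by (simp add: w_def s_def)
      have qs: "K.q s (y - x) > 0" by (rule K.q_pos[OF s])
      have pt: "(w r y)\<^sup>2 * ?\<phi> (K.q s (y - x) * \<sigma> z / w r y) \<le> Lip ^ (2 * k + 2) * ((K.q s (y - x))\<^sup>2 * exp (g * real k * s)) * ?\<phi> z" for z
      proof -
        have "K.q s (y - x) * \<sigma> z / w r y = exp (g * s / 2) * \<sigma> z"
          using qs by (simp add: w exp_minus field_simps)
        also have "?\<phi> \<dots> \<le> exp (g * s / 2) ^ (2 * k + 2) * ?\<phi> (\<sigma> z)"
          using n g s by (intro trunc_power_scale) auto
        also have "\<dots> \<le> exp (g * s / 2) ^ (2 * k + 2) * (Lip ^ (2 * k + 2) * ?\<phi> z)"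
        proof (intro mult_left_mono)
          have "?\<phi> (\<sigma> z) \<le> ?\<phi> (Lip * z)" using n Lip by (intro trunc_power_mono) (auto simp: abs_mult)
          also have "\<dots> \<le> Lip ^ (2 * k + 2) * ?\<phi> z" using n Lip by (intro trunc_power_scale) auto
          finally show "?\<phi> (\<sigma> z) \<le> Lip ^ (2 * k + 2) * ?\<phi> z" .
        qed auto
        also have "exp (g * s / 2) ^ (2 * k + 2) = exp (g * s) * exp (g * real k * s)"
          by (simp add: exp_of_nat_mult[symmetric] exp_add[symmetric] algebra_simps del: power_Suc)
        finally have "(w r y)\<^sup>2 * ?\<phi> (K.q s (y - x) * \<sigma> z / w r y) \<le> (w r y)\<^sup>2 * (exp (g * s) * exp (g * real k * s) * (Lip ^ (2 * k + 2) * ?\<phi> z))"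
          by (intro mult_left_mono) auto
        also have "\<dots> = Lip ^ (2 * k + 2) * ((K.q s (y - x))\<^sup>2 * exp (g * real k * s)) * ?\<phi> z"
        proof -
          have w2: "(w r y)\<^sup>2 = exp (- (g * s)) * (K.q s (y - x))\<^sup>2"
            by (simp add: w power_mult_distrib power2_eq_square exp_add[symmetric])
          have "(w r y)\<^sup>2 * (exp (g * s) * exp (g * real k * s) * (Lip ^ (2 * k + 2) * ?\<phi> z))
            = (exp (- (g * s)) * exp (g * s)) * (Lip ^ (2 * k + 2) * ((K.q s (y - x))\<^sup>2 * exp (g * real k * s)) * ?\<phi> z)"
            unfolding w2 by (simp only: mult_ac)
          moreover have "exp (- (g * s)) * exp (g * s) = 1" by (simp add: exp_add[symmetric])
          ultimately show ?thesis by simp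
        qed
        finally show ?thesis .
      qed
      have "(\<integral>\<^sup>+\<omega>. ennreal ((w r y)\<^sup>2 * ?\<phi> (K.q s (y - x) * \<sigma> (u r y \<omega>) / w r y)) \<partial>M)
        \<le> (\<integral>\<^sup>+\<omega>. ennreal (Lip ^ (2 * k + 2) * ((K.q s (y - x))\<^sup>2 * exp (g * real k * s))) * ennreal (?\<phi> (u r y \<omega>)) \<partial>M)"
        using Lip \<phi>0 pt by (intro nn_integral_mono) (simp add: ennreal_mult[symmetric] ennreal_leI)
      also have "\<dots> = ennreal (Lip ^ (2 * k + 2) * ((K.q s (y - x))\<^sup>2 * exp (g * real k * s))) * ?h r y"
        by (rule nn_integral_cmult) measurable
      also have "\<dots> = ennreal (Lip ^ (2 * k + 2)) * (ennreal ((K.q s (y - x))\<^sup>2 * exp (g * real k * s)) * (indicator {0..} r * ?h r y))"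
        using Lip r by (subst ennreal_mult) (auto simp: mult.assoc)
      finally show "(\<integral>\<^sup>+\<omega>. ennreal ((w r y)\<^sup>2 * ?\<phi> (K.q (t - r) (y - x) * \<sigma> (u r y \<omega>) / w r y)) \<partial>M) \<le>
          ennreal (Lip ^ (2 * k + 2)) * (ennreal ((K.q (t - r) (y - x))\<^sup>2 * exp (g * real k * (t - r))) * (indicator {0..} r * ?h r y))"
        unfolding s_def .
    qed
    finally have S: "?S \<le> \<dots>" .
    have hm[measurable]: "(\<lambda>z. indicator {0..} (fst z) * ?h (fst z) (snd z)) \<in> borel_measurable (borel \<Otimes>\<^sub>M borel)"
      by (rule expect_measurable) measurable
    have "?h t x = (\<integral>\<^sup>+\<omega>. ennreal (?\<phi> (J t x + I \<omega>)) \<partial>M)"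
      using I(2) by (intro nn_integral_cong_AE) auto
    also have "\<dots> \<le> ennreal (4 ^ (k + 1) * 4 ^ (k + 1) * exp (moment_const k * K')) * (ennreal (?\<phi> (J t x)) + ennreal (moment_factor k) * ?S)"
      by (rule walsh_moment[OF I(1) wm wpos K' n])
    also have "\<dots> \<le> ennreal E * (ennreal (A0 ^ (2 * k + 2)) + ennreal (moment_factor k) * st_int {0..<t} (\<lambda>r y. ennreal (Lip ^ (2 * k + 2)) * (ennreal ((K.q (t - r) (y - x))\<^sup>2 * exp (g * real k * (t - r))) * (indicator {0..} r * ?h r y))))"
    proof (intro mult_mono add_mono mult_left_mono S ennreal_leI Ele)
      have "?\<phi> (J t x) \<le> (J t x) ^ (2 * k + 2)" using n by (intro trunc_power_le_power) auto
      also have "\<dots> \<le> A0 ^ (2 * k + 2)" using J_nonneg J_le_A0 by (intro power_mono)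
      finally show "?\<phi> (J t x) \<le> A0 ^ (2 * k + 2)" .
    qed auto
    also have "\<dots> = ennreal B + st_int {0..<t} (\<lambda>r y. (ennreal E * ennreal (moment_factor k) * ennreal (Lip ^ (2 * k + 2))) * (ennreal ((K.q (t - r) (y - x))\<^sup>2 * exp (g * real k * (t - r))) * (indicator {0..} r * ?h r y)))"
      using E A0_nonneg
      by (subst (1 2) st_int_cmult) (auto simp: distrib_left B_def ennreal_mult mult.assoc)
    also have "st_int {0..<t} (\<lambda>r y. (ennreal E * ennreal (moment_factor k) * ennreal (Lip ^ (2 * k + 2))) * (ennreal ((K.q (t - r) (y - x))\<^sup>2 * exp (g * real k * (t - r))) * (indicator {0..} r * ?h r y)))
      = st_int {0..<t} (\<lambda>r y. ennreal (C * (K.q (t - r) (y - x))\<^sup>2 * exp (g * real k * (t - r))) * ?h r y)"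
    proof (rule st_int_cong)
      fix r y assume r: "r \<in> {0..<t}"
      have "ennreal E * ennreal (moment_factor k) * ennreal (Lip ^ (2 * k + 2)) = ennreal C"
        using E moment_factor_nonneg[of k] Lip by (simp add: C_def ennreal_mult)
      moreover have "ennreal C * ennreal ((K.q (t - r) (y - x))\<^sup>2 * exp (g * real k * (t - r))) = ennreal (C * (K.q (t - r) (y - x))\<^sup>2 * exp (g * real k * (t - r)))"
        using C by (subst ennreal_mult[symmetric]) (auto simp: mult.assoc)
      ultimately show "(ennreal E * ennreal (moment_factor k) * ennreal (Lip ^ (2 * k + 2))) * (ennreal ((K.q (t - r) (y - x))\<^sup>2 * exp (g * real k * (t - r))) * (indicator {0..} r * ?h r y))
        = ennreal (C * (K.q (t - r) (y - x))\<^sup>2 * exp (g * real k * (t - r))) * ?h r y"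
        using r by (simp add: mult.assoc[symmetric])
    qed
    finally show ?thesis .
  qed
  moreover have "g * real k \<ge> 0" using g by simp
  ultimately show ?thesis using B C by blast
qed

lemma moment_bound:
  "\<exists>A\<ge>0. \<exists>\<gamma>>0. \<forall>t\<ge>0. \<forall>x. (\<integral>\<^sup>+\<omega>. ennreal ((u t x \<omega>) ^ (2 * k + 2)) \<partial>M) \<le> ennreal (A * exp (\<gamma> * t))"
proof -
  obtain B C g where B: "B \<ge> 0" and C: "C \<ge> 0" and g: "g \<ge> 0"
    and ineq: "\<forall>n>0. \<forall>t\<ge>0. \<forall>x. (\<integral>\<^sup>+\<omega>. ennreal (trunc_power k n (u t x \<omega>)) \<partial>M) \<le> ennreal B +
      st_int {0..<t} (\<lambda>r y. ennreal (C * (K.q (t - r) (y - x))\<^sup>2 * exp (g * (t - r))) * (\<integral>\<^sup>+\<omega>. ennreal (trunc_power k n (u r y \<omega>)) \<partial>M))"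
    using trunc_moment_renewal[of k] by (elim exE conjE) (rule that)
  obtain g0 where g0: "g0 > 0" "st_int {0<..} (\<lambda>s z. ennreal (C * (K.q s z)\<^sup>2 * exp (- g0 * s + c * \<bar>z\<bar>))) \<le> ennreal (1 / 2)"
    using kernel_small_st_int[OF C] by auto
  \<comment> \<open>g cancels the exponential growth of the kernel in
    \<open>trunc_moment_renewal\<close>, and g0 brings the remaining mass below 1/2.\<close>
  define \<gamma> where "\<gamma> = g0 + g"
  have \<gamma>: "\<gamma> > 0" using g0 g by (simp add: \<gamma>_def)
  have bound: "(\<integral>\<^sup>+\<omega>. ennreal (trunc_power k n (u t x \<omega>)) \<partial>M) \<le> ennreal (2 * B * exp (\<gamma> * t))" if n: "n > 0" and t: "t \<ge> 0" for n t x
  proof -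
    let ?h = "\<lambda>r y. \<integral>\<^sup>+\<omega>. ennreal (trunc_power k n (u r y \<omega>)) \<partial>M"
    obtain D where D: "\<And>s y. s \<in> {0..t} \<Longrightarrow> v s y \<le> ennreal D" using v_locally_bounded[OF t] by blast
    have "ennreal (exp (- \<gamma> * t)) * ?h t x \<le> 2 * ennreal B"
    proof (rule renewal_bound[where T=t and \<rho>="\<lambda>t x. ennreal (exp (- \<gamma> * t))" and k="\<lambda>s z. ennreal (C * (K.q s z)\<^sup>2 * exp (g * s))"
        and e="\<lambda>s z. ennreal (exp (- \<gamma> * s))" and a="\<lambda>t x. ennreal B" and B="ennreal (n ^ k) * ennreal D" and h="?h"])
      show "ennreal (exp (- \<gamma> * t)) \<le> ennreal (exp (- \<gamma> * r)) * ennreal (exp (- \<gamma> * (t - r)))" for t r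
        by (simp add: ennreal_mult[symmetric] exp_add[symmetric] algebra_simps)
      have e1: "ennreal (exp (- \<gamma> * s)) \<le> 1" if "s \<ge> 0" for s
        using \<gamma> that by (simp add: ennreal_le_1)
      show "ennreal (exp (- \<gamma> * s)) * ennreal B \<le> ennreal B" if "0 \<le> s" for s
        using mult_right_mono[OF e1[OF that], of "ennreal B"] by simp
      show "st_int {0<..} (\<lambda>s z. ennreal (C * (K.q s z)\<^sup>2 * exp (g * s)) * ennreal (exp (- \<gamma> * s))) \<le> ennreal (1 / 2)"
      proof (rule order_trans[OF _ g0(2)], rule st_int_mono)
        fix s z :: real
        have "C * (K.q s z)\<^sup>2 * exp (g * s) * exp (- \<gamma> * s) = C * (K.q s z)\<^sup>2 * exp (- g0 * s)"
          by (simp add: \<gamma>_def mult.assoc exp_add[symmetric] algebra_simps)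
        also have "\<dots> \<le> C * (K.q s z)\<^sup>2 * exp (- g0 * s + c * \<bar>z\<bar>)"
          using C K.c_pos by (intro mult_left_mono) auto
        finally show "ennreal (C * (K.q s z)\<^sup>2 * exp (g * s)) * ennreal (exp (- \<gamma> * s)) \<le> ennreal (C * (K.q s z)\<^sup>2 * exp (- g0 * s + c * \<bar>z\<bar>))"
          using C by (simp add: ennreal_mult[symmetric] ennreal_leI)
      qed
      \<comment> \<open>Quadratic growth of the truncated power is used here: the assumed L^2 bound
        makes the supremum finite. The bound depends on n, but \<open>renewal_bound\<close> uses
        only its finiteness.\<close>
      show "ennreal (exp (- \<gamma> * s)) * ?h s y \<le> ennreal (n ^ k) * ennreal D" if s: "0 \<le> s" "s \<le> t" for s y
      proof -
        have [measurable]: "u s y \<in> borel_measurable M" by (rule u_measurable[OF s(1)])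
        have "?h s y \<le> (\<integral>\<^sup>+\<omega>. ennreal (n ^ k) * ennreal ((u s y \<omega>)\<^sup>2) \<partial>M)"
          using n by (intro nn_integral_mono) (simp add: ennreal_mult[symmetric] ennreal_leI trunc_power_le_square)
        also have "\<dots> = ennreal (n ^ k) * v s y" unfolding v_def by (rule nn_integral_cmult) measurable
        also have "\<dots> \<le> ennreal (n ^ k) * ennreal D" using D s by (intro mult_left_mono) auto
        finally have "1 * ?h s y \<le> ennreal (n ^ k) * ennreal D" by simp
        then show ?thesis using mult_right_mono[OF e1[OF s(1)] zero_le, of "?h s y"] by (rule order_trans[rotated])
      qed
      show "ennreal (n ^ k) * ennreal D < \<top>" by (simp add: ennreal_mult_less_top)
    qed (use t ineq n in auto)
    then have "ennreal (exp (\<gamma> * t)) * (ennreal (exp (- \<gamma> * t)) * ?h t x) \<le> ennreal (exp (\<gamma> * t)) * (2 * ennreal B)"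
      by (intro mult_left_mono) auto
    moreover have "ennreal (exp (\<gamma> * t)) * (ennreal (exp (- \<gamma> * t)) * ?h t x) = ?h t x"
      unfolding mult.assoc[symmetric] by (subst ennreal_mult[symmetric]) (auto simp: exp_minus)
    moreover have "ennreal (exp (\<gamma> * t)) * (2 * ennreal B) = ennreal (2 * B * exp (\<gamma> * t))"
      using B by (simp add: ennreal_mult' ennreal_mult mult_ac)
    ultimately show ?thesis by simp
  qed
  have "(\<integral>\<^sup>+\<omega>. ennreal ((u t x \<omega>) ^ (2 * k + 2)) \<partial>M) \<le> ennreal (2 * B * exp (\<gamma> * t))" if t: "t \<ge> 0" for t x
  proof -
    have [measurable]: "u t x \<in> borel_measurable M" by (rule u_measurable[OF t])
    have "(\<integral>\<^sup>+\<omega>. ennreal ((u t x \<omega>) ^ (2 * k + 2)) \<partial>M) = (\<integral>\<^sup>+\<omega>. liminf (\<lambda>i. ennreal (trunc_power k (real i) (u t x \<omega>))) \<partial>M)"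
      by (intro nn_integral_cong lim_imp_Liminf[symmetric] tendsto_ennrealI trunc_power_tendsto) simp
    also have "\<dots> \<le> liminf (\<lambda>i. \<integral>\<^sup>+\<omega>. ennreal (trunc_power k (real i) (u t x \<omega>)) \<partial>M)"
      by (rule nn_integral_liminf) measurable
    also have "\<dots> \<le> ennreal (2 * B * exp (\<gamma> * t))"
    proof (rule Liminf_le)
      show "\<forall>\<^sub>F i in sequentially. (\<integral>\<^sup>+\<omega>. ennreal (trunc_power k (real i) (u t x \<omega>)) \<partial>M) \<le> ennreal (2 * B * exp (\<gamma> * t))"
        using eventually_gt_at_top[of 0] by eventually_elim (rule bound[OF _ t], simp)
    qed simp
    finally show ?thesis .
  qed
  then show ?thesis using B \<gamma> by (intro exI[of _ "2 * B"] conjI exI[of _ \<gamma>]) auto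
qed

end

section \<open>Growth of the mass ahead of a moving front\<close>

context spde
begin

definition half_mass :: "real \<Rightarrow> real \<Rightarrow> ennreal" where
  "half_mass \<alpha> t = (\<integral>\<^sup>+x. indicator {\<alpha> * t..} x * v t x \<partial>lborel)"

definition half_kernel :: "real \<Rightarrow> real \<Rightarrow> ennreal" where
  "half_kernel \<alpha> s = (\<integral>\<^sup>+z. indicator {\<alpha> * s..} z * ennreal ((K.q s z)\<^sup>2) \<partial>lborel)"

lemma indicator_half_measurable [measurable]:
  "(\<lambda>z. indicator {\<alpha> * fst z..} (snd z) :: ennreal) \<in> borel_measurable (borel \<Otimes>\<^sub>M borel :: (real \<times> real) measure)"
proof -
  have "(\<lambda>z. indicator {\<alpha> * fst z..} (snd z) :: ennreal) = indicator {z :: real \<times> real. \<alpha> * fst z \<le> snd z}"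
    by (auto simp: indicator_def)
  moreover have "{z :: real \<times> real. \<alpha> * fst z \<le> snd z} \<in> sets (borel \<Otimes>\<^sub>M borel)"
  proof -
    have "(\<lambda>z :: real \<times> real. snd z - \<alpha> * fst z) \<in> borel_measurable (borel \<Otimes>\<^sub>M borel)" by measurable
    from measurable_sets[OF this, of "{0..}"] show ?thesis by (simp add: space_pair_measure vimage_def)
  qed
  ultimately show ?thesis by simp
qed

lemma half_kernel_measurable [measurable]: "half_kernel \<alpha> \<in> borel_measurable borel"
proof -
  have "(\<lambda>(s, z). indicator {\<alpha> * s..} z * ennreal ((K.q s z)\<^sup>2)) \<in> borel_measurable (borel \<Otimes>\<^sub>M lborel)"
    using indicator_half_measurable[of \<alpha>] unfolding split_beta by (simp cong: measurable_cong_sets)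
  then show ?thesis unfolding half_kernel_def[abs_def] by (rule lborel.borel_measurable_nn_integral)
qed

lemma half_mass_measurable [measurable]: "(\<lambda>t. indicator {0..} t * half_mass \<alpha> t) \<in> borel_measurable borel"
proof -
  have "(\<lambda>(t, x). indicator {\<alpha> * t..} x * (indicator {0..} t * v t x)) \<in> borel_measurable (borel \<Otimes>\<^sub>M lborel)"
    using borel_measurable_times_ennreal[OF indicator_half_measurable[of \<alpha>] v_measurable] unfolding split_beta
    by (simp cong: measurable_cong_sets)
  then have "(\<lambda>t. \<integral>\<^sup>+x. indicator {\<alpha> * t..} x * (indicator {0..} t * v t x) \<partial>lborel) \<in> borel_measurable borel"
    by (rule lborel.borel_measurable_nn_integral)
  then show ?thesis
    by (rule measurable_cong[THEN iffD1, rotated]) (auto simp: half_mass_def indicator_def)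
qed

text \<open>The contribution of the initial datum to the mass ahead of the front. The indicators of
  positive times are those of \<open>J_measurable\<close>.\<close>

definition source_mass :: "real \<Rightarrow> real \<Rightarrow> ennreal" where
  "source_mass \<alpha> t = (\<integral>\<^sup>+x. indicator {\<alpha> * t..} x * (indicator {0<..} t * ennreal (J t x) * (indicator {0<..} t * ennreal (J t x))) \<partial>lborel)"

lemma source_mass_measurable [measurable]: "source_mass \<alpha> \<in> borel_measurable borel"
proof -
  have "(\<lambda>(t, x). indicator {\<alpha> * t..} x * (indicator {0<..} t * ennreal (J t x) * (indicator {0<..} t * ennreal (J t x)))) \<in> borel_measurable (borel \<Otimes>\<^sub>M lborel)"
    using borel_measurable_times_ennreal[OF indicator_half_measurable[of \<alpha>] borel_measurable_times_ennreal[OF J_measurable J_measurable]]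
    unfolding split_beta by (simp cong: measurable_cong_sets)
  then show ?thesis unfolding source_mass_def[abs_def] by (rule lborel.borel_measurable_nn_integral)
qed

text \<open>J is positive everywhere, so a unit interval ahead of the front already carries
  mass.\<close>

lemma source_mass_pos:
  assumes t: "t > 0"
  shows "source_mass \<alpha> t > 0"
proof (rule ccontr)
  assume "\<not> source_mass \<alpha> t > 0"
  then have 0: "source_mass \<alpha> t = 0" by simp
  have m: "(\<lambda>x. indicator {0<..} t * ennreal (J t x)) \<in> borel_measurable borel"
    using measurable_compose[OF measurable_Pair1' J_measurable, of t] by simp
  have "AE x in lborel. indicator {\<alpha> * t..} x * (indicator {0<..} t * ennreal (J t x) * (indicator {0<..} t * ennreal (J t x))) = 0"
    using 0 m unfolding source_mass_def by (subst (asm) nn_integral_0_iff_AE) auto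
  then have "AE x in lborel. x \<notin> {\<alpha> * t<..<\<alpha> * t + 1}"
    using t J_pos[OF t] by (auto elim!: eventually_mono simp: indicator_def ennreal_eq_0_iff not_less[symmetric] split: if_splits)
  then have "emeasure lborel {\<alpha> * t<..<\<alpha> * t + 1} = 0"
    by (subst (asm) AE_iff_measurable[of "{\<alpha> * t<..<\<alpha> * t + 1}"]) auto
  then show False by simp
qed

text \<open>A point \<open>y \<ge> \<alpha> * r\<close> with \<open>x - y \<ge> \<alpha> * (t - r)\<close> forces \<open>x \<ge> \<alpha> * t\<close>: this makes the mass
  ahead of the front \<open>\<alpha> * t\<close> satisfy a renewal inequality of its own.\<close>

lemma half_mass_renewal:
  assumes t: "t > 0"
  shows "source_mass \<alpha> t + ennreal (ell\<^sup>2) * (\<integral>\<^sup>+r. indicator {0..<t} r * (half_kernel \<alpha> (t - r) * (indicator {0..} r * half_mass \<alpha> r)) \<partial>lborel) \<le> half_mass \<alpha> t"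
proof -
  define H where "H x r y = indicator {\<alpha> * t..} x * (ennreal (ell\<^sup>2 * (K.q (t - r) (y - x))\<^sup>2) * (indicator {0..} r * v r y))" for x r y
  have v1[measurable]: "(\<lambda>y. indicator {0..} r * v r y) \<in> borel_measurable borel" for r
    using measurable_compose[OF measurable_Pair1' v_measurable, of r] by simp
  have v2[measurable]: "(\<lambda>z. indicator {0..} (fst (snd z)) * v (fst (snd z)) (snd (snd z))) \<in> borel_measurable (borel \<Otimes>\<^sub>M (borel \<Otimes>\<^sub>M borel))"
    by (rule measurable_compose[OF measurable_snd v_measurable])
  have Hm[measurable]: "(\<lambda>z. H (fst z) (fst (snd z)) (snd (snd z))) \<in> borel_measurable (borel \<Otimes>\<^sub>M (borel \<Otimes>\<^sub>M borel))"
    unfolding H_def by measurable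
  have Hl: "(\<lambda>z. H (fst z) (fst (snd z)) (snd (snd z))) \<in> borel_measurable (lborel \<Otimes>\<^sub>M (borel \<Otimes>\<^sub>M borel))"
    using Hm measurable_cong_sets[OF sets_pair_measure_cong[OF sets_lborel refl] refl] by blast
  have Jm: "(\<lambda>x. indicator {0<..} t * ennreal (J t x)) \<in> borel_measurable borel"
    using measurable_compose[OF measurable_Pair1' J_measurable, of t] by simp
  have stm: "(\<lambda>x. st_int {0..<t} (H x)) \<in> borel_measurable borel"
    by (rule st_int_measurable[OF Hm]) simp
  have "source_mass \<alpha> t + (\<integral>\<^sup>+x. st_int {0..<t} (H x) \<partial>lborel)
    = (\<integral>\<^sup>+x. indicator {\<alpha> * t..} x * (indicator {0<..} t * ennreal (J t x) * (indicator {0<..} t * ennreal (J t x))) + st_int {0..<t} (H x) \<partial>lborel)"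
    unfolding source_mass_def using Jm stm by (subst nn_integral_add) auto
  also have "\<dots> \<le> half_mass \<alpha> t"
    unfolding half_mass_def
  proof (rule nn_integral_mono)
    fix x
    show "indicator {\<alpha> * t..} x * (indicator {0<..} t * ennreal (J t x) * (indicator {0<..} t * ennreal (J t x))) + st_int {0..<t} (H x) \<le> indicator {\<alpha> * t..} x * v t x"
    proof (cases "x \<ge> \<alpha> * t")
      case True
      have "st_int {0..<t} (H x) = st_int {0..<t} (\<lambda>r y. ennreal (ell\<^sup>2 * (K.q (t - r) (y - x))\<^sup>2) * v r y)"
        by (rule st_int_cong) (use True in \<open>auto simp: H_def\<close>)
      then show ?thesis using v_lower[of t x] t True J_nonneg[of t x] by (simp add: ennreal_mult power2_eq_square)
    next
      case False
      then have "st_int {0..<t} (H x) = st_int {0..<t} (\<lambda>r y. 0)" by (intro st_int_cong) (auto simp: H_def)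
      then show ?thesis using False by (simp add: st_int_def)
    qed
  qed
  also have "(\<integral>\<^sup>+x. st_int {0..<t} (H x) \<partial>lborel) = st_int {0..<t} (\<lambda>r y. \<integral>\<^sup>+x. H x r y \<partial>lborel)"
    by (rule st_int_swap[OF sigma_finite_lborel Hl]) simp
  finally have 1: "source_mass \<alpha> t + st_int {0..<t} (\<lambda>r y. \<integral>\<^sup>+x. H x r y \<partial>lborel) \<le> half_mass \<alpha> t" .
  have "ennreal (ell\<^sup>2) * (\<integral>\<^sup>+r. indicator {0..<t} r * (half_kernel \<alpha> (t - r) * (indicator {0..} r * half_mass \<alpha> r)) \<partial>lborel)
    = (\<integral>\<^sup>+r. ennreal (ell\<^sup>2) * (indicator {0..<t} r * (half_kernel \<alpha> (t - r) * (indicator {0..} r * half_mass \<alpha> r))) \<partial>lborel)"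
    by (rule nn_integral_cmult[symmetric]) measurable
  also have "\<dots> \<le> st_int {0..<t} (\<lambda>r y. \<integral>\<^sup>+x. H x r y \<partial>lborel)"
    unfolding st_int_def
  proof (rule nn_integral_mono)
    fix r :: real
    show "ennreal (ell\<^sup>2) * (indicator {0..<t} r * (half_kernel \<alpha> (t - r) * (indicator {0..} r * half_mass \<alpha> r))) \<le> (\<integral>\<^sup>+y. indicator {0..<t} r * (\<integral>\<^sup>+x. H x r y \<partial>lborel) \<partial>lborel)"
    proof (cases "r \<in> {0..<t}")
      case True
      have hm: "half_mass \<alpha> r = (\<integral>\<^sup>+y. indicator {\<alpha> * r..} y * (indicator {0..} r * v r y) \<partial>lborel)"
        unfolding half_mass_def using True by (intro nn_integral_cong) auto
      have "ennreal (ell\<^sup>2) * (half_kernel \<alpha> (t - r) * half_mass \<alpha> r)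
        = (\<integral>\<^sup>+y. (ennreal (ell\<^sup>2) * half_kernel \<alpha> (t - r)) * (indicator {\<alpha> * r..} y * (indicator {0..} r * v r y)) \<partial>lborel)"
        unfolding hm by (subst nn_integral_cmult) (auto simp: mult.assoc)
      also have "\<dots> \<le> (\<integral>\<^sup>+y. \<integral>\<^sup>+x. H x r y \<partial>lborel \<partial>lborel)"
      proof (rule nn_integral_mono)
        fix y
        show "(ennreal (ell\<^sup>2) * half_kernel \<alpha> (t - r)) * (indicator {\<alpha> * r..} y * (indicator {0..} r * v r y)) \<le> (\<integral>\<^sup>+x. H x r y \<partial>lborel)"
        proof (cases "y \<ge> \<alpha> * r")
          case y: True
          have "half_kernel \<alpha> (t - r) = (\<integral>\<^sup>+x. indicator {\<alpha> * (t - r)..} (x - y) * ennreal ((K.q (t - r) (x - y))\<^sup>2) \<partial>lborel)"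
            unfolding half_kernel_def by (rule nn_integral_shift[symmetric]) measurable
          also have "\<dots> \<le> (\<integral>\<^sup>+x. indicator {\<alpha> * t..} x * ennreal ((K.q (t - r) (y - x))\<^sup>2) \<partial>lborel)"
          proof (rule nn_integral_mono)
            fix x
            have "K.q (t - r) (x - y) = K.q (t - r) (y - x)" using K.q_even[of "t - r" "y - x"] by simp
            moreover have "x \<ge> \<alpha> * t" if "x - y \<ge> \<alpha> * (t - r)" using that y by (simp add: algebra_simps)
            ultimately show "indicator {\<alpha> * (t - r)..} (x - y) * ennreal ((K.q (t - r) (x - y))\<^sup>2) \<le> indicator {\<alpha> * t..} x * ennreal ((K.q (t - r) (y - x))\<^sup>2)"
              by (auto simp: indicator_def)
          qed
          finally have "(ennreal (ell\<^sup>2) * half_kernel \<alpha> (t - r)) * (indicator {0..} r * v r y)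
            \<le> (ennreal (ell\<^sup>2) * (\<integral>\<^sup>+x. indicator {\<alpha> * t..} x * ennreal ((K.q (t - r) (y - x))\<^sup>2) \<partial>lborel)) * (indicator {0..} r * v r y)"
            by (intro mult_right_mono mult_left_mono) auto
          also have "\<dots> = (ennreal (ell\<^sup>2) * (indicator {0..} r * v r y)) * (\<integral>\<^sup>+x. indicator {\<alpha> * t..} x * ennreal ((K.q (t - r) (y - x))\<^sup>2) \<partial>lborel)"
            by (simp only: mult_ac)
          also have "\<dots> = (\<integral>\<^sup>+x. (ennreal (ell\<^sup>2) * (indicator {0..} r * v r y)) * (indicator {\<alpha> * t..} x * ennreal ((K.q (t - r) (y - x))\<^sup>2)) \<partial>lborel)"
            by (rule nn_integral_cmult[symmetric]) measurable
          also have "\<dots> = (\<integral>\<^sup>+x. H x r y \<partial>lborel)"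
            unfolding H_def by (intro nn_integral_cong) (simp add: ennreal_mult mult_ac)
          finally show ?thesis using y by simp
        qed simp
      qed
      finally show ?thesis using True by simp
    qed simp
  qed
  finally show ?thesis using 1 by (meson add_left_mono order_trans)
qed

text \<open>The Laplace transform turns the renewal inequality into Jh + ell^2 Th Mh <= Mh. With
  ell^2 Th >= 1 this gives Jh + Mh <= Mh, and Jh > 0 leaves only Mh infinite.\<close>

lemma laplace_half_mass_infinite:
  assumes \<alpha>: "\<alpha> > 0" and ren: "1 \<le> ennreal (ell\<^sup>2) * (\<integral>\<^sup>+s. indicator {0<..} s * (ennreal (exp (- \<beta> * s)) * half_kernel \<alpha> s) \<partial>lborel)"
  shows "(\<integral>\<^sup>+t. indicator {0<..} t * (ennreal (exp (- \<beta> * t)) * (indicator {0..} t * half_mass \<alpha> t)) \<partial>lborel) = \<infinity>"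
proof -
  define Mh where "Mh = (\<integral>\<^sup>+t. indicator {0<..} t * (ennreal (exp (- \<beta> * t)) * (indicator {0..} t * half_mass \<alpha> t)) \<partial>lborel)"
  define Jh where "Jh = (\<integral>\<^sup>+t. indicator {0<..} t * (ennreal (exp (- \<beta> * t)) * source_mass \<alpha> t) \<partial>lborel)"
  define Th where "Th = (\<integral>\<^sup>+s. indicator {0<..} s * (ennreal (exp (- \<beta> * s)) * half_kernel \<alpha> s) \<partial>lborel)"
  define m where "m r = indicator {0..} r * half_mass \<alpha> r" for r
  have m[measurable]: "m \<in> borel_measurable borel" unfolding m_def by measurable
  \<comment> \<open>exp(-\<beta> t) is distributed as exp(-\<beta> (t - r)) exp(-\<beta> r), one
    part for the kernel and one for the mass, so that Tonelli yields the product of the two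
    transforms.\<close>
  define N where "N t r = indicator {0<..} (t - r) * (ennreal (exp (- \<beta> * (t - r))) * half_kernel \<alpha> (t - r)) * (ennreal (exp (- \<beta> * r)) * m r)" for t r
  have Nm: "(\<lambda>(t, r). N t r) \<in> borel_measurable (lborel \<Otimes>\<^sub>M lborel)"
    unfolding N_def split_beta by measurable
  have [measurable]: "(\<lambda>t. \<integral>\<^sup>+r. N t r \<partial>lborel) \<in> borel_measurable lborel"
    by (rule lborel.borel_measurable_nn_integral[OF Nm])
  have Mr: "Mh = (\<integral>\<^sup>+r. ennreal (exp (- \<beta> * r)) * m r \<partial>lborel)"
    unfolding Mh_def m_def using AE_lborel_singleton[of 0] by (intro nn_integral_cong_AE) (auto elim!: eventually_mono simp: indicator_def)
  have "(\<integral>\<^sup>+t. \<integral>\<^sup>+r. N t r \<partial>lborel \<partial>lborel) = (\<integral>\<^sup>+r. \<integral>\<^sup>+t. N t r \<partial>lborel \<partial>lborel)"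
    by (rule lborel_pair.Fubini'[OF Nm, symmetric])
  also have "\<dots> = (\<integral>\<^sup>+r. Th * (ennreal (exp (- \<beta> * r)) * m r) \<partial>lborel)"
  proof (rule nn_integral_cong)
    fix r :: real
    have "(\<integral>\<^sup>+t. N t r \<partial>lborel) = (\<integral>\<^sup>+t. indicator {0<..} (t - r) * (ennreal (exp (- \<beta> * (t - r))) * half_kernel \<alpha> (t - r)) \<partial>lborel) * (ennreal (exp (- \<beta> * r)) * m r)"
      unfolding N_def by (rule nn_integral_multc) measurable
    also have "(\<integral>\<^sup>+t. indicator {0<..} (t - r) * (ennreal (exp (- \<beta> * (t - r))) * half_kernel \<alpha> (t - r)) \<partial>lborel) = Th"
      unfolding Th_def by (rule nn_integral_shift) measurable
    finally show "(\<integral>\<^sup>+t. N t r \<partial>lborel) = Th * (ennreal (exp (- \<beta> * r)) * m r)" .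
  qed
  also have "\<dots> = Th * Mh" unfolding Mr by (rule nn_integral_cmult) measurable
  finally have NT: "(\<integral>\<^sup>+t. \<integral>\<^sup>+r. N t r \<partial>lborel \<partial>lborel) = Th * Mh" .
  have "Jh + ennreal (ell\<^sup>2) * (Th * Mh) = (\<integral>\<^sup>+t. indicator {0<..} t * (ennreal (exp (- \<beta> * t)) * source_mass \<alpha> t) + ennreal (ell\<^sup>2) * (\<integral>\<^sup>+r. N t r \<partial>lborel) \<partial>lborel)"
    unfolding Jh_def NT[symmetric] by (simp add: nn_integral_add nn_integral_cmult)
  also have "\<dots> \<le> Mh"
    unfolding Mh_def
  proof (rule nn_integral_mono)
    fix t :: real
    show "indicator {0<..} t * (ennreal (exp (- \<beta> * t)) * source_mass \<alpha> t) + ennreal (ell\<^sup>2) * (\<integral>\<^sup>+r. N t r \<partial>lborel)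
      \<le> indicator {0<..} t * (ennreal (exp (- \<beta> * t)) * (indicator {0..} t * half_mass \<alpha> t))"
    proof (cases "t > 0")
      case True
      have "N t r = ennreal (exp (- \<beta> * t)) * (indicator {0..<t} r * (half_kernel \<alpha> (t - r) * m r))" for r
      proof -
        have "ennreal (exp (- \<beta> * (t - r))) * ennreal (exp (- \<beta> * r)) = ennreal (exp (- \<beta> * t))"
          by (simp add: ennreal_mult[symmetric] exp_add[symmetric] algebra_simps)
        then have "N t r = indicator {0<..} (t - r) * (ennreal (exp (- \<beta> * t)) * (half_kernel \<alpha> (t - r) * m r))"
        proof -
          have "N t r = indicator {0<..} (t - r) * ((ennreal (exp (- \<beta> * (t - r))) * ennreal (exp (- \<beta> * r))) * (half_kernel \<alpha> (t - r) * m r))"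
            unfolding N_def by (simp only: mult_ac)
          then show ?thesis unfolding \<open>ennreal (exp (- \<beta> * (t - r))) * ennreal (exp (- \<beta> * r)) = ennreal (exp (- \<beta> * t))\<close> .
        qed
        then show ?thesis by (auto simp: indicator_def m_def)
      qed
      then have "(\<integral>\<^sup>+r. N t r \<partial>lborel) = ennreal (exp (- \<beta> * t)) * (\<integral>\<^sup>+r. indicator {0..<t} r * (half_kernel \<alpha> (t - r) * m r) \<partial>lborel)"
        by (simp add: nn_integral_cmult)
      then have "ennreal (exp (- \<beta> * t)) * source_mass \<alpha> t + ennreal (ell\<^sup>2) * (\<integral>\<^sup>+r. N t r \<partial>lborel)
        = ennreal (exp (- \<beta> * t)) * (source_mass \<alpha> t + ennreal (ell\<^sup>2) * (\<integral>\<^sup>+r. indicator {0..<t} r * (half_kernel \<alpha> (t - r) * m r) \<partial>lborel))"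
        by (simp add: distrib_left mult.left_commute)
      also have "\<dots> \<le> ennreal (exp (- \<beta> * t)) * half_mass \<alpha> t"
        using half_mass_renewal[OF True, of \<alpha>] unfolding m_def by (intro mult_left_mono) auto
      finally show ?thesis using True by simp
    next
      case False
      then have "N t r = 0" for r by (auto simp: N_def m_def indicator_def)
      then show ?thesis using False by simp
    qed
  qed
  finally have "Jh + ennreal (ell\<^sup>2) * (Th * Mh) \<le> Mh" .
  moreover have "1 * Mh \<le> (ennreal (ell\<^sup>2) * Th) * Mh" using ren unfolding Th_def by (intro mult_right_mono) auto
  then have "Jh + Mh \<le> Jh + ennreal (ell\<^sup>2) * (Th * Mh)" unfolding mult.assoc mult_1 by (rule add_left_mono)
  ultimately have le: "Jh + Mh \<le> Mh" by (rule order_trans[rotated])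
  have Jh: "Jh \<noteq> 0"
  proof
    assume "Jh = 0"
    then have "AE t in lborel. indicator {0<..} t * (ennreal (exp (- \<beta> * t)) * source_mass \<alpha> t) = 0"
      unfolding Jh_def by (subst (asm) nn_integral_0_iff_AE) auto
    then have "AE t in lborel. t \<notin> {0<..<1::real}"
    proof eventually_elim
      case (elim t)
      show ?case
      proof
        assume "t \<in> {0<..<1}"
        then have "ennreal (exp (- \<beta> * t)) * source_mass \<alpha> t = 0" "source_mass \<alpha> t > 0"
          using elim source_mass_pos[of t \<alpha>] by auto
        then show False by (simp add: ennreal_eq_0_iff)
      qed
    qed
    then have "emeasure lborel {0<..<1::real} = 0" by (subst (asm) AE_iff_measurable[of "{0<..<1}"]) auto
    then show False by simp
  qed
  have "Mh = \<infinity>"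
  proof (rule ccontr)
    assume "Mh \<noteq> \<infinity>"
    then obtain a where a: "Mh = ennreal a" "a \<ge> 0" by (cases Mh) auto
    obtain b where b: "Jh = ennreal b" "b \<ge> 0" using le a by (cases Jh) (auto simp: top_unique)
    have "b + a \<le> a" using le a b by (simp add: ennreal_plus[symmetric] del: ennreal_plus)
    then show False using Jh b by simp
  qed
  then show ?thesis unfolding Mh_def .
qed

text \<open>Ahead of the front the second moment grows at most at rate \<beta> / 2, and beyond a
  point linear in t its spatial decay takes over. The mass is therefore of order t exp(\<beta> t /
  2) at most.\<close>

lemma laplace_half_mass_finite:
  assumes \<alpha>: "\<alpha> > 0" and \<beta>: "\<beta> > 0" and t1: "t1 \<ge> 0"
    and small: "\<And>t x. t \<ge> t1 \<Longrightarrow> x \<ge> \<alpha> * t \<Longrightarrow> v t x \<le> ennreal (2 * exp (\<beta> / 2 * t))"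
  shows "(\<integral>\<^sup>+t. indicator {0<..} t * (ennreal (exp (- \<beta> * t)) * (indicator {0..} t * half_mass \<alpha> t)) \<partial>lborel) < \<infinity>"
proof -
  obtain A \<gamma> where A: "A \<ge> 0" "\<gamma> > 0" "\<And>t x. t \<ge> 0 \<Longrightarrow> v t x \<le> ennreal (A * exp (\<gamma> * t - c * \<bar>x\<bar>))"
    using second_moment_bound by blast
  have c: "c > 0" by (rule K.c_pos)
  \<comment> \<open>The second entry covers the times before t1 through the global second moment
    bound.\<close>
  define C1 where "C1 = max 2 (A * exp (\<gamma> * t1))"
  have C1: "C1 \<ge> 2" "C1 \<ge> A * exp (\<gamma> * t1)" by (auto simp: C1_def)
  \<comment> \<open>At x = B t the bound A exp(\<gamma> t - c x) has dropped to A; beyond it the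
    integral in x is at most A / c.\<close>
  define B where "B = \<gamma> / c"
  have B: "B > 0" using A c by (simp add: B_def)
  define D where "D = C1 * B * (4 / \<beta>) + A / c"
  have D: "D \<ge> 0" using C1 B \<beta> A c by (auto simp: D_def intro!: add_nonneg_nonneg)
  have mid: "v t x \<le> ennreal (C1 * exp (\<beta> / 2 * t))" if "t > 0" "x \<ge> \<alpha> * t" for t x
  proof (cases "t \<ge> t1")
    case True
    then show ?thesis using C1(1) by (intro order_trans[OF small[OF _ that(2)]] ennreal_leI) auto
  next
    case False
    have "A * exp (\<gamma> * t - c * \<bar>x\<bar>) \<le> A * exp (\<gamma> * t1)"
    proof (intro mult_left_mono A)
      have "\<gamma> * t \<le> \<gamma> * t1" using False A by simp
      moreover have "0 \<le> c * \<bar>x\<bar>" using c by simp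
      ultimately show "exp (\<gamma> * t - c * \<bar>x\<bar>) \<le> exp (\<gamma> * t1)" by simp
    qed
    also have "\<dots> \<le> C1 * 1" using C1 by simp
    also have "\<dots> \<le> C1 * exp (\<beta> / 2 * t)" using C1 \<beta> that by (intro mult_left_mono) auto
    finally show ?thesis using A(3)[of t x] that by (meson ennreal_leI less_imp_le order_trans)
  qed
  have hm: "half_mass \<alpha> t \<le> ennreal (D * exp (3 / 4 * \<beta> * t))" if t: "t > 0" for t
  proof -
    have "half_mass \<alpha> t \<le> (\<integral>\<^sup>+x. ennreal (C1 * exp (\<beta> / 2 * t)) * indicator {0..B * t} x
       + ennreal A * (indicator {0<..} (x - B * t) * ennreal (exp (- c * (x - B * t)))) \<partial>lborel)"
      unfolding half_mass_def
    proof (rule nn_integral_mono)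
      fix x
      show "indicator {\<alpha> * t..} x * v t x \<le> ennreal (C1 * exp (\<beta> / 2 * t)) * indicator {0..B * t} x
         + ennreal A * (indicator {0<..} (x - B * t) * ennreal (exp (- c * (x - B * t))))"
      proof (cases "x \<ge> \<alpha> * t")
        case True
        then have x0: "x \<ge> 0" using \<alpha> t by (meson less_imp_le mult_nonneg_nonneg order_trans)
        show ?thesis
        proof (cases "x \<le> B * t")
          case le: True
          then show ?thesis using mid[OF t True] x0 True by (simp add: add_increasing2)
        next
          case False
          have "\<gamma> * t - c * \<bar>x\<bar> = - c * (x - B * t)" using x0 c by (simp add: B_def algebra_simps)
          then have "v t x \<le> ennreal A * ennreal (exp (- c * (x - B * t)))"
            using A(3)[of t x] A(1) t by (simp add: ennreal_mult[symmetric])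
          then show ?thesis using True False by (simp add: add_increasing)
        qed
      qed simp
    qed
    also have "\<dots> = ennreal (C1 * exp (\<beta> / 2 * t)) * ennreal (B * t) + ennreal A * ennreal (1 / c)"
    proof -
      have "(\<integral>\<^sup>+x. indicator {0<..} (x - B * t) * ennreal (exp (- c * (x - B * t))) \<partial>lborel) = ennreal (1 / c)"
        using nn_integral_exp_Ioi[OF c] by (subst nn_integral_shift) auto
      moreover have "0 \<le> B * t" using B t by simp
      ultimately show ?thesis by (simp add: nn_integral_add nn_integral_cmult)
    qed
    also have "\<dots> = ennreal (C1 * exp (\<beta> / 2 * t) * (B * t) + A / c)"
      using C1 B t A c by (simp add: ennreal_mult[symmetric] ennreal_plus[symmetric] del: ennreal_plus)
    also have "\<dots> \<le> ennreal (D * exp (3 / 4 * \<beta> * t))"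
    proof (rule ennreal_leI)
      \<comment> \<open>The stretch up to B t costs a factor t, paid for by exp(\<beta> t / 4). The
        total rate 3 \<beta> / 4 stays below \<beta>.\<close>
      have "\<beta> / 4 * t \<le> exp (\<beta> / 4 * t)" using exp_ge_add_one_self[of "\<beta> / 4 * t"] by linarith
      then have "t \<le> 4 / \<beta> * exp (\<beta> / 4 * t)" using \<beta> by (simp add: field_simps)
      then have "C1 * exp (\<beta> / 2 * t) * (B * t) \<le> C1 * exp (\<beta> / 2 * t) * (B * (4 / \<beta> * exp (\<beta> / 4 * t)))"
        using C1 B by (intro mult_left_mono) auto
      also have "\<dots> = C1 * B * (4 / \<beta>) * (exp (\<beta> / 2 * t) * exp (\<beta> / 4 * t))" by (simp only: mult_ac)
      also have "exp (\<beta> / 2 * t) * exp (\<beta> / 4 * t) = exp (3 / 4 * \<beta> * t)" by (simp add: exp_add[symmetric] algebra_simps)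
      finally have 1: "C1 * exp (\<beta> / 2 * t) * (B * t) \<le> C1 * B * (4 / \<beta>) * exp (3 / 4 * \<beta> * t)" .
      have "A / c * 1 \<le> A / c * exp (3 / 4 * \<beta> * t)" using A c \<beta> t by (intro mult_left_mono) auto
      then show "C1 * exp (\<beta> / 2 * t) * (B * t) + A / c \<le> D * exp (3 / 4 * \<beta> * t)"
        using 1 by (simp only: D_def distrib_right)
    qed
    finally show ?thesis .
  qed
  have "(\<integral>\<^sup>+t. indicator {0<..} t * (ennreal (exp (- \<beta> * t)) * (indicator {0..} t * half_mass \<alpha> t)) \<partial>lborel)
    \<le> (\<integral>\<^sup>+t. ennreal D * (indicator {0<..} t * ennreal (exp (- (\<beta> / 4) * t))) \<partial>lborel)"
  proof (rule nn_integral_mono)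
    fix t :: real
    show "indicator {0<..} t * (ennreal (exp (- \<beta> * t)) * (indicator {0..} t * half_mass \<alpha> t)) \<le> ennreal D * (indicator {0<..} t * ennreal (exp (- (\<beta> / 4) * t)))"
    proof (cases "t > 0")
      case True
      have "ennreal (exp (- \<beta> * t)) * half_mass \<alpha> t \<le> ennreal (exp (- \<beta> * t)) * ennreal (D * exp (3 / 4 * \<beta> * t))"
        by (intro mult_left_mono hm True) auto
      also have "\<dots> = ennreal (D * (exp (- \<beta> * t) * exp (3 / 4 * \<beta> * t)))"
        using D by (subst ennreal_mult[symmetric]) (auto simp: mult_ac)
      also have "exp (- \<beta> * t) * exp (3 / 4 * \<beta> * t) = exp (- (\<beta> / 4) * t)" by (simp add: exp_add[symmetric])
      finally show ?thesis using True D by (simp add: ennreal_mult)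
    qed simp
  qed
  also have "\<dots> = ennreal D * ennreal (1 / (\<beta> / 4))"
    using nn_integral_exp_Ioi[of "\<beta> / 4"] \<beta> by (subst nn_integral_cmult) auto
  also have "\<dots> < \<infinity>" by (simp add: ennreal_mult_less_top)
  finally show ?thesis .
qed

end

section \<open>Growth indices\<close>

lemma eln_le_imp_le:
  assumes "eln a \<le> ereal y"
  shows "a \<le> ennreal (exp y)"
proof (cases a)
  case (real r)
  show ?thesis
  proof (cases "r = 0")
    case False
    then have "ln r \<le> y" using assms real by (auto simp: eln_def ennreal_eq_0_iff)
    then have "r \<le> exp y" using False real by (metis exp_ln exp_le_cancel_iff less_eq_real_def)
    then show ?thesis using real by (simp add: ennreal_leI)
  qed (simp add: real)
next
  case top
  then show ?thesis using assms by (simp add: eln_def)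
qed

lemma le_imp_eln_le:
  assumes "a \<le> ennreal (exp y)"
  shows "eln a \<le> ereal y"
proof (cases a)
  case (real r)
  show ?thesis
  proof (cases "r = 0")
    case False
    then have "r > 0" "r \<le> exp y" using real assms by auto
    then have "ln r \<le> y" by (metis ln_exp ln_le_cancel_iff exp_gt_zero)
    then show ?thesis using \<open>r > 0\<close> real by (simp add: eln_def ennreal_eq_0_iff)
  qed (simp add: real eln_def)
next
  case top
  then show ?thesis using assms by (simp add: top_unique)
qed

lemma growth_limsup_mono:
  assumes "0 < \<alpha>'" "\<alpha>' \<le> \<alpha>"
  shows "growth_limsup M u \<nu> \<alpha> \<le> growth_limsup M u \<nu> \<alpha>'"
  unfolding growth_limsup_def
proof (rule Limsup_mono)
  show "\<forall>\<^sub>F t in at_top. ereal (1 / t) * (SUP x\<in>{x. \<alpha> * t \<le> \<bar>x\<bar>}. eln (moment M u \<nu> t x))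
    \<le> ereal (1 / t) * (SUP x\<in>{x. \<alpha>' * t \<le> \<bar>x\<bar>}. eln (moment M u \<nu> t x))"
    using eventually_gt_at_top[of 0]
  proof eventually_elim
    case (elim t)
    then have "\<alpha>' * t \<le> \<alpha> * t" using assms by (intro mult_right_mono) auto
    then have "{x. \<alpha> * t \<le> \<bar>x\<bar>} \<subseteq> {x. \<alpha>' * t \<le> \<bar>x\<bar>}" by auto
    then show ?case using elim by (intro ereal_mult_left_mono SUP_subset_mono) auto
  qed
qed

text \<open>Below the level K the power is compared with the square, above it with the m-th power. K
  is free and will grow exponentially in time.\<close>

lemma powr_interpolation:
  fixes z K :: real
  assumes K: "K > 0" and \<nu>: "2 \<le> \<nu>" "\<nu> \<le> real m"
  shows "\<bar>z\<bar> powr \<nu> \<le> K powr (\<nu> - 2) * z\<^sup>2 + K powr (\<nu> - real m) * \<bar>z\<bar> ^ m"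
proof (cases "z = 0")
  case False
  then have z: "\<bar>z\<bar> > 0" by simp
  have split: "\<bar>z\<bar> powr \<nu> = \<bar>z\<bar> powr (\<nu> - b) * \<bar>z\<bar> powr b" for b by (simp add: powr_add[symmetric])
  show ?thesis
  proof (cases "\<bar>z\<bar> \<le> K")
    case True
    have "\<bar>z\<bar> powr \<nu> = \<bar>z\<bar> powr (\<nu> - 2) * z\<^sup>2" using split[of 2] z by (simp add: powr_numeral)
    also have "\<dots> \<le> K powr (\<nu> - 2) * z\<^sup>2" using True \<nu> by (intro mult_right_mono powr_mono2) auto
    finally show ?thesis by (simp add: add_increasing2)
  next
    case False
    have "\<bar>z\<bar> powr \<nu> = \<bar>z\<bar> powr (\<nu> - real m) * \<bar>z\<bar> ^ m" using split[of "real m"] z by (simp add: powr_realpow)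
    also have "\<dots> \<le> K powr (\<nu> - real m) * \<bar>z\<bar> ^ m" using False \<nu> K by (intro mult_right_mono powr_mono2') auto
    finally show ?thesis by (simp add: add_increasing)
  qed
qed (use \<nu> in auto)

context spde
begin

text \<open>At the level K = exp(b t) the high moment, which grows at most exponentially, is
  suppressed by K^(\<nu>-m). The price K^(\<nu>-2) in front of the second moment is paid by the
  spatial decay once |x| >= \<alpha> t.\<close>

lemma growth_upper:
  assumes \<nu>: "\<nu> \<ge> 2"
  shows "\<exists>\<alpha>>0. growth_limsup M u \<nu> \<alpha> < 0"
proof -
  define k where "k = nat \<lceil>\<nu>\<rceil>"
  define m where "m = 2 * k + 2"
  have m: "real m \<ge> \<nu> + 1" "even m" using \<nu> by (auto simp: m_def k_def) linarith
  obtain A \<gamma> where A: "A \<ge> 0" "\<gamma> > 0" "\<And>t x. t \<ge> 0 \<Longrightarrow> v t x \<le> ennreal (A * exp (\<gamma> * t - c * \<bar>x\<bar>))"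
    using second_moment_bound by blast
  obtain A' \<gamma>' where A': "A' \<ge> 0" "\<gamma>' > 0" "\<And>t x. t \<ge> 0 \<Longrightarrow> (\<integral>\<^sup>+\<omega>. ennreal ((u t x \<omega>) ^ m) \<partial>M) \<le> ennreal (A' * exp (\<gamma>' * t))"
    using moment_bound[of k] unfolding m_def by blast
  have c: "c > 0" by (rule K.c_pos)
  \<comment> \<open>Since m >= \<nu> + 1, the factor K^(\<nu>-m) is at most exp(-(\<gamma>' + 1) t),
    which turns exp(\<gamma>' t) into exp(-t).\<close>
  define b where "b = \<gamma>' + 1"
  have b: "b > 0" using A' by (simp add: b_def)
  \<comment> \<open>Chosen so that exp(-c \<alpha> t) cancels K^(\<nu>-2) exp(\<gamma> t) and leaves
    exp(-t).\<close>
  define \<alpha> where "\<alpha> = ((\<nu> - 2) * b + \<gamma> + 1) / c"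
  have \<alpha>: "\<alpha> > 0" using \<nu> b A c by (simp add: \<alpha>_def add_nonneg_pos)
  have bound: "moment M u \<nu> t x \<le> ennreal ((A + A') * exp (- t))" if t: "t > 0" and x: "\<bar>x\<bar> \<ge> \<alpha> * t" for t x
  proof -
    have [measurable]: "u t x \<in> borel_measurable M" using t by (intro u_measurable) auto
    define K where "K = exp (b * t)"
    have K: "K > 0" "K powr (\<nu> - 2) = exp ((\<nu> - 2) * (b * t))" "K powr (\<nu> - real m) = exp ((\<nu> - real m) * (b * t))"
      by (auto simp: K_def exp_powr_real mult_ac)
    have "moment M u \<nu> t x \<le> (\<integral>\<^sup>+\<omega>. ennreal (K powr (\<nu> - 2)) * ennreal ((u t x \<omega>)\<^sup>2) + ennreal (K powr (\<nu> - real m)) * ennreal ((u t x \<omega>) ^ m) \<partial>M)"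
      unfolding moment_def
    proof (rule nn_integral_mono)
      fix \<omega>
      have "\<bar>u t x \<omega>\<bar> powr \<nu> \<le> K powr (\<nu> - 2) * (u t x \<omega>)\<^sup>2 + K powr (\<nu> - real m) * \<bar>u t x \<omega>\<bar> ^ m"
        using \<nu> m K by (intro powr_interpolation) auto
      then show "ennreal (\<bar>u t x \<omega>\<bar> powr \<nu>) \<le> ennreal (K powr (\<nu> - 2)) * ennreal ((u t x \<omega>)\<^sup>2) + ennreal (K powr (\<nu> - real m)) * ennreal ((u t x \<omega>) ^ m)"
        using m(2) by (simp add: ennreal_mult[symmetric] ennreal_plus[symmetric] power_even_abs ennreal_leI zero_le_even_power del: ennreal_plus)
    qed
    also have "\<dots> = ennreal (K powr (\<nu> - 2)) * v t x + ennreal (K powr (\<nu> - real m)) * (\<integral>\<^sup>+\<omega>. ennreal ((u t x \<omega>) ^ m) \<partial>M)"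
      unfolding v_def by (simp add: nn_integral_add nn_integral_cmult)
    also have "\<dots> \<le> ennreal (K powr (\<nu> - 2)) * ennreal (A * exp (\<gamma> * t - c * \<bar>x\<bar>)) + ennreal (K powr (\<nu> - real m)) * ennreal (A' * exp (\<gamma>' * t))"
      using t by (intro add_mono mult_left_mono A A') auto
    also have "\<dots> = ennreal (A * (exp ((\<nu> - 2) * (b * t)) * exp (\<gamma> * t - c * \<bar>x\<bar>)) + A' * (exp ((\<nu> - real m) * (b * t)) * exp (\<gamma>' * t)))"
      using A A' by (simp add: K ennreal_mult[symmetric] ennreal_plus[symmetric] mult_ac del: ennreal_plus)
    also have "\<dots> \<le> ennreal ((A + A') * exp (- t))"
      unfolding distrib_right
    proof (intro ennreal_leI add_mono mult_left_mono A A')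
      have "c * (\<alpha> * t) \<le> c * \<bar>x\<bar>" using x c by (intro mult_left_mono) auto
      moreover have "c * (\<alpha> * t) = ((\<nu> - 2) * b + \<gamma> + 1) * t" using c by (simp add: \<alpha>_def)
      ultimately have "(\<nu> - 2) * (b * t) + (\<gamma> * t - c * \<bar>x\<bar>) \<le> - t" by (simp add: algebra_simps)
      then show "exp ((\<nu> - 2) * (b * t)) * exp (\<gamma> * t - c * \<bar>x\<bar>) \<le> exp (- t)" by (simp add: exp_add[symmetric])
      have "(\<nu> - real m) * (b * t) \<le> (- 1) * (b * t)" using m b t by (intro mult_right_mono) auto
      then have "(\<nu> - real m) * (b * t) + \<gamma>' * t \<le> - t" by (simp add: b_def algebra_simps)
      then show "exp ((\<nu> - real m) * (b * t)) * exp (\<gamma>' * t) \<le> exp (- t)" by (simp add: exp_add[symmetric])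
    qed
    finally show ?thesis .
  qed
  \<comment> \<open>The summand 1 makes a nonnegative. From t > 2 a on, (a - t) / t lies below
    -1/2.\<close>
  define a where "a = ln (A + A' + 1)"
  have a: "a \<ge> 0" "exp a = A + A' + 1" using A A' by (auto simp: a_def)
  have "\<forall>\<^sub>F t in at_top. ereal (1 / t) * (SUP x\<in>{x. \<alpha> * t \<le> \<bar>x\<bar>}. eln (moment M u \<nu> t x)) \<le> ereal (- 1 / 2)"
    using eventually_gt_at_top[of "2 * a + 1"]
  proof eventually_elim
    case (elim t)
    then have t: "t > 0" "t > 2 * a" using a by auto
    have "(SUP x\<in>{x. \<alpha> * t \<le> \<bar>x\<bar>}. eln (moment M u \<nu> t x)) \<le> ereal (a - t)"
    proof (rule SUP_least)
      fix x assume "x \<in> {x. \<alpha> * t \<le> \<bar>x\<bar>}"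
      then have "moment M u \<nu> t x \<le> ennreal ((A + A') * exp (- t))" using t by (intro bound) auto
      also have "\<dots> \<le> ennreal (exp (a - t))"
        unfolding exp_diff a(2) by (intro ennreal_leI) (simp add: exp_minus divide_inverse mult_right_mono)
      finally show "eln (moment M u \<nu> t x) \<le> ereal (a - t)" by (rule le_imp_eln_le)
    qed
    then have "ereal (1 / t) * (SUP x\<in>{x. \<alpha> * t \<le> \<bar>x\<bar>}. eln (moment M u \<nu> t x)) \<le> ereal (1 / t) * ereal (a - t)"
      using t by (intro ereal_mult_left_mono) auto
    also have "\<dots> \<le> ereal (- 1 / 2)" using t by (simp add: field_simps)
    finally show ?case .
  qed
  then have "growth_limsup M u \<nu> \<alpha> \<le> ereal (- 1 / 2)"
    unfolding growth_limsup_def by (rule Limsup_bounded)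
  also have "\<dots> < 0" by simp
  finally show ?thesis using \<alpha> by blast
qed

text \<open>A nonpositive exponent would bound the \<nu>-th moment by exp(\<beta> t / 2) ahead of
  the front for all large t, making finite a Laplace transform that the renewal inequality forces to
  be infinite.\<close>

lemma growth_lower:
  assumes \<nu>: "\<nu> \<ge> 2"
  shows "\<exists>\<alpha>>0. growth_limsup M u \<nu> \<alpha> > 0"
proof -
  obtain \<alpha> \<beta> where \<alpha>: "\<alpha> > 0" and \<beta>: "\<beta> > 0" and ren: "1 \<le> ennreal (ell\<^sup>2) * (\<integral>\<^sup>+s. indicator {0<..} s * (ennreal (exp (- \<beta> * s)) * half_kernel \<alpha> s) \<partial>lborel)"
    using K.renewal[of "ell\<^sup>2"] ell(1) unfolding half_kernel_def by auto
  have "\<not> growth_limsup M u \<nu> \<alpha> \<le> 0"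
  proof
    assume "growth_limsup M u \<nu> \<alpha> \<le> 0"
    then have "growth_limsup M u \<nu> \<alpha> < ereal (\<beta> / 2)" using \<beta> by (simp add: le_less_trans)
    then have "\<forall>\<^sub>F t in at_top. ereal (1 / t) * (SUP x\<in>{x. \<alpha> * t \<le> \<bar>x\<bar>}. eln (moment M u \<nu> t x)) < ereal (\<beta> / 2)"
      unfolding growth_limsup_def by (rule Limsup_lessD)
    then obtain t2 where t2: "\<And>t. t \<ge> t2 \<Longrightarrow> ereal (1 / t) * (SUP x\<in>{x. \<alpha> * t \<le> \<bar>x\<bar>}. eln (moment M u \<nu> t x)) < ereal (\<beta> / 2)"
      unfolding eventually_at_top_linorder by blast
    define t1 where "t1 = max t2 1"
    have "v t x \<le> ennreal (2 * exp (\<beta> / 2 * t))" if t: "t \<ge> t1" and x: "x \<ge> \<alpha> * t" for t x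
    proof -
      have t0: "t > 0" "t \<ge> t2" using t by (auto simp: t1_def)
      have [measurable]: "u t x \<in> borel_measurable M" using t0 by (intro u_measurable) auto
      have "eln (moment M u \<nu> t x) \<le> (SUP x\<in>{x. \<alpha> * t \<le> \<bar>x\<bar>}. eln (moment M u \<nu> t x))"
        using x by (intro SUP_upper) auto
      then have "ereal (1 / t) * eln (moment M u \<nu> t x) \<le> ereal (\<beta> / 2)"
        using t2[OF t0(2)] t0(1) by (meson ereal_mult_left_mono le_less_trans less_imp_le ereal_less_eq(5) zero_le_divide_1_iff)
      then have "eln (moment M u \<nu> t x) \<le> ereal (\<beta> / 2 * t)"
        using t0(1) by (cases "eln (moment M u \<nu> t x)") (auto simp: field_simps)
      then have mom: "moment M u \<nu> t x \<le> ennreal (exp (\<beta> / 2 * t))" by (rule eln_le_imp_le)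
      have "v t x \<le> (\<integral>\<^sup>+\<omega>. 1 + ennreal (\<bar>u t x \<omega>\<bar> powr \<nu>) \<partial>M)"
        unfolding v_def
      proof (rule nn_integral_mono)
        fix \<omega>
        \<comment> \<open>Reduces every \<nu> >= 2 to the second moment; the extra 1 is harmless
          next to exp(\<beta> t / 2).\<close>
        have "z\<^sup>2 \<le> 1 + \<bar>z\<bar> powr \<nu>" for z :: real
        proof (cases "\<bar>z\<bar> \<le> 1")
          case True
          then have "z\<^sup>2 \<le> 1" by (simp add: abs_square_le_1)
          then show ?thesis by (simp add: add_increasing2)
        next
          case False
          then have "\<bar>z\<bar> powr 2 \<le> \<bar>z\<bar> powr \<nu>" using \<nu> by (intro powr_mono) auto
          then show ?thesis using False by (simp add: powr_numeral)
        qed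
        then have "ennreal ((u t x \<omega>)\<^sup>2) \<le> ennreal (1 + \<bar>u t x \<omega>\<bar> powr \<nu>)" by (rule ennreal_leI)
        then show "ennreal ((u t x \<omega>)\<^sup>2) \<le> 1 + ennreal (\<bar>u t x \<omega>\<bar> powr \<nu>)" by simp
      qed
      also have "\<dots> = 1 + moment M u \<nu> t x"
        unfolding moment_def by (simp add: nn_integral_add emeasure_space_1)
      also have "\<dots> \<le> ennreal (exp (\<beta> / 2 * t)) + ennreal (exp (\<beta> / 2 * t))"
        using \<beta> t0 by (intro add_mono mom) (simp add: ennreal_1[symmetric] ennreal_leI del: ennreal_1)
      also have "\<dots> = ennreal (2 * exp (\<beta> / 2 * t))" by (simp add: ennreal_plus[symmetric] del: ennreal_plus)
      finally show ?thesis .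
    qed
    then have "(\<integral>\<^sup>+t. indicator {0<..} t * (ennreal (exp (- \<beta> * t)) * (indicator {0..} t * half_mass \<alpha> t)) \<partial>lborel) < \<infinity>"
      by (intro laplace_half_mass_finite[OF \<alpha> \<beta>, of t1]) (auto simp: t1_def)
    then show False using laplace_half_mass_infinite[OF \<alpha> ren] by simp
  qed
  then show ?thesis using \<alpha> by (auto simp: not_le)
qed

end

text \<open>The growth condition speaks of large |x| only; on the remaining bounded set boundedness
  gives the estimate with a larger constant.\<close>

lemma D_exp_bound:
  assumes "h \<in> D_exp"
  obtains \<rho> A where "\<rho> > 0" "\<And>x. h x \<le> A * exp (- \<rho> * \<bar>x\<bar>)"
proof -
  from assms obtain \<rho> where \<rho>: "\<rho> > 0" "h \<in> O[at_infinity](\<lambda>x. exp (- \<rho> * \<bar>x\<bar>))" and bdd: "bounded (range h)"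
    unfolding D_exp_def by blast
  obtain C where C: "\<forall>\<^sub>F x in at_infinity. norm (h x) \<le> C * norm (exp (- \<rho> * \<bar>x\<bar>))"
    using \<rho>(2) by (rule landau_o.bigE)
  then obtain b where b: "\<And>x. \<bar>x\<bar> \<ge> b \<Longrightarrow> \<bar>h x\<bar> \<le> C * exp (- \<rho> * \<bar>x\<bar>)"
    unfolding eventually_at_infinity by auto
  obtain B where B: "\<And>x. \<bar>h x\<bar> \<le> B" using bdd unfolding bounded_iff by auto
  have B0: "B \<ge> 0" using B[of 0] by linarith
  define A where "A = max C (B * exp (\<rho> * \<bar>b\<bar>))"
  have "h x \<le> A * exp (- \<rho> * \<bar>x\<bar>)" for x
  proof (cases "\<bar>x\<bar> \<ge> b")
    case True
    have "h x \<le> C * exp (- \<rho> * \<bar>x\<bar>)" using b[OF True] by linarith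
    also have "\<dots> \<le> A * exp (- \<rho> * \<bar>x\<bar>)" by (intro mult_right_mono) (auto simp: A_def)
    finally show ?thesis .
  next
    case False
    have "\<rho> * \<bar>x\<bar> \<le> \<rho> * \<bar>b\<bar>" using False \<rho> by (intro mult_left_mono) auto
    then have "1 \<le> exp (\<rho> * \<bar>b\<bar>) * exp (- \<rho> * \<bar>x\<bar>)" by (simp add: exp_add[symmetric])
    then have "B * 1 \<le> B * (exp (\<rho> * \<bar>b\<bar>) * exp (- \<rho> * \<bar>x\<bar>))" using B0 by (intro mult_left_mono)
    also have "\<dots> = (B * exp (\<rho> * \<bar>b\<bar>)) * exp (- \<rho> * \<bar>x\<bar>)" by (simp only: mult.assoc)
    also have "\<dots> \<le> A * exp (- \<rho> * \<bar>x\<bar>)" by (intro mult_right_mono) (auto simp: A_def)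
    finally show ?thesis using B[of x] by linarith
  qed
  then show ?thesis using that \<rho>(1) by blast
qed

lemma lsc_fun_measurable: "lsc_fun h \<Longrightarrow> h \<in> borel_measurable borel"
  unfolding lsc_fun_def borel_measurable_iff_greater by (auto intro: borel_open)

theorem theorem1p1:
  fixes P :: "'b measure" and X :: "real \<Rightarrow> 'b \<Rightarrow> real"
    and \<Psi> :: "real \<Rightarrow> real" and p :: "real \<Rightarrow> real \<Rightarrow> real"
    and \<sigma> :: "real \<Rightarrow> real" and u0 :: "real \<Rightarrow> real"
    and M :: "'a measure" and F :: "real \<Rightarrow> 'a measure"
    and W :: "real \<Rightarrow> real \<Rightarrow> 'a \<Rightarrow> real" and u :: "real \<Rightarrow> real \<Rightarrow> 'a \<Rightarrow> real"
  assumes levy: "levy_process P X"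
    and symm: "symmetric_process P X"
    and exponent: "\<forall>\<xi>. char (distr P borel (X 1)) \<xi> = exp (- complex_of_real (\<Psi> \<xi>))"
    and dalang: "\<exists>\<beta>>0. integrable lborel (\<lambda>\<xi>. 1 / (\<beta> + 2 * \<Psi> \<xi>))"
    and dens: "\<forall>t>0. distributed P lborel (X t) (\<lambda>z. ennreal (p t z))"
    and lip: "\<exists>L. L-lipschitz_on UNIV \<sigma>"
    and sigma0: "\<sigma> 0 = 0"
    and Lsigma: "(INF x\<in>-{0}. \<bar>\<sigma> x / x\<bar>) > 0"
    and u0_nonneg: "\<forall>x. u0 x \<ge> 0" and u0_bdd: "bounded (range u0)"
    and sheet: "brownian_sheet M W"
    and filt: "sheet_filtration M F W"
    and sol: "mild_solution M F W P X p \<sigma> u0 u"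
    and expmom: "\<exists>c>0. integrable P (\<lambda>\<omega>. exp (c * X 1 \<omega>))"
    and u0_Dexp: "u0 \<in> D_exp"
    and u0_pos: "emeasure lborel {x. u0 x > 0} > 0"
  shows "\<forall>\<nu>\<ge>2. 0 < lambda_lower M u \<nu> \<and> lambda_lower M u \<nu> \<le> lambda_upper M u \<nu>
                \<and> lambda_upper M u \<nu> < \<infinity>"
proof (intro allI impI)
  fix \<nu> :: real assume \<nu>: "\<nu> \<ge> 2"
  obtain L where L: "L-lipschitz_on UNIV \<sigma>" using lip by blast
  \<comment> \<open>At least 1, as \<open>trunc_power_scale\<close> requires of its factor.\<close>
  define Lip where "Lip = max 1 L"
  have Lip: "\<bar>\<sigma> z\<bar> \<le> Lip * \<bar>z\<bar>" for z
  proof -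
    have "dist (\<sigma> z) (\<sigma> 0) \<le> L * dist z 0" using L by (rule lipschitz_onD) auto
    then have "\<bar>\<sigma> z\<bar> \<le> L * \<bar>z\<bar>" by (simp add: sigma0 dist_real_def)
    also have "\<dots> \<le> Lip * \<bar>z\<bar>" by (intro mult_right_mono) (auto simp: Lip_def)
    finally show ?thesis .
  qed
  define ell where "ell = (INF x\<in>-{0}. \<bar>\<sigma> x / x\<bar>)"
  have ell: "ell * \<bar>z\<bar> \<le> \<bar>\<sigma> z\<bar>" for z
  proof (cases "z = 0")
    case False
    have "bdd_below ((\<lambda>x. \<bar>\<sigma> x / x\<bar>) ` (- {0}))" by (intro bdd_belowI[of _ 0]) auto
    then have "ell \<le> \<bar>\<sigma> z / z\<bar>" unfolding ell_def using False by (intro cINF_lower) auto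
    then show ?thesis using False by (simp add: abs_divide pos_le_divide_eq)
  qed simp
  have \<sigma>m: "\<sigma> \<in> borel_measurable borel"
    using lipschitz_on_continuous_on[OF L] by (rule borel_measurable_continuous_onI)
  have u0m: "u0 \<in> borel_measurable borel"
    using u0_Dexp by (intro lsc_fun_measurable) (simp add: D_exp_def)
  obtain \<rho> A where \<rho>: "\<rho> > 0" "\<And>x. u0 x \<le> A * exp (- \<rho> * \<bar>x\<bar>)"
    using u0_Dexp by (rule D_exp_bound) blast
  have A: "A \<ge> 0" using \<rho>(2)[of 0] u0_nonneg by (metis abs_zero exp_zero mult.right_neutral mult_zero_right order_trans)
  obtain c0 where c0: "c0 > 0" "integrable P (\<lambda>\<omega>. exp (c0 * X 1 \<omega>))" using expmom by blast
  \<comment> \<open>Both the exponential moment and the exponential bound on \<open>u0\<close>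
    persist when the rate is lowered.\<close>
  define c where "c = min c0 \<rho>"
  have c: "c > 0" "c \<le> c0" "c \<le> \<rho>" using c0 \<rho> by (auto simp: c_def)
  have P: "prob_space P" and Xm: "X 1 \<in> borel_measurable P" using levy unfolding levy_process_def by auto
  interpret P: prob_space P by (rule P)
  have "integrable P (\<lambda>\<omega>. exp (c * X 1 \<omega>))"
  proof (rule Bochner_Integration.integrable_bound)
    show "integrable P (\<lambda>\<omega>. 1 + exp (c0 * X 1 \<omega>))" using c0 by simp
    show "AE \<omega> in P. norm (exp (c * X 1 \<omega>)) \<le> norm (1 + exp (c0 * X 1 \<omega>))"
    proof (rule AE_I2)
      fix \<omega>
      show "norm (exp (c * X 1 \<omega>)) \<le> norm (1 + exp (c0 * X 1 \<omega>))"
      proof (cases "X 1 \<omega> \<ge> 0")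
        case True
        then have "c * X 1 \<omega> \<le> c0 * X 1 \<omega>" using c by (intro mult_right_mono) auto
        then have "exp (c * X 1 \<omega>) \<le> exp (c0 * X 1 \<omega>)" by simp
        then have "exp (c * X 1 \<omega>) \<le> 1 + exp (c0 * X 1 \<omega>)" by linarith
        then show ?thesis by simp
      next
        case False
        then have "c * X 1 \<omega> \<le> 0" using c by (simp add: mult_le_0_iff)
        then have "exp (c * X 1 \<omega>) \<le> 1" by simp
        then show ?thesis by (simp add: add_increasing2)
      qed
    qed
  qed (use Xm in measurable)
  moreover have "u0 x \<le> A * exp (- c * \<bar>x\<bar>)" for x
  proof -
    have "c * \<bar>x\<bar> \<le> \<rho> * \<bar>x\<bar>" using c by (intro mult_right_mono) auto
    then have "A * exp (- \<rho> * \<bar>x\<bar>) \<le> A * exp (- c * \<bar>x\<bar>)" using A by (intro mult_left_mono) auto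
    then show ?thesis using \<rho>(2)[of x] by linarith
  qed
  moreover have "prob_space M" using sheet unfolding brownian_sheet_def by blast
  ultimately interpret spde M F W P X \<Psi> p c \<sigma> u0 u Lip ell A
    using assms P c(1) \<sigma>m u0m Lip ell Lsigma unfolding ell_def[symmetric]
    by (intro spde.intro noise.intro levy_exp.intro levy_dalang.intro noise_axioms.intro levy_dalang_axioms.intro
        levy_exp_axioms.intro spde_axioms.intro) (auto simp: Lip_def)
  have "0 < lambda_lower M u \<nu>"
  proof -
    obtain \<alpha> where \<alpha>: "\<alpha> > 0" "growth_limsup M u \<nu> \<alpha> > 0" using growth_lower[OF \<nu>] by blast
    have "0 < ereal \<alpha>" using \<alpha> by simp
    also have "\<dots> \<le> lambda_lower M u \<nu>" unfolding lambda_lower_def using \<alpha> by (intro Sup_upper) auto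
    finally show ?thesis .
  qed
  moreover have "lambda_upper M u \<nu> < \<infinity>"
  proof -
    obtain \<alpha> where \<alpha>: "\<alpha> > 0" "growth_limsup M u \<nu> \<alpha> < 0" using growth_upper[OF \<nu>] by blast
    have "lambda_upper M u \<nu> \<le> ereal \<alpha>" unfolding lambda_upper_def using \<alpha> by (intro Inf_lower) auto
    also have "\<dots> < \<infinity>" by simp
    finally show ?thesis .
  qed
  moreover have "lambda_lower M u \<nu> \<le> lambda_upper M u \<nu>"
    unfolding lambda_lower_def lambda_upper_def
  proof (intro Sup_least Inf_greatest)
    fix y z assume y: "y \<in> insert 0 (ereal ` {\<alpha>. \<alpha> > 0 \<and> growth_limsup M u \<nu> \<alpha> > 0})"
      and "z \<in> ereal ` {\<alpha>. \<alpha> > 0 \<and> growth_limsup M u \<nu> \<alpha> < 0}"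
    then obtain \<alpha>' where \<alpha>': "z = ereal \<alpha>'" "\<alpha>' > 0" "growth_limsup M u \<nu> \<alpha>' < 0" by auto
    from y consider "y = 0" | \<alpha> where "y = ereal \<alpha>" "\<alpha> > 0" "growth_limsup M u \<nu> \<alpha> > 0" by auto
    then show "y \<le> z"
    proof cases
      case 2
      \<comment> \<open>The growth exponent decreases in \<alpha>, as the supremum runs over fewer
        points; a positive value cannot lie to the right of a negative one.\<close>
      have "\<not> \<alpha>' \<le> \<alpha>"
        using growth_limsup_mono[OF \<alpha>'(2), of \<alpha> M u \<nu>] 2(3) \<alpha>'(3) by (meson leD less_trans not_le)
      then show ?thesis using 2 \<alpha>' by simp
    qed (use \<alpha>' in simp)
  qed
  ultimately show "0 < lambda_lower M u \<nu> \<and> lambda_lower M u \<nu> \<le> lambda_upper M u \<nu> \<and> lambda_upper M u \<nu> < \<infinity>"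
    by blast
qed

end
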